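(* The Gray presentation $\mathsf{PAdj}$ of pseudoadjunctions is a coherent Gray presentation, i.e. any two parallel $3$-cells of the localization $\overline{\mathsf{PAdj}}^\top$ are equal.
   Context: **Precategories.** An $n$-precategory is an $n$-globular set $C$ (sets $C_0,\dots,C_n$ with source/target maps $\partial^-_i,\partial^+_i:C_{i+1}\to C_i$ satisfying the globular identities; $\partial^\epsilon_i$ also denotes iterated source/target) with identities $\mathrm{id}:C_{k-1}\to C_k$ and compositions $u\ast_i v\in C_{\max(k,l)}$ for $u\in C_k$, $v\in C_l$, $k,l>0$, $i=\min(k,l)-1$, $\partial^+_i(u)=\partial^-_i(v)$ ("$i$-composable"), such that: $\partial^\pm(\mathrm{id}_u)=u$; $\partial^\epsilon(u\ast_i v)$ is $u\ast_i\partial^\epsilon v$ if $k<l$, $\partial^\epsilon u\ast_i v$ if $k>l$, and $\partial^-u$ (resp. $\partial^+v$) for $\epsilon=-$ (resp. $+$) if $k=l$; composing with an identity on a cell of dimension $i$ via $\ast_i$ is trivial, and $\mathrm{id}_u\ast_i v=\mathrm{id}_{u\ast_i v}$, $v\ast_i\mathrm{id}_u=\mathrm{id}_{v\ast_i u}$ when $\dim u>i$ and $\dim v=i+1$; each $\ast_i$ is associative whenever both sides are defined; for $i<j$ and $u$ of dimension $i+1$, $u\ast_i(v\ast_j v')=(u\ast_i v)\ast_j(u\ast_i v')$ and $(v\ast_j v')\ast_i u=(v\ast_i u)\ast_j(v'\ast_i u)$ whenever the left sides are defined. Morphisms preserve all the structure. **Prepolygraphs.** A $0$-prepolygraph is a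 set $\mathsf P_0$, with $\mathsf P^*_0=\mathsf P_0$. An $(n+1)$-prepolygraph is an $n$-prepolygraph $(\mathsf P_0,\dots,\mathsf P_n)$, generating a free $n$-precategory with $i$-cells $\mathsf P^*_i$, together with a set $\mathsf P_{n+1}$ of $(n+1)$-generators with source and target in $\mathsf P^*_n$ (parallel if $n\ge1$); its free $(n+1)$-precategory $\mathsf P^*$ is obtained by freely adjoining the elements of $\mathsf P_{n+1}$ as $(n+1)$-cells. $\mathsf P_{\le k}$ is the underlying $k$-prepolygraph. Every $2$-cell of $\mathsf P^*$ is uniquely a $\ast_1$-composite of whiskers $l\ast_0\alpha\ast_0 r$ with $\alpha\in\mathsf P_2$, $l,r\in\mathsf P^*_1$. **Presented precategory, localization, coherence.** A congruence on an $n$-precategory $C$ is an equivalence relation on $C_n$ relating only cells with the same source and target and stable under $u\mapsto v\ast_i u\ast_i w$ for all $i<n$ and $v,w\in C_{i+1}$. For a $4$-prepolygraph $\mathsf P$, $\overline{\mathsf P}=(\mathsf P_{\le 3})^*/{\sim^{\mathsf P}}$ where $\sim^{\mathsf P}$ is the smallest congruence with $\partial^-(G)\sim^{\mathsf P}\partial^+(G)$ for all $G\in\mathsf P_4$. The localization $C^\top$ of a $3$-precategory $C$ is obtained by formally inverting all $3$-cells with respect to $\ast_2$ (image of $C$ under the left adjoint to the inclusion of $3$-precategories with all $3$-cells invertible); it has the same cells as $C$ in dimensions $\le2$. A Gray presentation $\mathsf P$ is coherent when any two parallel $3$-cells of $\overline{\mathsf P}^\top$ are equal. **Gray presentation.**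 A $4$-prepolygraph $\mathsf P$ containing the following distinguished generators. (a) For $\alpha:f\Rightarrow f'$, $\beta:h\Rightarrow h'$ in $\mathsf P_2$ and $g\in\mathsf P^*_1$ with $\alpha,g,\beta$ $0$-composable, a $3$-generator (interchange generator) $X_{\alpha,g,\beta}:(\alpha\ast_0 g\ast_0 h)\ast_1(f'\ast_0 g\ast_0\beta)\Rrightarrow(f\ast_0 g\ast_0\beta)\ast_1(\alpha\ast_0 g\ast_0 h')$. (b) For $A:\phi\Rrightarrow\phi'$, $B:\psi\Rrightarrow\psi'$ in $\mathsf P_3$, $e,h,e',h'\in\mathsf P^*_1$, $\chi\in\mathsf P^*_2$ such that $(e\ast_0\phi\ast_0 h)\ast_1\chi\ast_1(e'\ast_0\psi\ast_0 h')$ is defined, a $4$-generator (independence generator) from $((e\ast_0 A\ast_0 h)\ast_1\chi\ast_1(e'\ast_0\psi\ast_0 h'))\ast_2((e\ast_0\phi'\ast_0 h)\ast_1\chi\ast_1(e'\ast_0 B\ast_0 h'))$ to $((e\ast_0\phi\ast_0 h)\ast_1\chi\ast_1(e'\ast_0 B\ast_0 h'))\ast_2((e\ast_0 A\ast_0 h)\ast_1\chi\ast_1(e'\ast_0\psi'\ast_0 h'))$. (c) For $0$-composable $A,g,\beta$ with $A:\phi\Rrightarrow\phi':f\Rightarrow f'$ in $\mathsf P_3$, $g\in\mathsf P^*_1$, $\beta:h\Rightarrow h'$ in $\mathsf P_2$, a $4$-generator (interchange naturality generator) from $((A\ast_0 g\ast_0 h)\ast_1(f'\ast_0 g\ast_0\beta))\ast_2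 X_{\phi',g\ast_0\beta}$ to $X_{\phi,g\ast_0\beta}\ast_2((f\ast_0 g\ast_0\beta)\ast_1(A\ast_0 g\ast_0 h'))$; and for $0$-composable $\alpha,g,B$ with $\alpha:f\Rightarrow f'$ in $\mathsf P_2$, $B:\psi\Rrightarrow\psi':h\Rightarrow h'$ in $\mathsf P_3$, a $4$-generator from $((\alpha\ast_0 g\ast_0 h)\ast_1(f'\ast_0 g\ast_0 B))\ast_2 X_{\alpha\ast_0 g,\psi'}$ to $X_{\alpha\ast_0 g,\psi}\ast_2((f\ast_0 g\ast_0 B)\ast_1(\alpha\ast_0 g\ast_0 h'))$. Here, for $0$-composable $\phi,\psi\in\mathsf P^*_2$ with whisker decompositions $\phi=\phi_1\ast_1\cdots\ast_1\phi_k$, $\psi=\psi_1\ast_1\cdots\ast_1\psi_{k'}$, $\phi_i=f_i\ast_0\alpha_i\ast_0 g_i$, $\psi_j=f'_j\ast_0\beta_j\ast_0 g'_j$, the $3$-cell $X_{\phi,\psi}:(\phi\ast_0\partial^-_1\psi)\ast_1(\partial^+_1\phi\ast_0\psi)\Rrightarrow(\partial^-_1\phi\ast_0\psi)\ast_1(\phi\ast_0\partial^+_1\psi)$ is the $\ast_2$-composite of $kk'$ elementary swaps, which first move $\phi_k$ successively past $\psi_1,\dots,\psi_{k'}$, then $\phi_{k-1}$ past $\psi_1,\dots,\psi_{k'}$, and so on; the elementary swap of consecutive $\phi_i,\psi_j$ in an interleaving is $\lambda\ast_1(f_i\ast_0 X_{\alpha_i,\,g_i\ast_0 f'_j,\,\beta_j}\ast_0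 g'_j)\ast_1\rho$, where $\lambda,\rho$ are the parts of the interleaving before and after. **The Gray presentation $\mathsf{PAdj}$.** $0$-generators $x,y$; $1$-generators $f:x\to y$, $g:y\to x$; $2$-generators $\eta:\mathrm{id}_x\Rightarrow f\ast_0g$, $\varepsilon:g\ast_0f\Rightarrow\mathrm{id}_y$. $3$-generators: $\mathsf N:(\eta\ast_0f)\ast_1(f\ast_0\varepsilon)\Rrightarrow\mathrm{id}_f$, $\mathsf N':(g\ast_0\eta)\ast_1(\varepsilon\ast_0g)\Rrightarrow\mathrm{id}_g$, and the interchange generators $X_{\alpha,h,\beta}$ for all $0$-composable $\alpha,h,\beta$ with $\alpha,\beta\in\{\eta,\varepsilon\}$, $h$ a $1$-cell. $4$-generators: exactly the independence and interchange naturality generators required in (b), (c), and two more, one between the two parallel $3$-cells in each of the following pairs (the orientation of a $4$-generator is irrelevant for $\overline{\mathsf{PAdj}}$): 1. $(\mathsf N'\ast_0f)\ast_1\varepsilon$ and $((g\ast_0\eta\ast_0f)\ast_1X_{\varepsilon,\mathrm{id}_y,\varepsilon})\ast_2((g\ast_0\mathsf N)\ast_1\varepsilon)$, both from $(g\ast_0\eta\ast_0f)\ast_1(\varepsilon\ast_0g\ast_0f)\ast_1\varepsilon$ to $\varepsilon$; 2. $\eta\ast_1(f\ast_0\mathsf N')$ and $(X_{\eta,\mathrm{id}_x,\eta}\ast_1(f\ast_0\varepsilon\ast_0g))\ast_2(\eta\ast_1(\mathsf N\ast_0g))$, both from $\eta\ast_1(f\ast_0g\ast_0\eta)\ast_1(f\ast_0\varepsilon\ast_0g)$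 to $\eta$. *)

theory Defs
  imports Main
begin

section \<open>Precategories\<close>

text \<open>The same element may occur as a cell of several dimensions, so all operations carry
  dimensions: \<open>src C i\<close>, \<open>tgt C i\<close> map \<open>(i+1)\<close>-cells to \<open>i\<close>-cells, \<open>idc C k\<close> maps \<open>k\<close>-cells to
  \<open>(k+1)\<close>-cells, and \<open>cmp C k l u v\<close> is the composite of a \<open>k\<close>-cell \<open>u\<close> and an \<open>l\<close>-cell \<open>v\<close> along
  their common \<open>i\<close>-boundary, where \<open>i = min k l - 1\<close>, in diagrammatic order.\<close>

record 'c precat =
  cells :: "nat \<Rightarrow> 'c set"
  src :: "nat \<Rightarrow> 'c \<Rightarrow> 'c"
  tgt :: "nat \<Rightarrow> 'c \<Rightarrow> 'c"
  idc :: "nat \<Rightarrow> 'c \<Rightarrow> 'c"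
  cmp :: "nat \<Rightarrow> nat \<Rightarrow> 'c \<Rightarrow> 'c \<Rightarrow> 'c"

text \<open>Iterated boundaries \<open>C\<^sub>k \<rightarrow> C\<^sub>i\<close>, for \<open>i \<le> k\<close>.\<close>

definition srcs :: "'c precat \<Rightarrow> nat \<Rightarrow> nat \<Rightarrow> 'c \<Rightarrow> 'c" where
  "srcs C k i u = fold (src C) (rev [i..<k]) u"

definition tgts :: "'c precat \<Rightarrow> nat \<Rightarrow> nat \<Rightarrow> 'c \<Rightarrow> 'c" where
  "tgts C k i u = fold (tgt C) (rev [i..<k]) u"

definition composable :: "'c precat \<Rightarrow> nat \<Rightarrow> nat \<Rightarrow> 'c \<Rightarrow> 'c \<Rightarrow> bool" where
  "composable C k l u v \<longleftrightarrow> 0 < k \<and> 0 < l \<and> u \<in> cells C k \<and> v \<in> cells C l \<and>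
     tgts C k (min k l - 1) u = srcs C l (min k l - 1) v"

definition parallel :: "'c precat \<Rightarrow> nat \<Rightarrow> 'c \<Rightarrow> 'c \<Rightarrow> bool" where
  "parallel C k u v \<longleftrightarrow> u \<in> cells C k \<and> v \<in> cells C k \<and>
     (0 < k \<longrightarrow> src C (k - 1) u = src C (k - 1) v \<and> tgt C (k - 1) u = tgt C (k - 1) v)"

text \<open>\<open>pc_law C m u v\<close>: the \<open>m\<close>-cells \<open>u\<close> and \<open>v\<close> are the two sides of an instance of one of the
  equational axioms of precategories (units, associativity, distributivity). It is used both to
  define precategories and to define free precategories by generators and relations.\<close>

inductive pc_law :: "'c precat \<Rightarrow> nat \<Rightarrow> 'c \<Rightarrow> 'c \<Rightarrow> bool" for C where
  unit_left:
    "\<lbrakk>a \<in> cells C i; i < k; composable C (Suc i) k (idc C i a) u\<rbrakk>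
     \<Longrightarrow> pc_law C k (cmp C (Suc i) k (idc C i a) u) u"
| unit_right:
    "\<lbrakk>a \<in> cells C i; i < k; composable C k (Suc i) u (idc C i a)\<rbrakk>
     \<Longrightarrow> pc_law C k (cmp C k (Suc i) u (idc C i a)) u"
| id_left:
    "\<lbrakk>i < k; composable C k (Suc i) u v\<rbrakk>
     \<Longrightarrow> pc_law C (Suc k) (cmp C (Suc k) (Suc i) (idc C k u) v) (idc C k (cmp C k (Suc i) u v))"
| id_right:
    "\<lbrakk>i < k; composable C (Suc i) k v u\<rbrakk>
     \<Longrightarrow> pc_law C (Suc k) (cmp C (Suc i) (Suc k) v (idc C k u)) (idc C k (cmp C (Suc i) k v u))"
| assoc:
    "\<lbrakk>min k l = Suc i; min (max k l) m = Suc i; min l m = Suc i; min k (max l m) = Suc i;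
      composable C k l u v; composable C (max k l) m (cmp C k l u v) w;
      composable C l m v w; composable C k (max l m) u (cmp C l m v w)\<rbrakk>
     \<Longrightarrow> pc_law C (max (max k l) m) (cmp C (max k l) m (cmp C k l u v) w)
           (cmp C k (max l m) u (cmp C l m v w))"
| distrib_left:
    "\<lbrakk>Suc i < min k l; composable C k l v v';
      composable C (Suc i) (max k l) u (cmp C k l v v')\<rbrakk>
     \<Longrightarrow> pc_law C (max k l) (cmp C (Suc i) (max k l) u (cmp C k l v v'))
           (cmp C k l (cmp C (Suc i) k u v) (cmp C (Suc i) l u v'))"
| distrib_right:
    "\<lbrakk>Suc i < min k l; composable C k l v v';
      composable C (max k l) (Suc i) (cmp C k l v v') u\<rbrakk>
     \<Longrightarrow> pc_law C (max k l) (cmp C (max k l) (Suc i) (cmp C k l v v') u)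
           (cmp C k l (cmp C k (Suc i) v u) (cmp C l (Suc i) v' u))"

text \<open>Only the cells of dimension at most \<open>n\<close> are relevant for being an \<open>n\<close>-precategory.\<close>

definition precategory :: "nat \<Rightarrow> 'c precat \<Rightarrow> bool" where
  "precategory n C \<longleftrightarrow>
     (\<forall>i<n. \<forall>u\<in>cells C (Suc i). src C i u \<in> cells C i \<and> tgt C i u \<in> cells C i) \<and>
     (\<forall>i. Suc i < n \<longrightarrow> (\<forall>u\<in>cells C (Suc (Suc i)). parallel C (Suc i) (src C (Suc i) u) (tgt C (Suc i) u))) \<and>
     (\<forall>k<n. \<forall>u\<in>cells C k. idc C k u \<in> cells C (Suc k) \<and>
        src C k (idc C k u) = u \<and> tgt C k (idc C k u) = u) \<and>
     (\<forall>k\<le>n. \<forall>l\<le>n. \<forall>u v. composable C k l u v \<longrightarrow>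
        cmp C k l u v \<in> cells C (max k l) \<and>
        (k < l \<longrightarrow> src C (l - 1) (cmp C k l u v) = cmp C k (l - 1) u (src C (l - 1) v) \<and>
                  tgt C (l - 1) (cmp C k l u v) = cmp C k (l - 1) u (tgt C (l - 1) v)) \<and>
        (l < k \<longrightarrow> src C (k - 1) (cmp C k l u v) = cmp C (k - 1) l (src C (k - 1) u) v \<and>
                  tgt C (k - 1) (cmp C k l u v) = cmp C (k - 1) l (tgt C (k - 1) u) v) \<and>
        (k = l \<longrightarrow> src C (k - 1) (cmp C k l u v) = src C (k - 1) u \<and>
                  tgt C (k - 1) (cmp C k l u v) = tgt C (k - 1) v)) \<and>
     (\<forall>m\<le>n. \<forall>u v. pc_law C m u v \<longrightarrow> u = v)"

text \<open>\<open>whisk C i k v u w\<close> is \<open>v \<ast>\<^sub>i u \<ast>\<^sub>i w\<close> for a \<open>k\<close>-cell \<open>u\<close> and \<open>(i+1)\<close>-cells \<open>v\<close>, \<open>w\<close>, where \<open>i < k\<close>.\<close>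

definition whisk :: "'c precat \<Rightarrow> nat \<Rightarrow> nat \<Rightarrow> 'c \<Rightarrow> 'c \<Rightarrow> 'c \<Rightarrow> 'c" where
  "whisk C i k v u w = cmp C k (Suc i) (cmp C (Suc i) k v u) w"

definition whiskable :: "'c precat \<Rightarrow> nat \<Rightarrow> nat \<Rightarrow> 'c \<Rightarrow> 'c \<Rightarrow> 'c \<Rightarrow> bool" where
  "whiskable C i k v u w \<longleftrightarrow> composable C (Suc i) k v u \<and> composable C k (Suc i) u w"

text \<open>\<open>vcomp C k f us\<close> is the \<open>\<ast>\<^sub>k\<^sub>-\<^sub>1\<close>-composite of a list of \<open>k\<close>-cells starting at the
  \<open>(k-1)\<close>-cell \<open>f\<close>; it is the identity of \<open>f\<close> for the empty list.\<close>

primrec vcomp :: "'c precat \<Rightarrow> nat \<Rightarrow> 'c \<Rightarrow> 'c list \<Rightarrow> 'c" where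
  "vcomp C k f [] = idc C (k - 1) f"
| "vcomp C k f (u # us) = cmp C k k u (vcomp C k (tgt C (k - 1) u) us)"


section \<open>Congruences and quotients\<close>

definition congruence :: "nat \<Rightarrow> 'c precat \<Rightarrow> ('c \<times> 'c) set \<Rightarrow> bool" where
  "congruence n C R \<longleftrightarrow> equiv (cells C n) R \<and> (\<forall>(u, u')\<in>R. parallel C n u u') \<and>
     (\<forall>i<n. \<forall>(u, u')\<in>R. \<forall>v w. whiskable C i n v u w \<longrightarrow>
        (whisk C i n v u w, whisk C i n v u' w) \<in> R)"

definition least_congruence :: "nat \<Rightarrow> 'c precat \<Rightarrow> ('c \<Rightarrow> 'c \<Rightarrow> bool) \<Rightarrow> ('c \<times> 'c) set" where
  "least_congruence n C B = \<Inter>{R. congruence n C R \<and> (\<forall>u v. B u v \<longrightarrow> (u, v) \<in> R)}"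

text \<open>In the quotient by a relation \<open>R\<close> on \<open>n\<close>-cells, \<open>n\<close>-cells are \<open>R\<close>-classes and the cells
  of other dimensions are singletons.\<close>

definition qclass :: "nat \<Rightarrow> ('c \<times> 'c) set \<Rightarrow> nat \<Rightarrow> 'c \<Rightarrow> 'c set" where
  "qclass n R k u = (if k = n then R `` {u} else {u})"

definition quot :: "nat \<Rightarrow> 'c precat \<Rightarrow> ('c \<times> 'c) set \<Rightarrow> 'c set precat" where
  "quot n C R = \<lparr>
     cells = (\<lambda>k. qclass n R k ` cells C k),
     src = (\<lambda>i U. \<Union>u\<in>U. qclass n R i (src C i u)),
     tgt = (\<lambda>i U. \<Union>u\<in>U. qclass n R i (tgt C i u)),
     idc = (\<lambda>k U. \<Union>u\<in>U. qclass n R (Suc k) (idc C k u)),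
     cmp = (\<lambda>k l U V. \<Union>u\<in>U. \<Union>v\<in>V. qclass n R (max k l) (cmp C k l u v)) \<rparr>"


section \<open>Free extensions\<close>

text \<open>Given an \<open>n\<close>-precategory \<open>C\<close> and a set \<open>S\<close> of generators \<open>g\<close> with source \<open>s g\<close> and target
  \<open>t g\<close> among the \<open>n\<close>-cells of \<open>C\<close>, the formal \<open>(n+1)\<close>-cells are terms built from generators,
  identities on \<open>n\<close>-cells of \<open>C\<close>, composites with a lower-dimensional cell of \<open>C\<close> on the left or
  on the right (the number is the dimension of that cell), and composites of two formal
  \<open>(n+1)\<close>-cells.\<close>

datatype ('c, 'g) fterm =
    Gen 'g
  | Ident 'c
  | LComp nat 'c "('c, 'g) fterm"
  | RComp nat "('c, 'g) fterm" 'c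
  | TComp "('c, 'g) fterm" "('c, 'g) fterm"

primrec fsrc :: "nat \<Rightarrow> 'c precat \<Rightarrow> ('g \<Rightarrow> 'c) \<Rightarrow> ('c, 'g) fterm \<Rightarrow> 'c" where
  "fsrc n C s (Gen g) = s g"
| "fsrc n C s (Ident c) = c"
| "fsrc n C s (LComp k c u) = cmp C k n c (fsrc n C s u)"
| "fsrc n C s (RComp k u c) = cmp C n k (fsrc n C s u) c"
| "fsrc n C s (TComp u v) = fsrc n C s u"

primrec ftgt :: "nat \<Rightarrow> 'c precat \<Rightarrow> ('g \<Rightarrow> 'c) \<Rightarrow> ('c, 'g) fterm \<Rightarrow> 'c" where
  "ftgt n C t (Gen g) = t g"
| "ftgt n C t (Ident c) = c"
| "ftgt n C t (LComp k c u) = cmp C k n c (ftgt n C t u)"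
| "ftgt n C t (RComp k u c) = cmp C n k (ftgt n C t u) c"
| "ftgt n C t (TComp u v) = ftgt n C t v"

inductive_set fterms ::
  "nat \<Rightarrow> 'c precat \<Rightarrow> 'g set \<Rightarrow> ('g \<Rightarrow> 'c) \<Rightarrow> ('g \<Rightarrow> 'c) \<Rightarrow> ('c, 'g) fterm set"
  for n C S s t where
  "g \<in> S \<Longrightarrow> Gen g \<in> fterms n C S s t"
| "c \<in> cells C n \<Longrightarrow> Ident c \<in> fterms n C S s t"
| "\<lbrakk>0 < k; k \<le> n; c \<in> cells C k; u \<in> fterms n C S s t;
    tgt C (k - 1) c = srcs C n (k - 1) (fsrc n C s u)\<rbrakk> \<Longrightarrow> LComp k c u \<in> fterms n C S s t"
| "\<lbrakk>0 < k; k \<le> n; c \<in> cells C k; u \<in> fterms n C S s t;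
    tgts C n (k - 1) (ftgt n C t u) = src C (k - 1) c\<rbrakk> \<Longrightarrow> RComp k u c \<in> fterms n C S s t"
| "\<lbrakk>u \<in> fterms n C S s t; v \<in> fterms n C S s t; ftgt n C t u = fsrc n C s v\<rbrakk>
   \<Longrightarrow> TComp u v \<in> fterms n C S s t"

definition term_structure ::
  "nat \<Rightarrow> 'c precat \<Rightarrow> 'g set \<Rightarrow> ('g \<Rightarrow> 'c) \<Rightarrow> ('g \<Rightarrow> 'c) \<Rightarrow> ('c + ('c, 'g) fterm) precat" where
  "term_structure n C S s t = \<lparr>
     cells = (\<lambda>k. if k \<le> n then Inl ` cells C k
                  else if k = Suc n then Inr ` fterms n C S s t else {}),
     src = (\<lambda>i. case_sum (\<lambda>c. Inl (src C i c)) (\<lambda>u. Inl (fsrc n C s u))),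
     tgt = (\<lambda>i. case_sum (\<lambda>c. Inl (tgt C i c)) (\<lambda>u. Inl (ftgt n C t u))),
     idc = (\<lambda>k. case_sum (\<lambda>c. if k = n then Inr (Ident c) else Inl (idc C k c)) Inr),
     cmp = (\<lambda>k l x y. case (x, y) of
         (Inl c, Inl d) \<Rightarrow> Inl (cmp C k l c d)
       | (Inl c, Inr v) \<Rightarrow> Inr (LComp k c v)
       | (Inr u, Inl d) \<Rightarrow> Inr (RComp l u d)
       | (Inr u, Inr v) \<Rightarrow> Inr (TComp u v)) \<rparr>"

definition free_rel :: "nat \<Rightarrow> 'c precat \<Rightarrow> 'g set \<Rightarrow> ('g \<Rightarrow> 'c) \<Rightarrow> ('g \<Rightarrow> 'c) \<Rightarrow>
    (('c + ('c, 'g) fterm) \<times> ('c + ('c, 'g) fterm)) set" where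
  "free_rel n C S s t =
     least_congruence (Suc n) (term_structure n C S s t) (pc_law (term_structure n C S s t) (Suc n))"

type_synonym ('c, 'g) ext = "('c + ('c, 'g) fterm) set"

text \<open>The \<open>(n+1)\<close>-precategory obtained from the \<open>n\<close>-precategory \<open>C\<close> by freely adjoining \<open>S\<close>.\<close>

definition free_ext :: "nat \<Rightarrow> 'c precat \<Rightarrow> 'g set \<Rightarrow> ('g \<Rightarrow> 'c) \<Rightarrow> ('g \<Rightarrow> 'c) \<Rightarrow> ('c, 'g) ext precat" where
  "free_ext n C S s t = quot (Suc n) (term_structure n C S s t) (free_rel n C S s t)"

definition gen_cell :: "nat \<Rightarrow> 'c precat \<Rightarrow> 'g set \<Rightarrow> ('g \<Rightarrow> 'c) \<Rightarrow> ('g \<Rightarrow> 'c) \<Rightarrow> 'g \<Rightarrow> ('c, 'g) ext" where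
  "gen_cell n C S s t g = free_rel n C S s t `` {Inr (Gen g)}"

text \<open>The inclusion of the cells of \<open>C\<close> into a free extension of \<open>C\<close>.\<close>

definition up :: "'c \<Rightarrow> ('c, 'g) ext" where
  "up c = {Inl c}"


section \<open>Localization\<close>

text \<open>The localization of an \<open>n\<close>-precategory \<open>C\<close> (\<open>n > 0\<close>) at all its \<open>n\<close>-cells: to the underlying
  \<open>(n-1)\<close>-precategory one freely adjoins a copy \<open>Inl u\<close> and a formal inverse \<open>Inr u\<close> of each
  \<open>n\<close>-cell \<open>u\<close>; then one imposes that the canonical map from \<open>C\<close> is a morphism and that
  \<open>Inl u\<close> and \<open>Inr u\<close> are mutually inverse.\<close>

definition loc_free :: "nat \<Rightarrow> 'c precat \<Rightarrow> ('c, 'c + 'c) ext precat" where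
  "loc_free n C = free_ext (n - 1) C (cells C n <+> cells C n)
     (case_sum (src C (n - 1)) (tgt C (n - 1))) (case_sum (tgt C (n - 1)) (src C (n - 1)))"

definition loc_gen :: "nat \<Rightarrow> 'c precat \<Rightarrow> 'c + 'c \<Rightarrow> ('c, 'c + 'c) ext" where
  "loc_gen n C = gen_cell (n - 1) C (cells C n <+> cells C n)
     (case_sum (src C (n - 1)) (tgt C (n - 1))) (case_sum (tgt C (n - 1)) (src C (n - 1)))"

definition loc_map :: "nat \<Rightarrow> 'c precat \<Rightarrow> nat \<Rightarrow> 'c \<Rightarrow> ('c, 'c + 'c) ext" where
  "loc_map n C k u = (if k = n then loc_gen n C (Inl u) else up u)"

inductive loc_law :: "nat \<Rightarrow> 'c precat \<Rightarrow> ('c, 'c + 'c) ext \<Rightarrow> ('c, 'c + 'c) ext \<Rightarrow> bool"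
  for n C where
  "a \<in> cells C (n - 1) \<Longrightarrow>
     loc_law n C (loc_map n C n (idc C (n - 1) a)) (idc (loc_free n C) (n - 1) (up a))"
| "\<lbrakk>max k l = n; composable C k l u v\<rbrakk> \<Longrightarrow>
     loc_law n C (loc_map n C n (cmp C k l u v))
       (cmp (loc_free n C) k l (loc_map n C k u) (loc_map n C l v))"
| "u \<in> cells C n \<Longrightarrow>
     loc_law n C (cmp (loc_free n C) n n (loc_gen n C (Inl u)) (loc_gen n C (Inr u)))
       (idc (loc_free n C) (n - 1) (up (src C (n - 1) u)))"
| "u \<in> cells C n \<Longrightarrow>
     loc_law n C (cmp (loc_free n C) n n (loc_gen n C (Inr u)) (loc_gen n C (Inl u)))
       (idc (loc_free n C) (n - 1) (up (tgt C (n - 1) u)))"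

definition localization :: "nat \<Rightarrow> 'c precat \<Rightarrow> ('c, 'c + 'c) ext set precat" where
  "localization n C = quot n (loc_free n C) (least_congruence n (loc_free n C) (loc_law n C))"


section \<open>Prepolygraphs\<close>

type_synonym ('p0, 'p1) cell1 = "('p0, 'p1) ext"
type_synonym ('p0, 'p1, 'p2) cell2 = "(('p0, 'p1) cell1, 'p2) ext"
type_synonym ('p0, 'p1, 'p2, 'p3) cell3 = "(('p0, 'p1, 'p2) cell2, 'p3) ext"

record 'p0 prepoly0 =
  gens0 :: "'p0 set"

record ('p0, 'p1) prepoly1 = "'p0 prepoly0" +
  gens1 :: "'p1 set"
  dom1 :: "'p1 \<Rightarrow> 'p0"
  cod1 :: "'p1 \<Rightarrow> 'p0"

record ('p0, 'p1, 'p2) prepoly2 = "('p0, 'p1) prepoly1" +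
  gens2 :: "'p2 set"
  dom2 :: "'p2 \<Rightarrow> ('p0, 'p1) cell1"
  cod2 :: "'p2 \<Rightarrow> ('p0, 'p1) cell1"

record ('p0, 'p1, 'p2, 'p3) prepoly3 = "('p0, 'p1, 'p2) prepoly2" +
  gens3 :: "'p3 set"
  dom3 :: "'p3 \<Rightarrow> ('p0, 'p1, 'p2) cell2"
  cod3 :: "'p3 \<Rightarrow> ('p0, 'p1, 'p2) cell2"

record ('p0, 'p1, 'p2, 'p3, 'p4) prepoly4 = "('p0, 'p1, 'p2, 'p3) prepoly3" +
  gens4 :: "'p4 set"
  dom4 :: "'p4 \<Rightarrow> ('p0, 'p1, 'p2, 'p3) cell3"
  cod4 :: "'p4 \<Rightarrow> ('p0, 'p1, 'p2, 'p3) cell3"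

definition discrete :: "'c set \<Rightarrow> 'c precat" where
  "discrete A = \<lparr>cells = (\<lambda>k. if k = 0 then A else {}), src = (\<lambda>_ u. u), tgt = (\<lambda>_ u. u),
     idc = (\<lambda>_ u. u), cmp = (\<lambda>_ _ u _. u)\<rparr>"

definition free0 :: "('p0, 'z) prepoly0_scheme \<Rightarrow> 'p0 precat" where
  "free0 P = discrete (gens0 P)"

definition free1 :: "('p0, 'p1, 'z) prepoly1_scheme \<Rightarrow> ('p0, 'p1) cell1 precat" where
  "free1 P = free_ext 0 (free0 P) (gens1 P) (dom1 P) (cod1 P)"

definition free2 :: "('p0, 'p1, 'p2, 'z) prepoly2_scheme \<Rightarrow> ('p0, 'p1, 'p2) cell2 precat" where
  "free2 P = free_ext 1 (free1 P) (gens2 P) (dom2 P) (cod2 P)"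

definition free3 :: "('p0, 'p1, 'p2, 'p3, 'z) prepoly3_scheme \<Rightarrow> ('p0, 'p1, 'p2, 'p3) cell3 precat" where
  "free3 P = free_ext 2 (free2 P) (gens3 P) (dom3 P) (cod3 P)"

definition gen1 :: "('p0, 'p1, 'z) prepoly1_scheme \<Rightarrow> 'p1 \<Rightarrow> ('p0, 'p1) cell1" where
  "gen1 P = gen_cell 0 (free0 P) (gens1 P) (dom1 P) (cod1 P)"

definition gen2 :: "('p0, 'p1, 'p2, 'z) prepoly2_scheme \<Rightarrow> 'p2 \<Rightarrow> ('p0, 'p1, 'p2) cell2" where
  "gen2 P = gen_cell 1 (free1 P) (gens2 P) (dom2 P) (cod2 P)"

definition gen3 :: "('p0, 'p1, 'p2, 'p3, 'z) prepoly3_scheme \<Rightarrow> 'p3 \<Rightarrow> ('p0, 'p1, 'p2, 'p3) cell3" where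
  "gen3 P = gen_cell 2 (free2 P) (gens3 P) (dom3 P) (cod3 P)"

definition prepolygraph4 :: "('p0, 'p1, 'p2, 'p3, 'p4, 'z) prepoly4_scheme \<Rightarrow> bool" where
  "prepolygraph4 P \<longleftrightarrow>
     (\<forall>a\<in>gens1 P. parallel (free0 P) 0 (dom1 P a) (cod1 P a)) \<and>
     (\<forall>a\<in>gens2 P. parallel (free1 P) 1 (dom2 P a) (cod2 P a)) \<and>
     (\<forall>a\<in>gens3 P. parallel (free2 P) 2 (dom3 P a) (cod3 P a)) \<and>
     (\<forall>a\<in>gens4 P. parallel (free3 P) 3 (dom4 P a) (cod4 P a))"

inductive gen4_rel :: "('p0, 'p1, 'p2, 'p3, 'p4, 'z) prepoly4_scheme \<Rightarrow>
    ('p0, 'p1, 'p2, 'p3) cell3 \<Rightarrow> ('p0, 'p1, 'p2, 'p3) cell3 \<Rightarrow> bool" for P where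
  "G \<in> gens4 P \<Longrightarrow> gen4_rel P (dom4 P G) (cod4 P G)"

definition presented :: "('p0, 'p1, 'p2, 'p3, 'p4, 'z) prepoly4_scheme \<Rightarrow>
    ('p0, 'p1, 'p2, 'p3) cell3 set precat" where
  "presented P = quot 3 (free3 P) (least_congruence 3 (free3 P) (gen4_rel P))"


section \<open>Interchange of composite 2-cells\<close>

text \<open>A triple \<open>(l, \<alpha>, r)\<close> stands for the whisker \<open>l \<ast>\<^sub>0 \<alpha> \<ast>\<^sub>0 r\<close>.\<close>

definition whisker :: "('p0, 'p1, 'p2, 'z) prepoly2_scheme \<Rightarrow>
    ('p0, 'p1) cell1 \<times> 'p2 \<times> ('p0, 'p1) cell1 \<Rightarrow> ('p0, 'p1, 'p2) cell2" where
  "whisker P = (\<lambda>(l, \<alpha>, r). whisk (free2 P) 0 2 (up l) (gen2 P \<alpha>) (up r))"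

definition is_whisker :: "('p0, 'p1, 'p2, 'z) prepoly2_scheme \<Rightarrow>
    ('p0, 'p1) cell1 \<times> 'p2 \<times> ('p0, 'p1) cell1 \<Rightarrow> bool" where
  "is_whisker P = (\<lambda>(l, \<alpha>, r). \<alpha> \<in> gens2 P \<and> whiskable (free2 P) 0 2 (up l) (gen2 P \<alpha>) (up r))"

definition is_decomp :: "('p0, 'p1, 'p2, 'z) prepoly2_scheme \<Rightarrow> ('p0, 'p1, 'p2) cell2 \<Rightarrow>
    (('p0, 'p1) cell1 \<times> 'p2 \<times> ('p0, 'p1) cell1) list \<Rightarrow> bool" where
  "is_decomp P \<phi> ws \<longleftrightarrow> (\<forall>w\<in>set ws. is_whisker P w) \<and>
     successively (\<lambda>w w'. composable (free2 P) 2 2 (whisker P w) (whisker P w')) ws \<and>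
     vcomp (free2 P) 2 (src (free2 P) 1 \<phi>) (map (whisker P) ws) = \<phi>"

text \<open>Every 2-cell of a free precategory has exactly one whisker decomposition.\<close>

definition decomp :: "('p0, 'p1, 'p2, 'z) prepoly2_scheme \<Rightarrow> ('p0, 'p1, 'p2) cell2 \<Rightarrow>
    (('p0, 'p1) cell1 \<times> 'p2 \<times> ('p0, 'p1) cell1) list" where
  "decomp P \<phi> = (THE ws. is_decomp P \<phi> ws)"

text \<open>In the following definitions, \<open>X\<close> assigns the interchange generators. The cell
  \<open>elem_swap P X \<phi> \<psi> i j\<close> moves the whisker \<open>\<phi>\<^sub>i\<close> past \<open>\<psi>\<^sub>j\<close> (counted from 0), starting from the
  interleaving \<open>\<phi>\<^sub>0 \<dots> \<phi>\<^sub>i\<^sub>-\<^sub>1 \<psi>\<^sub>0 \<dots> \<psi>\<^sub>j\<^sub>-\<^sub>1 \<phi>\<^sub>i \<psi>\<^sub>j \<psi>\<^sub>j\<^sub>+\<^sub>1 \<dots> \<phi>\<^sub>i\<^sub>+\<^sub>1 \<dots>\<close>.\<close>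

definition elem_swap :: "('p0, 'p1, 'p2, 'p3, 'z) prepoly3_scheme \<Rightarrow>
    ('p2 \<Rightarrow> ('p0, 'p1) cell1 \<Rightarrow> 'p2 \<Rightarrow> 'p3) \<Rightarrow>
    ('p0, 'p1, 'p2) cell2 \<Rightarrow> ('p0, 'p1, 'p2) cell2 \<Rightarrow> nat \<Rightarrow> nat \<Rightarrow> ('p0, 'p1, 'p2, 'p3) cell3" where
  "elem_swap P X \<phi> \<psi> i j =
     (let C = free3 P;
          us = map (\<lambda>w. up (whisker P w)) (decomp P \<phi>);
          vs = map (\<lambda>w. up (whisker P w)) (decomp P \<psi>);
          h = src C 1 (up \<psi>); h' = tgt C 1 (up \<psi>);
          (l, \<alpha>, r) = decomp P \<phi> ! i;
          (l', \<beta>, r') = decomp P \<psi> ! j;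
          before = cmp C 2 2
                 (cmp C 2 1 (vcomp C 2 (src C 1 (up \<phi>)) (take i us)) h)
                 (cmp C 1 2 (src C 1 (us ! i)) (vcomp C 2 h (take j vs)));
          after = cmp C 2 2
                 (cmp C 1 2 (tgt C 1 (us ! i)) (vcomp C 2 (tgt C 1 (vs ! j)) (drop (Suc j) vs)))
                 (cmp C 2 1 (vcomp C 2 (tgt C 1 (us ! i)) (drop (Suc i) us)) h')
      in whisk C 1 3 before
           (whisk C 0 3 (up (up l)) (gen3 P (X \<alpha> (cmp (free1 P) 1 1 r l') \<beta>)) (up (up r'))) after)"

definition interchange :: "('p0, 'p1, 'p2, 'p3, 'z) prepoly3_scheme \<Rightarrow>
    ('p2 \<Rightarrow> ('p0, 'p1) cell1 \<Rightarrow> 'p2 \<Rightarrow> 'p3) \<Rightarrow>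
    ('p0, 'p1, 'p2) cell2 \<Rightarrow> ('p0, 'p1, 'p2) cell2 \<Rightarrow> ('p0, 'p1, 'p2, 'p3) cell3" where
  "interchange P X \<phi> \<psi> =
     (let C = free3 P
      in vcomp C 3
           (cmp C 2 2 (cmp C 2 1 (up \<phi>) (src C 1 (up \<psi>))) (cmp C 1 2 (tgt C 1 (up \<phi>)) (up \<psi>)))
           [elem_swap P X \<phi> \<psi> i j. i \<leftarrow> rev [0..<length (decomp P \<phi>)], j \<leftarrow> [0..<length (decomp P \<psi>)]])"


section \<open>Gray presentations\<close>

subsection \<open>Boundaries of the distinguished generators\<close>

text \<open>Interchange generators, indexed by 2-generators \<open>\<alpha>\<close>, \<open>\<beta>\<close> and a 1-cell \<open>g\<close>.\<close>

definition inter_ok :: "('p0, 'p1, 'p2, 'z) prepoly2_scheme \<Rightarrow>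
    'p2 \<Rightarrow> ('p0, 'p1) cell1 \<Rightarrow> 'p2 \<Rightarrow> bool" where
  "inter_ok P \<alpha> g \<beta> \<longleftrightarrow> \<alpha> \<in> gens2 P \<and> \<beta> \<in> gens2 P \<and> g \<in> cells (free1 P) 1 \<and>
     composable (free2 P) 2 1 (gen2 P \<alpha>) (up g) \<and> composable (free2 P) 1 2 (up g) (gen2 P \<beta>)"

definition inter_dom :: "('p0, 'p1, 'p2, 'z) prepoly2_scheme \<Rightarrow>
    'p2 \<Rightarrow> ('p0, 'p1) cell1 \<Rightarrow> 'p2 \<Rightarrow> ('p0, 'p1, 'p2) cell2" where
  "inter_dom P \<alpha> g \<beta> =
     (let C = free2 P; a = gen2 P \<alpha>; b = gen2 P \<beta>; f' = tgt C 1 a; h = src C 1 b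
      in cmp C 2 2 (cmp C 2 1 (cmp C 2 1 a (up g)) h) (cmp C 1 2 (cmp C 1 1 f' (up g)) b))"

definition inter_cod :: "('p0, 'p1, 'p2, 'z) prepoly2_scheme \<Rightarrow>
    'p2 \<Rightarrow> ('p0, 'p1) cell1 \<Rightarrow> 'p2 \<Rightarrow> ('p0, 'p1, 'p2) cell2" where
  "inter_cod P \<alpha> g \<beta> =
     (let C = free2 P; a = gen2 P \<alpha>; b = gen2 P \<beta>; f = src C 1 a; h' = tgt C 1 b
      in cmp C 2 2 (cmp C 1 2 (cmp C 1 1 f (up g)) b) (cmp C 2 1 (cmp C 2 1 a (up g)) h'))"

text \<open>Independence generators.\<close>

definition indep_ok :: "('p0, 'p1, 'p2, 'p3, 'z) prepoly3_scheme \<Rightarrow>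
    ('p0, 'p1) cell1 \<Rightarrow> 'p3 \<Rightarrow> ('p0, 'p1) cell1 \<Rightarrow> ('p0, 'p1, 'p2) cell2 \<Rightarrow>
    ('p0, 'p1) cell1 \<Rightarrow> 'p3 \<Rightarrow> ('p0, 'p1) cell1 \<Rightarrow> bool" where
  "indep_ok P e A h \<chi> e' B h' \<longleftrightarrow> A \<in> gens3 P \<and> B \<in> gens3 P \<and>
     whiskable (free2 P) 0 2 (up e) (dom3 P A) (up h) \<and>
     whiskable (free2 P) 0 2 (up e') (dom3 P B) (up h') \<and>
     whiskable (free2 P) 1 2 (whisk (free2 P) 0 2 (up e) (dom3 P A) (up h)) \<chi>
       (whisk (free2 P) 0 2 (up e') (dom3 P B) (up h'))"

definition indep_dom :: "('p0, 'p1, 'p2, 'p3, 'z) prepoly3_scheme \<Rightarrow>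
    ('p0, 'p1) cell1 \<Rightarrow> 'p3 \<Rightarrow> ('p0, 'p1) cell1 \<Rightarrow> ('p0, 'p1, 'p2) cell2 \<Rightarrow>
    ('p0, 'p1) cell1 \<Rightarrow> 'p3 \<Rightarrow> ('p0, 'p1) cell1 \<Rightarrow> ('p0, 'p1, 'p2, 'p3) cell3" where
  "indep_dom P e A h \<chi> e' B h' =
     (let C = free3 P;
          left = (\<lambda>k u. whisk C 0 k (up (up e)) u (up (up h)));
          right = (\<lambda>k u. whisk C 0 k (up (up e')) u (up (up h')))
      in cmp C 3 3
           (cmp C 3 2 (cmp C 3 2 (left 3 (gen3 P A)) (up \<chi>)) (right 2 (up (dom3 P B))))
           (cmp C 2 3 (cmp C 2 2 (left 2 (up (cod3 P A))) (up \<chi>)) (right 3 (gen3 P B))))"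

definition indep_cod :: "('p0, 'p1, 'p2, 'p3, 'z) prepoly3_scheme \<Rightarrow>
    ('p0, 'p1) cell1 \<Rightarrow> 'p3 \<Rightarrow> ('p0, 'p1) cell1 \<Rightarrow> ('p0, 'p1, 'p2) cell2 \<Rightarrow>
    ('p0, 'p1) cell1 \<Rightarrow> 'p3 \<Rightarrow> ('p0, 'p1) cell1 \<Rightarrow> ('p0, 'p1, 'p2, 'p3) cell3" where
  "indep_cod P e A h \<chi> e' B h' =
     (let C = free3 P;
          left = (\<lambda>k u. whisk C 0 k (up (up e)) u (up (up h)));
          right = (\<lambda>k u. whisk C 0 k (up (up e')) u (up (up h')))
      in cmp C 3 3
           (cmp C 2 3 (cmp C 2 2 (left 2 (up (dom3 P A))) (up \<chi>)) (right 3 (gen3 P B)))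
           (cmp C 3 2 (cmp C 3 2 (left 3 (gen3 P A)) (up \<chi>)) (right 2 (up (cod3 P B)))))"

text \<open>Interchange naturality generators for a 3-generator on the left.\<close>

definition natl_ok :: "('p0, 'p1, 'p2, 'p3, 'z) prepoly3_scheme \<Rightarrow>
    'p3 \<Rightarrow> ('p0, 'p1) cell1 \<Rightarrow> 'p2 \<Rightarrow> bool" where
  "natl_ok P A g \<beta> \<longleftrightarrow> A \<in> gens3 P \<and> \<beta> \<in> gens2 P \<and> g \<in> cells (free1 P) 1 \<and>
     composable (free3 P) 3 1 (gen3 P A) (up (up g)) \<and>
     composable (free2 P) 1 2 (up g) (gen2 P \<beta>)"

definition natl_dom :: "('p0, 'p1, 'p2, 'p3, 'z) prepoly3_scheme \<Rightarrow>
    ('p2 \<Rightarrow> ('p0, 'p1) cell1 \<Rightarrow> 'p2 \<Rightarrow> 'p3) \<Rightarrow>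
    'p3 \<Rightarrow> ('p0, 'p1) cell1 \<Rightarrow> 'p2 \<Rightarrow> ('p0, 'p1, 'p2, 'p3) cell3" where
  "natl_dom P X A g \<beta> =
     (let C = free3 P; G = up (up g); b = up (gen2 P \<beta>);
          f' = tgt C 1 (up (dom3 P A)); h = src C 1 b
      in cmp C 3 3
           (cmp C 3 2 (cmp C 3 1 (cmp C 3 1 (gen3 P A) G) h) (cmp C 1 2 (cmp C 1 1 f' G) b))
           (interchange P X (cod3 P A) (cmp (free2 P) 1 2 (up g) (gen2 P \<beta>))))"

definition natl_cod :: "('p0, 'p1, 'p2, 'p3, 'z) prepoly3_scheme \<Rightarrow>
    ('p2 \<Rightarrow> ('p0, 'p1) cell1 \<Rightarrow> 'p2 \<Rightarrow> 'p3) \<Rightarrow>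
    'p3 \<Rightarrow> ('p0, 'p1) cell1 \<Rightarrow> 'p2 \<Rightarrow> ('p0, 'p1, 'p2, 'p3) cell3" where
  "natl_cod P X A g \<beta> =
     (let C = free3 P; G = up (up g); b = up (gen2 P \<beta>);
          f = src C 1 (up (dom3 P A)); h' = tgt C 1 b
      in cmp C 3 3
           (interchange P X (dom3 P A) (cmp (free2 P) 1 2 (up g) (gen2 P \<beta>)))
           (cmp C 2 3 (cmp C 1 2 (cmp C 1 1 f G) b) (cmp C 3 1 (cmp C 3 1 (gen3 P A) G) h')))"

text \<open>Interchange naturality generators for a 3-generator on the right.\<close>

definition natr_ok :: "('p0, 'p1, 'p2, 'p3, 'z) prepoly3_scheme \<Rightarrow>
    'p2 \<Rightarrow> ('p0, 'p1) cell1 \<Rightarrow> 'p3 \<Rightarrow> bool" where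
  "natr_ok P \<alpha> g B \<longleftrightarrow> \<alpha> \<in> gens2 P \<and> B \<in> gens3 P \<and> g \<in> cells (free1 P) 1 \<and>
     composable (free2 P) 2 1 (gen2 P \<alpha>) (up g) \<and>
     composable (free3 P) 1 3 (up (up g)) (gen3 P B)"

definition natr_dom :: "('p0, 'p1, 'p2, 'p3, 'z) prepoly3_scheme \<Rightarrow>
    ('p2 \<Rightarrow> ('p0, 'p1) cell1 \<Rightarrow> 'p2 \<Rightarrow> 'p3) \<Rightarrow>
    'p2 \<Rightarrow> ('p0, 'p1) cell1 \<Rightarrow> 'p3 \<Rightarrow> ('p0, 'p1, 'p2, 'p3) cell3" where
  "natr_dom P X \<alpha> g B =
     (let C = free3 P; G = up (up g); a = up (gen2 P \<alpha>);
          f' = tgt C 1 a; h = src C 1 (up (dom3 P B))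
      in cmp C 3 3
           (cmp C 2 3 (cmp C 2 1 (cmp C 2 1 a G) h) (cmp C 1 3 (cmp C 1 1 f' G) (gen3 P B)))
           (interchange P X (cmp (free2 P) 2 1 (gen2 P \<alpha>) (up g)) (cod3 P B)))"

definition natr_cod :: "('p0, 'p1, 'p2, 'p3, 'z) prepoly3_scheme \<Rightarrow>
    ('p2 \<Rightarrow> ('p0, 'p1) cell1 \<Rightarrow> 'p2 \<Rightarrow> 'p3) \<Rightarrow>
    'p2 \<Rightarrow> ('p0, 'p1) cell1 \<Rightarrow> 'p3 \<Rightarrow> ('p0, 'p1, 'p2, 'p3) cell3" where
  "natr_cod P X \<alpha> g B =
     (let C = free3 P; G = up (up g); a = up (gen2 P \<alpha>);
          f = src C 1 a; h' = tgt C 1 (up (dom3 P B))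
      in cmp C 3 3
           (interchange P X (cmp (free2 P) 2 1 (gen2 P \<alpha>) (up g)) (dom3 P B))
           (cmp C 3 2 (cmp C 1 3 (cmp C 1 1 f G) (gen3 P B)) (cmp C 2 1 (cmp C 2 1 a G) h')))"

subsection \<open>Gray presentations and coherence\<close>

text \<open>The additional fields assign the distinguished generators to their indices; their values
  matter only on indices satisfying the respective composability condition.\<close>

record ('p0, 'p1, 'p2, 'p3, 'p4) gray = "('p0, 'p1, 'p2, 'p3, 'p4) prepoly4" +
  inter_gen :: "'p2 \<Rightarrow> ('p0, 'p1) cell1 \<Rightarrow> 'p2 \<Rightarrow> 'p3"
  indep_gen :: "('p0, 'p1) cell1 \<Rightarrow> 'p3 \<Rightarrow> ('p0, 'p1) cell1 \<Rightarrow> ('p0, 'p1, 'p2) cell2 \<Rightarrow>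
    ('p0, 'p1) cell1 \<Rightarrow> 'p3 \<Rightarrow> ('p0, 'p1) cell1 \<Rightarrow> 'p4"
  natl_gen :: "'p3 \<Rightarrow> ('p0, 'p1) cell1 \<Rightarrow> 'p2 \<Rightarrow> 'p4"
  natr_gen :: "'p2 \<Rightarrow> ('p0, 'p1) cell1 \<Rightarrow> 'p3 \<Rightarrow> 'p4"

definition gray_presentation :: "('p0, 'p1, 'p2, 'p3, 'p4) gray \<Rightarrow> bool" where
  "gray_presentation P \<longleftrightarrow> prepolygraph4 P \<and>
     (\<forall>\<alpha> g \<beta>. inter_ok P \<alpha> g \<beta> \<longrightarrow>
        inter_gen P \<alpha> g \<beta> \<in> gens3 P \<and>
        dom3 P (inter_gen P \<alpha> g \<beta>) = inter_dom P \<alpha> g \<beta> \<and>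
        cod3 P (inter_gen P \<alpha> g \<beta>) = inter_cod P \<alpha> g \<beta>) \<and>
     (\<forall>e A h \<chi> e' B h'. indep_ok P e A h \<chi> e' B h' \<longrightarrow>
        indep_gen P e A h \<chi> e' B h' \<in> gens4 P \<and>
        dom4 P (indep_gen P e A h \<chi> e' B h') = indep_dom P e A h \<chi> e' B h' \<and>
        cod4 P (indep_gen P e A h \<chi> e' B h') = indep_cod P e A h \<chi> e' B h') \<and>
     (\<forall>A g \<beta>. natl_ok P A g \<beta> \<longrightarrow>
        natl_gen P A g \<beta> \<in> gens4 P \<and>
        dom4 P (natl_gen P A g \<beta>) = natl_dom P (inter_gen P) A g \<beta> \<and>
        cod4 P (natl_gen P A g \<beta>) = natl_cod P (inter_gen P) A g \<beta>) \<and>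
     (\<forall>\<alpha> g B. natr_ok P \<alpha> g B \<longrightarrow>
        natr_gen P \<alpha> g B \<in> gens4 P \<and>
        dom4 P (natr_gen P \<alpha> g B) = natr_dom P (inter_gen P) \<alpha> g B \<and>
        cod4 P (natr_gen P \<alpha> g B) = natr_cod P (inter_gen P) \<alpha> g B)"

definition coherent :: "('p0, 'p1, 'p2, 'p3, 'p4) gray \<Rightarrow> bool" where
  "coherent P \<longleftrightarrow> (\<forall>u v. parallel (localization 3 (presented P)) 3 u v \<longrightarrow> u = v)"


section \<open>The Gray presentation of pseudoadjunctions\<close>

datatype adj0 = Ox | Oy

datatype adj1 = Ff | Fg

type_synonym adj_cell1 = "(adj0, adj1) cell1"

datatype adj2 = Eta | Eps

type_synonym adj_cell2 = "(adj0, adj1, adj2) cell2"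

datatype adj3 = Nf | Ng | Inter adj2 adj_cell1 adj2

type_synonym adj_cell3 = "(adj0, adj1, adj2, adj3) cell3"

datatype adj4 =
    Indep adj_cell1 adj3 adj_cell1 adj_cell2 adj_cell1 adj3 adj_cell1
  | NatL adj3 adj_cell1 adj2
  | NatR adj2 adj_cell1 adj3
  | TriEps
  | TriEta

definition Adj1 :: "(adj0, adj1) prepoly1" where
  "Adj1 = \<lparr>gens0 = UNIV, gens1 = UNIV,
     dom1 = (\<lambda>a. case a of Ff \<Rightarrow> Ox | Fg \<Rightarrow> Oy),
     cod1 = (\<lambda>a. case a of Ff \<Rightarrow> Oy | Fg \<Rightarrow> Ox)\<rparr>"

definition Adj2 :: "(adj0, adj1, adj2) prepoly2" where
  "Adj2 = prepoly1.extend Adj1 (prepoly2.fields UNIV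
     (\<lambda>a. case a of Eta \<Rightarrow> idc (free1 Adj1) 0 (up Ox)
                  | Eps \<Rightarrow> cmp (free1 Adj1) 1 1 (gen1 Adj1 Fg) (gen1 Adj1 Ff))
     (\<lambda>a. case a of Eta \<Rightarrow> cmp (free1 Adj1) 1 1 (gen1 Adj1 Ff) (gen1 Adj1 Fg)
                  | Eps \<Rightarrow> idc (free1 Adj1) 0 (up Oy)))"

definition Adj3 :: "(adj0, adj1, adj2, adj3) prepoly3" where
  "Adj3 =
     (let C = free2 Adj2; f = up (gen1 Adj2 Ff); g = up (gen1 Adj2 Fg);
          \<eta> = gen2 Adj2 Eta; \<epsilon> = gen2 Adj2 Eps
      in prepoly2.extend Adj2 (prepoly3.fields
           ({Nf, Ng} \<union> {Inter \<alpha> h \<beta> |\<alpha> h \<beta>. inter_ok Adj2 \<alpha> h \<beta>})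
           (\<lambda>A. case A of
               Nf \<Rightarrow> cmp C 2 2 (cmp C 2 1 \<eta> f) (cmp C 1 2 f \<epsilon>)
             | Ng \<Rightarrow> cmp C 2 2 (cmp C 1 2 g \<eta>) (cmp C 2 1 \<epsilon> g)
             | Inter \<alpha> h \<beta> \<Rightarrow> inter_dom Adj2 \<alpha> h \<beta>)
           (\<lambda>A. case A of
               Nf \<Rightarrow> idc C 1 f
             | Ng \<Rightarrow> idc C 1 g
             | Inter \<alpha> h \<beta> \<Rightarrow> inter_cod Adj2 \<alpha> h \<beta>)))"

definition PAdj :: "(adj0, adj1, adj2, adj3, adj4) gray" where
  "PAdj =
     (let C = free3 Adj3; f = up (up (gen1 Adj3 Ff)); g = up (up (gen1 Adj3 Fg));
          \<eta> = up (gen2 Adj3 Eta); \<epsilon> = up (gen2 Adj3 Eps);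
          N = gen3 Adj3 Nf; N' = gen3 Adj3 Ng;
          X\<epsilon> = gen3 Adj3 (Inter Eps (idc (free1 Adj3) 0 (up Oy)) Eps);
          X\<eta> = gen3 Adj3 (Inter Eta (idc (free1 Adj3) 0 (up Ox)) Eta)
      in prepoly4.extend (prepoly3.extend Adj3 (prepoly4.fields
           ({Indep e A h \<chi> e' B h' |e A h \<chi> e' B h'. indep_ok Adj3 e A h \<chi> e' B h'} \<union>
            {NatL A h \<beta> |A h \<beta>. natl_ok Adj3 A h \<beta>} \<union>
            {NatR \<alpha> h B |\<alpha> h B. natr_ok Adj3 \<alpha> h B} \<union>
            {TriEps, TriEta})
           (\<lambda>G. case G of
               Indep e A h \<chi> e' B h' \<Rightarrow> indep_dom Adj3 e A h \<chi> e' B h'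
             | NatL A h \<beta> \<Rightarrow> natl_dom Adj3 Inter A h \<beta>
             | NatR \<alpha> h B \<Rightarrow> natr_dom Adj3 Inter \<alpha> h B
             | TriEps \<Rightarrow> cmp C 3 2 (cmp C 3 1 N' f) \<epsilon>
             | TriEta \<Rightarrow> cmp C 2 3 \<eta> (cmp C 1 3 f N'))
           (\<lambda>G. case G of
               Indep e A h \<chi> e' B h' \<Rightarrow> indep_cod Adj3 e A h \<chi> e' B h'
             | NatL A h \<beta> \<Rightarrow> natl_cod Adj3 Inter A h \<beta>
             | NatR \<alpha> h B \<Rightarrow> natr_cod Adj3 Inter \<alpha> h B
             | TriEps \<Rightarrow> cmp C 3 3 (cmp C 2 3 (whisk C 0 2 g \<eta> f) X\<epsilon>)
                           (cmp C 3 2 (cmp C 1 3 g N) \<epsilon>)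
             | TriEta \<Rightarrow> cmp C 3 3 (cmp C 3 2 X\<eta> (whisk C 0 2 f \<epsilon> g))
                           (cmp C 2 3 \<eta> (cmp C 3 1 N g)))))
         (gray.fields Inter Indep NatL NatR))"

end

theory Submission
  imports Defs
begin

text \<open>A 2-cell of the free precategory on \<open>\<eta>\<close> and \<open>\<epsilon>\<close> is a \<^emph>\<open>string\<close>: a word in \<open>f\<close> and \<open>g\<close> together with
  the list of positions at which \<open>\<eta>\<close> or \<open>\<epsilon>\<close> is successively applied. In the localization of the
  presented precategory, the 3-cells between strings form a groupoid generated by the whiskered
  \<open>N\<close>, \<open>N'\<close> and interchangers. Choosing a direction for each of these generators gives a terminating
  rewriting system on strings. Non-overlapping steps commute by independence, and overlapping steps
  act on three consecutive generators: those peaks are closed by interchange naturality of an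
  interchanger (a hexagon) or of \<open>N\<close>, \<open>N'\<close> (a zigzag slides past a generator), and by the two
  triangle relations. So, by Newman's argument, every string \<open>s\<close> has an invertible 3-cell \<open>c s\<close> to a
  normal form, and every 3-cell from \<open>s\<close> to \<open>t\<close>, composed with \<open>c t\<close>, is equal to \<open>c s\<close>.\<close>

section \<open>Boundary calculus for iterated sources and targets, without the equational
  laws\<close>

section \<open>Boundaries in precategories\<close>

text \<open>Cells of the free and localized precategories are classes of terms, so their equality
  cannot be read off. An explicit model of words and strings decides it in dimensions 1 and 2, where
  localizing changes nothing; this makes the source and target strings of a 3-cell well defined.
  Compatibility with the chosen cells \<open>c s\<close> is not visibly stable under whiskering,
  since the normal form of a whiskered string is not the whiskered normal form. The induction over
  all 3-cells therefore carries compatibility in every context (\<open>nice\<close>), and confluence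
  is applied to generators in arbitrary contexts. Rewriting does not always follow the interchange
  generators: an \<eta> followed by an \<epsilon> far enough to its left is reduced by an inverse
  interchanger. Hence a peak may sit at an inner vertex of a hexagon or of a slide, and each such
  relation is exploited from several of its vertices. The boundaries of the 4-generators are
  computed as strings in the free 3-precategory and carried to the localization by the canonical
  morphism; the locale of strings serves both places.\<close>

definition pcbase :: "nat \<Rightarrow> 'c precat \<Rightarrow> bool" where
  "pcbase n C \<longleftrightarrow>
     (\<forall>i<n. \<forall>u\<in>cells C (Suc i). src C i u \<in> cells C i \<and> tgt C i u \<in> cells C i) \<and>
     (\<forall>i. Suc i < n \<longrightarrow> (\<forall>u\<in>cells C (Suc (Suc i)). parallel C (Suc i) (src C (Suc i) u) (tgt C (Suc i) u))) \<and>
     (\<forall>k<n. \<forall>u\<in>cells C k. idc C k u \<in> cells C (Suc k) \<and>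
        src C k (idc C k u) = u \<and> tgt C k (idc C k u) = u) \<and>
     (\<forall>k\<le>n. \<forall>l\<le>n. \<forall>u v. composable C k l u v \<longrightarrow>
        cmp C k l u v \<in> cells C (max k l) \<and>
        (k < l \<longrightarrow> src C (l - 1) (cmp C k l u v) = cmp C k (l - 1) u (src C (l - 1) v) \<and>
                  tgt C (l - 1) (cmp C k l u v) = cmp C k (l - 1) u (tgt C (l - 1) v)) \<and>
        (l < k \<longrightarrow> src C (k - 1) (cmp C k l u v) = cmp C (k - 1) l (src C (k - 1) u) v \<and>
                  tgt C (k - 1) (cmp C k l u v) = cmp C (k - 1) l (tgt C (k - 1) u) v) \<and>
        (k = l \<longrightarrow> src C (k - 1) (cmp C k l u v) = src C (k - 1) u \<and>
                  tgt C (k - 1) (cmp C k l u v) = tgt C (k - 1) v))"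

text \<open>The laws are separated from the other axioms because a structure of formal terms
  satisfies \<open>pcbase\<close> outright, while the laws in its top dimension hold only after a
  quotient.\<close>

lemma precategory_iff:
  "precategory n C \<longleftrightarrow> pcbase n C \<and> (\<forall>m\<le>n. \<forall>u v. pc_law C m u v \<longrightarrow> u = v)"
  unfolding precategory_def pcbase_def by meson

lemma pcbase_mono:
  assumes "pcbase n C" "m \<le> n"
  shows "pcbase m C"
proof -
  have mono: "\<And>P. \<forall>k\<le>n. \<forall>l\<le>n. P k l \<Longrightarrow> \<forall>k\<le>m. \<forall>l\<le>m. P k l"
    using assms(2) by (meson le_trans)
  have less: "i < m \<Longrightarrow> i < n" for i
    using assms(2) by simp
  show ?thesis
    unfolding pcbase_def
  proof (intro conjI)
    show "\<forall>k\<le>m. \<forall>l\<le>m. \<forall>u v. composable C k l u v \<longrightarrow>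
        cmp C k l u v \<in> cells C (max k l) \<and>
        (k < l \<longrightarrow> src C (l - 1) (cmp C k l u v) = cmp C k (l - 1) u (src C (l - 1) v) \<and>
                  tgt C (l - 1) (cmp C k l u v) = cmp C k (l - 1) u (tgt C (l - 1) v)) \<and>
        (l < k \<longrightarrow> src C (k - 1) (cmp C k l u v) = cmp C (k - 1) l (src C (k - 1) u) v \<and>
                  tgt C (k - 1) (cmp C k l u v) = cmp C (k - 1) l (tgt C (k - 1) u) v) \<and>
        (k = l \<longrightarrow> src C (k - 1) (cmp C k l u v) = src C (k - 1) u \<and>
                  tgt C (k - 1) (cmp C k l u v) = tgt C (k - 1) v)"
      by (rule mono, insert assms(1)[unfolded pcbase_def], elim conjE, assumption)
  qed (insert assms(1)[unfolded pcbase_def], elim conjE, simp add: less)+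
qed

lemma precategory_mono: "precategory n C \<Longrightarrow> m \<le> n \<Longrightarrow> precategory m C"
  unfolding precategory_iff using pcbase_mono le_trans by blast

lemma srcs_self [simp]: "srcs C k k u = u" and tgts_self [simp]: "tgts C k k u = u"
  by (simp_all add: srcs_def tgts_def)

lemma srcs_Suc: "i \<le> k \<Longrightarrow> srcs C (Suc k) i u = srcs C k i (src C k u)"
  and tgts_Suc: "i \<le> k \<Longrightarrow> tgts C (Suc k) i u = tgts C k i (tgt C k u)"
  by (simp_all add: srcs_def tgts_def)

lemma srcs_srcs: "i \<le> j \<Longrightarrow> j \<le> k \<Longrightarrow> srcs C j i (srcs C k j u) = srcs C k i u"
proof (induction k arbitrary: u)
  case (Suc k)
  then show ?case by (cases "j = Suc k") (auto simp: srcs_Suc)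
qed simp

lemma tgts_tgts: "i \<le> j \<Longrightarrow> j \<le> k \<Longrightarrow> tgts C j i (tgts C k j u) = tgts C k i u"
proof (induction k arbitrary: u)
  case (Suc k)
  then show ?case by (cases "j = Suc k") (auto simp: tgts_Suc)
qed simp

locale pcb =
  fixes n :: nat and C :: "'c precat"
  assumes pcb: "pcbase n C"
begin

lemma src_cell: "u \<in> cells C (Suc i) \<Longrightarrow> i < n \<Longrightarrow> src C i u \<in> cells C i"
  and tgt_cell: "u \<in> cells C (Suc i) \<Longrightarrow> i < n \<Longrightarrow> tgt C i u \<in> cells C i"
  using pcb unfolding pcbase_def by auto

lemma globular:
  assumes "u \<in> cells C (Suc (Suc i))" "Suc i < n"
  shows "src C i (src C (Suc i) u) = src C i (tgt C (Suc i) u)"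
    "tgt C i (src C (Suc i) u) = tgt C i (tgt C (Suc i) u)"
  using pcb assms unfolding pcbase_def parallel_def by auto

lemma id_cell: "u \<in> cells C k \<Longrightarrow> k < n \<Longrightarrow> idc C k u \<in> cells C (Suc k)"
  and src_id: "u \<in> cells C k \<Longrightarrow> k < n \<Longrightarrow> src C k (idc C k u) = u"
  and tgt_id: "u \<in> cells C k \<Longrightarrow> k < n \<Longrightarrow> tgt C k (idc C k u) = u"
  using pcb unfolding pcbase_def by auto

lemma srcs_tgt: "i < k \<Longrightarrow> k < n \<Longrightarrow> u \<in> cells C (Suc k) \<Longrightarrow> srcs C k i (tgt C k u) = srcs C (Suc k) i u"
  and tgts_src: "i < k \<Longrightarrow> k < n \<Longrightarrow> u \<in> cells C (Suc k) \<Longrightarrow> tgts C k i (src C k u) = tgts C (Suc k) i u"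
  by (cases k; simp add: srcs_Suc tgts_Suc globular)+

lemma srcs_cell: "u \<in> cells C k \<Longrightarrow> i \<le> k \<Longrightarrow> k \<le> n \<Longrightarrow> srcs C k i u \<in> cells C i"
proof (induction k arbitrary: u)
  case (Suc k)
  then show ?case by (cases "i = Suc k") (auto simp: srcs_Suc src_cell)
qed simp

lemma tgts_cell: "u \<in> cells C k \<Longrightarrow> i \<le> k \<Longrightarrow> k \<le> n \<Longrightarrow> tgts C k i u \<in> cells C i"
proof (induction k arbitrary: u)
  case (Suc k)
  then show ?case by (cases "i = Suc k") (auto simp: tgts_Suc tgt_cell)
qed simp

lemma srcs_tgts: "i < j \<Longrightarrow> j \<le> k \<Longrightarrow> k \<le> n \<Longrightarrow> u \<in> cells C k \<Longrightarrow> srcs C j i (tgts C k j u) = srcs C k i u"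
proof (induction k arbitrary: u)
  case (Suc k)
  then show ?case
    by (cases "j = Suc k") (auto simp: tgts_Suc tgt_cell srcs_tgt)
qed simp

lemma tgts_srcs: "i < j \<Longrightarrow> j \<le> k \<Longrightarrow> k \<le> n \<Longrightarrow> u \<in> cells C k \<Longrightarrow> tgts C j i (srcs C k j u) = tgts C k i u"
proof (induction k arbitrary: u)
  case (Suc k)
  then show ?case
    by (cases "j = Suc k") (auto simp: srcs_Suc src_cell tgts_src)
qed simp

lemma cmp_cell: "composable C k l u v \<Longrightarrow> k \<le> n \<Longrightarrow> l \<le> n \<Longrightarrow> cmp C k l u v \<in> cells C (max k l)"
  using pcb unfolding pcbase_def by blast

lemma cmp_cell_le: "composable C k l u v \<Longrightarrow> k \<le> l \<Longrightarrow> l \<le> n \<Longrightarrow> cmp C k l u v \<in> cells C l"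
  and cmp_cell_ge: "composable C k l u v \<Longrightarrow> l \<le> k \<Longrightarrow> k \<le> n \<Longrightarrow> cmp C k l u v \<in> cells C k"
  using cmp_cell[of k l u v] by (auto simp: max_def split: if_splits)

lemma cmp_boundary:
  assumes "composable C k l u v" "k \<le> n" "l \<le> n"
  shows "k < l \<Longrightarrow> src C (l - 1) (cmp C k l u v) = cmp C k (l - 1) u (src C (l - 1) v) \<and>
           tgt C (l - 1) (cmp C k l u v) = cmp C k (l - 1) u (tgt C (l - 1) v)"
    "l < k \<Longrightarrow> src C (k - 1) (cmp C k l u v) = cmp C (k - 1) l (src C (k - 1) u) v \<and>
           tgt C (k - 1) (cmp C k l u v) = cmp C (k - 1) l (tgt C (k - 1) u) v"
    "k = l \<Longrightarrow> src C (k - 1) (cmp C k l u v) = src C (k - 1) u \<and>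
           tgt C (k - 1) (cmp C k l u v) = tgt C (k - 1) v"
  using pcb assms unfolding pcbase_def by blast+

lemma src_cmp_less:
  assumes "composable C k (Suc l) u v" "k \<le> l" "l < n"
  shows "src C l (cmp C k (Suc l) u v) = cmp C k l u (src C l v)"
    "tgt C l (cmp C k (Suc l) u v) = cmp C k l u (tgt C l v)"
  using cmp_boundary(1)[OF assms(1)] assms(2,3) by auto

lemma src_cmp_greater:
  assumes "composable C (Suc k) l u v" "l \<le> k" "k < n"
  shows "src C k (cmp C (Suc k) l u v) = cmp C k l (src C k u) v"
    "tgt C k (cmp C (Suc k) l u v) = cmp C k l (tgt C k u) v"
  using cmp_boundary(2)[OF assms(1)] assms(2,3) by auto

lemma src_cmp_eq:
  assumes "composable C (Suc k) (Suc k) u v" "k < n"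
  shows "src C k (cmp C (Suc k) (Suc k) u v) = src C k u"
    "tgt C k (cmp C (Suc k) (Suc k) u v) = tgt C k v"
  using cmp_boundary(3)[OF assms(1)] assms(2) by auto

lemma composable_less:
  assumes "composable C k (Suc l) u v" "k \<le> l" "l < n"
  shows "composable C k l u (src C l v)" "composable C k l u (tgt C l v)"
  using assms unfolding composable_def
  by (auto simp: min_def srcs_Suc src_cell tgt_cell srcs_tgt)

lemma composable_greater:
  assumes "composable C (Suc k) l u v" "l \<le> k" "k < n"
  shows "composable C k l (src C k u) v" "composable C k l (tgt C k u) v"
  using assms unfolding composable_def
  by (auto simp: min_def tgts_Suc src_cell tgt_cell tgts_src)

lemma srcs_cmp_less:
  "composable C k l u v \<Longrightarrow> k \<le> j \<Longrightarrow> j \<le> l \<Longrightarrow> l \<le> n \<Longrightarrow>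
   composable C k j u (srcs C l j v) \<and> srcs C l j (cmp C k l u v) = cmp C k j u (srcs C l j v)"
proof (induction l arbitrary: v)
  case (Suc l)
  then show ?case by (cases "j = Suc l") (auto simp: srcs_Suc src_cmp_less composable_less)
qed simp

lemma tgts_cmp_less:
  "composable C k l u v \<Longrightarrow> k \<le> j \<Longrightarrow> j \<le> l \<Longrightarrow> l \<le> n \<Longrightarrow>
   composable C k j u (tgts C l j v) \<and> tgts C l j (cmp C k l u v) = cmp C k j u (tgts C l j v)"
proof (induction l arbitrary: v)
  case (Suc l)
  then show ?case by (cases "j = Suc l") (auto simp: tgts_Suc src_cmp_less composable_less)
qed simp

lemma srcs_cmp_greater:
  "composable C k l u v \<Longrightarrow> l \<le> j \<Longrightarrow> j \<le> k \<Longrightarrow> k \<le> n \<Longrightarrow>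
   composable C j l (srcs C k j u) v \<and> srcs C k j (cmp C k l u v) = cmp C j l (srcs C k j u) v"
proof (induction k arbitrary: u)
  case (Suc k)
  then show ?case by (cases "j = Suc k") (auto simp: srcs_Suc src_cmp_greater composable_greater)
qed simp

lemma tgts_cmp_greater:
  "composable C k l u v \<Longrightarrow> l \<le> j \<Longrightarrow> j \<le> k \<Longrightarrow> k \<le> n \<Longrightarrow>
   composable C j l (tgts C k j u) v \<and> tgts C k j (cmp C k l u v) = cmp C j l (tgts C k j u) v"
proof (induction k arbitrary: u)
  case (Suc k)
  then show ?case by (cases "j = Suc k") (auto simp: tgts_Suc src_cmp_greater composable_greater)
qed simp

text \<open>Taking boundaries of the higher-dimensional factor down to dimension
  \<open>Suc i\<close> turns the composite into one of two cells of that dimension, where the axiom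
  for equal dimensions applies.\<close>

lemma srcs_cmp_base:
  assumes "composable C k l u v" "k \<le> n" "l \<le> n" "min k l = Suc i"
  shows "srcs C (max k l) i (cmp C k l u v) = srcs C k i u"
    "tgts C (max k l) i (cmp C k l u v) = tgts C l i v"
proof -
  have c: "srcs C (Suc i) i x = src C i x" "tgts C (Suc i) i x = tgt C i x" for x
    by (simp_all add: srcs_Suc tgts_Suc)
  have "srcs C (max k l) i (cmp C k l u v) = srcs C k i u \<and>
    tgts C (max k l) i (cmp C k l u v) = tgts C l i v"
  proof (cases "k \<le> l")
    case True
    then have k: "k = Suc i" "max k l = l" using assms by auto
    have "srcs C l i (cmp C k l u v) = src C i (srcs C l k (cmp C k l u v))"
      using srcs_srcs[of i k l C "cmp C k l u v"] True k by (simp add: c)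
    moreover have "tgts C l i (cmp C k l u v) = tgt C i (tgts C l k (cmp C k l u v))"
      using tgts_tgts[of i k l C "cmp C k l u v"] True k by (simp add: c)
    moreover have "tgts C l i v = tgt C i (tgts C l k v)"
      using tgts_tgts[of i k l C v] True k by (simp add: c)
    ultimately show ?thesis
      using srcs_cmp_less[OF assms(1), of k] tgts_cmp_less[OF assms(1), of k] assms k True
      by (auto simp: src_cmp_eq c)
  next
    case False
    then have k: "l = Suc i" "max k l = k" using assms by auto
    have "srcs C k i (cmp C k l u v) = src C i (srcs C k l (cmp C k l u v))"
      using srcs_srcs[of i l k C "cmp C k l u v"] False k by (simp add: c)
    moreover have "tgts C k i (cmp C k l u v) = tgt C i (tgts C k l (cmp C k l u v))"
      using tgts_tgts[of i l k C "cmp C k l u v"] False k by (simp add: c)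
    moreover have "srcs C k i u = src C i (srcs C k l u)"
      using srcs_srcs[of i l k C u] False k by (simp add: c)
    ultimately show ?thesis
      using srcs_cmp_greater[OF assms(1), of l] tgts_cmp_greater[OF assms(1), of l] assms k False
      by (auto simp: src_cmp_eq c)
  qed
  then show "srcs C (max k l) i (cmp C k l u v) = srcs C k i u"
    "tgts C (max k l) i (cmp C k l u v) = tgts C l i v" by auto
qed

lemma composable_D:
  assumes "composable C k l u v" "min k l = Suc i"
  shows "u \<in> cells C k" "v \<in> cells C l" "tgts C k i u = srcs C l i v"
  using assms unfolding composable_def by auto

lemma composable_I:
  assumes "u \<in> cells C k" "v \<in> cells C l" "tgts C k i u = srcs C l i v" "min k l = Suc i"
  shows "composable C k l u v"
  using assms unfolding composable_def by auto

text \<open>Below the gluing dimension everything agrees by globularity: the cell along which the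
  factors are glued has the same source and target in dimension \<open>i\<close> as both of
  them.\<close>

lemma srcs_cmp_low:
  assumes "composable C k l u v" "k \<le> n" "l \<le> n" "Suc i < min k l"
  shows "srcs C (max k l) i (cmp C k l u v) = srcs C k i u"
    "srcs C k i u = srcs C l i v"
    "tgts C (max k l) i (cmp C k l u v) = tgts C k i u"
    "tgts C k i u = tgts C l i v"
proof -
  obtain j where j: "min k l = Suc j" using assms by (cases "min k l") auto
  then have ij: "i < j" "j \<le> k" "j \<le> l" using assms by auto
  note d = composable_D[OF assms(1) j]
  show a: "srcs C k i u = srcs C l i v"
    using srcs_srcs[of i j l C v] srcs_tgts[of i j k u] d ij assms by simp
  show b: "tgts C k i u = tgts C l i v"
    using tgts_tgts[of i j k C u] tgts_srcs[of i j l v] d ij assms by simp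
  show "srcs C (max k l) i (cmp C k l u v) = srcs C k i u"
    using srcs_srcs[of i j "max k l" C "cmp C k l u v"] srcs_srcs[of i j k C u] ij
      srcs_cmp_base[OF assms(1-3) j] by auto
  show "tgts C (max k l) i (cmp C k l u v) = tgts C k i u"
    unfolding b using tgts_tgts[of i j "max k l" C "cmp C k l u v"] tgts_tgts[of i j l C v] ij
      srcs_cmp_base[OF assms(1-3) j] by auto
qed

text \<open>The distributivity law assumes only that its left side is defined; definedness of the
  right side is supplied here.\<close>

lemma composable_distrib_left:
  assumes "Suc i < min k l" "composable C k l v v'" "composable C (Suc i) (max k l) u (cmp C k l v v')"
    "k \<le> n" "l \<le> n"
  shows "composable C (Suc i) k u v" "composable C (Suc i) l u v'"
    "composable C k l (cmp C (Suc i) k u v) (cmp C (Suc i) l u v')"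
proof -
  have u: "u \<in> cells C (Suc i)" "tgts C (Suc i) i u = srcs C (max k l) i (cmp C k l v v')"
    using composable_D[OF assms(3), of i] assms(1) by auto
  have vc: "v \<in> cells C k" "v' \<in> cells C l" using assms(2) unfolding composable_def by auto
  show a: "composable C (Suc i) k u v" "composable C (Suc i) l u v'"
    using u vc srcs_cmp_low[OF assms(2) assms(4,5) assms(1)] assms(1) by (auto intro!: composable_I[where i = i])
  obtain j where j: "min k l = Suc j" using assms by (cases "min k l") auto
  have "tgts C k j (cmp C (Suc i) k u v) = srcs C l j (cmp C (Suc i) l u v')"
    using tgts_cmp_less[OF a(1), of j] srcs_cmp_less[OF a(2), of j] composable_D[OF assms(2) j] assms j by auto
  then show "composable C k l (cmp C (Suc i) k u v) (cmp C (Suc i) l u v')"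
    using cmp_cell_le[OF a(1)] cmp_cell_le[OF a(2)] j assms by (intro composable_I) auto
qed

lemma composable_distrib_right:
  assumes "Suc i < min k l" "composable C k l v v'" "composable C (max k l) (Suc i) (cmp C k l v v') u"
    "k \<le> n" "l \<le> n"
  shows "composable C k (Suc i) v u" "composable C l (Suc i) v' u"
    "composable C k l (cmp C k (Suc i) v u) (cmp C l (Suc i) v' u)"
proof -
  have u: "u \<in> cells C (Suc i)" "srcs C (Suc i) i u = tgts C (max k l) i (cmp C k l v v')"
    using composable_D[OF assms(3), of i] assms(1) by auto
  have vc: "v \<in> cells C k" "v' \<in> cells C l" using assms(2) unfolding composable_def by auto
  show a: "composable C k (Suc i) v u" "composable C l (Suc i) v' u"
    using u vc srcs_cmp_low[OF assms(2) assms(4,5) assms(1)] assms(1) by (auto intro!: composable_I[where i = i])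
  obtain j where j: "min k l = Suc j" using assms by (cases "min k l") auto
  have "tgts C k j (cmp C k (Suc i) v u) = srcs C l j (cmp C l (Suc i) v' u)"
    using tgts_cmp_greater[OF a(1), of j] srcs_cmp_greater[OF a(2), of j] composable_D[OF assms(2) j] assms j by auto
  then show "composable C k l (cmp C k (Suc i) v u) (cmp C l (Suc i) v' u)"
    using cmp_cell_ge[OF a(1)] cmp_cell_ge[OF a(2)] j assms by (intro composable_I) auto
qed

end

section \<open>Parallel sides of laws, least congruences, and quotient precategories\<close>

section \<open>Quotients by congruences\<close>

context pcb
begin

lemma parallelI:
  "u \<in> cells C (Suc m) \<Longrightarrow> v \<in> cells C (Suc m) \<Longrightarrow> src C m u = src C m v \<Longrightarrow> tgt C m u = tgt C m v \<Longrightarrow>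
   parallel C (Suc m) u v"
  unfolding parallel_def by simp

text \<open>The boundaries of the two sides of a law in dimension \<open>n\<close> are equal by
  direct computation or are the two sides of the same law one dimension lower, where it holds by
  assumption. Congruences relate only parallel cells, so this is what allows the laws of a term
  structure to generate one.\<close>

lemma law_parallel:
  assumes n: "n = Suc m" and law: "pc_law C n u v"
    and laws: "\<And>k u v. k < n \<Longrightarrow> pc_law C k u v \<Longrightarrow> u = v"
  shows "parallel C n u v"
proof -
  have laws: "pc_law C m u v \<Longrightarrow> u = v" for u v using laws[of m] n by simp
  have c: "srcs C (Suc i) i x = src C i x" "tgts C (Suc i) i x = tgt C i x" for i x
    by (simp_all add: srcs_Suc tgts_Suc)
  obtain n' where n': "n' = n" by simp
  from law have "parallel C n' u v" unfolding n'[symmetric]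
  proof cases
    case (unit_left a i)
    have k: "i \<le> m" using unit_left(3) n n' by simp
    have com: "composable C (Suc i) (Suc m) (idc C i a) v" using unit_left(4) n n' by simp
    have v: "v \<in> cells C (Suc m)" and e: "a = srcs C (Suc m) i v"
      using composable_D[OF com, of i] k n unit_left by (auto simp: c tgt_id)
    have cell: "cmp C (Suc i) (Suc m) (idc C i a) v \<in> cells C (Suc m)"
      using cmp_cell_le[OF com] k n by simp
    show ?thesis
    proof (cases "i = m")
      case True
      then show ?thesis using src_cmp_eq[of m "idc C m a" v] com n n' cell v unit_left e
        by (auto intro!: parallelI simp: src_id c)
    next
      case False
      then have "Suc i \<le> m" using k by simp
      then show ?thesis
        using src_cmp_less[OF com] composable_less[OF com] cell v n n' unit_left(1,2)
        by (auto intro!: parallelI laws pc_law.unit_left)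
    qed
  next
    case (unit_right a i)
    have k: "i \<le> m" using unit_right(3) n n' by simp
    have com: "composable C (Suc m) (Suc i) v (idc C i a)" using unit_right(4) n n' by simp
    have v: "v \<in> cells C (Suc m)" and e: "tgts C (Suc m) i v = a"
      using composable_D[OF com, of i] k n unit_right by (auto simp: c src_id)
    have cell: "cmp C (Suc m) (Suc i) v (idc C i a) \<in> cells C (Suc m)"
      using cmp_cell_ge[OF com] k n by simp
    show ?thesis
    proof (cases "i = m")
      case True
      then show ?thesis using src_cmp_eq[of m v "idc C m a"] com n n' cell v unit_right e
        by (auto intro!: parallelI simp: tgt_id c)
    next
      case False
      then have "Suc i \<le> m" using k by simp
      then show ?thesis
        using src_cmp_greater[OF com] composable_greater[OF com] cell v n n' unit_right(1,2)
        by (auto intro!: parallelI laws pc_law.unit_right)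
    qed
  next
    case (id_left i k x y)
    have k: "k = m" using id_left n n' by simp
    have com: "composable C m (Suc i) x y" "Suc i \<le> m" using id_left k by simp_all
    have x: "x \<in> cells C m" and y: "y \<in> cells C (Suc i)" "tgts C m i x = src C i y"
      using composable_D[OF com(1), of i] com(2) by (auto simp: c)
    have com': "composable C (Suc m) (Suc i) (idc C m x) y"
      using x y com n by (intro composable_I[where i = i]) (auto simp: id_cell tgts_Suc tgt_id c)
    have "cmp C m (Suc i) x y \<in> cells C m" using com n cmp_cell_ge by simp
    then show ?thesis
      unfolding id_left(2,3) k n'[unfolded n] using src_cmp_greater[OF com'] cmp_cell_ge[OF com'] com n x
      by (intro parallelI) (auto simp: id_cell src_id tgt_id)
  next
    case (id_right i k y x)
    have k: "k = m" using id_right n n' by simp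
    have com: "composable C (Suc i) m y x" "Suc i \<le> m" using id_right k by simp_all
    have x: "x \<in> cells C m" and y: "y \<in> cells C (Suc i)" "tgt C i y = srcs C m i x"
      using composable_D[OF com(1), of i] com(2) by (auto simp: c)
    have com': "composable C (Suc i) (Suc m) y (idc C m x)"
      using x y com n by (intro composable_I[where i = i]) (auto simp: id_cell srcs_Suc src_id c)
    have "cmp C (Suc i) m y x \<in> cells C m" using com n cmp_cell_le by simp
    then show ?thesis
      unfolding id_right(2,3) k n'[unfolded n] using src_cmp_less[OF com'] cmp_cell_le[OF com'] com n x
      by (intro parallelI) (auto simp: id_cell src_id tgt_id)
  next
    case (assoc k l i p x y z)
    have N: "max (max k l) p = Suc m" using assoc(1) n n' by simp
    \<comment> \<open>The four \<open>min\<close> conditions leave at most one of the three cells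
      with dimension above \<open>Suc i\<close>; so either all three have dimension
      \<open>Suc m\<close> or exactly one does.\<close>
    have "k = Suc i \<and> l = Suc i \<and> p = Suc i \<and> i = m \<or> k = Suc m \<and> i < m \<and> l = Suc i \<and> p = Suc i \<or>
       l = Suc m \<and> i < m \<and> k = Suc i \<and> p = Suc i \<or> p = Suc m \<and> i < m \<and> k = Suc i \<and> l = Suc i"
      using assoc(4-7) N by linarith
    then consider "k = Suc m" "l = Suc m" "p = Suc m" "i = m" | "k = Suc m" "i < m" "l = Suc i" "p = Suc i"
      | "l = Suc m" "i < m" "k = Suc i" "p = Suc i" | "p = Suc m" "i < m" "k = Suc i" "l = Suc i"
      by blast
    then show ?thesis
    proof cases
      case 1
      note com = assoc(8-11)[unfolded 1 max.idem]
      show ?thesis unfolding assoc(1-3) 1 max.idem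
        using n com src_cmp_eq cmp_cell_le[OF com(2)] cmp_cell_le[OF com(4)] by (intro parallelI) auto
    next
      case 2
      have d: "max (Suc m) (Suc i) = Suc m" "max (Suc i) (Suc i) = Suc i" "max m (Suc i) = m" "min m (Suc i) = Suc i"
        using 2 by auto
      note com = assoc(8-11)[unfolded 2 d]
      have "\<And>x'. composable C m (Suc i) x' y \<Longrightarrow> composable C m (Suc i) (cmp C m (Suc i) x' y) z \<Longrightarrow>
        composable C m (Suc i) x' (cmp C (Suc i) (Suc i) y z) \<Longrightarrow>
        cmp C m (Suc i) (cmp C m (Suc i) x' y) z = cmp C m (Suc i) x' (cmp C (Suc i) (Suc i) y z)"
        using pc_law.assoc[of m "Suc i" i "Suc i" C _ y z] com(3) 2 d by (auto intro!: laws)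
      then show ?thesis unfolding assoc(1-3) 2 d
        using com n 2 src_cmp_greater composable_greater[OF com(1)] composable_greater[OF com(2)] composable_greater[OF com(4)]
          cmp_cell_ge[OF com(2)] cmp_cell_ge[OF com(4)]
        by (auto intro!: parallelI)
    next
      case 3
      have d: "max (Suc i) (Suc m) = Suc m" "max (Suc m) (Suc i) = Suc m"  "max m (Suc i) = m" "min m (Suc i) = Suc i"
        "max (Suc i) m = m" "min (Suc i) m = Suc i"
        using 3 by auto
      note com = assoc(8-11)[unfolded 3 d]
      have "\<And>y'. composable C (Suc i) m x y' \<Longrightarrow> composable C m (Suc i) (cmp C (Suc i) m x y') z \<Longrightarrow>
        composable C m (Suc i) y' z \<Longrightarrow> composable C (Suc i) m x (cmp C m (Suc i) y' z) \<Longrightarrow>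
        cmp C m (Suc i) (cmp C (Suc i) m x y') z = cmp C (Suc i) m x (cmp C m (Suc i) y' z)"
        using pc_law.assoc[of "Suc i" m i "Suc i" C x _ z] 3 d by (auto intro!: laws)
      then show ?thesis unfolding assoc(1-3) 3 d
        using com n 3 src_cmp_greater src_cmp_less composable_less[OF com(1)] composable_greater[OF com(2)]
          composable_greater[OF com(3)] composable_less[OF com(4)]
          cmp_cell_ge[OF com(2)] cmp_cell_le[OF com(4)]
        by (auto intro!: parallelI)
    next
      case 4
      have d: "max (Suc i) (Suc m) = Suc m" "max (Suc i) (Suc i) = Suc i" "max (Suc i) m = m" "min (Suc i) m = Suc i"
        using 4 by auto
      note com = assoc(8-11)[unfolded 4 d]
      have "\<And>z'. composable C (Suc i) m (cmp C (Suc i) (Suc i) x y) z' \<Longrightarrow>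
        composable C (Suc i) m y z' \<Longrightarrow> composable C (Suc i) m x (cmp C (Suc i) m y z') \<Longrightarrow>
        cmp C (Suc i) m (cmp C (Suc i) (Suc i) x y) z' = cmp C (Suc i) m x (cmp C (Suc i) m y z')"
        using pc_law.assoc[of "Suc i" "Suc i" i m C x y] com(1) 4 d by (auto intro!: laws)
      then show ?thesis unfolding assoc(1-3) 4 d
        using com n 4 src_cmp_less composable_less[OF com(2)]
          composable_less[OF com(3)] composable_less[OF com(4)]
          cmp_cell_le[OF com(2)] cmp_cell_le[OF com(4)]
        by (auto intro!: parallelI)
    qed
  next
    case (distrib_left i k l y y' x)
    have N: "max k l = Suc m" using distrib_left(1) n n' by simp
    have kl: "k \<le> n" "l \<le> n" using N n by auto
    note com = distrib_left(5,6) composable_distrib_left[OF distrib_left(4-6) kl]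
    consider "k = Suc m" "l = Suc m" | "k \<le> m" "l = Suc m" | "l \<le> m" "k = Suc m" using N by linarith
    then show ?thesis
    proof cases
      case 1
      have m: "Suc i \<le> m" using distrib_left(4) 1 by auto
      note com = com[unfolded 1 max.idem]
      show ?thesis unfolding distrib_left(1-3) 1 max.idem
        using com m n src_cmp_eq src_cmp_less cmp_cell_le[OF com(2)] cmp_cell_le[OF com(5)]
        by (intro parallelI) auto
    next
      case 2
      have d: "max k (Suc m) = Suc m" "max k m = m" using 2 by auto
      have m: "Suc i \<le> m" "Suc i < min k m" "min k (Suc m) = k" using distrib_left(4) 2 by auto
      note com = com[unfolded 2 d]
      have "\<And>y'. composable C k m y y' \<Longrightarrow> composable C (Suc i) m x (cmp C k m y y') \<Longrightarrow>
        cmp C (Suc i) m x (cmp C k m y y') = cmp C k m (cmp C (Suc i) k x y) (cmp C (Suc i) m x y')"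
        using pc_law.distrib_left[of i k m C y _ x] m d by (auto intro!: laws)
      then show ?thesis unfolding distrib_left(1-3) 2 d
        using com n 2 m src_cmp_less composable_less[OF com(1)] composable_less[OF com(2)]
          composable_less[OF com(4)] composable_less[OF com(5)] cmp_cell_le[OF com(2)] cmp_cell_le[OF com(5)]
        by (auto intro!: parallelI)
    next
      case 3
      have d: "max (Suc m) l = Suc m" "max m l = m" using 3 by auto
      have m: "Suc i \<le> m" "Suc i < min m l" "min (Suc m) l = l" using distrib_left(4) 3 by auto
      note com = com[unfolded 3 d]
      have "\<And>y. composable C m l y y' \<Longrightarrow> composable C (Suc i) m x (cmp C m l y y') \<Longrightarrow>
        cmp C (Suc i) m x (cmp C m l y y') = cmp C m l (cmp C (Suc i) m x y) (cmp C (Suc i) l x y')"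
        using pc_law.distrib_left[of i m l C _ y' x] m d by (auto intro!: laws)
      then show ?thesis unfolding distrib_left(1-3) 3 d
        using com n 3 m src_cmp_less src_cmp_greater composable_greater[OF com(1)] composable_less[OF com(2)]
          composable_less[OF com(3)] composable_greater[OF com(5)] cmp_cell_le[OF com(2)] cmp_cell_ge[OF com(5)]
        by (auto intro!: parallelI)
    qed
  next
    case (distrib_right i k l y y' x)
    have N: "max k l = Suc m" using distrib_right(1) n n' by simp
    have kl: "k \<le> n" "l \<le> n" using N n by auto
    note com = distrib_right(5,6) composable_distrib_right[OF distrib_right(4-6) kl]
    consider "k = Suc m" "l = Suc m" | "k \<le> m" "l = Suc m" | "l \<le> m" "k = Suc m" using N by linarith
    then show ?thesis
    proof cases
      case 1
      have m: "Suc i \<le> m" using distrib_right(4) 1 by auto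
      note com = com[unfolded 1 max.idem]
      show ?thesis unfolding distrib_right(1-3) 1 max.idem
        using com m n src_cmp_eq src_cmp_greater cmp_cell_ge[OF com(2)] cmp_cell_le[OF com(5)]
        by (intro parallelI) auto
    next
      case 2
      have d: "max k (Suc m) = Suc m" "max k m = m" using 2 by auto
      have m: "Suc i \<le> m" "Suc i < min k m" "min k (Suc m) = k" using distrib_right(4) 2 by auto
      note com = com[unfolded 2 d]
      have "\<And>y'. composable C k m y y' \<Longrightarrow> composable C m (Suc i) (cmp C k m y y') x \<Longrightarrow>
        cmp C m (Suc i) (cmp C k m y y') x = cmp C k m (cmp C k (Suc i) y x) (cmp C m (Suc i) y' x)"
        using pc_law.distrib_right[of i k m C y _ x] m d by (auto intro!: laws)
      then show ?thesis unfolding distrib_right(1-3) 2 d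
        using com n 2 m src_cmp_less src_cmp_greater composable_less[OF com(1)] composable_greater[OF com(2)]
          composable_greater[OF com(4)] composable_less[OF com(5)] cmp_cell_ge[OF com(2)] cmp_cell_le[OF com(5)]
        by (auto intro!: parallelI)
    next
      case 3
      have d: "max (Suc m) l = Suc m" "max m l = m" using 3 by auto
      have m: "Suc i \<le> m" "Suc i < min m l" "min (Suc m) l = l" using distrib_right(4) 3 by auto
      note com = com[unfolded 3 d]
      have "\<And>y. composable C m l y y' \<Longrightarrow> composable C m (Suc i) (cmp C m l y y') x \<Longrightarrow>
        cmp C m (Suc i) (cmp C m l y y') x = cmp C m l (cmp C m (Suc i) y x) (cmp C l (Suc i) y' x)"
        using pc_law.distrib_right[of i m l C _ y' x] m d by (auto intro!: laws)
      then show ?thesis unfolding distrib_right(1-3) 3 d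
        using com n 3 m src_cmp_less src_cmp_greater composable_greater[OF com(1)] composable_greater[OF com(2)]
          composable_greater[OF com(3)] composable_greater[OF com(5)] cmp_cell_ge[OF com(2)] cmp_cell_ge[OF com(5)]
        by (auto intro!: parallelI)
    qed
  qed
  then show ?thesis using n' by simp
qed

end

lemma parallel_srcs:
  assumes "parallel C (Suc m) u u'" "i \<le> m"
  shows "srcs C (Suc m) i u = srcs C (Suc m) i u'" "tgts C (Suc m) i u = tgts C (Suc m) i u'"
  using assms by (auto simp: srcs_Suc tgts_Suc parallel_def)

text \<open>Composability looks only at boundaries strictly below dimension \<open>n\<close>. Cells
  are replaced by parallel ones in the top dimension only, hence the case distinction.\<close>

lemma (in pcb) composable_parallel:
  assumes "composable C k l u v" "k \<le> n" "l \<le> n"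
    and "if k = n then parallel C n u u' else u = u'" "if l = n then parallel C n v v' else v = v'"
  shows "composable C k l u' v'"
proof -
  obtain i where i: "min k l = Suc i" using assms(1) unfolding composable_def by (cases "min k l") auto
  then obtain m where m: "n = Suc m" "i \<le> m" using assms(2,3) by (cases n) auto
  have "tgts C k i u' = tgts C k i u" "u' \<in> cells C k"
    using assms(1,4) m parallel_srcs(2)[of C m u u' i] by (auto split: if_splits simp: parallel_def composable_def)
  moreover have "srcs C l i v' = srcs C l i v" "v' \<in> cells C l"
    using assms(1,5) m parallel_srcs(1)[of C m v v' i] by (auto split: if_splits simp: parallel_def composable_def)
  ultimately show ?thesis using composable_D[OF assms(1) i] i by (intro composable_I) auto
qed

lemma (in pcb) parallel_cmp:
  assumes "composable C k l u v" "max k l = n" "0 < n"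
    and "if k = n then parallel C n u u' else u = u'" "if l = n then parallel C n v v' else v = v'"
  shows "parallel C n (cmp C k l u v) (cmp C k l u' v')"
proof -
  have kl: "k \<le> n" "l \<le> n" using assms by auto
  note com = assms(1) composable_parallel[OF assms(1) kl assms(4,5)]
  obtain m where m: "n = Suc m" using assms by (cases n) auto
  note cell = cmp_cell[OF com(1) kl] cmp_cell[OF com(2) kl]
  consider "k = Suc m" "l = Suc m" | "k \<le> m" "l = Suc m" | "l \<le> m" "k = Suc m" using assms m by linarith
  then show ?thesis
  proof cases
    case 1
    then show ?thesis
      using cell assms m com src_cmp_eq by (auto intro!: parallelI simp: parallel_def)
  next
    case 2
    then show ?thesis
      using cell assms m src_cmp_less[OF com(1)[unfolded 2(2)]] src_cmp_less[OF com(2)[unfolded 2(2)]]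
      by (auto intro!: parallelI simp: parallel_def)
  next
    case 3
    then show ?thesis
      using cell assms m src_cmp_greater[OF com(1)[unfolded 3(2)]] src_cmp_greater[OF com(2)[unfolded 3(2)]]
      by (auto intro!: parallelI simp: parallel_def)
  qed
qed

text \<open>\<open>whiskable\<close> speaks of \<open>u\<close> and \<open>w\<close>, whereas
  \<open>whisk\<close> composes \<open>w\<close> with the composite of \<open>v\<close> and
  \<open>u\<close>.\<close>

lemma (in pcb) composable_whisk:
  assumes "whiskable C i n v u w" "i < n"
  shows "composable C (Suc i) n v u" "composable C n (Suc i) (cmp C (Suc i) n v u) w"
proof -
  show a: "composable C (Suc i) n v u" using assms unfolding whiskable_def by simp
  have b: "composable C n (Suc i) u w" using assms unfolding whiskable_def by simp
  show "composable C n (Suc i) (cmp C (Suc i) n v u) w"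
    using srcs_cmp_base(2)[OF a, of i] composable_D[OF b, of i] assms(2) cmp_cell_le[OF a]
    by (auto intro!: composable_I[where i = i] simp: max_def)
qed

text \<open>This is the largest congruence, so the intersection defining a least congruence runs
  over a nonempty family as soon as the generating pairs are parallel.\<close>

lemma (in pcb) congruence_parallel:
  assumes "0 < n"
  shows "congruence n C {(u, v). parallel C n u v}"
  unfolding congruence_def
proof (intro conjI)
  show "equiv (cells C n) {(u, v). parallel C n u v}"
    unfolding equiv_def refl_on_def sym_def trans_def parallel_def by auto
  show "\<forall>i<n. \<forall>(u, u')\<in>{(u, v). parallel C n u v}. \<forall>v w. whiskable C i n v u w \<longrightarrow>
    (whisk C i n v u w, whisk C i n v u' w) \<in> {(u, v). parallel C n u v}"
  proof safe
    fix i u u' v w assume i: "i < n" and p: "parallel C n u u'" and w: "whiskable C i n v u w"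
    note c = composable_whisk[OF w i]
    have self: "x \<in> cells C n \<Longrightarrow> parallel C n x x" for x unfolding parallel_def by simp
    have "v \<in> cells C (Suc i)" "w \<in> cells C (Suc i)" using w unfolding whiskable_def composable_def by auto
    then have vw: "if Suc i = n then parallel C n v v else v = v" "if Suc i = n then parallel C n w w else w = w"
      using self by auto
    have "parallel C n (cmp C (Suc i) n v u) (cmp C (Suc i) n v u')"
      using parallel_cmp[OF c(1) _ assms vw(1)] p i by auto
    then show "parallel C n (whisk C i n v u w) (whisk C i n v u' w)"
      unfolding whisk_def using parallel_cmp[OF c(2) _ assms _ vw(2)] i by auto
  qed
qed auto

lemma congruenceD:
  assumes "congruence n C R"
  shows "equiv (cells C n) R" "(u, v) \<in> R \<Longrightarrow> parallel C n u v"
    "i < n \<Longrightarrow> (u, u') \<in> R \<Longrightarrow> whiskable C i n v u w \<Longrightarrow> (whisk C i n v u w, whisk C i n v u' w) \<in> R"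
proof -
  have c: "equiv (cells C n) R" "\<forall>x\<in>R. case x of (u, v) \<Rightarrow> parallel C n u v"
    "\<forall>i<n. \<forall>x\<in>R. case x of (u, u') \<Rightarrow> \<forall>v w. whiskable C i n v u w \<longrightarrow>
        (whisk C i n v u w, whisk C i n v u' w) \<in> R"
    using assms unfolding congruence_def by blast+
  show "equiv (cells C n) R" by (fact c)
  show "(u, v) \<in> R \<Longrightarrow> parallel C n u v" using bspec[OF c(2), of "(u, v)"] by simp
  show "i < n \<Longrightarrow> (u, u') \<in> R \<Longrightarrow> whiskable C i n v u w \<Longrightarrow> (whisk C i n v u w, whisk C i n v u' w) \<in> R"
    using c(3)[rule_format, of i "(u, u')"] by simp
qed

lemma congruence_Inter:
  assumes "\<R> \<noteq> {}" "\<And>R. R \<in> \<R> \<Longrightarrow> congruence n C R"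
  shows "congruence n C (\<Inter>\<R>)"
proof -
  note e = congruenceD[OF assms(2)]
  obtain R\<^sub>0 where R\<^sub>0: "R\<^sub>0 \<in> \<R>" using assms(1) by auto
  show ?thesis
    unfolding congruence_def
  proof (intro conjI)
    show "equiv (cells C n) (\<Inter>\<R>)"
    proof (intro equivI)
      show "\<Inter>\<R> \<subseteq> cells C n \<times> cells C n" using R\<^sub>0 e(2)[OF R\<^sub>0] unfolding parallel_def by auto
      show "refl_on (cells C n) (\<Inter>\<R>)"
        using e(1) unfolding equiv_def refl_on_def by blast
      show "sym (\<Inter>\<R>)" using e(1) unfolding equiv_def sym_def by blast
      show "trans (\<Inter>\<R>)" using e(1) unfolding equiv_def trans_def by blast
    qed
    show "\<forall>(u, u')\<in>\<Inter>\<R>. parallel C n u u'" using R\<^sub>0 e(2)[OF R\<^sub>0] by auto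
    show "\<forall>i<n. \<forall>(u, u')\<in>\<Inter>\<R>. \<forall>v w. whiskable C i n v u w \<longrightarrow> (whisk C i n v u w, whisk C i n v u' w) \<in> \<Inter>\<R>"
      using e(3) by (auto simp del: Union_iff)
  qed
qed

lemma (in pcb) least_congruence:
  assumes "0 < n" "\<And>u v. B u v \<Longrightarrow> parallel C n u v"
  shows "congruence n C (least_congruence n C B)"
  unfolding least_congruence_def
  by (rule congruence_Inter) (use congruence_parallel[OF assms(1)] assms(2) in auto)

lemma least_congruence_contains: "B u v \<Longrightarrow> (u, v) \<in> least_congruence n C B"
  unfolding least_congruence_def by auto

lemma least_congruence_least:
  "congruence n C R \<Longrightarrow> (\<And>u v. B u v \<Longrightarrow> (u, v) \<in> R) \<Longrightarrow> least_congruence n C B \<subseteq> R"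
  unfolding least_congruence_def by auto

text \<open>Laws hold strictly below dimension \<open>n\<close> and up to \<open>R\<close> in
  dimension \<open>n\<close>. This covers both a term structure modulo the laws and a genuine
  precategory modulo further relations.\<close>

locale quotient = pcb n C for n and C :: "'c precat" +
  fixes R :: "('c \<times> 'c) set"
  assumes pos: "0 < n"
    and cong: "congruence n C R"
    and lower_laws: "k < n \<Longrightarrow> pc_law C k u v \<Longrightarrow> u = v"
    and law_R: "pc_law C n u v \<Longrightarrow> (u, v) \<in> R"
begin

lemma R_equiv: "equiv (cells C n) R"
  and R_parallel: "(u, v) \<in> R \<Longrightarrow> parallel C n u v"
  and R_whisk: "i < n \<Longrightarrow> (u, u') \<in> R \<Longrightarrow> whiskable C i n v u w \<Longrightarrow> (whisk C i n v u w, whisk C i n v u' w) \<in> R"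
  using congruenceD[OF cong] by blast+

lemma R_refl: "u \<in> cells C n \<Longrightarrow> (u, u) \<in> R"
  and R_sym: "(u, v) \<in> R \<Longrightarrow> (v, u) \<in> R"
  and R_trans: "(u, v) \<in> R \<Longrightarrow> (v, w) \<in> R \<Longrightarrow> (u, w) \<in> R"
  using R_equiv unfolding equiv_def refl_on_def sym_def trans_def by blast+

definition rel :: "nat \<Rightarrow> 'c \<Rightarrow> 'c \<Rightarrow> bool" where
  "rel k u v \<longleftrightarrow> (if k = n then (u, v) \<in> R else u = v)"

lemma rel_parallel: "rel k u v \<Longrightarrow> if k = n then parallel C n u v else u = v"
  by (auto simp: rel_def R_parallel)

text \<open>A congruence is stable under two-sided whiskering. A one-sided composite is whiskered on
  the other side by an identity, which the unit law, itself contained in \<open>R\<close>, removes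
  again.\<close>

lemma rel_cmp_right:
  assumes com: "composable C k n u v" and k: "k \<le> n" and v: "(v, v') \<in> R"
  shows "(cmp C k n u v, cmp C k n u v') \<in> R"
proof -
  obtain i where i: "k = Suc i" using com unfolding composable_def by (cases k) auto
  have *: "(whisk C i n u v w, cmp C k n u v) \<in> R \<and> whiskable C i n u v w"
    if "composable C k n u v" "w = idc C i (tgts C n i v)" for v w
  proof -
    have "v \<in> cells C n" using that(1) unfolding composable_def by simp
    then have t: "tgts C n i v \<in> cells C i" using tgts_cell i k by simp
    have "composable C n k v w"
      using i k that t by (intro composable_I[where i = i]) (auto simp: id_cell srcs_Suc src_id composable_def)
    then have w: "whiskable C i n u v w" using that i unfolding whiskable_def by simp
    have "pc_law C n (cmp C n (Suc i) (cmp C k n u v) w) (cmp C k n u v)"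
      using composable_whisk[OF w] i k t that by (auto intro: pc_law.unit_right)
    then show ?thesis using w law_R i unfolding whisk_def by simp
  qed
  have com': "composable C k n u v'"
    using composable_parallel[OF com k] R_parallel[OF v] com unfolding composable_def parallel_def
    by (cases "k = n") auto
  have "tgts C n i v = tgts C n i v'"
    using R_parallel[OF v] i k by (cases n) (auto simp: parallel_srcs)
  then show ?thesis
    using *[OF com refl] *[OF com' refl] R_whisk[OF _ v] i k R_sym R_trans by (metis Suc_le_eq)
qed

text \<open>Here the auxiliary identity is composed first, so associativity moves it outward before
  the unit law applies.\<close>

lemma rel_cmp_left:
  assumes com: "composable C n k u v" and k: "k \<le> n" and u: "(u, u') \<in> R"
  shows "(cmp C n k u v, cmp C n k u' v) \<in> R"
proof -
  obtain i where i: "k = Suc i" using com unfolding composable_def by (cases k) auto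
  have mx: "max n (Suc i) = n" "max (Suc i) n = n" "min n (Suc i) = Suc i" "min (Suc i) n = Suc i" using i k by auto
  have *: "(whisk C i n w u v, cmp C n k u v) \<in> R \<and> whiskable C i n w u v"
    if "composable C n k u v" "w = idc C i (srcs C n i u)" for u w
  proof -
    have c: "u \<in> cells C n" using that(1) unfolding composable_def by simp
    then have t: "srcs C n i u \<in> cells C i" using srcs_cell i k by simp
    have wu: "composable C k n w u"
      using i k that t c by (intro composable_I[where i = i]) (auto simp: id_cell tgts_Suc tgt_id)
    then have w: "whiskable C i n w u v" using that i unfolding whiskable_def by simp
    note cw = composable_whisk[OF w]
    have uv: "composable C n (Suc i) u v" using that i by simp
    have com2: "composable C (Suc i) n w (cmp C n (Suc i) u v)"
      using srcs_cmp_base(1)[OF uv, of i] cmp_cell_ge[OF uv] wu i k mx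
      by (auto simp: composable_def)
    have "pc_law C n (cmp C n (Suc i) (cmp C (Suc i) n w u) v) (cmp C (Suc i) n w (cmp C n (Suc i) u v))"
      using pc_law.assoc[of "Suc i" n i "Suc i" C w u v] uv com2 cw mx i k by simp
    moreover have "pc_law C n (cmp C (Suc i) n w (cmp C n (Suc i) u v)) (cmp C n (Suc i) u v)"
      using com2 i k t that by (auto intro: pc_law.unit_left)
    ultimately show ?thesis using w law_R i R_trans unfolding whisk_def by blast
  qed
  have com': "composable C n k u' v"
    using composable_parallel[OF com _ k] R_parallel[OF u] com unfolding composable_def parallel_def
    by (cases "k = n") auto
  have "srcs C n i u = srcs C n i u'"
    using R_parallel[OF u] i k by (cases n) (auto simp: parallel_srcs)
  then show ?thesis
    using *[OF com refl] *[OF com' refl] R_whisk[OF _ u] i k R_sym R_trans by (metis Suc_le_eq)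
qed

lemma rel_cmp:
  assumes com: "composable C k l u v" and kl: "k \<le> n" "l \<le> n" and uv: "rel k u u'" "rel l v v'"
  shows "composable C k l u' v'" "rel (max k l) (cmp C k l u v) (cmp C k l u' v')"
proof -
  note p = composable_parallel[OF com kl]
  have vv: "if l = n then parallel C n v v else v = v"
    using com unfolding composable_def parallel_def by auto
  have c1: "composable C k l u' v" using p[OF rel_parallel[OF uv(1)] vv] .
  show "composable C k l u' v'" using p[OF rel_parallel[OF uv(1)] rel_parallel[OF uv(2)]] .
  show "rel (max k l) (cmp C k l u v) (cmp C k l u' v')"
  proof (cases "max k l = n")
    case True
    have "(cmp C k l u v, cmp C k l u' v) \<in> R"
    proof (cases "k = n")
      case True
      then show ?thesis using rel_cmp_left com uv(1) kl unfolding rel_def by auto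
    next
      case False
      then show ?thesis using uv(1) R_refl cmp_cell[OF com kl] \<open>max k l = n\<close> unfolding rel_def by auto
    qed
    moreover have "(cmp C k l u' v, cmp C k l u' v') \<in> R"
    proof (cases "l = n")
      case True
      then show ?thesis using rel_cmp_right c1 uv(2) kl unfolding rel_def by auto
    next
      case False
      then show ?thesis using uv(2) R_refl cmp_cell[OF c1 kl] \<open>max k l = n\<close> unfolding rel_def by auto
    qed
    ultimately show ?thesis using R_trans True unfolding rel_def by auto
  next
    case False
    then have "k \<noteq> n" "l \<noteq> n" using kl by auto
    then show ?thesis using uv unfolding rel_def by auto
  qed
qed

abbreviation "Q \<equiv> quot n C R"
abbreviation "q \<equiv> qclass n R"

lemma q_eq: "u \<in> cells C k \<Longrightarrow> v \<in> cells C k \<Longrightarrow> q k u = q k v \<longleftrightarrow> rel k u v"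
  unfolding qclass_def rel_def using eq_equiv_class_iff[OF R_equiv] by auto

lemma q_mem: "u \<in> cells C k \<Longrightarrow> u' \<in> q k u \<longleftrightarrow> rel k u u'"
  unfolding qclass_def rel_def by auto

lemma rel_refl: "u \<in> cells C k \<Longrightarrow> rel k u u"
  unfolding rel_def by (auto simp: R_refl)

lemma cells_Q: "cells Q k = q k ` cells C k"
  by (simp add: quot_def)

lemma UN_const: "x \<in> A \<Longrightarrow> (\<And>y. y \<in> A \<Longrightarrow> f y = c) \<Longrightarrow> (\<Union>y\<in>A. f y) = c"
  by auto

lemma q_self: "u \<in> cells C k \<Longrightarrow> u \<in> q k u"
  by (simp add: q_mem rel_refl)

lemma src_Q: "u \<in> cells C (Suc i) \<Longrightarrow> i < n \<Longrightarrow> src Q i (q (Suc i) u) = q i (src C i u)"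
  and tgt_Q: "u \<in> cells C (Suc i) \<Longrightarrow> i < n \<Longrightarrow> tgt Q i (q (Suc i) u) = q i (tgt C i u)"
proof -
  assume u: "u \<in> cells C (Suc i)" "i < n"
  have e: "src C i u' = src C i u" "tgt C i u' = tgt C i u" if "u' \<in> q (Suc i) u" for u'
    using that u rel_parallel[of "Suc i" u u'] by (auto simp: q_mem parallel_def split: if_splits)
  show "src Q i (q (Suc i) u) = q i (src C i u)" "tgt Q i (q (Suc i) u) = q i (tgt C i u)"
    unfolding quot_def precat.select_convs by (rule UN_const[OF q_self[OF u(1)]], simp add: e)+
qed

lemma id_Q: "u \<in> cells C k \<Longrightarrow> k < n \<Longrightarrow> idc Q k (q k u) = q (Suc k) (idc C k u)"
  by (simp add: quot_def qclass_def)

lemma cmp_Q: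
  assumes "composable C k l u v" "k \<le> n" "l \<le> n"
  shows "cmp Q k l (q k u) (q l v) = q (max k l) (cmp C k l u v)"
proof -
  have c: "u \<in> cells C k" "v \<in> cells C l" using assms unfolding composable_def by auto
  have "q (max k l) (cmp C k l u' v') = q (max k l) (cmp C k l u v)" if "u' \<in> q k u" "v' \<in> q l v" for u' v'
    using that c rel_cmp[OF assms, of u' v'] q_eq[of "cmp C k l u v" "max k l" "cmp C k l u' v'"]
      cmp_cell[OF _ assms(2,3)] assms(1)
    by (simp add: q_mem)
  then show ?thesis unfolding quot_def precat.select_convs
    by (intro UN_const[OF q_self[OF c(1)]] UN_const[OF q_self[OF c(2)]])
qed

lemma srcs_Q: "u \<in> cells C k \<Longrightarrow> i \<le> k \<Longrightarrow> k \<le> n \<Longrightarrow> srcs Q k i (q k u) = q i (srcs C k i u)"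
proof (induction k arbitrary: u)
  case (Suc k)
  then show ?case by (cases "i = Suc k") (auto simp: srcs_Suc src_Q src_cell)
qed simp

lemma tgts_Q: "u \<in> cells C k \<Longrightarrow> i \<le> k \<Longrightarrow> k \<le> n \<Longrightarrow> tgts Q k i (q k u) = q i (tgts C k i u)"
proof (induction k arbitrary: u)
  case (Suc k)
  then show ?case by (cases "i = Suc k") (auto simp: tgts_Suc tgt_Q tgt_cell)
qed simp

lemma composable_Q:
  assumes "u \<in> cells C k" "v \<in> cells C l" "k \<le> n" "l \<le> n"
  shows "composable Q k l (q k u) (q l v) \<longleftrightarrow> composable C k l u v"
proof (cases "min k l")
  case 0
  then show ?thesis unfolding composable_def by auto
next
  case (Suc i)
  have "i < n" using assms Suc by linarith
  have "tgts Q k i (q k u) = srcs Q l i (q l v) \<longleftrightarrow> tgts C k i u = srcs C l i v"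
    using assms Suc \<open>i < n\<close> by (simp add: tgts_Q srcs_Q q_eq tgts_cell srcs_cell rel_def)
  then show ?thesis unfolding composable_def Suc using assms Suc by (auto simp: cells_Q)
qed

lemma composable_QE:
  assumes "composable Q k l U V" "k \<le> n" "l \<le> n"
  obtains u v where "U = q k u" "V = q l v" "composable C k l u v" "u \<in> cells C k" "v \<in> cells C l"
proof -
  obtain u v where "U = q k u" "V = q l v" "u \<in> cells C k" "v \<in> cells C l"
    using assms(1) unfolding composable_def cells_Q by auto
  then show ?thesis using that composable_Q assms by auto
qed

lemma Q_pcbase: "pcbase n Q"
  unfolding pcbase_def
proof (intro conjI allI ballI impI)
  fix k l U V assume kl: "k \<le> n" "l \<le> n" and "composable Q k l U V"
  then obtain u v where uv: "U = q k u" "V = q l v" "composable C k l u v" "u \<in> cells C k" "v \<in> cells C l"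
    by (auto elim: composable_QE)
  note c = cmp_cell[OF uv(3) kl]
  show "cmp Q k l U V \<in> cells Q (max k l)"
    using c by (simp add: uv(1,2) cmp_Q[OF uv(3) kl] cells_Q)
  show "src Q (l - 1) (cmp Q k l U V) = cmp Q k (l - 1) U (src Q (l - 1) V)" if "k < l"
  proof (cases l)
    case (Suc l')
    then show ?thesis using that c uv kl composable_less[of k l' u v] cmp_Q[OF _ kl(1), of l' u "src C l' v"]
      by (simp add: cmp_Q src_Q src_cmp_less max_absorb2)
  qed (use that in simp)
  show "tgt Q (l - 1) (cmp Q k l U V) = cmp Q k (l - 1) U (tgt Q (l - 1) V)" if "k < l"
  proof (cases l)
    case (Suc l')
    then show ?thesis using that c uv kl composable_less[of k l' u v] cmp_Q[OF _ kl(1), of l' u "tgt C l' v"]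
      by (simp add: cmp_Q tgt_Q src_cmp_less max_absorb2)
  qed (use that in simp)
  show "src Q (k - 1) (cmp Q k l U V) = cmp Q (k - 1) l (src Q (k - 1) U) V" if "l < k"
  proof (cases k)
    case (Suc k')
    then show ?thesis using that c uv kl composable_greater[of k' l u v] cmp_Q[OF _ _ kl(2), of k' "src C k' u" v]
      by (simp add: cmp_Q src_Q src_cmp_greater max_absorb1)
  qed (use that in simp)
  show "tgt Q (k - 1) (cmp Q k l U V) = cmp Q (k - 1) l (tgt Q (k - 1) U) V" if "l < k"
  proof (cases k)
    case (Suc k')
    then show ?thesis using that c uv kl composable_greater[of k' l u v] cmp_Q[OF _ _ kl(2), of k' "tgt C k' u" v]
      by (simp add: cmp_Q tgt_Q src_cmp_greater max_absorb1)
  qed (use that in simp)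
  show "src Q (k - 1) (cmp Q k l U V) = src Q (k - 1) U" if "k = l"
    using that c uv kl pos cmp_Q[OF uv(3) kl] by (cases k) (auto simp: src_Q src_cmp_eq composable_def[of C 0])
  show "tgt Q (k - 1) (cmp Q k l U V) = tgt Q (k - 1) V" if "k = l"
    using that c uv kl pos cmp_Q[OF uv(3) kl] by (cases k) (auto simp: tgt_Q src_cmp_eq composable_def[of C 0])
next
  fix i U assume i: "Suc i < n" and "U \<in> cells Q (Suc (Suc i))"
  then obtain u where u: "U = q (Suc (Suc i)) u" "u \<in> cells C (Suc (Suc i))" unfolding cells_Q by auto
  then show "parallel Q (Suc i) (src Q (Suc i) U) (tgt Q (Suc i) U)"
    using i src_cell[of u "Suc i"] tgt_cell[of u "Suc i"]
    by (simp add: src_Q tgt_Q parallel_def cells_Q globular)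
qed (auto simp: cells_Q src_Q tgt_Q src_cell tgt_cell id_Q id_cell src_id tgt_id)

lemma q_law:
  assumes m: "m \<le> n" and "pc_law C m u v"
  shows "q m u = q m v"
proof (cases "m = n")
  case True
  then show ?thesis
    using equiv_class_eq[OF R_equiv law_R[of u v]] assms(2) unfolding qclass_def by simp
next
  case False
  then show ?thesis using lower_laws assms by (metis le_neq_implies_less)
qed

text \<open>Each instance of a law lifts to representatives, because composability in the quotient
  is composability of representatives by \<open>composable_Q\<close>.\<close>

lemma Q_law:
  assumes m: "m \<le> n" and "pc_law Q m U V"
  shows "U = V"
proof -
  obtain m' where m': "m' = m" by simp
  from assms(2) show ?thesis unfolding m'[symmetric]
  proof cases
    case (unit_left A i)
    obtain a v where a: "A = q i a" "a \<in> cells C i" and v: "V = q m' v" "v \<in> cells C m'"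
      using unit_left(2,4) unfolding cells_Q composable_def by auto
    have b: "Suc i \<le> n" "m' \<le> n" "max (Suc i) m' = m'" using unit_left(3) m m' by auto
    have com: "composable C (Suc i) m' (idc C i a) v"
      using unit_left(4) a v b composable_Q[OF _ v(2)] by (simp add: id_Q id_cell)
    show ?thesis unfolding unit_left(1) using cmp_Q[OF com b(1,2)] a v b
        q_law[OF b(2) pc_law.unit_left[OF a(2) unit_left(3) com]] by (simp add: id_Q)
  next
    case (unit_right A i)
    obtain a v where a: "A = q i a" "a \<in> cells C i" and v: "V = q m' v" "v \<in> cells C m'"
      using unit_right(2,4) unfolding cells_Q composable_def by auto
    have b: "Suc i \<le> n" "m' \<le> n" "max m' (Suc i) = m'" using unit_right(3) m m' by auto
    have com: "composable C m' (Suc i) v (idc C i a)"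
      using unit_right(4) a v b composable_Q[OF v(2)] by (simp add: id_Q id_cell)
    show ?thesis unfolding unit_right(1) using cmp_Q[OF com b(2,1)] a v b
        q_law[OF b(2) pc_law.unit_right[OF a(2) unit_right(3) com]] by (simp add: id_Q)
  next
    case (id_left i k X Y)
    have b: "Suc k \<le> n" "k < n" "k \<le> n" "Suc i \<le> n" "max k (Suc i) = k" "max (Suc k) (Suc i) = Suc k"
      "min k (Suc i) = Suc i" "min (Suc k) (Suc i) = Suc i" "i < k" using id_left(1,4) m m' by auto
    obtain x y where x: "X = q k x" "Y = q (Suc i) y" "composable C k (Suc i) x y" "x \<in> cells C k" "y \<in> cells C (Suc i)"
      using composable_QE[OF id_left(5) b(3,4)] by auto
    have com: "composable C (Suc k) (Suc i) (idc C k x) y"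
      using x b composable_D[OF x(3)] by (intro composable_I[where i = i]) (auto simp: id_cell tgts_Suc tgt_id)
    show ?thesis unfolding id_left(2,3)
      using cmp_Q[OF com b(1,4)] cmp_Q[OF x(3) b(3,4)] q_law[OF b(1) pc_law.id_left[OF id_left(4) x(3)]]
        cmp_cell[OF x(3) b(3,4)] b x by (simp add: id_Q)
  next
    case (id_right i k Y X)
    have b: "Suc k \<le> n" "k < n" "k \<le> n" "Suc i \<le> n" "max (Suc i) k = k" "max (Suc i) (Suc k) = Suc k"
      "min (Suc i) k = Suc i" "min (Suc i) (Suc k) = Suc i" "i < k" using id_right(1,4) m m' by auto
    obtain x y where x: "X = q k x" "Y = q (Suc i) y" "composable C (Suc i) k y x" "x \<in> cells C k" "y \<in> cells C (Suc i)"
      by (rule composable_QE[OF id_right(5) b(4,3)])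
    have com: "composable C (Suc i) (Suc k) y (idc C k x)"
      using x b composable_D[OF x(3)] by (intro composable_I[where i = i]) (auto simp: id_cell srcs_Suc src_id)
    show ?thesis unfolding id_right(2,3)
      using cmp_Q[OF com b(4,1)] cmp_Q[OF x(3) b(4,3)] q_law[OF b(1) pc_law.id_right[OF id_right(4) x(3)]]
        cmp_cell[OF x(3) b(4,3)] b x by (simp add: id_Q)
  next
    case (assoc k l i p X Y Z)
    have b: "k \<le> n" "l \<le> n" "p \<le> n" "max k l \<le> n" "max l p \<le> n" "max (max k l) p \<le> n" "max k (max l p) = max (max k l) p"
      using assoc(1) m m' by auto
    obtain x y z where x: "X = q k x" "Y = q l y" "Z = q p z" "x \<in> cells C k" "y \<in> cells C l" "z \<in> cells C p"
      using assoc(8,10) unfolding composable_def cells_Q by auto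
    have c1: "composable C k l x y" "composable C l p y z"
      using assoc(8,10) composable_Q x b by auto
    note e = cmp_Q[OF c1(1) b(1,2)] cmp_Q[OF c1(2) b(2,3)] cmp_cell[OF c1(1) b(1,2)] cmp_cell[OF c1(2) b(2,3)]
    have c2: "composable C (max k l) p (cmp C k l x y) z" "composable C k (max l p) x (cmp C l p y z)"
      using assoc(9,11) composable_Q x b e by auto
    show ?thesis unfolding assoc(2,3) x(1-3) e(1,2) cmp_Q[OF c2(1) b(4,3)] cmp_Q[OF c2(2) b(1,5)] b(7)
      by (rule q_law[OF b(6) pc_law.assoc[OF assoc(4-7) c1(1) c2(1) c1(2) c2(2)]])
  next
    case (distrib_left i k l Y Y' X)
    have b: "k \<le> n" "l \<le> n" "max k l \<le> n" "Suc i \<le> n" "max (Suc i) k = k" "max (Suc i) l = l"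
      "max (Suc i) (max k l) = max k l"
      using distrib_left(1,4) m m' by auto
    obtain x y y' where x: "Y = q k y" "Y' = q l y'" "X = q (Suc i) x" "y \<in> cells C k" "y' \<in> cells C l" "x \<in> cells C (Suc i)"
      using distrib_left(5,6) unfolding composable_def cells_Q by auto
    have c1: "composable C k l y y'"
      using distrib_left(5) composable_Q x b by auto
    note e = cmp_Q[OF c1 b(1,2)] cmp_cell[OF c1 b(1,2)]
    have c2: "composable C (Suc i) (max k l) x (cmp C k l y y')"
      using distrib_left(6) composable_Q x b e by auto
    note d = composable_distrib_left[OF distrib_left(4) c1 c2 b(1,2)]
    show ?thesis unfolding distrib_left(2,3) x(1-3) e(1) cmp_Q[OF c2 b(4,3)] cmp_Q[OF d(1) b(4,1)] cmp_Q[OF d(2) b(4,2)]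
        b(5-7) cmp_Q[OF d(3) b(1,2)]
      by (rule q_law[OF b(3) pc_law.distrib_left[OF distrib_left(4) c1 c2]])
  next
    case (distrib_right i k l Y Y' X)
    have b: "k \<le> n" "l \<le> n" "max k l \<le> n" "Suc i \<le> n" "max k (Suc i) = k" "max l (Suc i) = l"
      "max (max k l) (Suc i) = max k l"
      using distrib_right(1,4) m m' by auto
    obtain x y y' where x: "Y = q k y" "Y' = q l y'" "X = q (Suc i) x" "y \<in> cells C k" "y' \<in> cells C l" "x \<in> cells C (Suc i)"
      using distrib_right(5,6) unfolding composable_def cells_Q by auto
    have c1: "composable C k l y y'"
      using distrib_right(5) composable_Q x b by auto
    note e = cmp_Q[OF c1 b(1,2)] cmp_cell[OF c1 b(1,2)]
    have c2: "composable C (max k l) (Suc i) (cmp C k l y y') x"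
      using distrib_right(6) composable_Q x b e by auto
    note d = composable_distrib_right[OF distrib_right(4) c1 c2 b(1,2)]
    show ?thesis unfolding distrib_right(2,3) x(1-3) e(1) cmp_Q[OF c2 b(3,4)] cmp_Q[OF d(1) b(1,4)] cmp_Q[OF d(2) b(2,4)]
        b(5-7) cmp_Q[OF d(3) b(1,2)]
      by (rule q_law[OF b(3) pc_law.distrib_right[OF distrib_right(4) c1 c2]])
  qed
qed

lemma Q_precategory: "precategory n Q"
  unfolding precategory_iff using Q_pcbase Q_law by auto

end

section \<open>Universal properties of quotients and of free extensions\<close>

section \<open>Morphisms and free extensions\<close>

definition pmorph :: "nat \<Rightarrow> 'c precat \<Rightarrow> 'd precat \<Rightarrow> (nat \<Rightarrow> 'c \<Rightarrow> 'd) \<Rightarrow> bool" where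
  "pmorph n C D F \<longleftrightarrow>
     (\<forall>k\<le>n. \<forall>u\<in>cells C k. F k u \<in> cells D k) \<and>
     (\<forall>i<n. \<forall>u\<in>cells C (Suc i). src D i (F (Suc i) u) = F i (src C i u) \<and>
        tgt D i (F (Suc i) u) = F i (tgt C i u)) \<and>
     (\<forall>k<n. \<forall>u\<in>cells C k. F (Suc k) (idc C k u) = idc D k (F k u)) \<and>
     (\<forall>k\<le>n. \<forall>l\<le>n. \<forall>u v. composable C k l u v \<longrightarrow>
        F (max k l) (cmp C k l u v) = cmp D k l (F k u) (F l v))"

lemma pmorph_cell: "pmorph n C D F \<Longrightarrow> k \<le> n \<Longrightarrow> u \<in> cells C k \<Longrightarrow> F k u \<in> cells D k"
  and pmorph_src: "pmorph n C D F \<Longrightarrow> i < n \<Longrightarrow> u \<in> cells C (Suc i) \<Longrightarrow> src D i (F (Suc i) u) = F i (src C i u)"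
  and pmorph_tgt: "pmorph n C D F \<Longrightarrow> i < n \<Longrightarrow> u \<in> cells C (Suc i) \<Longrightarrow> tgt D i (F (Suc i) u) = F i (tgt C i u)"
  and pmorph_idc: "pmorph n C D F \<Longrightarrow> k < n \<Longrightarrow> u \<in> cells C k \<Longrightarrow> F (Suc k) (idc C k u) = idc D k (F k u)"
  and pmorph_cmp: "pmorph n C D F \<Longrightarrow> k \<le> n \<Longrightarrow> l \<le> n \<Longrightarrow> composable C k l u v \<Longrightarrow>
    F (max k l) (cmp C k l u v) = cmp D k l (F k u) (F l v)"
  by (simp_all add: pmorph_def)

lemma pmorph_cmp_le: "pmorph n C D F \<Longrightarrow> k \<le> l \<Longrightarrow> l \<le> n \<Longrightarrow> composable C k l u v \<Longrightarrow>
    F l (cmp C k l u v) = cmp D k l (F k u) (F l v)"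
  and pmorph_cmp_ge: "pmorph n C D F \<Longrightarrow> l \<le> k \<Longrightarrow> k \<le> n \<Longrightarrow> composable C k l u v \<Longrightarrow>
    F k (cmp C k l u v) = cmp D k l (F k u) (F l v)"
  using pmorph_cmp[of n C D F k l u v] by (auto simp: max_def split: if_splits)

lemma pmorph_mono: "pmorph n C D F \<Longrightarrow> m \<le> n \<Longrightarrow> pmorph m C D F"
  by (simp add: pmorph_def)

lemma (in pcb) pmorph_srcs:
  assumes "pmorph n C D F"
  shows "u \<in> cells C k \<Longrightarrow> i \<le> k \<Longrightarrow> k \<le> n \<Longrightarrow> srcs D k i (F k u) = F i (srcs C k i u)"
proof (induction k arbitrary: u)
  case (Suc k)
  then show ?case by (cases "i = Suc k") (auto simp: srcs_Suc pmorph_src[OF assms] src_cell)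
qed simp

lemma (in pcb) pmorph_tgts:
  assumes "pmorph n C D F"
  shows "u \<in> cells C k \<Longrightarrow> i \<le> k \<Longrightarrow> k \<le> n \<Longrightarrow> tgts D k i (F k u) = F i (tgts C k i u)"
proof (induction k arbitrary: u)
  case (Suc k)
  then show ?case by (cases "i = Suc k") (auto simp: tgts_Suc pmorph_tgt[OF assms] tgt_cell)
qed simp

lemma (in pcb) pmorph_composable:
  assumes "pmorph n C D F" "composable C k l u v" "k \<le> n" "l \<le> n"
  shows "composable D k l (F k u) (F l v)"
  using assms(2) pmorph_cell[OF assms(1)] pmorph_tgts[OF assms(1), of u k "min k l - 1"]
    pmorph_srcs[OF assms(1), of v l "min k l - 1"] assms(3,4)
  unfolding composable_def by auto

lemma (in pcb) pmorph_comp: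
  assumes "pmorph n C D F" "pmorph n D E G"
  shows "pmorph n C E (\<lambda>k u. G k (F k u))"
  using assms(1,2) pmorph_composable[OF assms(1)]
  unfolding pmorph_def by simp

text \<open>Law instances are sent to law instances, not merely to equal cells: the domain may be a
  term structure, whose top dimension does not satisfy the laws.\<close>

lemma (in pcb) pmorph_law:
  assumes F: "pmorph n C D F" and m: "m \<le> n" and "pc_law C m u v"
  shows "pc_law D m (F m u) (F m v)"
proof -
  note com = pmorph_composable[OF F]
  note cmp = pmorph_cmp[OF F]
  from assms(3) m show ?thesis
  proof cases
    case (unit_left a i)
    then show ?thesis
      using com[OF unit_left(4)] m pc_law.unit_left[of "F i a" D i m "F m v"]
      by (simp add: pmorph_cell[OF F] pmorph_idc[OF F] pmorph_cmp_le[OF F])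
  next
    case (unit_right a i)
    then show ?thesis
      using com[OF unit_right(4)] m pc_law.unit_right[of "F i a" D i m "F m v"]
      by (simp add: pmorph_cell[OF F] pmorph_idc[OF F] pmorph_cmp_ge[OF F])
  next
    case (id_left i k x y)
    have c: "x \<in> cells C k" "y \<in> cells C (Suc i)" "tgts C k i x = srcs C (Suc i) i y"
      using id_left(4,5) composable_D[OF id_left(5)] by auto
    have "composable C (Suc k) (Suc i) (idc C k x) y"
      using c id_left(1,4) m by (intro composable_I[where i = i]) (auto simp: id_cell tgts_Suc tgt_id)
    then show ?thesis
      using id_left m c com[OF id_left(5)] pc_law.id_left[of i k D "F k x" "F (Suc i) y"]
      by (simp add: pmorph_cmp_ge[OF F] pmorph_idc[OF F] cmp_cell_ge)
  next
    case (id_right i k y x)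
    have c: "x \<in> cells C k" "y \<in> cells C (Suc i)" "tgts C (Suc i) i y = srcs C k i x"
      using id_right(4,5) composable_D[OF id_right(5)] by auto
    have "composable C (Suc i) (Suc k) y (idc C k x)"
      using c id_right(1,4) m by (intro composable_I[where i = i]) (auto simp: id_cell srcs_Suc src_id)
    then show ?thesis
      using id_right m c com[OF id_right(5)] pc_law.id_right[of i k D "F (Suc i) y" "F k x"]
      by (simp add: pmorph_cmp_le[OF F] pmorph_idc[OF F] cmp_cell_le)
  next
    case (assoc k l i p x y z)
    have b: "k \<le> n" "l \<le> n" "p \<le> n" "max k l \<le> n" "max l p \<le> n" "max k (max l p) = max (max k l) p"
      using assoc(1) m by auto
    show ?thesis
      using pc_law.assoc[OF assoc(4-7), of D "F k x" "F l y" "F p z"] com[OF assoc(8) b(1,2)] com[OF assoc(9) b(4,3)]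
        com[OF assoc(10) b(2,3)] com[OF assoc(11) b(1,5)]
        cmp[OF b(1,2) assoc(8)] cmp[OF b(4,3) assoc(9)] cmp[OF b(2,3) assoc(10)] cmp[OF b(1,5) assoc(11)]
      by (simp add: assoc(1-3) b(6))
  next
    case (distrib_left i k l y y' x)
    have b: "k \<le> n" "l \<le> n" "Suc i \<le> n" "max k l \<le> n" "max (Suc i) (max k l) = max k l"
       "max (Suc i) k = k" "max (Suc i) l = l"
      using distrib_left(1,4) m by auto
    note d = composable_distrib_left[OF distrib_left(4-6) b(1,2)]
    show ?thesis
      using pc_law.distrib_left[OF distrib_left(4), of D "F k y" "F l y'" "F (Suc i) x"]
        com[OF distrib_left(5) b(1,2)] com[OF distrib_left(6) b(3,4)]
        cmp[OF b(1,2) distrib_left(5)] cmp[OF b(3,4) distrib_left(6)]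
        cmp[OF b(3,1) d(1)] cmp[OF b(3,2) d(2)] cmp[OF b(1,2) d(3)]
      unfolding distrib_left(1-3) b(5-7) by simp
  next
    case (distrib_right i k l y y' x)
    have b: "k \<le> n" "l \<le> n" "Suc i \<le> n" "max k l \<le> n" "max (max k l) (Suc i) = max k l"
       "max k (Suc i) = k" "max l (Suc i) = l"
      using distrib_right(1,4) m by auto
    note d = composable_distrib_right[OF distrib_right(4-6) b(1,2)]
    show ?thesis
      using pc_law.distrib_right[OF distrib_right(4), of D "F k y" "F l y'" "F (Suc i) x"]
        com[OF distrib_right(5) b(1,2)] com[OF distrib_right(6) b(4,3)]
        cmp[OF b(1,2) distrib_right(5)] cmp[OF b(4,3) distrib_right(6)]
        cmp[OF b(1,3) d(1)] cmp[OF b(2,3) d(2)] cmp[OF b(1,2) d(3)]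
      unfolding distrib_right(1-3) b(5-7) by simp
  qed
qed

text \<open>Restricting equality of images to parallel cells gives a congruence. A least congruence
  whose generating pairs have equal images therefore stays inside the kernel, which is how
  evaluation of terms is seen to respect formal equality.\<close>

lemma (in pcb) congruence_kernel:
  assumes H: "pmorph n C D H" and pos: "0 < n"
  shows "congruence n C {(u, v). parallel C n u v \<and> H n u = H n v}"
proof -
  note p = congruenceD[OF congruence_parallel[OF pos]]
  have w: "H n (whisk C i n v u w) = whisk D i n (H (Suc i) v) (H n u) (H (Suc i) w)"
    if "i < n" "whiskable C i n v u w" for i u v w
    using composable_whisk[OF that(2,1)] that(1)
    by (simp add: whisk_def pmorph_cmp_ge[OF H] pmorph_cmp_le[OF H])
  show ?thesis
    unfolding congruence_def
  proof (intro conjI)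
    show "equiv (cells C n) {(u, v). parallel C n u v \<and> H n u = H n v}"
      unfolding equiv_def refl_on_def sym_def trans_def parallel_def by auto
    show "\<forall>i<n. \<forall>(u, u')\<in>{(u, v). parallel C n u v \<and> H n u = H n v}. \<forall>v w. whiskable C i n v u w \<longrightarrow>
      (whisk C i n v u w, whisk C i n v u' w) \<in> {(u, v). parallel C n u v \<and> H n u = H n v}"
    proof safe
      fix i u u' v w assume i: "i < n" and a: "parallel C n u u'" "whiskable C i n v u w" and e: "H n u = H n u'"
      show "parallel C n (whisk C i n v u w) (whisk C i n v u' w)" using p(3)[OF i _ a(2)] a(1) by auto
      have "srcs C n i u = srcs C n i u'" "tgts C n i u = tgts C n i u'"
        using parallel_srcs[of C "n - 1" u u' i] a(1) i by auto
      then have "whiskable C i n v u' w"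
        using a i unfolding whiskable_def composable_def parallel_def by simp
      then show "H n (whisk C i n v u w) = H n (whisk C i n v u' w)" using w i a e by simp
    qed
  qed auto
qed

context quotient
begin

lemma pmorph_q: "pmorph n C Q q"
  unfolding pmorph_def by (auto simp: cells_Q src_Q tgt_Q id_Q cmp_Q)

lemma pmorph_Q:
  assumes H: "pmorph n C D H" and R: "\<And>u v. (u, v) \<in> R \<Longrightarrow> H n u = H n v"
  obtains H' where "pmorph n Q D H'" "\<And>k u. u \<in> cells C k \<Longrightarrow> H' k (q k u) = H k u"
proof -
  \<comment> \<open>A representative is chosen; its choice does not matter because \<open>R\<close>
    lies in the kernel of \<open>H\<close>.\<close>
  define H' where "H' k U = H k (SOME u. u \<in> cells C k \<and> U = q k u)" for k U
  have H': "H' k (q k u) = H k u" if "u \<in> cells C k" for k u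
  proof -
    have "\<exists>v. v \<in> cells C k \<and> q k u = q k v" using that by auto
    then have "(SOME v. v \<in> cells C k \<and> q k u = q k v) \<in> cells C k \<and> q k u = q k (SOME v. v \<in> cells C k \<and> q k u = q k v)"
      by (rule someI_ex)
    then have "rel k u (SOME v. v \<in> cells C k \<and> q k u = q k v)" using that q_eq by blast
    then show ?thesis unfolding H'_def rel_def using R by (auto split: if_splits)
  qed
  have "pmorph n Q D H'"
    unfolding pmorph_def
  proof (intro conjI allI ballI impI)
    fix k l U V assume kl: "k \<le> n" "l \<le> n" and "composable Q k l U V"
    then obtain u v where "U = q k u" "V = q l v" "composable C k l u v" "u \<in> cells C k" "v \<in> cells C l"
      by (auto elim: composable_QE)
    then show "H' (max k l) (cmp Q k l U V) = cmp D k l (H' k U) (H' l V)"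
      using kl cmp_cell by (simp add: cmp_Q H' pmorph_cmp[OF H])
  qed (auto simp: cells_Q H' src_Q tgt_Q id_Q src_cell tgt_cell id_cell pmorph_cell[OF H]
      pmorph_src[OF H] pmorph_tgt[OF H] pmorph_idc[OF H])
  then show ?thesis using that H' by blast
qed

end

lemma law_pos: "pc_law C m u v \<Longrightarrow> 0 < m"
  by (induction rule: pc_law.induct) auto

locale extension =
  fixes n :: nat and C :: "'c precat" and S :: "'g set" and s t :: "'g \<Rightarrow> 'c"
  assumes precat: "precategory n C"
    and gens: "g \<in> S \<Longrightarrow> parallel C n (s g) (t g)"
begin

abbreviation "T \<equiv> term_structure n C S s t"
abbreviation "FT \<equiv> fterms n C S s t"

sublocale base: pcb n C
  by standard (use precat precategory_iff in auto)

lemma base_law: "m \<le> n \<Longrightarrow> pc_law C m u v \<Longrightarrow> u = v"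
  using precat unfolding precategory_iff by auto

lemma LComp_composable:
  assumes "0 < k" "k \<le> n" "c \<in> cells C k" "tgt C (k - 1) c = srcs C n (k - 1) d" "d \<in> cells C n"
  shows "composable C k n c d"
proof -
  obtain k' where "k = Suc k'" using assms by (cases k) auto
  then show ?thesis using assms unfolding composable_def by (simp add: tgts_Suc min_def)
qed

lemma RComp_composable:
  assumes "0 < k" "k \<le> n" "c \<in> cells C k" "tgts C n (k - 1) d = src C (k - 1) c" "d \<in> cells C n"
  shows "composable C n k d c"
proof -
  obtain k' where "k = Suc k'" using assms by (cases k) auto
  then show ?thesis using assms unfolding composable_def by (simp add: srcs_Suc min_absorb2)
qed

lemma parallel_lower:
  assumes "parallel C n u v" "i < n"
  shows "srcs C n i u = srcs C n i v" "tgts C n i u = tgts C n i v"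
  using assms parallel_srcs[of C "n - 1" u v i] by (cases n; auto)+

text \<open>Term formation tests composability at the source for \<open>LComp\<close> and at the
  target for \<open>RComp\<close>; by parallelism either test may be made at either end.\<close>

lemma fterm_parallel: "u \<in> FT \<Longrightarrow> parallel C n (fsrc n C s u) (ftgt n C t u)"
proof (induction rule: fterms.induct)
  case (3 k c u)
  have p: "fsrc n C s u \<in> cells C n" using 3 unfolding parallel_def by auto
  have com: "composable C k n c (fsrc n C s u)" using LComp_composable 3 p by simp
  have "if k = n then parallel C n c c else c = c" using 3 unfolding parallel_def by auto
  then show ?case using base.parallel_cmp[OF com, of c] 3 by simp
next
  case (4 k c u)
  have p: "fsrc n C s u \<in> cells C n" using 4 unfolding parallel_def by auto
  have "tgts C n (k - 1) (fsrc n C s u) = tgts C n (k - 1) (ftgt n C t u)"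
    using parallel_lower(2)[OF 4(6)] 4 by auto
  then have com: "composable C n k (fsrc n C s u) c" using RComp_composable 4 p by simp
  have "if k = n then parallel C n c c else c = c" using 4 unfolding parallel_def by auto
  then show ?case using base.parallel_cmp[OF com, of _ c] 4 by simp
qed (use gens in \<open>auto simp: parallel_def\<close>)

lemma fterm_cells: "u \<in> FT \<Longrightarrow> fsrc n C s u \<in> cells C n" "u \<in> FT \<Longrightarrow> ftgt n C t u \<in> cells C n"
  using fterm_parallel unfolding parallel_def by auto

lemma cells_T [simp]: "k \<le> n \<Longrightarrow> cells T k = Inl ` cells C k" "cells T (Suc n) = Inr ` FT"
  unfolding term_structure_def by auto

lemma T_simps [simp]:
  "src T i (Inl c) = Inl (src C i c)" "tgt T i (Inl c) = Inl (tgt C i c)"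
  "src T i (Inr u) = Inl (fsrc n C s u)" "tgt T i (Inr u) = Inl (ftgt n C t u)"
  "k < n \<Longrightarrow> idc T k (Inl c) = Inl (idc C k c)" "idc T n (Inl c) = Inr (Ident c)"
  "cmp T k l (Inl c) (Inl d) = Inl (cmp C k l c d)"
  "cmp T k l (Inl c) (Inr v) = Inr (LComp k c v)"
  "cmp T k l (Inr u) (Inl d) = Inr (RComp l u d)"
  "cmp T k l (Inr u) (Inr v) = Inr (TComp u v)"
  unfolding term_structure_def by auto

lemma srcs_T_Inl [simp]: "srcs T k i (Inl c) = Inl (srcs C k i c)"
proof (induction k arbitrary: c)
  case 0 then show ?case by (simp add: srcs_def)
next
  case (Suc k) then show ?case by (cases "i \<le> k") (auto simp: srcs_Suc, simp add: srcs_def)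
qed

lemma tgts_T_Inl [simp]: "tgts T k i (Inl c) = Inl (tgts C k i c)"
proof (induction k arbitrary: c)
  case 0 then show ?case by (simp add: tgts_def)
next
  case (Suc k) then show ?case by (cases "i \<le> k") (auto simp: tgts_Suc, simp add: tgts_def)
qed

lemma T_Inr [simp]: "i \<le> n \<Longrightarrow> srcs T (Suc n) i (Inr u) = Inl (srcs C n i (fsrc n C s u))"
  "i \<le> n \<Longrightarrow> tgts T (Suc n) i (Inr u) = Inl (tgts C n i (ftgt n C t u))"
  by (simp_all add: srcs_Suc tgts_Suc)

lemma cell_T_cases:
  assumes "x \<in> cells T k" "k \<le> Suc n"
  obtains c where "x = Inl c" "c \<in> cells C k" "k \<le> n" | u where "x = Inr u" "u \<in> FT" "k = Suc n"
  using assms by (cases "k = Suc n") auto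

lemma composable_T:
  "k \<le> n \<Longrightarrow> l \<le> n \<Longrightarrow> composable T k l (Inl c) (Inl d) \<longleftrightarrow> composable C k l c d"
  "k \<le> n \<Longrightarrow> composable T k (Suc n) (Inl c) (Inr v) \<longleftrightarrow> v \<in> FT \<and> composable C k n c (fsrc n C s v)"
  "l \<le> n \<Longrightarrow> composable T (Suc n) l (Inr u) (Inl d) \<longleftrightarrow> u \<in> FT \<and> composable C n l (ftgt n C t u) d"
  "composable T (Suc n) (Suc n) (Inr u) (Inr v) \<longleftrightarrow> u \<in> FT \<and> v \<in> FT \<and> ftgt n C t u = fsrc n C s v"
  unfolding composable_def using fterm_cells by (auto simp: min_def inj_image_mem_iff)

lemma composable_T_cases:
  assumes "composable T k l x y" "k \<le> Suc n" "l \<le> Suc n"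
  obtains c d where "x = Inl c" "y = Inl d" "k \<le> n" "l \<le> n" "composable C k l c d"
  | c v where "x = Inl c" "y = Inr v" "k \<le> n" "l = Suc n" "v \<in> FT" "composable C k n c (fsrc n C s v)"
  | u d where "x = Inr u" "y = Inl d" "k = Suc n" "l \<le> n" "u \<in> FT" "composable C n l (ftgt n C t u) d"
  | u v where "x = Inr u" "y = Inr v" "k = Suc n" "l = Suc n" "u \<in> FT" "v \<in> FT" "ftgt n C t u = fsrc n C s v"
proof -
  have "x \<in> cells T k" "y \<in> cells T l" using assms unfolding composable_def by auto
  then show ?thesis
    using assms composable_T that by (elim cell_T_cases[OF _ assms(2)] cell_T_cases[OF _ assms(3)]) auto
qed

lemma LComp_fterm: "v \<in> FT \<Longrightarrow> composable C k n c (fsrc n C s v) \<Longrightarrow> k \<le> n \<Longrightarrow> LComp k c v \<in> FT"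
  unfolding composable_def by (intro fterms.intros) (auto simp: min_def split: if_splits dest!: gr0_implies_Suc simp: tgts_Suc)

lemma RComp_fterm: "v \<in> FT \<Longrightarrow> composable C n k (ftgt n C t v) c \<Longrightarrow> k \<le> n \<Longrightarrow> RComp k v c \<in> FT"
  unfolding composable_def by (intro fterms.intros) (auto simp: min_def split: if_splits dest!: gr0_implies_Suc simp: srcs_Suc)

lemma T_pcbase: "pcbase (Suc n) T"
  unfolding pcbase_def
proof (intro conjI allI ballI impI)
  fix i x assume "i < Suc n" "x \<in> cells T (Suc i)"
  then show "src T i x \<in> cells T i" "tgt T i x \<in> cells T i"
    using base.src_cell base.tgt_cell fterm_cells by (auto elim!: cell_T_cases)
next
  fix i x assume i: "Suc i < Suc n" "x \<in> cells T (Suc (Suc i))"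
  show "parallel T (Suc i) (src T (Suc i) x) (tgt T (Suc i) x)"
  proof (rule cell_T_cases[OF i(2)])
    fix c assume "x = Inl c" "c \<in> cells C (Suc (Suc i))" "Suc (Suc i) \<le> n"
    then show ?thesis using base.src_cell[of c] base.tgt_cell[of c] base.globular[of c i] unfolding parallel_def by auto
  next
    fix u assume "x = Inr u" "u \<in> FT" "Suc (Suc i) = Suc n"
    then show ?thesis using fterm_parallel[of u] i(1) unfolding parallel_def by auto
  qed (use i in simp)
next
  fix k x assume "k < Suc n" "x \<in> cells T k"
  then show "idc T k x \<in> cells T (Suc k)" "src T k (idc T k x) = x" "tgt T k (idc T k x) = x"
    using base.id_cell base.src_id base.tgt_id by (cases "k = n"; auto simp: fterms.intros)+
next
  fix k l x y assume kl: "k \<le> Suc n" "l \<le> Suc n" and com: "composable T k l x y"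
  show "cmp T k l x y \<in> cells T (max k l)"
    using composable_T_cases[OF com kl]
    by cases (auto simp: base.cmp_cell max_def LComp_fterm RComp_fterm fterms.intros base.cmp_cell_le base.cmp_cell_ge)
  show "src T (l - 1) (cmp T k l x y) = cmp T k (l - 1) x (src T (l - 1) y)" if "k < l"
    using composable_T_cases[OF com kl] that by cases (auto simp: base.cmp_boundary[simplified])
  show "tgt T (l - 1) (cmp T k l x y) = cmp T k (l - 1) x (tgt T (l - 1) y)" if "k < l"
    using composable_T_cases[OF com kl] that by cases (auto simp: base.cmp_boundary[simplified])
  show "src T (k - 1) (cmp T k l x y) = cmp T (k - 1) l (src T (k - 1) x) y" if "l < k"
    using composable_T_cases[OF com kl] that by cases (auto simp: base.cmp_boundary[simplified])
  show "tgt T (k - 1) (cmp T k l x y) = cmp T (k - 1) l (tgt T (k - 1) x) y" if "l < k"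
    using composable_T_cases[OF com kl] that by cases (auto simp: base.cmp_boundary[simplified])
  show "src T (k - 1) (cmp T k l x y) = src T (k - 1) x" if "k = l"
    using composable_T_cases[OF com kl] that by cases (auto simp: base.cmp_boundary(3)[simplified])
  show "tgt T (k - 1) (cmp T k l x y) = tgt T (k - 1) y" if "k = l"
    using composable_T_cases[OF com kl] that by cases (auto simp: base.cmp_boundary(3)[simplified])
qed

sublocale terms: pcb "Suc n" T
  by standard (rule T_pcbase)

lemma projl_pmorph: "pmorph n T C (\<lambda>_. projl)"
  unfolding pmorph_def by (auto simp: composable_T elim!: composable_T_cases)

text \<open>Up to dimension \<open>n\<close> the term structure is a copy of \<open>C\<close>. The
  induction makes \<open>law_parallel\<close> available, which places both sides of the law in this
  copy, where \<open>projl\<close> is injective.\<close>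

lemma T_law: "m \<le> n \<Longrightarrow> pc_law T m x y \<Longrightarrow> x = y"
proof (induction m arbitrary: x y rule: less_induct)
  case (less m)
  obtain m' where m': "m = Suc m'" using law_pos[OF less(3)] by (cases m) auto
  have pm: "pcb m T" using pcbase_mono[OF T_pcbase] less(2) unfolding pcb_def by simp
  have "parallel T m x y"
    using pcb.law_parallel[OF pm m' less(3)] less(1,2) by auto
  then have "x \<in> Inl ` cells C m" "y \<in> Inl ` cells C m" using less(2) unfolding parallel_def by auto
  moreover have "projl x = projl y"
    using base_law[OF less(2)] pcb.pmorph_law[OF pm _ order_refl less(3)] pmorph_mono[OF projl_pmorph less(2)] by blast
  ultimately show ?case by auto
qed

sublocale fr: quotient "Suc n" T "free_rel n C S s t"
proof
  have par: "parallel T (Suc n) u v" if "pc_law T (Suc n) u v" for u v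
    using terms.law_parallel[OF refl that] T_law less_Suc_eq_le by blast
  show "congruence (Suc n) T (free_rel n C S s t)"
    unfolding free_rel_def by (rule terms.least_congruence) (use par in auto)
  show "pc_law T (Suc n) u v \<Longrightarrow> (u, v) \<in> free_rel n C S s t" for u v
    unfolding free_rel_def by (rule least_congruence_contains)
  show "k < Suc n \<Longrightarrow> pc_law T k u v \<Longrightarrow> u = v" for k u v
    using T_law less_Suc_eq_le by blast
qed simp

abbreviation "E \<equiv> free_ext n C S s t"
abbreviation "gc \<equiv> gen_cell n C S s t"

lemma E_Q: "E = fr.Q"
  by (simp add: free_ext_def)

lemma E_precategory: "precategory (Suc n) E"
  unfolding E_Q by (rule fr.Q_precategory)

lemma q_Inl: "k \<le> n \<Longrightarrow> fr.q k (Inl c) = up c"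
  by (simp add: qclass_def up_def)

lemma q_Gen: "fr.q (Suc n) (Inr (Gen g)) = gc g"
  by (simp add: qclass_def gen_cell_def)

lemma cells_E: "k \<le> n \<Longrightarrow> cells E k = up ` cells C k"
  by (auto simp: E_Q fr.cells_Q q_Inl image_image)

lemma pmorph_up: "pmorph n C E (\<lambda>_. up)"
proof -
  have 1: "pmorph n C T (\<lambda>_. Inl)"
    unfolding pmorph_def by auto
  have 2: "pmorph n C E (\<lambda>k u. fr.q k (Inl u))"
    unfolding E_Q using base.pmorph_comp[OF 1 pmorph_mono[OF fr.pmorph_q]] by simp
  then show ?thesis unfolding pmorph_def by (simp add: q_Inl base.cmp_cell base.src_cell)
qed

lemma gc_cell: "g \<in> S \<Longrightarrow> gc g \<in> cells E (Suc n)"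
  and src_gc: "g \<in> S \<Longrightarrow> src E n (gc g) = up (s g)"
  and tgt_gc: "g \<in> S \<Longrightarrow> tgt E n (gc g) = up (t g)"
proof -
  assume "g \<in> S"
  then have c: "Inr (Gen g) \<in> cells T (Suc n)" by (auto intro: fterms.intros)
  show "gc g \<in> cells E (Suc n)" "src E n (gc g) = up (s g)" "tgt E n (gc g) = up (t g)"
    unfolding q_Gen[symmetric] E_Q using c fr.src_Q[OF c] fr.tgt_Q[OF c] by (auto simp: fr.cells_Q q_Inl)
qed

text \<open>Every top-dimensional cell is represented by a term, and lower cells enter terms only as
  cells of \<open>C\<close>; so induction over terms descends to classes.\<close>

lemma E_induct [consumes 1, case_names gen ident left right comp]:
  assumes "x \<in> cells E (Suc n)"
    and g: "\<And>g. g \<in> S \<Longrightarrow> P (gc g)"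
    and i: "\<And>c. c \<in> cells C n \<Longrightarrow> P (idc E n (up c))"
    and l: "\<And>k c u. k \<le> n \<Longrightarrow> c \<in> cells C k \<Longrightarrow> u \<in> cells E (Suc n) \<Longrightarrow> P u \<Longrightarrow>
      composable E k (Suc n) (up c) u \<Longrightarrow> P (cmp E k (Suc n) (up c) u)"
    and r: "\<And>k c u. k \<le> n \<Longrightarrow> c \<in> cells C k \<Longrightarrow> u \<in> cells E (Suc n) \<Longrightarrow> P u \<Longrightarrow>
      composable E (Suc n) k u (up c) \<Longrightarrow> P (cmp E (Suc n) k u (up c))"
    and c: "\<And>u v. u \<in> cells E (Suc n) \<Longrightarrow> v \<in> cells E (Suc n) \<Longrightarrow> P u \<Longrightarrow> P v \<Longrightarrow>
      composable E (Suc n) (Suc n) u v \<Longrightarrow> P (cmp E (Suc n) (Suc n) u v)"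
  shows "P x"
proof -
  have mem: "u \<in> FT \<Longrightarrow> fr.q (Suc n) (Inr u) \<in> cells E (Suc n)" for u
    by (auto simp: E_Q fr.cells_Q)
  have "u \<in> FT \<Longrightarrow> P (fr.q (Suc n) (Inr u))" for u
  proof (induction rule: fterms.induct)
    case (1 g)
    then show ?case using g by (simp add: q_Gen)
  next
    case (2 c)
    then show ?case using i[of c] fr.id_Q[of "Inl c" n] by (simp add: E_Q q_Inl)
  next
    case (3 k c u)
    have com: "composable T k (Suc n) (Inl c) (Inr u)"
      using 3 LComp_composable fterm_cells by (simp add: composable_T)
    have "fr.q (Suc n) (Inr (LComp k c u)) = cmp E k (Suc n) (up c) (fr.q (Suc n) (Inr u))"
      using fr.cmp_Q[OF com] 3 by (simp add: E_Q q_Inl)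
    moreover have "composable E k (Suc n) (up c) (fr.q (Suc n) (Inr u))"
      using fr.composable_Q[of "Inl c" k "Inr u" "Suc n"] com 3 by (simp add: E_Q q_Inl)
    ultimately show ?case using l[of k c "fr.q (Suc n) (Inr u)"] 3 mem by simp
  next
    case (4 k c u)
    have com: "composable T (Suc n) k (Inr u) (Inl c)"
      using 4 RComp_composable fterm_cells by (simp add: composable_T)
    have "fr.q (Suc n) (Inr (RComp k u c)) = cmp E (Suc n) k (fr.q (Suc n) (Inr u)) (up c)"
      using fr.cmp_Q[OF com] 4 by (simp add: E_Q q_Inl)
    moreover have "composable E (Suc n) k (fr.q (Suc n) (Inr u)) (up c)"
      using fr.composable_Q[of "Inr u" "Suc n" "Inl c" k] com 4 by (simp add: E_Q q_Inl)
    ultimately show ?case using r[of k c "fr.q (Suc n) (Inr u)"] 4 mem by simp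
  next
    case (5 u v)
    have com: "composable T (Suc n) (Suc n) (Inr u) (Inr v)"
      using 5 by (simp add: composable_T)
    have "fr.q (Suc n) (Inr (TComp u v)) = cmp E (Suc n) (Suc n) (fr.q (Suc n) (Inr u)) (fr.q (Suc n) (Inr v))"
      using fr.cmp_Q[OF com] by (simp add: E_Q)
    moreover have "composable E (Suc n) (Suc n) (fr.q (Suc n) (Inr u)) (fr.q (Suc n) (Inr v))"
      using fr.composable_Q[of "Inr u" "Suc n" "Inr v" "Suc n"] com 5 by (simp add: E_Q)
    ultimately show ?case using c[of "fr.q (Suc n) (Inr u)" "fr.q (Suc n) (Inr v)"] 5 mem by simp
  qed
  moreover obtain u where "x = fr.q (Suc n) (Inr u)" "u \<in> FT"
    using assms(1) by (auto simp: E_Q fr.cells_Q)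
  ultimately show ?thesis by simp
qed

text \<open>Terms are evaluated in \<open>D\<close> by recursion. As \<open>D\<close> satisfies the
  laws, the kernel of the evaluation is a congruence containing them, hence contains the defining
  relation of the free extension.\<close>

lemma E_universal:
  assumes D: "precategory (Suc n) D" and F: "pmorph n C D F"
    and \<gamma>: "\<And>g. g \<in> S \<Longrightarrow> \<gamma> g \<in> cells D (Suc n) \<and> src D n (\<gamma> g) = F n (s g) \<and> tgt D n (\<gamma> g) = F n (t g)"
  obtains H where "pmorph (Suc n) E D H" "\<And>k c. k \<le> n \<Longrightarrow> c \<in> cells C k \<Longrightarrow> H k (up c) = F k c"
    "\<And>g. g \<in> S \<Longrightarrow> H (Suc n) (gc g) = \<gamma> g"
proof -
  interpret D: pcb "Suc n" D
    using D unfolding precategory_iff pcb_def by simp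
  define ev where "ev = rec_fterm \<gamma> (\<lambda>c. idc D n (F n c)) (\<lambda>k c u e. cmp D k (Suc n) (F k c) e)
    (\<lambda>k u c e. cmp D (Suc n) k e (F k c)) (\<lambda>u v e e'. cmp D (Suc n) (Suc n) e e')"
  have ev: "ev (Gen g) = \<gamma> g" "ev (Ident c) = idc D n (F n c)" "ev (LComp k c u) = cmp D k (Suc n) (F k c) (ev u)"
    "ev (RComp k u c) = cmp D (Suc n) k (ev u) (F k c)" "ev (TComp u v) = cmp D (Suc n) (Suc n) (ev u) (ev v)" for g c k u v
    unfolding ev_def by simp_all
  have Dcom: "composable D k (Suc n) (F k c) e"
    if "composable C k n c d" "src D n e = F n d" "e \<in> cells D (Suc n)" "k \<le> n" for k c d e
  proof -
    have "composable D k n (F k c) (src D n e)" using base.pmorph_composable[OF F that(1)] that by simp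
    then show ?thesis using that by (auto simp: composable_def min_def srcs_Suc)
  qed
  have Dcom': "composable D (Suc n) k e (F k c)"
    if "composable C n k d c" "tgt D n e = F n d" "e \<in> cells D (Suc n)" "k \<le> n" for k c d e
  proof -
    have "composable D n k (tgt D n e) (F k c)" using base.pmorph_composable[OF F that(1)] that by simp
    then show ?thesis using that by (auto simp: composable_def min_absorb2 tgts_Suc)
  qed
  have cell: "u \<in> FT \<Longrightarrow> ev u \<in> cells D (Suc n) \<and> src D n (ev u) = F n (fsrc n C s u) \<and> tgt D n (ev u) = F n (ftgt n C t u)" for u
  proof (induction rule: fterms.induct)
    case (1 g) then show ?case using \<gamma> by (simp add: ev)
  next
    case (2 c) then show ?case by (simp add: ev D.id_cell D.src_id D.tgt_id pmorph_cell[OF F])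
  next
    case (3 k c u)
    have com: "composable C k n c (fsrc n C s u)" "composable C k n c (ftgt n C t u)"
      using 3 LComp_composable fterm_cells parallel_lower(1)[OF fterm_parallel[of u], of "k - 1"] by auto
    have d: "composable D k (Suc n) (F k c) (ev u)" using Dcom[OF com(1)] 3 by auto
    show ?case
      using 3 D.cmp_cell_le[OF d] D.src_cmp_less[OF d] com by (simp add: ev pmorph_cmp_le[OF F])
  next
    case (4 k c u)
    have com: "composable C n k (fsrc n C s u) c" "composable C n k (ftgt n C t u) c"
      using 4 RComp_composable fterm_cells parallel_lower(2)[OF fterm_parallel[of u], of "k - 1"] by auto
    have d: "composable D (Suc n) k (ev u) (F k c)" using Dcom'[OF com(2)] 4 by auto
    show ?case
      using 4 D.cmp_cell_ge[OF d] D.src_cmp_greater[OF d] com by (simp add: ev pmorph_cmp_ge[OF F])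
  next
    case (5 u v)
    then have d: "composable D (Suc n) (Suc n) (ev u) (ev v)"
      by (auto intro!: D.composable_I[where i = n] simp: srcs_Suc tgts_Suc)
    then show ?case using 5 D.cmp_cell_ge[OF d] D.src_cmp_eq[OF d] by (simp add: ev)
  qed
  define H where "H k x = case_sum (F k) ev x" for k x
  have H: "pmorph (Suc n) T D H"
    unfolding pmorph_def
  proof (intro conjI allI ballI impI)
    fix k l x y assume kl: "k \<le> Suc n" "l \<le> Suc n" and com: "composable T k l x y"
    show "H (max k l) (cmp T k l x y) = cmp D k l (H k x) (H l y)"
      using composable_T_cases[OF com kl]
      by cases (auto simp: H_def ev pmorph_cmp[OF F])
  next
    fix k x assume "k \<le> Suc n" "x \<in> cells T k"
    then show "H k x \<in> cells D k" using cell pmorph_cell[OF F] by (auto elim!: cell_T_cases simp: H_def)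
  next
    fix i x assume "i < Suc n" "x \<in> cells T (Suc i)"
    then show "src D i (H (Suc i) x) = H i (src T i x)" "tgt D i (H (Suc i) x) = H i (tgt T i x)"
      using cell pmorph_src[OF F] pmorph_tgt[OF F] by (auto elim!: cell_T_cases simp: H_def)
  next
    fix k x assume "k < Suc n" "x \<in> cells T k"
    then show "H (Suc k) (idc T k x) = idc D k (H k x)"
      using pmorph_idc[OF F] by (cases "k = n") (auto simp: H_def ev)
  qed
  have "free_rel n C S s t \<subseteq> {(u, v). parallel T (Suc n) u v \<and> H (Suc n) u = H (Suc n) v}"
    unfolding free_rel_def
  proof (rule least_congruence_least)
    show "congruence (Suc n) T {(u, v). parallel T (Suc n) u v \<and> H (Suc n) u = H (Suc n) v}"
      by (rule terms.congruence_kernel[OF H]) simp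
    fix u v assume law: "pc_law T (Suc n) u v"
    then show "(u, v) \<in> {(u, v). parallel T (Suc n) u v \<and> H (Suc n) u = H (Suc n) v}"
      using terms.pmorph_law[OF H order_refl law] D terms.law_parallel[OF refl law] T_law less_Suc_eq_le
      unfolding precategory_iff by blast
  qed
  then have "H (Suc n) u = H (Suc n) v" if "(u, v) \<in> free_rel n C S s t" for u v
    using that by auto
  then show ?thesis
  proof (rule fr.pmorph_Q[OF H])
    fix H' assume H': "pmorph (Suc n) fr.Q D H'" "\<And>k u. u \<in> cells T k \<Longrightarrow> H' k (fr.q k u) = H k u"
  show ?thesis
  proof (rule that[of H'])
    show "pmorph (Suc n) E D H'" using H' by (simp add: E_Q)
    show "H' k (up c) = F k c" if "k \<le> n" "c \<in> cells C k" for k c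
      using H'(2)[of "Inl c" k] that by (simp add: q_Inl H_def)
    show "H' (Suc n) (gc g) = \<gamma> g" if "g \<in> S" for g
      using H'(2)[of "Inr (Gen g)" "Suc n"] that by (simp add: q_Gen H_def ev fterms.intros)
    qed
  qed
qed

end

section \<open>The laws as calculation rules\<close>

section \<open>Equations in low dimensions\<close>

locale precat = pcb n C for n and C :: "'c precat" +
  assumes law: "m \<le> n \<Longrightarrow> pc_law C m u v \<Longrightarrow> u = v"

lemma precat_iff: "precat n C \<longleftrightarrow> precategory n C"
  unfolding precat_def precat_axioms_def pcb_def precategory_iff by auto

context precat
begin

text \<open>Both bracketings are defined because, by \<open>srcs_cmp_base\<close>, a composite has
  the base source of its first factor and the base target of its second.\<close>

lemma assoc_general:
  assumes "composable C k l u v" "composable C l m v w" "k \<le> n" "l \<le> n" "m \<le> n"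
    "min k l = Suc i" "min (max k l) m = Suc i" "min l m = Suc i" "min k (max l m) = Suc i"
  shows "composable C (max k l) m (cmp C k l u v) w" "composable C k (max l m) u (cmp C l m v w)"
    "cmp C (max k l) m (cmp C k l u v) w = cmp C k (max l m) u (cmp C l m v w)"
proof -
  show 1: "composable C (max k l) m (cmp C k l u v) w"
    using assms composable_D(2,3)[OF assms(2,8)] srcs_cmp_base(2)[OF assms(1,3,4,6)] cmp_cell[OF assms(1,3,4)]
    by (intro composable_I[where i = i]) auto
  show 2: "composable C k (max l m) u (cmp C l m v w)"
    using assms composable_D(1,3)[OF assms(1,6)] srcs_cmp_base(1)[OF assms(2,4,5,8)] cmp_cell[OF assms(2,4,5)]
    by (intro composable_I[where i = i]) auto
  have "max (max k l) m \<le> n" using assms by simp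
  then show "cmp C (max k l) m (cmp C k l u v) w = cmp C k (max l m) u (cmp C l m v w)"
    using pc_law.assoc[OF assms(6-9) assms(1) 1 assms(2) 2] law by blast
qed

lemma assoc_low:
  assumes "k \<le> l" "l \<le> n"
  shows "composable C k k u v \<Longrightarrow> composable C k l v w \<Longrightarrow>
      cmp C k l (cmp C k k u v) w = cmp C k l u (cmp C k l v w) \<and>
      composable C k l (cmp C k k u v) w \<and> composable C k l u (cmp C k l v w)"
    "composable C k l u v \<Longrightarrow> composable C l k v w \<Longrightarrow>
      cmp C l k (cmp C k l u v) w = cmp C k l u (cmp C l k v w) \<and>
      composable C l k (cmp C k l u v) w \<and> composable C k l u (cmp C l k v w)"
    "composable C l k u v \<Longrightarrow> composable C k k v w \<Longrightarrow>
      cmp C l k (cmp C l k u v) w = cmp C l k u (cmp C k k v w) \<and>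
      composable C l k (cmp C l k u v) w \<and> composable C l k u (cmp C k k v w)"
proof -
  have e: "max k l = l" "max l k = l" "min k l = k" "min l k = k" using assms by auto
  have n: "k \<le> n" using assms by simp
  show "cmp C k l (cmp C k k u v) w = cmp C k l u (cmp C k l v w) \<and>
      composable C k l (cmp C k k u v) w \<and> composable C k l u (cmp C k l v w)"
    if c: "composable C k k u v" "composable C k l v w"
  proof -
    have k: "k = Suc (k - 1)" using c unfolding composable_def by simp
    show ?thesis
      using assoc_general[of k k u v l w "k - 1", unfolded e max.idem min.idem, OF c n n assms(2) k k k k] by blast
  qed
  show "cmp C l k (cmp C k l u v) w = cmp C k l u (cmp C l k v w) \<and>
      composable C l k (cmp C k l u v) w \<and> composable C k l u (cmp C l k v w)"
    if c: "composable C k l u v" "composable C l k v w"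
  proof -
    have k: "k = Suc (k - 1)" using c unfolding composable_def by simp
    show ?thesis
      using assoc_general[of k l u v k w "k - 1", unfolded e max.idem min.idem, OF c n assms(2) n k k k k] by blast
  qed
  show "cmp C l k (cmp C l k u v) w = cmp C l k u (cmp C k k v w) \<and>
      composable C l k (cmp C l k u v) w \<and> composable C l k u (cmp C k k v w)"
    if c: "composable C l k u v" "composable C k k v w"
  proof -
    have k: "k = Suc (k - 1)" using c unfolding composable_def by simp
    show ?thesis
      using assoc_general[of l k u v k w "k - 1", unfolded e max.idem min.idem, OF c assms(2) n n k k k k] by blast
  qed
qed

lemma unit_l: "a \<in> cells C i \<Longrightarrow> i < k \<Longrightarrow> k \<le> n \<Longrightarrow> u \<in> cells C k \<Longrightarrow> srcs C k i u = a \<Longrightarrow>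
    cmp C (Suc i) k (idc C i a) u = u"
  by (rule law[OF _ pc_law.unit_left]) (auto intro!: composable_I[where i = i] simp: id_cell tgts_Suc tgt_id)

lemma unit_r: "a \<in> cells C i \<Longrightarrow> i < k \<Longrightarrow> k \<le> n \<Longrightarrow> u \<in> cells C k \<Longrightarrow> tgts C k i u = a \<Longrightarrow>
    cmp C k (Suc i) u (idc C i a) = u"
  by (rule law[OF _ pc_law.unit_right]) (auto intro!: composable_I[where i = i] simp: id_cell srcs_Suc src_id)

lemma id_l: "i < k \<Longrightarrow> k < n \<Longrightarrow> composable C k (Suc i) u v \<Longrightarrow>
    cmp C (Suc k) (Suc i) (idc C k u) v = idc C k (cmp C k (Suc i) u v)"
  by (rule law[OF _ pc_law.id_left]) auto

lemma id_r: "i < k \<Longrightarrow> k < n \<Longrightarrow> composable C (Suc i) k v u \<Longrightarrow>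
    cmp C (Suc i) (Suc k) v (idc C k u) = idc C k (cmp C (Suc i) k v u)"
  by (rule law[OF _ pc_law.id_right]) auto

lemma distrib_l:
  assumes "Suc i < min k l" "k \<le> n" "l \<le> n" "composable C k l v v'" "composable C (Suc i) k u v"
  shows "cmp C (Suc i) (max k l) u (cmp C k l v v') = cmp C k l (cmp C (Suc i) k u v) (cmp C (Suc i) l u v')"
proof -
  have "composable C (Suc i) (max k l) u (cmp C k l v v')"
    using assms composable_D(1,3)[OF assms(5), of i] srcs_cmp_low(1)[OF assms(4,2,3,1)] cmp_cell[OF assms(4,2,3)]
    by (intro composable_I[where i = i]) auto
  then show ?thesis using law[OF _ pc_law.distrib_left[OF assms(1,4)]] assms by simp
qed

lemma distrib_r:
  assumes "Suc i < min k l" "k \<le> n" "l \<le> n" "composable C k l v v'" "composable C k (Suc i) v u"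
  shows "cmp C (max k l) (Suc i) (cmp C k l v v') u = cmp C k l (cmp C k (Suc i) v u) (cmp C l (Suc i) v' u)"
proof -
  have "composable C (max k l) (Suc i) (cmp C k l v v') u"
    using assms composable_D(2,3)[OF assms(5), of i] srcs_cmp_low(3)[OF assms(4,2,3,1)] cmp_cell[OF assms(4,2,3)]
    by (intro composable_I[where i = i]) auto
  then show ?thesis using law[OF _ pc_law.distrib_right[OF assms(1,4)]] assms by simp
qed

end

section \<open>Explicit form of the free 1-cells and 2-cells\<close>

section \<open>Words and strings of the free adjunction\<close>

text \<open>A 1-cell is an alternating word in \<open>f\<close> and \<open>g\<close>, hence determined by its source object \<open>a\<close>
  and its length; \<open>ob a p\<close> is the object at position \<open>p\<close> of such a word. At position \<open>p\<close> one can
  apply exactly one of the generators: \<open>\<eta>\<close> (inserting two letters) if that object is \<open>x\<close>, and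
  \<open>\<epsilon>\<close> (deleting two letters) if it is \<open>y\<close>. So a 2-cell is a word together with the list of the
  positions at which generators are applied.\<close>

primrec opp :: "adj0 \<Rightarrow> adj0" where
  "opp Ox = Oy" | "opp Oy = Ox"

definition ob :: "adj0 \<Rightarrow> nat \<Rightarrow> adj0" where
  "ob a n = (if even n then a else opp a)"

text \<open>The generator at an object replaces \<open>din\<close> letters by \<open>dout\<close>
  letters. Both numbers are even, so the letters to its right keep their objects.\<close>

primrec din :: "adj0 \<Rightarrow> nat" where "din Ox = 0" | "din Oy = 2"
primrec dout :: "adj0 \<Rightarrow> nat" where "dout Ox = 2" | "dout Oy = 0"

definition nx :: "adj0 \<Rightarrow> nat \<Rightarrow> nat \<Rightarrow> nat" where
  "nx a n p = n - din (ob a p) + dout (ob a p)"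

fun len :: "adj0 \<Rightarrow> nat \<Rightarrow> nat list \<Rightarrow> nat" where
  "len a n [] = n" | "len a n (p # ps) = len a (nx a n p) ps"

fun ok :: "adj0 \<Rightarrow> nat \<Rightarrow> nat list \<Rightarrow> bool" where
  "ok a n [] = True" | "ok a n (p # ps) = (p + din (ob a p) \<le> n \<and> ok a (nx a n p) ps)"

lemma opp_opp [simp]: "opp (opp a) = a"
  by (cases a) auto

lemma opp_neq [simp]: "opp a \<noteq> a" "a \<noteq> opp a"
  by (cases a; simp)+

lemma even_din [simp]: "even (din a)" "even (dout a)"
  by (cases a; simp)+

lemma ob_0 [simp]: "ob a 0 = a"
  by (simp add: ob_def)

lemma ob_ob [simp]: "ob (ob a m) n = ob a (m + n)"
  by (auto simp: ob_def)

lemma ob_Suc: "ob a (Suc n) = opp (ob a n)"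
  by (auto simp: ob_def)

lemma ob_even [simp]: "even k \<Longrightarrow> ob a (n + k) = ob a n" "even k \<Longrightarrow> ob a (k + n) = ob a n"
  "even k \<Longrightarrow> ob a k = a"
  by (auto simp: ob_def)

lemma ob_nx: "p + din (ob a p) \<le> n \<Longrightarrow> ob a (nx a n p) = ob a n"
  by (auto simp: nx_def ob_def)

lemma ob_len: "ok a n ps \<Longrightarrow> ob a (len a n ps) = ob a n"
  by (induction a n ps rule: ok.induct) (auto simp: ob_nx)

lemma nx_add: "p + din (ob a p) \<le> n \<Longrightarrow> nx a (n + k) p = nx a n p + k"
  by (auto simp: nx_def)

lemma nx_shift: "p + din (ob (ob b k) p) \<le> n \<Longrightarrow> nx b (k + n) (k + p) = k + nx (ob b k) n p"
  by (auto simp: nx_def)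

lemma ok_append [simp]: "ok a n (ps @ qs) \<longleftrightarrow> ok a n ps \<and> ok a (len a n ps) qs"
  by (induction a n ps rule: ok.induct) auto

lemma len_append [simp]: "len a n (ps @ qs) = len a (len a n ps) qs"
  by (induction a n ps rule: ok.induct) auto

lemma ok_add: "ok a n ps \<Longrightarrow> ok a (n + k) ps" and len_add: "ok a n ps \<Longrightarrow> len a (n + k) ps = len a n ps + k"
  by (induction a n ps rule: ok.induct) (auto simp: nx_add)

definition sh :: "nat \<Rightarrow> nat list \<Rightarrow> nat list" where
  "sh k = map ((+) k)"

lemma sh_simps [simp]: "sh k [] = []" "sh k (p # ps) = (k + p) # sh k ps" "sh k (ps @ qs) = sh k ps @ sh k qs"
  "sh 0 ps = ps" "length (sh k ps) = length ps" "sh k (sh l ps) = sh (k + l) ps"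
  by (auto simp: sh_def add.assoc comp_def map_idI)

lemma ok_shift: "ok (ob b k) n ps \<Longrightarrow> ok b (k + n) (sh k ps)"
  and len_shift: "ok (ob b k) n ps \<Longrightarrow> len b (k + n) (sh k ps) = k + len (ob b k) n ps"
  by (induction "ob b k" n ps rule: ok.induct) (auto simp: nx_shift)

subsection \<open>A model\<close>

text \<open>Telling classes of terms apart requires a morphism to a precategory with explicit cells.
  Whiskering on the left shifts positions, whiskering on the right only lengthens the word, and
  strings compose by concatenation; ill-typed arguments receive dummy values.\<close>

datatype model = M0 adj0 | M1 adj0 nat | M2 adj0 nat "nat list"

definition model :: "model precat" where
  "model = \<lparr>
     cells = (\<lambda>k. if k = 0 then range M0 else if k = 1 then {M1 a n |a n. True}
       else if k = 2 then {M2 a n ps |a n ps. ok a n ps} else {}),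
     src = (\<lambda>_ u. case u of M0 a \<Rightarrow> M0 a | M1 a n \<Rightarrow> M0 a | M2 a n ps \<Rightarrow> M1 a n),
     tgt = (\<lambda>_ u. case u of M0 a \<Rightarrow> M0 a | M1 a n \<Rightarrow> M0 (ob a n) | M2 a n ps \<Rightarrow> M1 a (len a n ps)),
     idc = (\<lambda>_ u. case u of M0 a \<Rightarrow> M1 a 0 | M1 a n \<Rightarrow> M2 a n [] | M2 a n ps \<Rightarrow> M2 a n ps),
     cmp = (\<lambda>_ _ u v. case (u, v) of
         (M1 a m, M1 b n) \<Rightarrow> M1 a (m + n)
       | (M1 a m, M2 b n ps) \<Rightarrow> M2 a (m + n) (sh m ps)
       | (M2 a m ps, M1 b n) \<Rightarrow> M2 a (m + n) ps
       | (M2 a m ps, M2 b n qs) \<Rightarrow> M2 a m (ps @ qs)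
       | _ \<Rightarrow> u)\<rparr>"

lemma model_simps [simp]:
  "cells model 0 = range M0" "cells model (Suc 0) = {M1 a n |a n. True}"
  "cells model 2 = {M2 a n ps |a n ps. ok a n ps}"
  "cells model (Suc (Suc 0)) = {M2 a n ps |a n ps. ok a n ps}"
  "src model k (M1 a n) = M0 a" "tgt model k (M1 a n) = M0 (ob a n)"
  "src model k (M2 a n ps) = M1 a n" "tgt model k (M2 a n ps) = M1 a (len a n ps)"
  "idc model k (M0 a) = M1 a 0" "idc model k (M1 a n) = M2 a n []"
  "cmp model k l (M1 a m) (M1 b n) = M1 a (m + n)"
  "cmp model k l (M1 a m) (M2 b n ps) = M2 a (m + n) (sh m ps)"
  "cmp model k l (M2 a m ps) (M1 b n) = M2 a (m + n) ps"
  "cmp model k l (M2 a m ps) (M2 b n qs) = M2 a m (ps @ qs)"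
  by (auto simp: model_def)

lemma srcs_low: "srcs C 2 0 u = src C 0 (src C 1 u)" "tgts C 2 0 u = tgt C 0 (tgt C 1 u)"
  "srcs C 2 1 u = src C 1 u" "tgts C 2 1 u = tgt C 1 u"
  "srcs C 1 0 u = src C 0 u" "tgts C 1 0 u = tgt C 0 u"
  "srcs C 3 0 u = src C 0 (src C 1 (src C 2 u))" "tgts C 3 0 u = tgt C 0 (tgt C 1 (tgt C 2 u))"
  "srcs C 3 1 u = src C 1 (src C 2 u)" "tgts C 3 1 u = tgt C 1 (tgt C 2 u)"
  "srcs C 3 2 u = src C 2 u" "tgts C 3 2 u = tgt C 2 u"
  by (simp_all add: numeral_eq_Suc srcs_Suc tgts_Suc)

lemma composable_model_cases:
  assumes "composable model k l u v" "k \<le> 2" "l \<le> 2"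
  obtains a m n where "k = 1" "l = 1" "u = M1 a m" "v = M1 (ob a m) n"
  | a m n ps where "k = 1" "l = 2" "u = M1 a m" "v = M2 (ob a m) n ps" "ok (ob a m) n ps"
  | a m n ps where "k = 2" "l = 1" "u = M2 a m ps" "v = M1 (ob a m) n" "ok a m ps"
  | a m ps qs where "k = 2" "l = 2" "u = M2 a m ps" "v = M2 a (len a m ps) qs" "ok a m ps" "ok a (len a m ps) qs"
proof -
  have "0 < k" "0 < l" and uv: "u \<in> cells model k" "v \<in> cells model l"
    and e: "tgts model k (min k l - 1) u = srcs model l (min k l - 1) v"
    using assms(1) unfolding composable_def by auto
  then consider "k = 1" "l = 1" | "k = 1" "l = 2" | "k = 2" "l = 1" | "k = 2" "l = 2"
    using assms(2,3) by linarith
  then show ?thesis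
  proof cases
    case 1
    then obtain a m b n where "u = M1 a m" "v = M1 b n" using uv by auto
    then show ?thesis using that(1)[of a m n] 1 e by (simp add: srcs_low[simplified])
  next
    case 2
    then obtain a m b n ps where "u = M1 a m" "v = M2 b n ps" "ok b n ps" using uv by auto
    then show ?thesis using that(2)[of a m n ps] 2 e by (simp add: srcs_low[simplified])
  next
    case 3
    then obtain a m b n ps where "u = M2 a m ps" "v = M1 b n" "ok a m ps" using uv by auto
    then show ?thesis using that(3)[of a m ps n] 3 e by (simp add: srcs_low[simplified] ob_len)
  next
    case 4
    then obtain a m b n ps qs where "u = M2 a m ps" "v = M2 b n qs" "ok a m ps" "ok b n qs" using uv by auto
    then show ?thesis using that(4)[of a m ps qs] 4 e by (auto simp: srcs_low[simplified])
  qed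
qed

lemma model_pcbase: "pcbase 2 model"
  unfolding pcbase_def
proof (intro conjI allI ballI impI)
  fix k l u v assume "k \<le> 2" "l \<le> 2" and com: "composable model k l u v"
  note c = composable_model_cases[OF com this(1,2)]
  show "cmp model k l u v \<in> cells model (max k l)"
    by (rule c) (auto simp: ok_shift ok_add)
  show "src model (l - 1) (cmp model k l u v) = cmp model k (l - 1) u (src model (l - 1) v)" if "k < l"
    by (rule c) (use that in auto)
  show "tgt model (l - 1) (cmp model k l u v) = cmp model k (l - 1) u (tgt model (l - 1) v)" if "k < l"
    by (rule c) (use that in \<open>auto simp: len_shift\<close>)
  show "src model (k - 1) (cmp model k l u v) = cmp model (k - 1) l (src model (k - 1) u) v" if "l < k"
    by (rule c) (use that in auto)
  show "tgt model (k - 1) (cmp model k l u v) = cmp model (k - 1) l (tgt model (k - 1) u) v" if "l < k"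
    by (rule c) (use that in \<open>auto simp: len_add\<close>)
  show "src model (k - 1) (cmp model k l u v) = src model (k - 1) u" if "k = l"
    by (rule c) (use that in auto)
  show "tgt model (k - 1) (cmp model k l u v) = tgt model (k - 1) v" if "k = l"
    by (rule c) (use that in \<open>auto simp: add.commute\<close>)
next
  fix i u assume "i < 2" "u \<in> cells model (Suc i)"
  then show "src model i u \<in> cells model i" "tgt model i u \<in> cells model i"
    by (auto simp: less_2_cases_iff numeral_2_eq_2[symmetric])
next
  fix i u assume "Suc i < 2" "u \<in> cells model (Suc (Suc i))"
  then show "parallel model (Suc i) (src model (Suc i) u) (tgt model (Suc i) u)"
    by (auto simp: parallel_def numeral_2_eq_2[symmetric] ob_len)
next
  fix k u assume "k < 2" "u \<in> cells model k"
  then show "idc model k u \<in> cells model (Suc k)" "src model k (idc model k u) = u" "tgt model k (idc model k u) = u"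
    by (auto simp: less_2_cases_iff numeral_2_eq_2[symmetric])
qed

lemma model_precategory: "precategory 2 model"
  unfolding precategory_iff
proof (intro conjI allI impI)
  show "pcbase 2 model" by (rule model_pcbase)
  fix m' u v assume m: "m' \<le> 2" and law: "pc_law model m' u v"
  from law m show "u = v"
  proof (induction rule: pc_law.induct)
    case (unit_left a i k u)
    have b: "Suc i \<le> 2" using unit_left by simp
    show ?case using unit_left(1,2) by (rule_tac composable_model_cases[OF unit_left(3) b unit_left(4)]) auto
  next
    case (unit_right a i k u)
    have b: "Suc i \<le> 2" using unit_right by simp
    show ?case using unit_right(1,2) by (rule_tac composable_model_cases[OF unit_right(3) unit_right(4) b]) auto
  next
    case (id_left i k u v)
    have b: "Suc i \<le> 2" "k \<le> 2" using id_left by simp_all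
    show ?case using id_left(1,3) by (rule_tac composable_model_cases[OF id_left(2) b(2,1)]) auto
  next
    case (id_right i k v u)
    have b: "Suc i \<le> 2" "k \<le> 2" using id_right by simp_all
    show ?case using id_right(1,3) by (rule_tac composable_model_cases[OF id_right(2) b(1,2)]) auto
  next
    case (assoc k l i m u v w)
    have b: "k \<le> 2" "l \<le> 2" "m \<le> 2" using assoc by simp_all
    show ?case
      by (rule composable_model_cases[OF assoc(5) b(1,2)]; rule composable_model_cases[OF assoc(7) b(2,3)])
        (use assoc(1-4) in \<open>auto simp: add.assoc\<close>)
  next
    case (distrib_left i k l v v' u)
    have b: "k \<le> 2" "l \<le> 2" "Suc i \<le> 2" "max k l \<le> 2" using distrib_left by simp_all
    show ?case
      by (rule composable_model_cases[OF distrib_left(2) b(1,2)]; rule composable_model_cases[OF distrib_left(3) b(3,4)])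
        (use distrib_left(1) in auto)
  next
    case (distrib_right i k l v v' u)
    have b: "k \<le> 2" "l \<le> 2" "Suc i \<le> 2" "max k l \<le> 2" using distrib_right by simp_all
    show ?case
      by (rule composable_model_cases[OF distrib_right(2) b(1,2)]; rule composable_model_cases[OF distrib_right(3) b(4,3)])
        (use distrib_right(1) in auto)
  qed
qed

subsection \<open>1-cells\<close>

text \<open>The numeral \<open>1\<close> becomes the normal form of \<open>Suc 0\<close>, so that
  rules stated for fixed low dimensions keep matching.\<close>

declare One_nat_def [simp del] One_nat_def [symmetric, simp] srcs_low [simp]

lemma up_eq [simp]: "up c = up d \<longleftrightarrow> c = d"
  by (simp add: up_def)

lemma model_cells_1 [simp]: "cells model 1 = {M1 a n |a n. True}"
  using model_simps(2) by simp

lemma Adj1_simps [simp]: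
  "gens0 Adj1 = UNIV" "gens1 Adj1 = UNIV"
  by (simp_all add: Adj1_def)

lemma Adj2_simps [simp]:
  "gens0 Adj2 = gens0 Adj1" "gens1 Adj2 = gens1 Adj1"
  "dom1 Adj2 = dom1 Adj1" "cod1 Adj2 = cod1 Adj1" "gens2 Adj2 = UNIV"
  by (simp_all add: Adj2_def prepoly1.defs prepoly2.defs)

lemma Adj3_simps [simp]:
  "gens0 Adj3 = gens0 Adj2" "gens1 Adj3 = gens1 Adj2" "dom1 Adj3 = dom1 Adj2" "cod1 Adj3 = cod1 Adj2"
  "gens2 Adj3 = gens2 Adj2" "dom2 Adj3 = dom2 Adj2" "cod2 Adj3 = cod2 Adj2"
  by (simp_all only: Adj3_def Let_def prepoly2.defs prepoly3.defs prepoly0.select_convs prepoly1.select_convs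
      prepoly2.select_convs)

lemma PAdj_simps [simp]:
  "gens0 PAdj = gens0 Adj3" "gens1 PAdj = gens1 Adj3" "dom1 PAdj = dom1 Adj3" "cod1 PAdj = cod1 Adj3"
  "gens2 PAdj = gens2 Adj3" "dom2 PAdj = dom2 Adj3" "cod2 PAdj = cod2 Adj3"
  "gens3 PAdj = gens3 Adj3" "dom3 PAdj = dom3 Adj3" "cod3 PAdj = cod3 Adj3"
  by (simp_all only: PAdj_def Let_def prepoly3.defs prepoly4.defs gray.defs prepoly0.select_convs
      prepoly1.select_convs prepoly2.select_convs prepoly3.select_convs)

lemma free_simps [simp]:
  "free0 Adj2 = free0 Adj1" "free0 Adj3 = free0 Adj1" "free0 PAdj = free0 Adj1"
  "free1 Adj2 = free1 Adj1" "free1 Adj3 = free1 Adj1" "free1 PAdj = free1 Adj1"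
  "free2 Adj3 = free2 Adj2" "free2 PAdj = free2 Adj2" "free3 PAdj = free3 Adj3"
  "gen1 Adj2 = gen1 Adj1" "gen1 Adj3 = gen1 Adj1" "gen1 PAdj = gen1 Adj1"
  "gen2 Adj3 = gen2 Adj2" "gen2 PAdj = gen2 Adj2" "gen3 PAdj = gen3 Adj3"
  by (simp_all add: fun_eq_iff free0_def free1_def free2_def free3_def gen1_def gen2_def gen3_def)

abbreviation "C1 \<equiv> free1 Adj1"
abbreviation "C2 \<equiv> free2 Adj2"
abbreviation "C3 \<equiv> free3 Adj3"

lemma free0_precategory: "precategory 0 (free0 Adj1)"
  unfolding precategory_def by (auto simp: composable_def dest: law_pos)

lemma free0_cells [simp]: "cells (free0 Adj1) 0 = UNIV"
  by (simp add: free0_def discrete_def)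

interpretation e1: extension 0 "free0 Adj1" "gens1 Adj1" "dom1 Adj1" "cod1 Adj1"
  by standard (auto simp: free0_precategory parallel_def)

lemma C1_def: "C1 = e1.E"
  by (simp add: free1_def)

lemma C1_precategory: "precategory 1 C1"
  using e1.E_precategory by (simp add: C1_def)

interpretation c1: precat 1 C1
  using C1_precategory by (simp add: precat_iff)

lemma C1_cells_0: "cells C1 0 = range up"
  using e1.cells_E[of 0] by (simp add: C1_def)

text \<open>The only letter starting at a given object; this is why a word is determined by its
  source and its length.\<close>

primrec arr :: "adj0 \<Rightarrow> adj1" where
  "arr Ox = Ff" | "arr Oy = Fg"

lemma dom_arr [simp]: "dom1 Adj1 (arr a) = a" "cod1 Adj1 (arr a) = opp a"
  by (cases a; simp add: Adj1_def)+

lemma arr_exhaust: obtains a where "h = arr a"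
  using arr.simps by (cases h) metis+

lemma gen1_arr: "gen1 Adj1 (arr a) \<in> cells C1 1" "src C1 0 (gen1 Adj1 (arr a)) = up a"
  "tgt C1 0 (gen1 Adj1 (arr a)) = up (opp a)"
  using e1.gc_cell[of "arr a"] e1.src_gc[of "arr a"] e1.tgt_gc[of "arr a"]
  by (simp_all add: C1_def gen1_def)

fun word :: "adj0 \<Rightarrow> nat \<Rightarrow> adj_cell1" where
  "word a 0 = idc C1 0 (up a)"
| "word a (Suc n) = cmp C1 1 1 (gen1 Adj1 (arr a)) (word (opp a) n)"

lemma composable_11: "composable C 1 1 u v \<longleftrightarrow> u \<in> cells C 1 \<and> v \<in> cells C 1 \<and> tgt C 0 u = src C 0 v"
  by (simp add: composable_def srcs_low)

lemma ob_opp [simp]: "ob (opp a) n = opp (ob a n)"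
  by (auto simp: ob_def)

lemma word_cell: "word a n \<in> cells C1 1 \<and> src C1 0 (word a n) = up a \<and> tgt C1 0 (word a n) = up (ob a n)"
proof (induction n arbitrary: a)
  case 0
  then show ?case using c1.id_cell[of "up a" 0] c1.src_id[of "up a" 0] c1.tgt_id[of "up a" 0] by (simp add: C1_cells_0)
next
  case (Suc n)
  have "composable C1 1 1 (gen1 Adj1 (arr a)) (word (opp a) n)"
    using Suc[of "opp a"] gen1_arr by (simp add: composable_11)
  then show ?case
    using Suc[of "opp a"] gen1_arr[of a] c1.src_cmp_eq[of 0 "gen1 Adj1 (arr a)" "word (opp a) n"]
      c1.cmp_cell[of 1 1 "gen1 Adj1 (arr a)" "word (opp a) n"]
    by (simp add: ob_Suc)
qed

lemmas word_simps [simp] = word_cell[THEN conjunct1] word_cell[THEN conjunct2, THEN conjunct1]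
  word_cell[THEN conjunct2, THEN conjunct2]

lemma word_cmp: "b = ob a m \<Longrightarrow> cmp C1 1 1 (word a m) (word b n) = word a (m + n)"
proof (induction m arbitrary: a b)
  case 0
  then show ?case using c1.unit_l[of "up a" 0 1 "word a n"] word_cell[of a n] by (simp add: C1_cells_0)
next
  case (Suc m)
  have "composable C1 1 1 (gen1 Adj1 (arr a)) (word (opp a) m)" "composable C1 1 1 (word (opp a) m) (word b n)"
    using gen1_arr word_cell Suc(2) by (auto simp: composable_11 ob_Suc)
  from c1.assoc_low(1)[OF order_refl _ this] show ?case
    using Suc(1)[of b "opp a"] Suc(2) by (simp add: ob_Suc)
qed

lemma gen1_word: "gen1 Adj1 (arr a) = word a 1"
  using c1.unit_r[of "up (opp a)" 0 1 "gen1 Adj1 (arr a)"] gen1_arr[of a] word.simps(2)[of a 0]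
  by (simp add: C1_cells_0)

lemma C1_word: "x \<in> cells C1 1 \<Longrightarrow> \<exists>a n. x = word a n"
  unfolding C1_def One_nat_def
proof (induction rule: e1.E_induct)
  case (gen g)
  then show ?case using gen1_word by (metis arr_exhaust gen1_def)
next
  case (ident c)
  then show ?case using word.simps(1)[of c] by (metis C1_def)
next
  case (comp u v)
  obtain a m b n where "u = word a m" "v = word b n" using comp.IH by blast
  moreover have "composable C1 1 1 u v" using comp.hyps(3) by (simp add: C1_def)
  ultimately have "cmp C1 1 1 u v = word a (m + n)" using word_cmp[of b a m n] by (simp add: composable_11)
  then show ?case by (auto simp: C1_def)
qed (auto simp: composable_def)

text \<open>The universal property sends each letter to a word of length 1. The resulting values
  separate words, which gives \<open>word_inj\<close>.\<close>

lemma word_model: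
  obtains H where "pmorph 1 C1 model H" "\<And>a. H 0 (up a) = M0 a" "\<And>a n. H 1 (word a n) = M1 a n"
proof -
  have F: "pmorph 0 (free0 Adj1) model (\<lambda>_. M0)"
    by (auto simp: pmorph_def composable_def)
  have "case_adj1 (M1 Ox 1) (M1 Oy 1) g \<in> cells model (Suc 0) \<and>
    src model 0 (case_adj1 (M1 Ox 1) (M1 Oy 1) g) = M0 (dom1 Adj1 g) \<and>
    tgt model 0 (case_adj1 (M1 Ox 1) (M1 Oy 1) g) = M0 (cod1 Adj1 g)" for g
    by (cases g) (auto simp: Adj1_def ob_def)
  then obtain H where H: "pmorph (Suc 0) e1.E model H" "\<And>k c. k \<le> 0 \<Longrightarrow> c \<in> cells (free0 Adj1) k \<Longrightarrow> H k (up c) = M0 c"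
    "\<And>g. g \<in> gens1 Adj1 \<Longrightarrow> H (Suc 0) (e1.gc g) = case_adj1 (M1 Ox 1) (M1 Oy 1) g"
    using e1.E_universal[OF precategory_mono[OF model_precategory] F] by (metis One_nat_def one_le_numeral)
  have P: "pmorph 1 C1 model H" using H(1) by (simp add: C1_def)
  have H0: "H 0 (up a) = M0 a" for a using H(2)[of 0 a] by simp
  have g: "H 1 (gen1 Adj1 (arr a)) = M1 a 1" for a
    using H(3)[of "arr a"] by (cases a) (auto simp: gen1_def)
  have "H 1 (word a n) = M1 a n" for a n
  proof (induction n arbitrary: a)
    case 0
    show ?case using pmorph_idc[OF P, of 0 "up a"] H0 by (simp add: C1_cells_0)
  next
    case (Suc n)
    have com: "composable C1 1 1 (gen1 Adj1 (arr a)) (word (opp a) n)"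
      using gen1_arr word_cell by (simp add: composable_11)
    show ?case using pmorph_cmp[OF P _ _ com] Suc g by simp
  qed
  then show ?thesis using that P H0 by blast
qed

lemma word_inj [simp]: "word a m = word b n \<longleftrightarrow> a = b \<and> m = n"
  using word_model model.inject(2) by metis

subsection \<open>2-cells\<close>

primrec tp :: "adj0 \<Rightarrow> adj2" where
  "tp Ox = Eta" | "tp Oy = Eps"

lemma tp_exhaust: obtains a where "\<alpha> = tp a"
  using tp.simps by (cases \<alpha>) metis+

lemma tp_inj [simp]: "tp a = tp b \<longleftrightarrow> a = b"
  by (cases a; cases b) auto

lemma dom2_tp [simp]: "dom2 Adj2 (tp a) = word a (din a)" "cod2 Adj2 (tp a) = word a (dout a)"
  using word_cmp[of Oy Ox 1 1] word_cmp[of Ox Oy 1 1] gen1_word[of Ox] gen1_word[of Oy]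
  by (cases a; simp add: Adj2_def prepoly1.defs prepoly2.defs ob_def)+

interpretation e2: extension 1 C1 "gens2 Adj2" "dom2 Adj2" "cod2 Adj2"
proof
  show "parallel C1 1 (dom2 Adj2 g) (cod2 Adj2 g)" for g
    by (rule tp_exhaust[of g]) (simp add: parallel_def)
qed (rule C1_precategory)

lemma C2_def: "C2 = e2.E"
  by (simp add: free2_def)

lemma C2_precategory: "precategory 2 C2"
  using e2.E_precategory by (simp add: C2_def)

interpretation c2: precat 2 C2
  using C2_precategory by (simp add: precat_iff)

lemma up1: "pmorph 1 C1 C2 (\<lambda>_. up)"
  using e2.pmorph_up by (simp add: C2_def)

lemma C2_cells: "cells C2 0 = range (\<lambda>a. up (up a))" "cells C2 1 = up ` cells C1 1"
  using e2.cells_E[of 0] e2.cells_E[of 1] by (auto simp: C2_def C1_cells_0)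

definition gcell :: "adj0 \<Rightarrow> adj_cell2" where "gcell a = gen2 Adj2 (tp a)"

lemma gcell: "gcell a \<in> cells C2 2" "src C2 1 (gcell a) = up (word a (din a))"
  "tgt C2 1 (gcell a) = up (word a (dout a))"
  using e2.gc_cell[of "tp a"] e2.src_gc[of "tp a"] e2.tgt_gc[of "tp a"]
  by (simp_all add: C2_def gen2_def gcell_def)

lemma up_word [simp]: "up (word a n) \<in> cells C2 1" "src C2 0 (up (word a n)) = up (up a)"
  "tgt C2 0 (up (word a n)) = up (up (ob a n))"
  using pmorph_src[OF up1, of 0 "word a n"] pmorph_tgt[OF up1, of 0 "word a n"] by (auto simp: C2_cells)

lemma up_word_cmp: "b = ob a m \<Longrightarrow> cmp C2 1 1 (up (word a m)) (up (word b n)) = up (word a (m + n))"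
  using pmorph_cmp[OF up1, of 1 1 "word a m" "word b n"] word_cmp[of b a m n] by (simp add: composable_11)

lemma composable_12: "composable C 1 2 u v \<longleftrightarrow> u \<in> cells C 1 \<and> v \<in> cells C 2 \<and> tgt C 0 u = src C 0 (src C 1 v)"
  and composable_21: "composable C 2 1 v u \<longleftrightarrow> v \<in> cells C 2 \<and> u \<in> cells C 1 \<and> tgt C 0 (tgt C 1 v) = src C 0 u"
  and composable_22: "composable C 2 2 v w \<longleftrightarrow> v \<in> cells C 2 \<and> w \<in> cells C 2 \<and> tgt C 1 v = src C 1 w"
  by (auto simp: composable_def)

lemma (in precat) cmp_12:
  assumes "2 \<le> n" "composable C 1 2 u v"
  shows "cmp C 1 2 u v \<in> cells C 2" "src C 1 (cmp C 1 2 u v) = cmp C 1 1 u (src C 1 v)"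
    "tgt C 1 (cmp C 1 2 u v) = cmp C 1 1 u (tgt C 1 v)"
  using assms cmp_cell_le[OF assms(2)] src_cmp_less[of 1 1 u v] by auto

lemma (in precat) cmp_21:
  assumes "2 \<le> n" "composable C 2 1 v u"
  shows "cmp C 2 1 v u \<in> cells C 2" "src C 1 (cmp C 2 1 v u) = cmp C 1 1 (src C 1 v) u"
    "tgt C 1 (cmp C 2 1 v u) = cmp C 1 1 (tgt C 1 v) u"
  using assms cmp_cell_ge[OF assms(2)] src_cmp_greater[of 1 1 v u] by auto

lemma (in precat) cmp_22:
  assumes "2 \<le> n" "composable C 2 2 v w"
  shows "cmp C 2 2 v w \<in> cells C 2" "src C 1 (cmp C 2 2 v w) = src C 1 v" "tgt C 1 (cmp C 2 2 v w) = tgt C 1 w"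
  using assms cmp_cell_ge[OF assms(2)] src_cmp_eq[of 1 v w] by auto

text \<open>The right whisker is what remains of a word of length \<open>n\<close> behind the input
  of the generator; the truncated difference is meaningful when
  \<open>p + din (ob a p) \<le> n\<close>.\<close>

definition wtriple :: "adj0 \<Rightarrow> nat \<Rightarrow> nat \<Rightarrow> adj_cell1 \<times> adj2 \<times> adj_cell1" where
  "wtriple a n p = (word a p, tp (ob a p), word (ob a p) (n - p - din (ob a p)))"

definition op2 :: "adj0 \<Rightarrow> nat \<Rightarrow> nat \<Rightarrow> adj_cell2" where
  "op2 a n p = whisk C2 0 2 (up (word a p)) (gcell (ob a p)) (up (word (ob a p) (n - p - din (ob a p))))"

fun str2 :: "adj0 \<Rightarrow> nat \<Rightarrow> nat list \<Rightarrow> adj_cell2" where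
  "str2 a n [] = idc C2 1 (up (word a n))"
| "str2 a n (p # ps) = cmp C2 2 2 (op2 a n p) (str2 a (nx a n p) ps)"

lemma whisker_wtriple [simp]: "whisker Adj2 (wtriple a n p) = op2 a n p"
  by (simp add: whisker_def wtriple_def op2_def gcell_def)

lemma gcell_composable:
  "ob a p = b \<Longrightarrow> composable C2 1 2 (up (word a p)) (gcell b)"
  "c = b \<Longrightarrow> composable C2 2 1 (gcell b) (up (word c m))"
  by (auto simp: composable_12 composable_21 gcell)

lemma op2_cell:
  assumes "p + din (ob a p) \<le> n"
  shows "op2 a n p \<in> cells C2 2" "src C2 1 (op2 a n p) = up (word a n)" "tgt C2 1 (op2 a n p) = up (word a (nx a n p))"
proof -
  have 1: "composable C2 1 2 (up (word a p)) (gcell (ob a p))" by (rule gcell_composable) simp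
  note x = c2.cmp_12[OF _ 1, simplified]
  have s: "src C2 1 (cmp C2 1 2 (up (word a p)) (gcell (ob a p))) = up (word a (p + din (ob a p)))"
    "tgt C2 1 (cmp C2 1 2 (up (word a p)) (gcell (ob a p))) = up (word a (p + dout (ob a p)))"
    using x by (simp_all add: gcell up_word_cmp)
  have 2: "composable C2 2 1 (cmp C2 1 2 (up (word a p)) (gcell (ob a p))) (up (word (ob a p) m))" for m
    using x(1) s by (simp add: composable_21)
  have "p + dout (ob a p) + (n - p - din (ob a p)) = nx a n p" using assms by (simp add: nx_def)
  then show "op2 a n p \<in> cells C2 2" "src C2 1 (op2 a n p) = up (word a n)" "tgt C2 1 (op2 a n p) = up (word a (nx a n p))"
    using c2.cmp_21[OF _ 2, simplified] assms s unfolding op2_def whisk_def by (simp_all add: up_word_cmp)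
qed

lemma op2_left:
  assumes "p + din (ob a p) \<le> n" "a = ob b k"
  shows "cmp C2 1 2 (up (word b k)) (op2 a n p) = op2 b (k + n) (k + p)"
proof -
  let ?g = "gcell (ob a p)" and ?r = "up (word (ob a p) (n - p - din (ob a p)))"
  have 0: "composable C2 1 1 (up (word b k)) (up (word a p))" using assms by (simp add: composable_11)
  have 1: "composable C2 1 2 (up (word a p)) ?g" by (rule gcell_composable) simp
  note x = c2.cmp_12[OF _ 1, simplified]
  have 2: "composable C2 2 1 (cmp C2 1 2 (up (word a p)) ?g) ?r"
    using x by (simp add: composable_21 gcell up_word_cmp)
  have 3: "composable C2 1 2 (up (word b k)) (cmp C2 1 2 (up (word a p)) ?g)"
    using x assms by (simp add: composable_12 gcell up_word_cmp)
  have "cmp C2 1 2 (up (word b k)) (op2 a n p) = cmp C2 2 1 (cmp C2 1 2 (up (word b k)) (cmp C2 1 2 (up (word a p)) ?g)) ?r"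
    using c2.assoc_low(2)[OF _ _ 3 2] by (simp add: op2_def whisk_def)
  also have "\<dots> = cmp C2 2 1 (cmp C2 1 2 (up (word b (k + p))) ?g) ?r"
    using c2.assoc_low(1)[OF _ _ 0 1] assms(2) by (simp add: up_word_cmp)
  also have "\<dots> = op2 b (k + n) (k + p)"
    using assms by (simp add: op2_def whisk_def)
  finally show ?thesis .
qed

lemma op2_right:
  assumes "p + din (ob a p) \<le> n" "c = ob a n"
  shows "cmp C2 2 1 (op2 a n p) (up (word c k)) = op2 a (n + k) p"
proof -
  let ?g = "gcell (ob a p)" and ?r = "up (word (ob a p) (n - p - din (ob a p)))"
  have 1: "composable C2 1 2 (up (word a p)) ?g" by (rule gcell_composable) simp
  note x = c2.cmp_12[OF _ 1, simplified]
  have 2: "composable C2 2 1 (cmp C2 1 2 (up (word a p)) ?g) ?r"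
    using x by (simp add: composable_21 gcell up_word_cmp)
  have c: "c = ob (ob a p) (n - p - din (ob a p))" using assms by (auto simp: ob_def)
  have 3: "composable C2 1 1 ?r (up (word c k))" using c by (simp add: composable_11)
  have "n + k - p - din (ob a p) = n - p - din (ob a p) + k" using assms by simp
  then show ?thesis using c2.assoc_low(3)[OF _ _ 2 3] c by (simp add: op2_def whisk_def up_word_cmp)
qed

lemma str2_cell:
  "ok a n ps \<Longrightarrow> str2 a n ps \<in> cells C2 2 \<and> src C2 1 (str2 a n ps) = up (word a n) \<and>
    tgt C2 1 (str2 a n ps) = up (word a (len a n ps))"
proof (induction a n ps rule: ok.induct)
  case (1 a n)
  then show ?case using c2.id_cell[of "up (word a n)" 1] c2.src_id[of "up (word a n)" 1] c2.tgt_id[of "up (word a n)" 1] by simp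
next
  case (2 a n p ps)
  then have "composable C2 2 2 (op2 a n p) (str2 a (nx a n p) ps)"
    by (simp add: composable_22 op2_cell)
  then show ?case using 2 c2.cmp_22[of "op2 a n p" "str2 a (nx a n p) ps"] by (simp add: op2_cell)
qed

lemma str2_simps [simp]:
  assumes "ok a n ps"
  shows "str2 a n ps \<in> cells C2 2" "src C2 1 (str2 a n ps) = up (word a n)"
    "tgt C2 1 (str2 a n ps) = up (word a (len a n ps))"
  using str2_cell[OF assms] by auto

lemma str2_append:
  "ok a n ps \<Longrightarrow> ok a (len a n ps) qs \<Longrightarrow> cmp C2 2 2 (str2 a n ps) (str2 a (len a n ps) qs) = str2 a n (ps @ qs)"
proof (induction a n ps rule: ok.induct)
  case (1 a n)
  then show ?case using c2.unit_l[of "up (word a n)" 1 2 "str2 a n qs"] by simp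
next
  case (2 a n p ps)
  have c: "composable C2 2 2 (op2 a n p) (str2 a (nx a n p) ps)"
    "composable C2 2 2 (str2 a (nx a n p) ps) (str2 a (len a (nx a n p) ps) qs)"
    using 2 by (simp_all add: composable_22 op2_cell)
  show ?case using c2.assoc_low(1)[OF order_refl _ c] 2 by simp
qed

lemma str2_single: "p + din (ob a p) \<le> n \<Longrightarrow> str2 a n [p] = op2 a n p"
  using c2.unit_r[of "up (word a (nx a n p))" 1 2 "op2 a n p"] by (simp add: op2_cell)

lemma str2_left:
  "ok a n ps \<Longrightarrow> a = ob b k \<Longrightarrow> cmp C2 1 2 (up (word b k)) (str2 a n ps) = str2 b (k + n) (sh k ps)"
proof (induction a n ps rule: ok.induct)
  case (1 a n)
  then show ?case using c2.id_r[of 0 1 "up (word b k)" "up (word a n)"] by (simp add: composable_11 up_word_cmp)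
next
  case (2 a n p ps)
  have c: "composable C2 2 2 (op2 a n p) (str2 a (nx a n p) ps)" "composable C2 1 2 (up (word b k)) (op2 a n p)"
    using 2 by (simp_all add: composable_22 composable_12 op2_cell)
  have "cmp C2 1 2 (up (word b k)) (str2 a n (p # ps)) =
    cmp C2 2 2 (cmp C2 1 2 (up (word b k)) (op2 a n p)) (cmp C2 1 2 (up (word b k)) (str2 a (nx a n p) ps))"
    using c2.distrib_l[of 0 2 2, OF _ _ _ c(1), of "up (word b k)"] c(2) by simp
  then show ?case using 2 by (simp add: op2_left nx_shift)
qed

lemma str2_right:
  "ok a n ps \<Longrightarrow> c = ob a n \<Longrightarrow> cmp C2 2 1 (str2 a n ps) (up (word c k)) = str2 a (n + k) ps"
proof (induction a n ps rule: ok.induct)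
  case (1 a n)
  then show ?case using c2.id_l[of 0 1 "up (word a n)" "up (word c k)"] by (simp add: composable_11 up_word_cmp)
next
  case (2 a n p ps)
  have d: "composable C2 2 2 (op2 a n p) (str2 a (nx a n p) ps)" "composable C2 2 1 (op2 a n p) (up (word c k))"
    using 2 by (simp_all add: composable_22 composable_21 op2_cell ob_nx)
  have "cmp C2 2 1 (str2 a n (p # ps)) (up (word c k)) =
    cmp C2 2 2 (cmp C2 2 1 (op2 a n p) (up (word c k))) (cmp C2 2 1 (str2 a (nx a n p) ps) (up (word c k)))"
    using c2.distrib_r[of 0 2 2, OF _ _ _ d(1), of "up (word c k)"] d(2) by simp
  then show ?case using 2 by (simp add: op2_right nx_add ob_nx)
qed

lemma gcell_str2: "gcell a = str2 a (din a) [0]"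
proof -
  have "gcell a = op2 a (din a) 0"
    using c2.unit_l[of "up (up a)" 0 2 "gcell a"] c2.unit_r[of "up (up a)" 0 2 "gcell a"] gcell[of a]
      pmorph_idc[OF up1, of 0 "up a"]
    by (simp add: op2_def whisk_def C2_cells C1_cells_0)
  then show ?thesis using str2_single[of 0 a "din a"] by (simp del: str2.simps)
qed

text \<open>Strings include the generators and identities and are closed under whiskering by words
  and under vertical composition.\<close>

lemma C2_str2: "x \<in> cells C2 2 \<Longrightarrow> \<exists>a n ps. ok a n ps \<and> x = str2 a n ps"
proof -
  assume "x \<in> cells C2 2"
  then have "x \<in> cells e2.E (Suc 1)" by (simp add: C2_def)
  then show ?thesis
  proof (induction rule: e2.E_induct)
    case (gen g)
    obtain a where "g = tp a" by (rule tp_exhaust)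
    then have "e2.gc g = str2 a (din a) [0]" using gcell_str2[of a] by (simp add: gcell_def gen2_def)
    then show ?case by (metis add_0 le_refl ob_0 ok.simps)
  next
    case (ident c)
    then obtain a n where "c = word a n" using C1_word by blast
    then have "idc e2.E 1 (up c) = str2 a n []" by (simp add: C2_def)
    then show ?case by (metis ok.simps(1))
  next
    case (left k c u)
    obtain a n ps where u: "ok a n ps" "u = str2 a n ps" using left.IH by blast
    have com: "composable C2 k 2 (up c) u" using left.hyps by (simp add: C2_def)
    then have k: "k = 1" using left.hyps(1) by (cases k) (auto simp: composable_def)
    then obtain b m where "c = word b m" using C1_word left.hyps by blast
    then have "a = ob b m" "c = word b m" using com k u by (auto simp: composable_12)
    then have "cmp C2 k 2 (up c) u = str2 b (m + n) (sh m ps) \<and> ok b (m + n) (sh m ps)"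
      using k u by (simp add: str2_left ok_shift)
    then show ?case unfolding C2_def by auto
  next
    case (right k c u)
    obtain a n ps where u: "ok a n ps" "u = str2 a n ps" using right.IH by blast
    have com: "composable C2 2 k u (up c)" using right.hyps by (simp add: C2_def)
    then have k: "k = 1" using right.hyps(1) by (cases k) (auto simp: composable_def)
    then obtain b m where "c = word b m" using C1_word right.hyps by blast
    then have "b = ob a n" "c = word b m" using com k u by (auto simp: composable_21 ob_len)
    then have "cmp C2 2 k u (up c) = str2 a (n + m) ps \<and> ok a (n + m) ps"
      using k u by (simp add: str2_right ok_add)
    then show ?case unfolding C2_def by auto
  next
    case (comp u v)
    obtain a n ps where u: "ok a n ps" "u = str2 a n ps" using comp.IH by blast
    obtain b m qs where v: "ok b m qs" "v = str2 b m qs" using comp.IH by blast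
    have com: "composable C2 2 2 u v" using comp.hyps by (simp add: C2_def)
    then have "b = a" "m = len a n ps" using u v by (auto simp: composable_22)
    then have "cmp C2 2 2 u v = str2 a n (ps @ qs) \<and> ok a n (ps @ qs)" using u v by (simp add: str2_append)
    then have "\<exists>a n ps. ok a n ps \<and> cmp C2 2 2 u v = str2 a n ps" by blast
    then show ?case by (simp add: C2_def)
  qed
qed

text \<open>The word model extends to dimension 2 by sending a generator to the string with the
  single position 0. A string is recovered from its image, so strings are distinct as
  2-cells.\<close>

lemma str2_model:
  obtains H where "pmorph 2 C2 model H" "\<And>a n. H 1 (up (word a n)) = M1 a n"
    "\<And>a n ps. ok a n ps \<Longrightarrow> H 2 (str2 a n ps) = M2 a n ps"
proof -
  obtain F where F: "pmorph 1 C1 model F" "\<And>a. F 0 (up a) = M0 a" "\<And>a n. F 1 (word a n) = M1 a n"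
    using word_model by metis
  define \<gamma> where "\<gamma> g = (case g of Eta \<Rightarrow> M2 Ox 0 [0] | Eps \<Rightarrow> M2 Oy 2 [0])" for g
  have \<gamma>: "\<gamma> (tp a) = M2 a (din a) [0]" for a by (cases a) (auto simp: \<gamma>_def)
  have "\<gamma> g \<in> cells model (Suc 1) \<and> src model 1 (\<gamma> g) = F 1 (dom2 Adj2 g) \<and> tgt model 1 (\<gamma> g) = F 1 (cod2 Adj2 g)" for g
    by (rule tp_exhaust[of g]) (simp add: \<gamma> F nx_def)
  moreover have "precategory (Suc 1) model" using model_precategory by simp
  ultimately obtain H where H: "pmorph (Suc 1) e2.E model H" "\<And>k c. k \<le> 1 \<Longrightarrow> c \<in> cells C1 k \<Longrightarrow> H k (up c) = F k c"
    "\<And>g. g \<in> gens2 Adj2 \<Longrightarrow> H (Suc 1) (e2.gc g) = \<gamma> g"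
    using e2.E_universal[of model F \<gamma>] F(1) by (metis (no_types, lifting))
  have P: "pmorph 2 C2 model H" using H(1) by (simp add: C2_def)
  have H0: "H 1 (up (word a n)) = M1 a n" for a n using H(2)[of 1 "word a n"] F by simp
  have g: "H 2 (gcell a) = M2 a (din a) [0]" for a
    using H(3)[of "tp a"] by (simp add: gcell_def gen2_def \<gamma>)
  have op: "H 2 (op2 a n p) = M2 a n [p]" if "p + din (ob a p) \<le> n" for a n p
  proof -
    let ?g = "gcell (ob a p)" and ?r = "up (word (ob a p) (n - p - din (ob a p)))"
    have 1: "composable C2 1 2 (up (word a p)) ?g" by (rule gcell_composable) simp
    note x = c2.cmp_12[OF _ 1, simplified]
    have 2: "composable C2 2 1 (cmp C2 1 2 (up (word a p)) ?g) ?r"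
      using x by (simp add: composable_21 gcell up_word_cmp)
    show ?thesis using pmorph_cmp_le[OF P _ _ 1] pmorph_cmp_ge[OF P _ _ 2] that
      by (simp add: op2_def whisk_def g H0)
  qed
  have "ok a n ps \<Longrightarrow> H 2 (str2 a n ps) = M2 a n ps" for a n ps
  proof (induction a n ps rule: ok.induct)
    case (1 a n)
    show ?case using pmorph_idc[OF P, of 1 "up (word a n)"] H0 by simp
  next
    case (2 a n p ps)
    have com: "composable C2 2 2 (op2 a n p) (str2 a (nx a n p) ps)" using 2 by (simp add: composable_22 op2_cell)
    show ?case using pmorph_cmp_le[OF P _ _ com] 2 op by simp
  qed
  then show ?thesis using that P H0 by blast
qed

lemma str2_inj: "ok a n ps \<Longrightarrow> ok b m qs \<Longrightarrow> str2 a n ps = str2 b m qs \<longleftrightarrow> a = b \<and> n = m \<and> ps = qs"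
  using str2_model model.inject(3) by metis

subsection \<open>Whisker decompositions\<close>

fun wtriples :: "adj0 \<Rightarrow> nat \<Rightarrow> nat list \<Rightarrow> (adj_cell1 \<times> adj2 \<times> adj_cell1) list" where
  "wtriples a n [] = []" | "wtriples a n (p # ps) = wtriple a n p # wtriples a (nx a n p) ps"

lemma is_whisker_iff: "is_whisker Adj2 w \<longleftrightarrow> (\<exists>a n p. p + din (ob a p) \<le> n \<and> w = wtriple a n p)"
proof
  assume w: "is_whisker Adj2 w"
  obtain l \<alpha> r where e: "w = (l, \<alpha>, r)" by (cases w) auto
  obtain b where b: "\<alpha> = tp b" by (rule tp_exhaust)
  have c: "composable C2 1 2 (up l) (gcell b)" "composable C2 2 1 (gcell b) (up r)"
    using w e b by (auto simp: is_whisker_def whiskable_def gcell_def)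
  then obtain a p c m where lr: "l = word a p" "r = word c m"
    using C1_word by (fastforce simp: composable_12 composable_21 C2_cells)
  then have "b = ob a p" "c = b" using c by (auto simp: composable_12 composable_21 gcell)
  then have "w = wtriple a (p + din b + m) p" using lr e b by (simp add: wtriple_def)
  then show "\<exists>a n p. p + din (ob a p) \<le> n \<and> w = wtriple a n p" using \<open>b = ob a p\<close> by (metis le_add1)
next
  assume "\<exists>a n p. p + din (ob a p) \<le> n \<and> w = wtriple a n p"
  then show "is_whisker Adj2 w"
    using gcell_composable by (auto simp: is_whisker_def whiskable_def wtriple_def gcell_def[symmetric])
qed

lemma vcomp_wtriples:
  "ok a n ps \<Longrightarrow> vcomp C2 2 (up (word a n)) (map (whisker Adj2) (wtriples a n ps)) = str2 a n ps"
  by (induction a n ps rule: ok.induct) (auto simp: op2_cell)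

lemma wtriples_whisker: "ok a n ps \<Longrightarrow> \<forall>w\<in>set (wtriples a n ps). is_whisker Adj2 w"
  by (induction a n ps rule: ok.induct) (auto simp: is_whisker_iff)

lemma wtriples_successively:
  "ok a n ps \<Longrightarrow> successively (\<lambda>w w'. composable C2 2 2 (whisker Adj2 w) (whisker Adj2 w')) (wtriples a n ps)"
proof (induction a n ps rule: ok.induct)
  case (2 a n p ps)
  then show ?case by (cases ps) (auto simp: composable_22 op2_cell)
qed simp

text \<open>Composability of consecutive whiskers forces a common source object and matching
  lengths, so a nonempty chain of whiskers comes from a string.\<close>

lemma wtriples_exhaust:
  assumes "\<forall>w\<in>set ws. is_whisker Adj2 w" "ws \<noteq> []"
    "successively (\<lambda>w w'. composable C2 2 2 (whisker Adj2 w) (whisker Adj2 w')) ws"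
  shows "\<exists>a n ps. ok a n ps \<and> ws = wtriples a n ps"
  using assms
proof (induction ws)
  case (Cons w ws)
  obtain a n p where w: "p + din (ob a p) \<le> n" "w = wtriple a n p" using Cons(2) by (auto simp: is_whisker_iff)
  show ?case
  proof (cases ws)
    case Nil
    then have "ok a n [p] \<and> w # ws = wtriples a n [p]" using w by simp
    then show ?thesis by blast
  next
    case (Cons w' ws')
    then obtain b m qs where q: "ok b m qs" "ws = wtriples b m qs" using Cons.IH Cons.prems by auto
    then obtain q qs' where qs: "qs = q # qs'" "w' = wtriple b m q" using Cons by (cases qs) auto
    have "composable C2 2 2 (op2 a n p) (op2 b m q)" using Cons.prems(3) Cons w qs by simp
    then have "b = a" "m = nx a n p" using w q qs by (auto simp: composable_22 op2_cell)
    then have "ok a n (p # qs) \<and> w # ws = wtriples a n (p # qs)" using w q by simp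
    then show ?thesis by blast
  qed
qed simp

text \<open>This gives meaning to the definite description in \<open>decomp\<close>. Uniqueness
  reduces to \<open>str2_inj\<close>, since every nonempty decomposition comes from a
  string.\<close>

lemma decomp_str2:
  assumes ok: "ok a n ps"
  shows "decomp Adj2 (str2 a n ps) = wtriples a n ps"
  unfolding decomp_def
proof (rule the_equality)
  show "is_decomp Adj2 (str2 a n ps) (wtriples a n ps)"
    using ok by (simp add: is_decomp_def wtriples_whisker wtriples_successively vcomp_wtriples)
  fix ws assume ws: "is_decomp Adj2 (str2 a n ps) ws"
  show "ws = wtriples a n ps"
  \<comment> \<open>An empty list carries no word; here the composite is the identity on the
    starting 1-cell handed to \<open>vcomp\<close>.\<close>
  proof (cases "ws = []")
    case True
    then have "str2 a n ps = str2 a n []" using ws ok by (simp add: is_decomp_def)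
    then show ?thesis using str2_inj[OF ok, of a n "[]"] True by simp
  next
    case False
    then obtain b m qs where q: "ok b m qs" "ws = wtriples b m qs"
      using wtriples_exhaust ws unfolding is_decomp_def by blast
    then obtain q qs' where qs: "qs = q # qs'" using False by (cases qs) auto
    have "vcomp C2 2 x (map (whisker Adj2) ws) = str2 b m qs" for x
      using vcomp_wtriples[OF q(1)] q qs by simp
    then have "str2 b m qs = str2 a n ps" using ws by (simp add: is_decomp_def)
    then show ?thesis using str2_inj[OF ok q(1)] q by simp
  qed
qed

lemma decomp_eq [simp]: "decomp Adj3 = decomp Adj2" "decomp PAdj = decomp Adj2"
  "whisker Adj3 = whisker Adj2" "whisker PAdj = whisker Adj2"
  by (simp_all add: fun_eq_iff decomp_def is_decomp_def is_whisker_def whisker_def)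

section \<open>Whiskering calculus for 3-cells between strings\<close>

section \<open>3-cells between strings\<close>

lemma composable_13: "composable C 1 3 u A \<longleftrightarrow> u \<in> cells C 1 \<and> A \<in> cells C 3 \<and> tgt C 0 u = src C 0 (src C 1 (src C 2 A))"
  and composable_31: "composable C 3 1 A u \<longleftrightarrow> A \<in> cells C 3 \<and> u \<in> cells C 1 \<and> tgt C 0 (tgt C 1 (tgt C 2 A)) = src C 0 u"
  and composable_23: "composable C 2 3 v A \<longleftrightarrow> v \<in> cells C 2 \<and> A \<in> cells C 3 \<and> tgt C 1 v = src C 1 (src C 2 A)"
  and composable_32: "composable C 3 2 A v \<longleftrightarrow> A \<in> cells C 3 \<and> v \<in> cells C 2 \<and> tgt C 1 (tgt C 2 A) = src C 1 v"
  and composable_33: "composable C 3 3 A B \<longleftrightarrow> A \<in> cells C 3 \<and> B \<in> cells C 3 \<and> tgt C 2 A = src C 2 B"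
  by (auto simp: composable_def)

lemmas composable_low_simps = composable_11 composable_12 composable_21 composable_22
  composable_13 composable_31 composable_23 composable_32 composable_33

text \<open>Interpreted twice: in the free 3-precategory, where boundaries of generators are
  computed, and in the localization, where coherence is proved. Injectivity of \<open>F\<close> in
  dimensions 1 and 2 lets a 3-cell determine its source and target strings.\<close>

locale strings = precat 3 D for D :: "'d precat" +
  fixes F :: "nat \<Rightarrow> adj_cell2 \<Rightarrow> 'd"
  assumes F: "pmorph 2 C2 D F"
    and inj1: "inj_on (F 1) (cells C2 1)"
    and inj2: "inj_on (F 2) (cells C2 2)"
begin

definition W :: "adj0 \<Rightarrow> nat \<Rightarrow> 'd" where "W a n = F 1 (up (word a n))"
definition S :: "adj0 \<Rightarrow> nat \<Rightarrow> nat list \<Rightarrow> 'd" where "S a n ps = F 2 (str2 a n ps)"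
definition O0 :: "adj0 \<Rightarrow> 'd" where "O0 a = F 0 (up (up a))"

lemma O0_cell: "O0 a \<in> cells D 0"
  unfolding O0_def by (rule pmorph_cell[OF F]) (auto simp: C2_cells)

lemma W_simps [simp]: "W a n \<in> cells D 1" "src D 0 (W a n) = O0 a" "tgt D 0 (W a n) = O0 (ob a n)"
  using pmorph_cell[OF F, of 1 "up (word a n)"] pmorph_src[OF F, of 0 "up (word a n)"]
    pmorph_tgt[OF F, of 0 "up (word a n)"] by (simp_all add: W_def O0_def)

lemma S_simps [simp]: "ok a n ps \<Longrightarrow> S a n ps \<in> cells D 2" "ok a n ps \<Longrightarrow> src D 1 (S a n ps) = W a n"
   "ok a n ps \<Longrightarrow> tgt D 1 (S a n ps) = W a (len a n ps)"
  using pmorph_cell[OF F, of 2 "str2 a n ps"] pmorph_src[OF F, of 1 "str2 a n ps"]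
    pmorph_tgt[OF F, of 1 "str2 a n ps"] by (simp_all add: W_def S_def)

lemma W_inj [simp]: "W a n = W b m \<longleftrightarrow> a = b \<and> n = m"
  unfolding W_def using inj_on_eq_iff[OF inj1, of "up (word a n)" "up (word b m)"] by simp

lemma S_inj: "ok a n ps \<Longrightarrow> ok b m qs \<Longrightarrow> S a n ps = S b m qs \<longleftrightarrow> a = b \<and> n = m \<and> ps = qs"
  unfolding S_def using inj_on_eq_iff[OF inj2, of "str2 a n ps" "str2 b m qs"] by (simp add: str2_inj)

lemma W_cmp: "b = ob a m \<Longrightarrow> cmp D 1 1 (W a m) (W b n) = W a (m + n)"
  using pmorph_cmp[OF F, of 1 1 "up (word a m)" "up (word b n)"] up_word_cmp[of b a m n]
  by (simp add: W_def composable_11)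

lemma S_cmp: "ok a n ps \<Longrightarrow> ok a m qs \<Longrightarrow> m = len a n ps \<Longrightarrow> cmp D 2 2 (S a n ps) (S a m qs) = S a n (ps @ qs)"
  using pmorph_cmp[OF F, of 2 2 "str2 a n ps" "str2 a m qs"] str2_append[of a n ps qs]
  by (simp add: S_def composable_22)

lemma W_S: "ok a n ps \<Longrightarrow> a = ob b k \<Longrightarrow> cmp D 1 2 (W b k) (S a n ps) = S b (k + n) (sh k ps)"
  using pmorph_cmp_le[OF F, of 1 2 "up (word b k)" "str2 a n ps"] str2_left[of a n ps b k]
  by (simp add: S_def W_def composable_12)

lemma S_W: "ok a n ps \<Longrightarrow> c = ob a n \<Longrightarrow> cmp D 2 1 (S a n ps) (W c k) = S a (n + k) ps"
  using pmorph_cmp_ge[OF F, of 1 2 "str2 a n ps" "up (word c k)"] str2_right[of a n ps c k]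
  by (simp add: S_def W_def composable_21 ob_len)

lemma W_0: "idc D 0 (O0 a) = W a 0"
  using pmorph_idc[OF F, of 0 "up (up a)"] pmorph_idc[OF up1, of 0 "up a"]
  by (simp add: O0_def W_def C2_cells C1_cells_0)

lemma S_Nil: "idc D 1 (W a n) = S a n []"
  using pmorph_idc[OF F, of 1 "up (word a n)"] by (simp add: S_def W_def)

definition hom :: "adj0 \<Rightarrow> nat \<Rightarrow> nat list \<Rightarrow> nat list \<Rightarrow> 'd \<Rightarrow> bool" where
  "hom a n s t A \<longleftrightarrow> A \<in> cells D 3 \<and> ok a n s \<and> ok a n t \<and> src D 2 A = S a n s \<and> tgt D 2 A = S a n t"

abbreviation "vc \<equiv> cmp D 3 3"

lemma homD:
  assumes "hom a n s t A"
  shows "A \<in> cells D 3" "ok a n s" "ok a n t" "src D 2 A = S a n s" "tgt D 2 A = S a n t" "len a n t = len a n s"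
proof -
  show *: "A \<in> cells D 3" "ok a n s" "ok a n t" "src D 2 A = S a n s" "tgt D 2 A = S a n t"
    using assms unfolding hom_def by auto
  show "len a n t = len a n s" using globular[of A 1] * by simp
qed

lemma hom_unique:
  assumes "hom a n s t A" "hom b m s' t' A"
  shows "a = b \<and> n = m \<and> s = s' \<and> t = t'"
  using homD[OF assms(1)] homD[OF assms(2)] by (metis S_inj)

definition lw :: "adj0 \<Rightarrow> nat \<Rightarrow> 'd \<Rightarrow> 'd" where "lw b k A = cmp D 1 3 (W b k) A"
definition rw :: "'d \<Rightarrow> adj0 \<Rightarrow> nat \<Rightarrow> 'd" where "rw A c k = cmp D 3 1 A (W c k)"
definition pr :: "adj0 \<Rightarrow> nat \<Rightarrow> nat list \<Rightarrow> 'd \<Rightarrow> 'd" where "pr a n ps A = cmp D 2 3 (S a n ps) A"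
definition po :: "'d \<Rightarrow> adj0 \<Rightarrow> nat \<Rightarrow> nat list \<Rightarrow> 'd" where "po A a n qs = cmp D 3 2 A (S a n qs)"

lemma hom_composable:
  assumes "hom a n s t A"
  shows "a = ob b k \<Longrightarrow> composable D 1 3 (W b k) A"
    "c = ob a n \<Longrightarrow> composable D 3 1 A (W c k)"
    "ok a m ps \<Longrightarrow> n = len a m ps \<Longrightarrow> composable D 2 3 (S a m ps) A"
    "ok a m qs \<Longrightarrow> m = len a n s \<Longrightarrow> composable D 3 2 A (S a m qs)"
    "hom a n t u B \<Longrightarrow> composable D 3 3 A B"
  using homD[OF assms] by (auto simp: composable_low_simps ob_len hom_def)

lemma hom_lw:
  assumes A: "hom a n s t A" and a: "a = ob b k"
  shows "hom b (k + n) (sh k s) (sh k t) (lw b k A)"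
proof -
  note c = hom_composable(1)[OF A a]
  show ?thesis
    using cmp_cell_le[OF c] src_cmp_less[of 1 2 "W b k" A] c homD[OF A] a
    by (simp add: hom_def lw_def ok_shift W_S)
qed

lemma hom_rw:
  assumes A: "hom a n s t A" and c: "c = ob a n"
  shows "hom a (n + k) s t (rw A c k)"
proof -
  note d = hom_composable(2)[OF A c]
  show ?thesis
    using cmp_cell_ge[OF d] src_cmp_greater[of 2 1 A "W c k"] d homD[OF A] c
    by (simp add: hom_def rw_def ok_add S_W)
qed

lemma hom_pr:
  assumes A: "hom a m s t A" and p: "ok a n ps" "m = len a n ps"
  shows "hom a n (ps @ s) (ps @ t) (pr a n ps A)"
proof -
  note d = hom_composable(3)[OF A p]
  show ?thesis
    using cmp_cell_le[OF d] src_cmp_less[of 2 2 "S a n ps" A] d homD[OF A] p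
    by (simp add: hom_def pr_def S_cmp)
qed

lemma hom_po:
  assumes A: "hom a n s t A" and q: "ok a m qs" "m = len a n s"
  shows "hom a n (s @ qs) (t @ qs) (po A a m qs)"
proof -
  note d = hom_composable(4)[OF A q]
  show ?thesis
    using cmp_cell_ge[OF d] src_cmp_greater[of 2 2 A "S a m qs"] d homD[OF A] q
    by (simp add: hom_def po_def S_cmp)
qed

lemma hom_vc:
  assumes A: "hom a n s t A" and B: "hom a n t u B"
  shows "hom a n s u (vc A B)"
proof -
  note d = hom_composable(5)[OF A B]
  show ?thesis
    using cmp_cell_ge[OF d] src_cmp_eq[of 2 A B] d homD[OF A] homD[OF B]
    by (simp add: hom_def)
qed

lemma hom_id: "ok a n s \<Longrightarrow> hom a n s s (idc D 2 (S a n s))"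
  using id_cell[of "S a n s" 2] src_id[of "S a n s" 2] tgt_id[of "S a n s" 2] by (simp add: hom_def)

lemma vc_assoc:
  assumes "hom a n s t A" "hom a n t u B" "hom a n u v E"
  shows "vc (vc A B) E = vc A (vc B E)"
  using assoc_low(1)[OF order_refl _ hom_composable(5)[OF assms(1,2)] hom_composable(5)[OF assms(2,3)]] by simp

lemma vc_id:
  assumes "hom a n s t A"
  shows "vc (idc D 2 (S a n s)) A = A" "vc A (idc D 2 (S a n t)) = A"
  using unit_l[of "S a n s" 2 3 A] unit_r[of "S a n t" 2 3 A] homD[OF assms] by simp_all

lemma lw_lw:
  assumes "hom a n s t A" "a = ob b k" "b = ob c l"
  shows "lw c l (lw b k A) = lw c (l + k) A"
  using assoc_low(1)[of 1 3 "W c l" "W b k" A] hom_composable(1)[OF assms(1,2)] assms(3)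
  by (simp add: lw_def W_cmp composable_11)

lemma rw_rw:
  assumes "hom a n s t A" "b = ob a n" "c = ob b k"
  shows "rw (rw A b k) c l = rw A b (k + l)"
  using assoc_low(3)[of 1 3 A "W b k" "W c l"] hom_composable(2)[OF assms(1,2)] assms(3)
  by (simp add: rw_def W_cmp composable_11)

lemma rw_lw:
  assumes "hom a n s t A" "a = ob b k" "c = ob a n"
  shows "lw b k (rw A c l) = rw (lw b k A) c l"
  using assoc_low(2)[of 1 3 "W b k" A "W c l"] hom_composable(1)[OF assms(1,2)] hom_composable(2)[OF assms(1,3)]
  by (simp add: rw_def lw_def)

lemma lw_vc:
  assumes "hom a n s t A" "hom a n t u B" "a = ob b k"
  shows "lw b k (vc A B) = vc (lw b k A) (lw b k B)"
  using distrib_l[of 0 3 3 A B "W b k"] hom_composable(5)[OF assms(1,2)] hom_composable(1)[OF assms(1,3)]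
  by (simp add: lw_def)

lemma rw_vc:
  assumes "hom a n s t A" "hom a n t u B" "c = ob a n"
  shows "rw (vc A B) c k = vc (rw A c k) (rw B c k)"
  using distrib_r[of 0 3 3 A B "W c k"] hom_composable(5)[OF assms(1,2)] hom_composable(2)[OF assms(1,3)]
  by (simp add: rw_def)

lemma lw_pr:
  assumes "hom a m s t A" "ok a n ps" "m = len a n ps" "a = ob b k"
  shows "lw b k (pr a n ps A) = pr b (k + n) (sh k ps) (lw b k A)"
  using distrib_l[of 0 2 3 "S a n ps" A "W b k"] hom_composable(3)[OF assms(1-3)] assms
  by (simp add: lw_def pr_def W_S composable_12)

lemma lw_po:
  assumes "hom a n s t A" "ok a m qs" "m = len a n s" "a = ob b k"
  shows "lw b k (po A a m qs) = po (lw b k A) b (k + m) (sh k qs)"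
  using distrib_l[of 0 3 2 A "S a m qs" "W b k"] hom_composable(4)[OF assms(1-3)] hom_composable(1)[OF assms(1,4)] assms
  by (simp add: lw_def po_def W_S)

lemma rw_pr:
  assumes "hom a m s t A" "ok a n ps" "m = len a n ps" "c = ob a n"
  shows "rw (pr a n ps A) c k = pr a (n + k) ps (rw A c k)"
  using distrib_r[of 0 2 3 "S a n ps" A "W c k"] hom_composable(3)[OF assms(1-3)] assms
  by (simp add: rw_def pr_def S_W composable_21 ob_len)

lemma rw_po:
  assumes "hom a n s t A" "ok a m qs" "m = len a n s" "c = ob a n"
  shows "rw (po A a m qs) c k = po (rw A c k) a (m + k) qs"
  using distrib_r[of 0 3 2 A "S a m qs" "W c k"] hom_composable(4)[OF assms(1-3)] hom_composable(2)[OF assms(1,4)] assms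
    homD(2)[OF assms(1)]
  by (simp add: rw_def po_def S_W ob_len)

lemma pr_pr:
  assumes "hom a m s t A" "ok a n ps" "m = len a n ps" "ok a l qs" "n = len a l qs"
  shows "pr a l qs (pr a n ps A) = pr a l (qs @ ps) A"
  using assoc_low(1)[of 2 3 "S a l qs" "S a n ps" A] hom_composable(3)[OF assms(1-3)] assms
  by (simp add: pr_def S_cmp composable_22)

lemma po_po:
  assumes "hom a n s t A" "ok a m qs" "m = len a n s" "ok a l rs" "l = len a m qs"
  shows "po (po A a m qs) a l rs = po A a m (qs @ rs)"
  using assoc_low(3)[of 2 3 A "S a m qs" "S a l rs"] hom_composable(4)[OF assms(1-3)] assms
  by (simp add: po_def S_cmp composable_22)

lemma pr_po:
  assumes "hom a m s t A" "ok a n ps" "m = len a n ps" "ok a l qs" "l = len a m s"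
  shows "pr a n ps (po A a l qs) = po (pr a n ps A) a l qs"
  using assoc_low(2)[of 2 3 "S a n ps" A "S a l qs"] hom_composable(3)[OF assms(1-3)] hom_composable(4)[OF assms(1,4,5)]
  by (simp add: pr_def po_def)

lemma pr_vc:
  assumes "hom a m s t A" "hom a m t u B" "ok a n ps" "m = len a n ps"
  shows "pr a n ps (vc A B) = vc (pr a n ps A) (pr a n ps B)"
  using distrib_l[of 1 3 3 A B "S a n ps"] hom_composable(5)[OF assms(1,2)] hom_composable(3)[OF assms(1,3,4)]
  by (simp add: pr_def)

lemma po_vc:
  assumes "hom a n s t A" "hom a n t u B" "ok a m qs" "m = len a n s"
  shows "po (vc A B) a m qs = vc (po A a m qs) (po B a m qs)"
  using distrib_r[of 1 3 3 A B "S a m qs"] hom_composable(5)[OF assms(1,2)] hom_composable(4)[OF assms(1,3,4)]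
  by (simp add: po_def)

lemma lw_0: "hom a n s t A \<Longrightarrow> lw a 0 A = A"
  using unit_l[of "O0 a" 0 3 A] homD[of a n s t A] by (simp add: lw_def W_0 O0_cell)

lemma rw_0: "hom a n s t A \<Longrightarrow> c = ob a n \<Longrightarrow> rw A c 0 = A"
  using unit_r[of "O0 c" 0 3 A] homD[of a n s t A] by (simp add: rw_def W_0 O0_cell ob_len)

lemma pr_Nil: "hom a n s t A \<Longrightarrow> pr a n [] A = A"
  using unit_l[of "W a n" 1 3 A] homD[of a n s t A] by (simp add: pr_def S_Nil)

lemma po_Nil: "hom a n s t A \<Longrightarrow> m = len a n s \<Longrightarrow> po A a m [] = A"
  using unit_r[of "W a m" 1 3 A] homD[of a n s t A] by (simp add: po_def S_Nil)

lemma lw_id: "ok a n s \<Longrightarrow> a = ob b k \<Longrightarrow> lw b k (idc D 2 (S a n s)) = idc D 2 (S b (k + n) (sh k s))"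
  using id_r[of 0 2 "W b k" "S a n s"] by (simp add: lw_def W_S composable_12)

lemma rw_id: "ok a n s \<Longrightarrow> c = ob a n \<Longrightarrow> rw (idc D 2 (S a n s)) c k = idc D 2 (S a (n + k) s)"
  using id_l[of 0 2 "S a n s" "W c k"] by (simp add: rw_def S_W composable_21 ob_len)

lemma pr_id: "ok a n s \<Longrightarrow> ok a m ps \<Longrightarrow> n = len a m ps \<Longrightarrow> pr a m ps (idc D 2 (S a n s)) = idc D 2 (S a m (ps @ s))"
  using id_r[of 1 2 "S a m ps" "S a n s"] by (simp add: pr_def S_cmp composable_22)

lemma po_id: "ok a n s \<Longrightarrow> ok a m qs \<Longrightarrow> m = len a n s \<Longrightarrow> po (idc D 2 (S a n s)) a m qs = idc D 2 (S a n (s @ qs))"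
  using id_l[of 1 2 "S a n s" "S a m qs"] by (simp add: po_def S_cmp composable_22)

subsection \<open>Contexts\<close>

text \<open>\<open>cx a n ps k m s A qs\<close> applies the 3-cell \<open>A\<close>, whose source is the string \<open>s\<close> on a word of
  length \<open>m\<close>, at position \<open>k\<close>, between the strings \<open>ps\<close> and \<open>qs\<close>.\<close>

definition cx :: "adj0 \<Rightarrow> nat \<Rightarrow> nat list \<Rightarrow> nat \<Rightarrow> nat \<Rightarrow> nat list \<Rightarrow> 'd \<Rightarrow> nat list \<Rightarrow> 'd" where
  "cx a n ps k m s A qs = whisk D 1 3 (S a n ps)
     (whisk D 0 3 (W a k) A (W (ob a (k + m)) (len a n ps - k - m))) (S a (len a n (ps @ sh k s)) qs)"

lemma cx_def': "cx a n ps k m s A qs =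
    po (pr a n ps (rw (lw a k A) (ob a (k + m)) (len a n ps - k - m))) a (len a n (ps @ sh k s)) qs"
  by (simp add: cx_def whisk_def lw_def rw_def pr_def po_def)

lemma ok_context: "ok (ob a k) m s \<Longrightarrow> k + m \<le> N \<Longrightarrow> ok a N (sh k s) \<and> len a N (sh k s) = k + len (ob a k) m s + (N - k - m)"
  using ok_shift[of a k m s] len_shift[of a k m s] ok_add[of a "k + m" "sh k s" "N - k - m"]
    len_add[of a "k + m" "sh k s" "N - k - m"] by simp

lemma hom_lrw:
  assumes A: "hom (ob a k) m s t A" and k: "k + m \<le> N"
  shows "hom a N (sh k s) (sh k t) (rw (lw a k A) (ob a (k + m)) (N - k - m))"
  using hom_rw[OF hom_lw[OF A refl], of "ob a (k + m)" "N - k - m"] k by simp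

lemma hom_prw:
  assumes A: "hom (ob a k) m s t A" and "ok a n ps" "k + m \<le> len a n ps"
  shows "hom a n (ps @ sh k s) (ps @ sh k t) (pr a n ps (rw (lw a k A) (ob a (k + m)) (len a n ps - k - m)))"
  using hom_pr[OF hom_lrw[OF assms(1,3)] assms(2) refl] .

lemma hom_cx:
  assumes "hom (ob a k) m s t A" "ok a n ps" "k + m \<le> len a n ps" "ok a (len a n (ps @ sh k s)) qs"
  shows "hom a n (ps @ sh k s @ qs) (ps @ sh k t @ qs) (cx a n ps k m s A qs)"
  using hom_po[OF hom_prw[OF assms(1-3)] assms(4) refl] by (simp add: cx_def')

lemma cx_vc:
  assumes A: "hom (ob a k) m s t A" and B: "hom (ob a k) m t u B"
    and c: "ok a n ps" "k + m \<le> len a n ps" "ok a (len a n (ps @ sh k s)) qs"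
  shows "cx a n ps k m s (vc A B) qs = vc (cx a n ps k m s A qs) (cx a n ps k m t B qs)"
proof -
  let ?c = "ob a (k + m)" and ?r = "len a n ps - k - m"
  have e: "len a n (ps @ sh k t) = len a n (ps @ sh k s)"
    using homD(6)[OF hom_prw[OF A c(1,2)]] .
  have "rw (lw a k (vc A B)) ?c ?r = vc (rw (lw a k A) ?c ?r) (rw (lw a k B) ?c ?r)"
    using lw_vc[OF A B refl] rw_vc[OF hom_lw[OF A refl] hom_lw[OF B refl], of ?c ?r] by simp
  then show ?thesis
    unfolding cx_def' e
    using pr_vc[OF hom_lrw[OF A c(2)] hom_lrw[OF B c(2)] c(1) refl]
      po_vc[OF hom_prw[OF A c(1,2)] hom_prw[OF B c(1,2)] c(3) refl] by simp
qed

lemma cx_id: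
  assumes s: "ok (ob a k) m s" and c: "ok a n ps" "k + m \<le> len a n ps" "ok a (len a n (ps @ sh k s)) qs"
  shows "cx a n ps k m s (idc D 2 (S (ob a k) m s)) qs = idc D 2 (S a n (ps @ sh k s @ qs))"
proof -
  let ?r = "len a n ps - k - m"
  have "rw (lw a k (idc D 2 (S (ob a k) m s))) (ob a (k + m)) ?r = idc D 2 (S a (len a n ps) (sh k s))"
    using c s by (simp add: lw_id rw_id ok_shift)
  then show ?thesis using c s ok_context[OF s c(2)] by (simp add: cx_def' pr_id po_id)
qed

text \<open>The outer whiskers pass through the inner composites by distributivity, after which the
  words and strings on each side merge. A relation established on its smallest word can thus be
  moved into any context.\<close>

lemma cx_cx:
  assumes A: "hom (ob (ob a' k') k) m s t A"
    and c: "ok (ob a' k') n ps" "k + m \<le> len (ob a' k') n ps" "ok (ob a' k') (len (ob a' k') n (ps @ sh k s)) qs"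
    and c': "ok a' n' ps'" "k' + n \<le> len a' n' ps'"
      "ok a' (len a' n' (ps' @ sh k' (ps @ sh k s @ qs))) qs'"
  shows "cx a' n' ps' k' n (ps @ sh k s @ qs) (cx (ob a' k') n ps k m s A qs) qs' =
    cx a' n' (ps' @ sh k' ps) (k' + k) m s A (sh k' qs @ qs')"
proof -
  define a where "a = ob a' k'"
  define N where "N = len a n ps"
  define M where "M = len a N (sh k s)"
  define N' where "N' = len a' n' ps'"
  define r where "r = N - k - m"
  define r' where "r' = N' - k' - n"
  let ?c = "ob a (k + m)" and ?c' = "ob a' (k' + n)"
  note A = A[folded a_def] and c = c[folded a_def]
  have M: "len a n (ps @ sh k s) = M" by (simp add: M_def N_def)
  have r: "N = k + m + r" using c(2) by (simp add: r_def N_def)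
  have r': "N' = k' + n + r'" using c'(2) by (simp add: r'_def N'_def)
  have cc: "?c' = ob ?c r"
    using ob_len[OF c(1)] r unfolding N_def[symmetric] by (simp add: a_def add.assoc)
  have h1: "hom a (k + m) (sh k s) (sh k t) (lw a k A)" using hom_lw[OF A refl] .
  have h2: "hom a N (sh k s) (sh k t) (rw (lw a k A) ?c r)" using hom_rw[OF h1, of ?c r] r by simp
  have h3: "hom a n (ps @ sh k s) (ps @ sh k t) (pr a n ps (rw (lw a k A) ?c r))"
    using hom_pr[OF h2 c(1)] by (simp add: N_def)
  have h4: "hom a n (ps @ sh k s @ qs) (ps @ sh k t @ qs) (cx a n ps k m s A qs)"
    using hom_cx[OF A c] .
  have g1: "hom a' (k' + (k + m)) (sh (k' + k) s) (sh (k' + k) t) (lw a' (k' + k) A)"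
    using hom_lw[of "ob a k" m s t A a' "k' + k"] A a_def by (simp add: add.assoc)
  have g1': "hom a' (k' + N) (sh (k' + k) s) (sh (k' + k) t) (rw (lw a' (k' + k) A) ?c r)"
    using hom_rw[OF g1, of ?c r] r a_def by (simp add: add.assoc)
  have eM: "k' + M = len a' (k' + N) (sh (k' + k) s)"
    using len_shift[of a' k' N "sh k s"] h2 a_def homD(2)[OF h2] by (simp add: M_def)
  have okq: "ok a' (k' + n) (sh k' ps)" "len a' (k' + n) (sh k' ps) = k' + N"
    using ok_shift[of a' k' n ps] len_shift[of a' k' n ps] c(1) a_def N_def by auto
  have okq': "ok a' (k' + M) (sh k' qs)" "len a' (k' + M) (sh k' qs) = k' + len a M qs"
    using ok_shift[of a' k' M qs] len_shift[of a' k' M qs] c(3) a_def M by auto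
  have g2: "hom a' (k' + n) (sh k' ps @ sh (k' + k) s) (sh k' ps @ sh (k' + k) t)
     (pr a' (k' + n) (sh k' ps) (rw (lw a' (k' + k) A) ?c r))"
    using hom_pr[OF g1' okq(1)] okq(2) by simp
  have e1: "lw a' k' (cx a n ps k m s A qs) =
    po (pr a' (k' + n) (sh k' ps) (rw (lw a' (k' + k) A) ?c r)) a' (k' + M) (sh k' qs)"
  proof -
    have "lw a' k' (cx a n ps k m s A qs) = po (lw a' k' (pr a n ps (rw (lw a k A) ?c r))) a' (k' + M) (sh k' qs)"
      unfolding cx_def' N_def[symmetric] r_def[symmetric]
      using lw_po[OF h3 c(3) refl a_def] by (simp add: M_def N_def)
    also have "lw a' k' (pr a n ps (rw (lw a k A) ?c r)) = pr a' (k' + n) (sh k' ps) (lw a' k' (rw (lw a k A) ?c r))"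
      using lw_pr[OF h2 c(1) _ a_def] N_def by simp
    also have "lw a' k' (rw (lw a k A) ?c r) = rw (lw a' (k' + k) A) ?c r"
      using rw_lw[OF h1 a_def refl, of r] lw_lw[OF A refl a_def] by simp
    finally show ?thesis .
  qed
  have h5: "hom a' (k' + n) (sh k' (ps @ sh k s @ qs)) (sh k' (ps @ sh k t @ qs)) (lw a' k' (cx a n ps k m s A qs))"
    by (rule hom_lw[OF h4 a_def])
  let ?X = "rw (lw a' (k' + k) A) ?c (r + r')"
  have c1: "?c' = ob a' (k' + n)" by simp
  \<comment> \<open>A string preserves the object at the right end of its word, so the outer right
    whisker still fits after \<open>ps\<close>.\<close>
  have c2: "?c' = ob a' (k' + N)"
    using ob_len[OF okq(1)] okq(2) by simp
  have e2: "rw (lw a' k' (cx a n ps k m s A qs)) ?c' r' =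
     po (pr a' N' (sh k' ps) ?X) a' (k' + M + r') (sh k' qs)"
  proof -
    have "rw (lw a' k' (cx a n ps k m s A qs)) ?c' r' =
      po (rw (pr a' (k' + n) (sh k' ps) (rw (lw a' (k' + k) A) ?c r)) ?c' r') a' (k' + M + r') (sh k' qs)"
      unfolding e1 using rw_po[OF g2 okq'(1) _ c1] eM okq(2) by simp
    also have "rw (pr a' (k' + n) (sh k' ps) (rw (lw a' (k' + k) A) ?c r)) ?c' r' =
       pr a' N' (sh k' ps) (rw (rw (lw a' (k' + k) A) ?c r) ?c' r')"
      using rw_pr[OF g1' okq(1) _ c1] okq(2) r' by simp
    also have "rw (rw (lw a' (k' + k) A) ?c r) ?c' r' = ?X"
      using rw_rw[OF g1, of ?c ?c' r r'] cc a_def by simp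
    finally show ?thesis .
  qed
  have g3: "hom a' (k' + N + r') (sh (k' + k) s) (sh (k' + k) t) ?X"
    using hom_rw[OF g1, of ?c "r + r'"] r a_def by (simp add: add_ac)
  have okN: "ok a' N' (sh k' ps)" "len a' N' (sh k' ps) = k' + N + r'"
    using ok_add[OF okq(1), of r'] len_add[OF okq(1), of r'] okq(2) r' by auto
  have g4: "hom a' N' (sh k' ps @ sh (k' + k) s) (sh k' ps @ sh (k' + k) t) (pr a' N' (sh k' ps) ?X)"
    using hom_pr[OF g3 okN(1)] okN(2) by simp
  have lenX: "len a' (k' + N + r') (sh (k' + k) s) = k' + M + r'"
    using len_add[of a' "k' + N" "sh (k' + k) s" r'] homD(2)[OF g1'] eM by simp
  have okM: "ok a' (k' + M + r') (sh k' qs)" "len a' (k' + M + r') (sh k' qs) = k' + len a M qs + r'"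
    using ok_add[OF okq'(1), of r'] len_add[OF okq'(1), of r'] okq'(2) by auto
  have tot: "len a' n' (ps' @ sh k' (ps @ sh k s @ qs)) = k' + len a M qs + r'"
    using okN lenX okM unfolding N'_def by simp
  have qs': "ok a' (k' + len a M qs + r') qs'" using c'(3) unfolding tot .
  have lhs: "cx a' n' ps' k' n (ps @ sh k s @ qs) (cx a n ps k m s A qs) qs' =
     po (pr a' n' ps' (po (pr a' N' (sh k' ps) ?X) a' (k' + M + r') (sh k' qs))) a' (k' + len a M qs + r') qs'"
    unfolding cx_def'[of a' n'] tot N'_def[symmetric] r'_def[symmetric] e2 ..
  also have "pr a' n' ps' (po (pr a' N' (sh k' ps) ?X) a' (k' + M + r') (sh k' qs)) =
     po (pr a' n' ps' (pr a' N' (sh k' ps) ?X)) a' (k' + M + r') (sh k' qs)"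
    by (rule pr_po[OF g4 c'(1) N'_def okM(1)]) (use okN lenX in simp)
  also have "pr a' n' ps' (pr a' N' (sh k' ps) ?X) = pr a' n' (ps' @ sh k' ps) ?X"
    by (rule pr_pr[OF g3 okN(1) _ c'(1) N'_def]) (use okN in simp)
  also have "po (po (pr a' n' (ps' @ sh k' ps) ?X) a' (k' + M + r') (sh k' qs)) a' (k' + len a M qs + r') qs' =
    po (pr a' n' (ps' @ sh k' ps) ?X) a' (k' + M + r') (sh k' qs @ qs')"
  proof (rule po_po)
    show "hom a' n' ((ps' @ sh k' ps) @ sh (k' + k) s) ((ps' @ sh k' ps) @ sh (k' + k) t) (pr a' n' (ps' @ sh k' ps) ?X)"
      by (rule hom_pr[OF g3]) (use c'(1) okN N'_def in simp_all)
  qed (use okM qs' okN lenX N'_def in simp_all)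
  also have "\<dots> = cx a' n' (ps' @ sh k' ps) (k' + k) m s A (sh k' qs @ qs')"
  proof -
    have "len a' n' (ps' @ sh k' ps) - (k' + k) - m = r + r'" using okN r N'_def by simp
    moreover have "len a' n' ((ps' @ sh k' ps) @ sh (k' + k) s) = k' + M + r'" using okN lenX N'_def by simp
    moreover have "ob a' (k' + k + m) = ?c" by (simp add: a_def add.assoc)
    ultimately show ?thesis unfolding cx_def' by simp
  qed
  finally show ?thesis unfolding a_def .
qed

lemma cx_unit: "hom a n s t A \<Longrightarrow> cx a n [] 0 n s A [] = A"
  by (simp add: cx_def' lw_0 rw_0 pr_Nil po_Nil)

text \<open>This lemma and the next three present each one-sided composite of a 3-cell with a lower
  cell as a context, so closure under contexts later handles all of these composites.\<close>

lemma lw_cx: "hom a n s t A \<Longrightarrow> a = ob b k \<Longrightarrow> lw b k A = cx b (k + n) [] k n s A []"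
  using hom_lw[of a n s t A b k] by (simp add: cx_def' rw_0 pr_Nil po_Nil)

lemma rw_cx: "hom a n s t A \<Longrightarrow> c = ob a n \<Longrightarrow> rw A c k = cx a (n + k) [] 0 n s A []"
  using hom_rw[of a n s t A c k] by (simp add: cx_def' lw_0 pr_Nil po_Nil)

lemma pr_cx: "hom a m s t A \<Longrightarrow> ok a n ps \<Longrightarrow> m = len a n ps \<Longrightarrow> pr a n ps A = cx a n ps 0 m s A []"
  using hom_pr[of a m s t A n ps] by (simp add: cx_def' lw_0 rw_0 po_Nil)

lemma po_cx: "hom a n s t A \<Longrightarrow> ok a m qs \<Longrightarrow> m = len a n s \<Longrightarrow> po A a m qs = cx a n [] 0 n s A qs"
  by (simp add: cx_def' lw_0 rw_0 pr_Nil)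

end

section \<open>3-generators and 4-generators of the presentation in terms of strings\<close>

section \<open>The 3-generators\<close>

text \<open>\<open>LN a\<close> stands for \<open>N\<close> (\<open>a = x\<close>) or \<open>N'\<close> (\<open>a = y\<close>), and \<open>LX a m\<close> for the interchange of the
  generator at an object \<open>a\<close> with the generator at the object reached by a word of length \<open>m\<close>.\<close>

datatype lab = LN adj0 | LX adj0 nat

text \<open>Base object, lengths of the source and target words, and source and target strings. In
  \<open>LX\<close> the second position is counted past the output of the first generator in
  \<open>ls\<close> and past its input in \<open>lt\<close>, whence \<open>dout\<close> and
  \<open>din\<close>.\<close>

primrec lb :: "lab \<Rightarrow> adj0" where "lb (LN a) = a" | "lb (LX a m) = a"
primrec ll :: "lab \<Rightarrow> nat" where "ll (LN a) = 1" | "ll (LX a m) = din a + m + din (ob a m)"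
primrec lc :: "lab \<Rightarrow> nat" where "lc (LN a) = 1" | "lc (LX a m) = dout a + m + dout (ob a m)"
primrec ls :: "lab \<Rightarrow> nat list" where
  "ls (LN a) = (case a of Ox \<Rightarrow> [0, 1] | Oy \<Rightarrow> [1, 0])" | "ls (LX a m) = [0, dout a + m]"
primrec lt :: "lab \<Rightarrow> nat list" where "lt (LN a) = []" | "lt (LX a m) = [din a + m, 0]"

primrec la :: "lab \<Rightarrow> adj3" where
  "la (LN a) = (case a of Ox \<Rightarrow> Nf | Oy \<Rightarrow> Ng)"
| "la (LX a m) = Inter (tp a) (word a m) (tp (ob a m))"

lemma ob_1 [simp]: "ob a 1 = opp a"
  by (simp add: ob_def)

lemma ob_add_right [simp]: "even k \<Longrightarrow> ob a (m + k + n) = ob a (m + n)" "even k \<Longrightarrow> ob a (k + m + n) = ob a (m + n)"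
  by (auto simp: ob_def)

lemma label_ok [simp]: "ok (lb L) (ll L) (ls L)" "ok (lb L) (ll L) (lt L)"
  "len (lb L) (ll L) (ls L) = lc L" "len (lb L) (ll L) (lt L) = lc L"
proof -
  have "ok (lb L) (ll L) (ls L) \<and> ok (lb L) (ll L) (lt L) \<and>
    len (lb L) (ll L) (ls L) = lc L \<and> len (lb L) (ll L) (lt L) = lc L"
  proof (cases L)
    case (LN a)
    then show ?thesis by (cases a) (auto simp: nx_def)
  next
    case (LX a m)
    then show ?thesis by (auto simp: nx_def)
  qed
  then show "ok (lb L) (ll L) (ls L)" "ok (lb L) (ll L) (lt L)"
    "len (lb L) (ll L) (ls L) = lc L" "len (lb L) (ll L) (lt L) = lc L" by auto
qed

locale gen_strings = strings D F for D :: "'d precat" and F +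
  fixes \<gamma> :: "lab \<Rightarrow> 'd"
  assumes \<gamma>: "hom (lb L) (ll L) (ls L) (lt L) (\<gamma> L)"
begin

definition gx :: "adj0 \<Rightarrow> nat \<Rightarrow> nat list \<Rightarrow> nat \<Rightarrow> lab \<Rightarrow> nat list \<Rightarrow> 'd" where
  "gx a n ps k L qs = cx a n ps k (ll L) (ls L) (\<gamma> L) qs"

text \<open>The interchanger of consecutive generators at \<open>p\<close> and \<open>q\<close>. Its
  label is recovered from the positions: the gap runs from the end of the output at \<open>p\<close>
  to \<open>q\<close>, so \<open>p + dout (ob a p) \<le> q\<close> is the condition under which it
  is meaningful.\<close>

definition sx :: "adj0 \<Rightarrow> nat \<Rightarrow> nat list \<Rightarrow> nat \<Rightarrow> nat \<Rightarrow> nat list \<Rightarrow> 'd" where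
  "sx a n ps p q qs = gx a n ps p (LX (ob a p) (q - p - dout (ob a p))) qs"

text \<open>The 3-cells \<open>X\<^bsub>\<phi>,\<psi>\<^esub>\<close> for \<open>\<phi>\<close> a string of length 0 or 2 and \<open>\<psi>\<close> a generator, applied at
  position \<open>q\<close> after \<open>\<phi>\<close>, and symmetrically.\<close>

definition intl :: "adj0 \<Rightarrow> nat \<Rightarrow> nat list \<Rightarrow> nat \<Rightarrow> 'd" where
  "intl a n s q = (if s = [] then idc D 2 (S a n [q]) else
     vc (sx a n [s!0] (s!1) q []) (sx a n [] (s!0) (q - dout (ob a (s!1)) + din (ob a (s!1))) [s!1]))"

definition intr :: "adj0 \<Rightarrow> nat \<Rightarrow> nat \<Rightarrow> nat list \<Rightarrow> 'd" where
  "intr a n m t = (if t = [] then idc D 2 (S a n [0]) else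
     vc (sx a n [] 0 (dout a + m + t!0) [dout a + m + t!1]) (sx a n [din a + m + t!0] 0 (dout a + m + t!1) []))"

lemma hom_gx:
  assumes "lb L = ob a k" "ok a n ps" "k + ll L \<le> len a n ps" "ok a (len a n (ps @ sh k (ls L))) qs"
  shows "hom a n (ps @ sh k (ls L) @ qs) (ps @ sh k (lt L) @ qs) (gx a n ps k L qs)"
  unfolding gx_def using hom_cx[of a k "ll L" "ls L" "lt L" "\<gamma> L" n ps qs] \<gamma>[of L] assms by simp

lemma hom_sx:
  assumes "ok a n (ps @ p # q # qs)" "p + dout (ob a p) \<le> q"
  shows "hom a n (ps @ p # q # qs) (ps @ (q - dout (ob a p) + din (ob a p)) # p # qs) (sx a n ps p q qs)"
proof -
  define m where "m = q - p - dout (ob a p)"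
  have q: "q = p + dout (ob a p) + m" using assms(2) by (simp add: m_def)
  have oq: "ob a q = ob a (p + m)" unfolding q by simp
  let ?N = "len a n ps"
  have A: "ok a n ps" "p + din (ob a p) \<le> ?N" "q + din (ob a (p + m)) \<le> nx a ?N p" "ok a (nx a (nx a ?N p) q) qs"
    using assms(1) oq by auto
  have l: "ls (LX (ob a p) m) = [0, dout (ob a p) + m]" "lt (LX (ob a p) m) = [din (ob a p) + m, 0]" by simp_all
  have sq: "sh p [0, dout (ob a p) + m] = [p, q]" "sh p [din (ob a p) + m, 0] = [q - dout (ob a p) + din (ob a p), p]"
    by (simp_all add: q)
  have "p + ll (LX (ob a p) m) \<le> ?N" using A(2,3) by (simp add: nx_def q)
  then show ?thesis
    using hom_gx[of "LX (ob a p) m" a p n ps qs, unfolded l sq] A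
    unfolding sx_def m_def[symmetric] by simp
qed

end

context
begin

private lemma str2_1: "gen1 Adj1 Ff = word Ox 1" "gen1 Adj1 Fg = word Oy 1"
  "gen2 Adj2 Eta = str2 Ox 0 [0]" "gen2 Adj2 Eps = str2 Oy 2 [0]"
  using gen1_word[of Ox] gen1_word[of Oy] gcell_str2[of Ox] gcell_str2[of Oy] by (simp_all add: gcell_def)

lemma gen2_tp: "gen2 Adj2 (tp a) = str2 a (din a) [0]"
  using gcell_str2 by (simp add: gcell_def)

lemma inter_ok_iff: "inter_ok Adj2 \<alpha> h \<beta> \<longleftrightarrow> (\<exists>a m. \<alpha> = tp a \<and> h = word a m \<and> \<beta> = tp (ob a m))"
proof
  assume i: "inter_ok Adj2 \<alpha> h \<beta>"
  obtain a b where ab: "\<alpha> = tp a" "\<beta> = tp b" by (metis tp_exhaust)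
  obtain c m where h: "h = word c m" using i C1_word[of h] unfolding inter_ok_def by auto
  show "\<exists>a m. \<alpha> = tp a \<and> h = word a m \<and> \<beta> = tp (ob a m)"
    using i ab h unfolding inter_ok_def
    by (auto simp: composable_12 composable_21 gcell gcell_def[symmetric])
next
  assume "\<exists>a m. \<alpha> = tp a \<and> h = word a m \<and> \<beta> = tp (ob a m)"
  then show "inter_ok Adj2 \<alpha> h \<beta>"
    unfolding inter_ok_def by (auto simp: composable_12 composable_21 gcell gcell_def[symmetric])
qed

text \<open>In a composable index of an interchange generator, the first generator and the length of
  the middle word determine the rest, so labels enumerate all 3-generators.\<close>

lemma gens3_Adj3: "gens3 Adj3 = range la"
proof -
  have e: "gens3 Adj3 = {Nf, Ng} \<union> {Inter \<alpha> h \<beta> |\<alpha> h \<beta>. inter_ok Adj2 \<alpha> h \<beta>}"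
    by (simp only: Adj3_def Let_def prepoly2.defs prepoly3.defs prepoly3.select_convs)
  have "Nf = la (LN Ox)" "Ng = la (LN Oy)" by simp_all
  then have r: "Nf \<in> range la" "Ng \<in> range la" "Inter (tp a) (word a m) (tp (ob a m)) \<in> range la" for a m
    using rangeI[of la "LX a m"] by (metis rangeI, metis rangeI, simp)
  show ?thesis
  proof
    show "gens3 Adj3 \<subseteq> range la"
      unfolding e inter_ok_iff
      using r by auto
    show "range la \<subseteq> gens3 Adj3"
    proof
      fix A assume "A \<in> range la"
      then obtain L where A: "A = la L" by auto
      show "A \<in> gens3 Adj3"
      proof (cases L)
        case (LN a) then show ?thesis unfolding A e by (cases a) auto
      next
        case (LX a m) then show ?thesis unfolding A e inter_ok_iff by auto
      qed
    qed
  qed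
qed

lemma inter_dom: "inter_dom Adj2 (tp a) (word a m) (tp (ob a m)) = str2 (lb (LX a m)) (ll (LX a m)) (ls (LX a m))"
  and inter_cod: "inter_cod Adj2 (tp a) (word a m) (tp (ob a m)) = str2 (lb (LX a m)) (ll (LX a m)) (lt (LX a m))"
proof -
  let ?b = "ob a m"
  have 1: "cmp C2 2 1 (cmp C2 2 1 (str2 a (din a) [0]) (up (word a m))) (up (word ?b k)) = str2 a (din a + m + k) [0]" for k
    by (simp add: str2_right del: str2.simps)
  have 2: "cmp C2 1 2 (cmp C2 1 1 (up (word a (dout a))) (up (word a m))) (str2 ?b (din ?b) [0]) =
      str2 a (dout a + m + din ?b) [dout a + m]"
     "cmp C2 1 2 (cmp C2 1 1 (up (word a (din a))) (up (word a m))) (str2 ?b (din ?b) [0]) =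
      str2 a (din a + m + din ?b) [din a + m]"
    by (simp_all add: str2_left up_word_cmp del: str2.simps)
  have 3: "cmp C2 2 2 (str2 a (din a + m + din ?b) [0]) (str2 a (dout a + m + din ?b) [dout a + m]) =
     str2 a (din a + m + din ?b) [0, dout a + m]"
    using str2_append[of a "din a + m + din ?b" "[0]" "[dout a + m]"] by (simp add: nx_def add_ac del: str2.simps)
  have 4: "cmp C2 2 2 (str2 a (din a + m + din ?b) [din a + m]) (str2 a (din a + m + dout ?b) [0]) =
     str2 a (din a + m + din ?b) [din a + m, 0]"
    using str2_append[of a "din a + m + din ?b" "[din a + m]" "[0]"] by (simp add: nx_def add_ac del: str2.simps)
  have b: "src C2 1 (str2 c (din c) [0]) = up (word c (din c))" "tgt C2 1 (str2 c (din c) [0]) = up (word c (dout c))" for c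
    by (simp_all add: nx_def del: str2.simps)
  show "inter_dom Adj2 (tp a) (word a m) (tp ?b) = str2 (lb (LX a m)) (ll (LX a m)) (ls (LX a m))"
    unfolding inter_dom_def Let_def gen2_tp b 1 2 by (simp add: 3 del: str2.simps)
  show "inter_cod Adj2 (tp a) (word a m) (tp ?b) = str2 (lb (LX a m)) (ll (LX a m)) (lt (LX a m))"
    unfolding inter_cod_def Let_def gen2_tp b 1 2 by (simp add: 4 del: str2.simps)
qed

lemma dom3_la: "dom3 Adj3 (la L) = str2 (lb L) (ll L) (ls L)" "cod3 Adj3 (la L) = str2 (lb L) (ll L) (lt L)"
proof -
  have d: "dom3 Adj3 = (\<lambda>A. case A of
               Nf \<Rightarrow> cmp C2 2 2 (cmp C2 2 1 (gen2 Adj2 Eta) (up (gen1 Adj1 Ff))) (cmp C2 1 2 (up (gen1 Adj1 Ff)) (gen2 Adj2 Eps))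
             | Ng \<Rightarrow> cmp C2 2 2 (cmp C2 1 2 (up (gen1 Adj1 Fg)) (gen2 Adj2 Eta)) (cmp C2 2 1 (gen2 Adj2 Eps) (up (gen1 Adj1 Fg)))
             | Inter \<alpha> h \<beta> \<Rightarrow> inter_dom Adj2 \<alpha> h \<beta>)"
    "cod3 Adj3 = (\<lambda>A. case A of Nf \<Rightarrow> idc C2 1 (up (gen1 Adj1 Ff)) | Ng \<Rightarrow> idc C2 1 (up (gen1 Adj1 Fg))
             | Inter \<alpha> h \<beta> \<Rightarrow> inter_cod Adj2 \<alpha> h \<beta>)"
    by (simp_all only: Adj3_def Let_def prepoly2.defs prepoly3.defs prepoly3.select_convs free_simps)
  have 1: "cmp C2 2 1 (str2 Ox 0 [0]) (up (word Ox 1)) = str2 Ox 1 [0]" "cmp C2 1 2 (up (word Ox 1)) (str2 Oy 2 [0]) = str2 Ox 3 [1]"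
    "cmp C2 1 2 (up (word Oy 1)) (str2 Ox 0 [0]) = str2 Oy 1 [1]" "cmp C2 2 1 (str2 Oy 2 [0]) (up (word Oy 1)) = str2 Oy 3 [0]"
    by (simp_all add: str2_right str2_left del: str2.simps)
  have 2: "cmp C2 2 2 (str2 Ox 1 [0]) (str2 Ox 3 [1]) = str2 Ox 1 [0, 1]" "cmp C2 2 2 (str2 Oy 1 [1]) (str2 Oy 3 [0]) = str2 Oy 1 [1, 0]"
    using str2_append[of Ox 1 "[0]" "[1]"] str2_append[of Oy 1 "[1]" "[0]"] by (simp_all add: nx_def del: str2.simps)
  show "dom3 Adj3 (la L) = str2 (lb L) (ll L) (ls L)"
  proof (cases L)
    case (LN a) then show ?thesis by (cases a) (simp_all add: d str2_1 1 2 del: str2.simps)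
  next
    case (LX a m) then show ?thesis using inter_dom[of a m] by (simp add: d del: str2.simps)
  qed
  show "cod3 Adj3 (la L) = str2 (lb L) (ll L) (lt L)"
  proof (cases L)
    case (LN a) then show ?thesis by (cases a) (simp_all add: d str2_1)
  next
    case (LX a m) then show ?thesis using inter_cod[of a m] by (simp add: d del: str2.simps)
  qed
qed

end

declare str2.simps [simp del]

interpretation e3: extension 2 C2 "gens3 Adj3" "dom3 Adj3" "cod3 Adj3"
proof
  show "parallel C2 2 (dom3 Adj3 A) (cod3 Adj3 A)" if "A \<in> gens3 Adj3" for A
    using that unfolding gens3_Adj3 by (auto simp: dom3_la parallel_def)
qed (rule C2_precategory)

lemma C3_def: "C3 = e3.E"
  by (simp add: free3_def)

lemma C3_precategory: "precategory 3 C3"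
  using e3.E_precategory by (simp add: C3_def)

interpretation c3: precat 3 C3
  using C3_precategory by (simp add: precat_iff)

interpretation s3: strings C3 "\<lambda>_. up"
proof
  show "pmorph 2 C2 C3 (\<lambda>_. up)" using e3.pmorph_up by (simp add: C3_def)
qed (auto intro: inj_onI)

definition g3 :: "lab \<Rightarrow> adj_cell3" where "g3 L = gen3 Adj3 (la L)"

interpretation s3: gen_strings C3 "\<lambda>_. up" g3
proof
  fix L
  have L: "la L \<in> gens3 Adj3" by (simp add: gens3_Adj3)
  show "s3.hom (lb L) (ll L) (ls L) (lt L) (g3 L)"
    using e3.gc_cell[OF L, folded C3_def] e3.src_gc[OF L, folded C3_def] e3.tgt_gc[OF L, folded C3_def]
    by (simp add: s3.hom_def g3_def gen3_def s3.S_def dom3_la)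
qed

subsection \<open>Interchange of composite 2-cells\<close>

lemma length_wtriples [simp]: "length (wtriples a n s) = length s"
  by (induction a n s rule: wtriples.induct) auto

lemma wtriples_nth: "i < length s \<Longrightarrow> wtriples a n s ! i = wtriple a (len a n (take i s)) (s ! i)"
  by (induction a n s arbitrary: i rule: wtriples.induct) (auto simp: nth_Cons split: nat.splits)

lemma wtriples_append: "wtriples a n (s @ t) = wtriples a n s @ wtriples a (len a n s) t"
  by (induction a n s rule: wtriples.induct) auto

lemma vcomp_up:
  "ok a n ps \<Longrightarrow> vcomp C3 2 (s3.W a n) (map (\<lambda>w. up (whisker Adj2 w)) (wtriples a n ps)) = s3.S a n ps"
proof (induction a n ps rule: ok.induct)
  case (1 a n)
  then show ?case by (simp add: s3.S_Nil)
next
  case (2 a n p ps)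
  have u: "up (op2 a n p) = s3.S a n [p]" using 2 by (simp add: s3.S_def str2_single)
  have t: "tgt C3 1 (s3.S a n [p]) = s3.W a (nx a n p)" using 2 by simp
  have IH: "vcomp C3 2 (s3.W a (nx a n p)) (map (\<lambda>w. up (whisker Adj2 w)) (wtriples a (nx a n p) ps)) = s3.S a (nx a n p) ps"
    using 2 by simp
  have "cmp C3 2 2 (s3.S a n [p]) (s3.S a (nx a n p) ps) = s3.S a n (p # ps)"
  proof -
    have o: "ok a n [p]" "ok a (nx a n p) ps" "nx a n p = len a n [p]" using 2(2) by simp_all
    from s3.S_cmp[OF o] show ?thesis by simp
  qed
  moreover have "(2::nat) - 1 = 1" by simp
  ultimately show ?case
    by (simp only: wtriples.simps list.map vcomp.simps whisker_wtriple u t IH)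
qed

lemma take_wtriples: "i \<le> length s \<Longrightarrow> take i (wtriples a n s) = wtriples a n (take i s)"
  "i \<le> length s \<Longrightarrow> drop i (wtriples a n s) = wtriples a (len a n (take i s)) (drop i s)"
  using wtriples_append[of a n "take i s" "drop i s"] by (simp_all add: append_eq_conv_conj)

text \<open>In an interleaving \<psi> stands to the right of \<phi>, so its positions are shifted by
  the current length of the \<phi> part, which is \<open>n'\<close> before and \<open>n''\<close>
  after the whisker \<open>s ! i\<close>.\<close>

lemma elem_swap_gx:
  assumes s: "ok a n s" and t: "ok b m t" and b: "b = ob a n" and i: "i < length s" and j: "j < length t"
  defines "n' \<equiv> len a n (take i s)" and "n'' \<equiv> len a n (take (Suc i) s)"
  shows "elem_swap Adj3 Inter (str2 a n s) (str2 b m t) i j =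
    s3.sx a (n + m) (take i s @ sh n' (take j t)) (s ! i) (n'' + t ! j) (sh n'' (drop (Suc j) t) @ drop (Suc i) s)"
proof -
  define m' where "m' = len b m (take j t)"
  define m'' where "m'' = len b m (take (Suc j) t)"
  define p where "p = s ! i"
  define q where "q = t ! j"
  have ts: "take (Suc i) s = take i s @ [p]" "take (Suc j) t = take j t @ [q]"
    using i j by (simp_all add: take_Suc_conv_app_nth p_def q_def)
  have ss: "s = take i s @ p # drop (Suc i) s" "t = take j t @ q # drop (Suc j) t"
    using i j by (simp_all add: id_take_nth_drop p_def q_def)
  have oks: "ok a n (take i s)" "p + din (ob a p) \<le> n'" "ok a n'' (drop (Suc i) s)" "n'' = nx a n' p"
    using s ts unfolding n'_def n''_def by (subst (asm) ss(1); simp)+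
  have okt: "ok b m (take j t)" "q + din (ob b q) \<le> m'" "ok b m'' (drop (Suc j) t)" "m'' = nx b m' q"
    using t ts unfolding m'_def m''_def by (subst (asm) ss(2); simp)+
  have lens: "len a n'' (drop (Suc i) s) = len a n s" "len b m'' (drop (Suc j) t) = len b m t"
    using len_append[of a n "take (Suc i) s" "drop (Suc i) s"] len_append[of b m "take (Suc j) t" "drop (Suc j) t"]
    by (simp_all only: n''_def m''_def append_take_drop_id)
  have obs: "ob a n' = b" "ob a n'' = b" "ob a (len a n s) = b"
    using oks b s by (simp_all add: n'_def ob_len ob_nx)
  have obt: "ob b m' = ob b m" "ob b m'' = ob b m"
    using okt by (simp_all add: m'_def ob_len ob_nx)
  define us where "us = map (\<lambda>w. up (whisker Adj2 w) :: adj_cell3) (wtriples a n s)"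
  define vs where "vs = map (\<lambda>w. up (whisker Adj2 w) :: adj_cell3) (wtriples b m t)"
  have tu: "take i us = map (\<lambda>w. up (whisker Adj2 w)) (wtriples a n (take i s))"
    "drop (Suc i) us = map (\<lambda>w. up (whisker Adj2 w)) (wtriples a n'' (drop (Suc i) s))"
    "us ! i = s3.S a n' [p]"
    using i oks(2) by (simp_all add: us_def take_map drop_map take_wtriples wtriples_nth n'_def n''_def p_def s3.S_def str2_single)
  have tv: "take j vs = map (\<lambda>w. up (whisker Adj2 w)) (wtriples b m (take j t))"
    "drop (Suc j) vs = map (\<lambda>w. up (whisker Adj2 w)) (wtriples b m'' (drop (Suc j) t))"
    "vs ! j = s3.S b m' [q]"
    using j okt(2) by (simp_all add: vs_def take_map drop_map take_wtriples wtriples_nth m'_def m''_def q_def s3.S_def str2_single)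
  have st: "src C3 1 (up (str2 a n s)) = s3.W a n" "src C3 1 (up (str2 b m t)) = s3.W b m"
    "tgt C3 1 (up (str2 b m t)) = s3.W b (len b m t)"
    using s3.S_simps[OF s] s3.S_simps[OF t] by (simp_all add: s3.S_def)
  have st': "src C3 1 (us ! i) = s3.W a n'" "tgt C3 1 (us ! i) = s3.W a n''" "tgt C3 1 (vs ! j) = s3.W b m''"
    using oks okt by (simp_all add: tu tv)
  define before where "before = cmp C3 2 2 (cmp C3 2 1 (vcomp C3 2 (s3.W a n) (take i us)) (s3.W b m))
      (cmp C3 1 2 (s3.W a n') (vcomp C3 2 (s3.W b m) (take j vs)))"
  define after where "after = cmp C3 2 2 (cmp C3 1 2 (s3.W a n'') (vcomp C3 2 (s3.W b m'') (drop (Suc j) vs)))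
      (cmp C3 2 1 (vcomp C3 2 (s3.W a n'') (drop (Suc i) us)) (s3.W b (len b m t)))"
  have len1: "len a (n + m) (take i s) = n' + m" using oks by (simp add: len_add n'_def)
  have len2: "len a (n' + m) (sh n' (take j t)) = n' + m'"
    using okt len_shift[of a n' m "take j t"] obs by (simp add: m'_def)
  have before: "before = s3.S a (n + m) (take i s @ sh n' (take j t))"
    unfolding before_def tu tv using oks okt b obs len1 ok_shift[of a n' m "take j t"]
    by (simp add: vcomp_up s3.S_W s3.W_S s3.S_cmp ok_add)
  have len3: "len a (n'' + m'') (sh n'' (drop (Suc j) t)) = n'' + len b m t"
    using okt len_shift[of a n'' m'' "drop (Suc j) t"] obs lens by simp
  have after: "after = s3.S a (n'' + m'') (sh n'' (drop (Suc j) t) @ drop (Suc i) s)"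
    unfolding after_def tu tv using oks okt b obs len3 ok_shift[of a n'' m'' "drop (Suc j) t"]
    by (simp add: vcomp_up s3.S_W s3.W_S s3.S_cmp ok_add)
  \<comment> \<open>The gap between the two generators consists of what is left of the \<phi> word
    to the right of \<open>p\<close>, followed by the first \<open>q\<close> letters of the \<psi>
    word.\<close>
  define M where "M = n' - p - din (ob a p) + q"
  have r: "ob (ob a p) (n' - p - din (ob a p)) = b" using oks(2) obs(1) by (auto simp: ob_def)
  have M3: "ob (ob a p) M = ob b q"
    unfolding r[symmetric] M_def by (simp add: add.assoc)
  have M: "n'' + q - p - dout (ob a p) = M" "p + (din (ob a p) + M + din (ob (ob a p) M)) = n' + q + din (ob b q)"
    "ob (ob a p) M = ob b q"
    using oks(2,4) M3 by (simp_all add: M_def nx_def del: ob_ob)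
  have l: "cmp C1 1 1 (word (ob a p) (n' - p - din (ob a p))) (word b q) = word (ob a p) M"
    using r by (simp add: word_cmp M_def)
  have "elem_swap Adj3 Inter (str2 a n s) (str2 b m t) i j =
     whisk C3 1 3 before (whisk C3 0 3 (s3.W a p) (g3 (LX (ob a p) M)) (s3.W (ob b q) (m' - q - din (ob b q)))) after"
    using i j M(3)
    by (simp add: elem_swap_def Let_def decomp_str2[OF s] decomp_str2[OF t] us_def[symmetric] vs_def[symmetric]
        st st' before_def[symmetric] after_def[symmetric] wtriples_nth n'_def[symmetric] m'_def[symmetric]
        p_def[symmetric] q_def[symmetric] wtriple_def l[unfolded diff_diff_left] g3_def s3.W_def[symmetric])
  also have "\<dots> = s3.sx a (n + m) (take i s @ sh n' (take j t)) p (n'' + q) (sh n'' (drop (Suc j) t) @ drop (Suc i) s)"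
  proof -
    have e1: "ob a (p + ll (LX (ob a p) M)) = ob b q" using M(3) by (simp add: ob_def split: if_splits)
    have e2: "n' + m' - p - ll (LX (ob a p) M) = m' - q - din (ob b q)"
      using M(2) okt(2) by simp
    have e3: "len a (n' + m') (sh p (ls (LX (ob a p) M))) = n'' + m''"
    proof -
      have o: "ob a (p + (dout (ob a p) + M)) = ob b q"
        using M(3) by (simp flip: ob_ob)
      show ?thesis using oks(2,4) okt(2,4) by (simp add: nx_def o)
    qed
    show ?thesis unfolding s3.sx_def s3.gx_def s3.cx_def before after M(1) len_append len1 len2 e1 e2 e3 ..
  qed
  finally show ?thesis by (simp add: p_def q_def)
qed

lemma take_1 [simp]: "take 1 (x # xs) = [x]" "drop 1 (x # xs) = xs"
  by (simp_all add: take_Cons' drop_Cons')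

lemma upt_1_2 [simp]: "[0..<1] = [0]" "[0..<2] = [0, 1]"
  by (simp_all add: upt_rec)

lemma label_lists:
  obtains s1 s2 t1 t2 where "ls L = [] \<or> ls L = [s1, s2]" "lt L = [] \<or> lt L = [t1, t2]"
proof (cases L)
  case (LN a)
  then show ?thesis using that by (cases a) auto
qed (use that in auto)

context gen_strings
begin

text \<open>In the boundaries of the 4-generators a whiskered generator is composed with a string on
  one side at a time; such a composite is a context whose other string is empty.\<close>

lemma gx_single:
  assumes L: "lb L = ob a k" "k + ll L \<le> N" and c: "c = ob a (k + ll L)" "r = N - k - ll L"
  shows "hom a N (sh k (ls L)) (sh k (lt L)) (rw (lw a k (\<gamma> L)) c r)"
    "ok a M qs \<Longrightarrow> M = len a N (sh k (ls L)) \<Longrightarrow> po (rw (lw a k (\<gamma> L)) c r) a M qs = gx a N [] k L qs"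
    "ok a n ps \<Longrightarrow> N = len a n ps \<Longrightarrow> pr a n ps (rw (lw a k (\<gamma> L)) c r) = gx a n ps k L []"
proof -
  have h: "hom (ob a k) (ll L) (ls L) (lt L) (\<gamma> L)" using \<gamma>[of L] L by simp
  show 1: "hom a N (sh k (ls L)) (sh k (lt L)) (rw (lw a k (\<gamma> L)) c r)"
    using hom_lrw[OF h L(2)] c by simp
  show "ok a M qs \<Longrightarrow> M = len a N (sh k (ls L)) \<Longrightarrow> po (rw (lw a k (\<gamma> L)) c r) a M qs = gx a N [] k L qs"
    using c pr_Nil[OF 1] by (simp add: gx_def cx_def')
  show "ok a n ps \<Longrightarrow> N = len a n ps \<Longrightarrow> pr a n ps (rw (lw a k (\<gamma> L)) c r) = gx a n ps k L []"
    using c po_Nil[OF hom_pr[OF 1], of n ps] by (simp add: gx_def cx_def')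
qed

text \<open>The last generator passes first \<open>p2\<close> and then \<open>p1\<close>. Each
  passage exchanges \<open>dout\<close> for \<open>din\<close>, and it ends at \<open>n + m\<close>,
  that is, behind the source word of the string.\<close>

lemma intl_parts:
  assumes s: "ok a n [p1, p2]" and m: "ok (ob a n) k [m]"
  defines "q \<equiv> len a n [p1, p2] + m"
  defines "q' \<equiv> q - dout (ob a p2) + din (ob a p2)"
  shows "ok a (n + k) ([p1] @ p2 # q # [])" "p2 + dout (ob a p2) \<le> q"
    "ok a (n + k) ([] @ p1 # q' # [p2])" "p1 + dout (ob a p1) \<le> q'" "q' - dout (ob a p1) + din (ob a p1) = n + m"
proof -
  define n1 where "n1 = nx a n p1"
  define n2 where "n2 = nx a n1 p2"
  have o: "p1 + din (ob a p1) \<le> n" "p2 + din (ob a p2) \<le> n1" using s by (simp_all add: n1_def)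
  have q: "q = n2 + m" by (simp add: q_def n1_def n2_def)
  have q': "q' = n1 + m" using o by (simp add: q'_def q n1_def n2_def nx_def)
  show "q' - dout (ob a p1) + din (ob a p1) = n + m"
    using o by (simp add: q' n1_def nx_def)
  show "p2 + dout (ob a p2) \<le> q" "p1 + dout (ob a p1) \<le> q'"
    using o by (simp_all add: q q' n1_def n2_def nx_def)
  have nn: "nx a (n + k) p1 = n1 + k" "nx a (n1 + k) p2 = n2 + k" using o by (simp_all add: nx_add n1_def n2_def)
  have ob: "ob a n1 = ob a n" "ob a n2 = ob a n" using o by (simp_all add: n1_def n2_def ob_nx)
  have obm: "ob a (n2 + m) = ob (ob a n) m" "ob a (n1 + m) = ob (ob a n) m"
    using ob by (metis ob_ob)+
  have "nx a (n1 + k) (n1 + m) = n1 + nx (ob a n1) k m" using m ob(1) by (intro nx_shift) simp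
  then show "ok a (n + k) ([] @ p1 # q' # [p2])"
    using o m nn obm unfolding q' by (auto simp: nx_def)
  show "ok a (n + k) ([p1] @ p2 # q # [])" unfolding q using o m nn obm by auto
qed

lemma hom_intl:
  assumes s: "ok a n s" "s = [] \<or> s = [p1, p2]" and m: "ok (ob a n) k [m]"
  shows "hom a (n + k) (s @ [len a n s + m]) ((n + m) # s) (intl a (n + k) s (len a n s + m))"
  using s(2)
proof
  assume "s = []"
  then show ?thesis using hom_id[of a "n + k" "[n + m]"] m by (simp add: intl_def)
next
  assume e: "s = [p1, p2]"
  note o = intl_parts[OF s(1)[unfolded e] m]
  show ?thesis
    using hom_vc[OF hom_sx[OF o(1,2)]] hom_sx[OF o(3,4)] o(5) e by (simp add: intl_def)
qed

lemma intr_parts: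
  assumes t: "ok (ob a m) n [q1, q2]"
  shows "ok a (din a + m + n) ([] @ 0 # (dout a + m + q1) # [dout a + m + q2])"
    "ok a (din a + m + n) ([din a + m + q1] @ 0 # (dout a + m + q2) # [])"
proof -
  define b where "b = ob a m"
  define n1 where "n1 = nx b n q1"
  have o: "q1 + din (ob b q1) \<le> n" "q2 + din (ob b q2) \<le> n1" using t by (simp_all add: n1_def b_def)
  have obq: "ob a (dout a + m + q) = ob b q" "ob a (din a + m + q) = ob b q" for q
    by (simp_all add: b_def)
  have nn: "nx a (dout a + m + n) (dout a + m + q1) = dout a + m + n1" "nx a (din a + m + n) (din a + m + q1) = din a + m + n1"
    "nx a (din a + m + k) 0 = dout a + m + k" for k
    using o by (simp_all only: nx_def obq n1_def, simp_all)
  show "ok a (din a + m + n) ([] @ 0 # (dout a + m + q1) # [dout a + m + q2])"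
    "ok a (din a + m + n) ([din a + m + q1] @ 0 # (dout a + m + q2) # [])"
    using o by (simp_all add: nn obq del: ob_add_right)
qed

lemma hom_intr:
  assumes t: "ok (ob a m) n t" "t = [] \<or> t = [q1, q2]"
  shows "hom a (din a + m + n) (0 # sh (dout a + m) t) (sh (din a + m) t @ [0]) (intr a (din a + m + n) m t)"
  using t(2)
proof
  assume "t = []"
  then show ?thesis using hom_id[of a "din a + m + n" "[0]"] by (simp add: intr_def)
next
  assume e: "t = [q1, q2]"
  note ok1 = intr_parts[OF t(1)[unfolded e]]
  show ?thesis
    using hom_vc[OF hom_sx[OF ok1(1)]] hom_sx[OF ok1(2)] e by (simp add: intr_def add_ac)
qed

text \<open>Sources (1) and targets (2) of the interchange naturality generators, for a 3-generator on the left
  (\<open>nl\<close>) or on the right (\<open>nr\<close>), and of the independence generators (\<open>in\<close>).\<close>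

definition nl1 :: "lab \<Rightarrow> nat \<Rightarrow> 'd" where
  "nl1 A m = (let a = lb A; N = ll A + (m + din (ob a (ll A + m)))
     in vc (gx a N [] 0 A [lc A + m]) (intl a N (lt A) (lc A + m)))"

definition nl2 :: "lab \<Rightarrow> nat \<Rightarrow> 'd" where
  "nl2 A m = (let a = lb A; N = ll A + (m + din (ob a (ll A + m)))
     in vc (intl a N (ls A) (lc A + m)) (gx a N [ll A + m] 0 A []))"

definition nr1 :: "adj0 \<Rightarrow> nat \<Rightarrow> lab \<Rightarrow> 'd" where
  "nr1 a m B = (let N = din a + m + ll B in vc (gx a N [0] (dout a + m) B []) (intr a N m (lt B)))"

definition nr2 :: "adj0 \<Rightarrow> nat \<Rightarrow> lab \<Rightarrow> 'd" where
  "nr2 a m B = (let N = din a + m + ll B in vc (intr a N m (ls B)) (gx a N [] (din a + m) B [0]))"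

definition in1 :: "adj0 \<Rightarrow> nat \<Rightarrow> nat \<Rightarrow> lab \<Rightarrow> nat list \<Rightarrow> nat \<Rightarrow> lab \<Rightarrow> 'd" where
  "in1 a N k A x k' B = vc (gx a N [] k A (x @ sh k' (ls B))) (gx a N (sh k (lt A) @ x) k' B [])"

definition in2 :: "adj0 \<Rightarrow> nat \<Rightarrow> nat \<Rightarrow> lab \<Rightarrow> nat list \<Rightarrow> nat \<Rightarrow> lab \<Rightarrow> 'd" where
  "in2 a N k A x k' B = vc (gx a N (sh k (ls A) @ x) k' B []) (gx a N [] k A (x @ sh k' (lt B)))"

lemma ob_lc [simp]: "ob (lb L) (lc L) = ob (lb L) (ll L)"
  using ob_len[OF label_ok(1), of L] by simp

lemma ob_lc_add [simp]: "ob (lb L) (lc L + m) = ob (lb L) (ll L + m)"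
  by (metis ob_lc ob_ob)

lemma hom_nl: "hom (lb A) (ll A + (m + din (ob (lb A) (ll A + m)))) (ls A @ [lc A + m]) ((ll A + m) # lt A) (nl1 A m)"
  "hom (lb A) (ll A + (m + din (ob (lb A) (ll A + m)))) (ls A @ [lc A + m]) ((ll A + m) # lt A) (nl2 A m)"
proof -
  let ?a = "lb A" and ?b = "ob (lb A) (ll A + m)"
  let ?k = "m + din ?b"
  obtain s1 s2 t1 t2 where s: "ls A = [] \<or> ls A = [s1, s2]" "lt A = [] \<or> lt A = [t1, t2]"
    by (rule label_lists)
  have m: "ok (ob ?a (ll A)) ?k [m]" by simp
  note i = hom_intl[OF label_ok(1) s(1) m] hom_intl[OF label_ok(2) s(2) m]
  have len: "len ?a (ll A + ?k) (ls A) = lc A + ?k" by (simp add: len_add)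
  have oks: "ok ?a (ll A + ?k) (ls A)" by (simp add: ok_add)
  have g1: "hom ?a (ll A + ?k) (ls A @ [lc A + m]) (lt A @ [lc A + m]) (gx ?a (ll A + ?k) [] 0 A [lc A + m])"
    using hom_gx[of A ?a 0 "ll A + ?k" "[]" "[lc A + m]"] len by simp
  have nx: "nx ?a (ll A + ?k) (ll A + m) = ll A + (m + dout ?b)" by (simp add: nx_def)
  have g2: "hom ?a (ll A + ?k) ((ll A + m) # ls A) ((ll A + m) # lt A) (gx ?a (ll A + ?k) [ll A + m] 0 A [])"
    using hom_gx[of A ?a 0 "ll A + ?k" "[ll A + m]" "[]"] nx by simp
  show "hom ?a (ll A + ?k) (ls A @ [lc A + m]) ((ll A + m) # lt A) (nl1 A m)"
    "hom ?a (ll A + ?k) (ls A @ [lc A + m]) ((ll A + m) # lt A) (nl2 A m)"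
    using hom_vc[OF g1] hom_vc[OF _ g2] i by (simp_all add: nl1_def nl2_def Let_def)
qed

lemma hom_nr:
  assumes B: "lb B = ob a m"
  shows "hom a (din a + m + ll B) (0 # sh (dout a + m) (ls B)) (sh (din a + m) (lt B) @ [0]) (nr1 a m B)"
    "hom a (din a + m + ll B) (0 # sh (dout a + m) (ls B)) (sh (din a + m) (lt B) @ [0]) (nr2 a m B)"
proof -
  obtain s1 s2 t1 t2 where s: "ls B = [] \<or> ls B = [s1, s2]" "lt B = [] \<or> lt B = [t1, t2]"
    by (rule label_lists)
  have okB: "ok (ob a m) (ll B) (ls B)" "ok (ob a m) (ll B) (lt B)" "len (ob a m) (ll B) (ls B) = lc B"
    using label_ok[of B] B by auto
  note i = hom_intr[OF okB(1) s(1)] hom_intr[OF okB(2) s(2)]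
  have nx: "nx a (din a + m + ll B) 0 = dout a + m + ll B" by (simp add: nx_def)
  have g1: "hom a (din a + m + ll B) (0 # sh (dout a + m) (ls B)) (0 # sh (dout a + m) (lt B)) (gx a (din a + m + ll B) [0] (dout a + m) B [])"
    using hom_gx[of B a "dout a + m" "din a + m + ll B" "[0]" "[]"] B nx by simp
  have "len a (din a + m + ll B) (sh (din a + m) (ls B)) = din a + m + lc B"
    using len_shift[of a "din a + m" "ll B" "ls B"] okB by simp
  then have g2: "hom a (din a + m + ll B) (sh (din a + m) (ls B) @ [0]) (sh (din a + m) (lt B) @ [0]) (gx a (din a + m + ll B) [] (din a + m) B [0])"
    using hom_gx[of B a "din a + m" "din a + m + ll B" "[]" "[0]"] B by simp
  show "hom a (din a + m + ll B) (0 # sh (dout a + m) (ls B)) (sh (din a + m) (lt B) @ [0]) (nr1 a m B)"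
    "hom a (din a + m + ll B) (0 # sh (dout a + m) (ls B)) (sh (din a + m) (lt B) @ [0]) (nr2 a m B)"
    using hom_vc[OF g1] hom_vc[OF _ g2] i by (simp_all add: nr1_def nr2_def Let_def)
qed

lemma hom_in:
  assumes A: "lb A = ob a k" "k + ll A \<le> N" and x: "ok a (len a N (sh k (ls A))) x"
    and B: "lb B = ob a k'" "k' + ll B \<le> len a (len a N (sh k (ls A))) x"
  shows "hom a N (sh k (ls A) @ x @ sh k' (ls B)) (sh k (lt A) @ x @ sh k' (lt B)) (in1 a N k A x k' B)"
    "hom a N (sh k (ls A) @ x @ sh k' (ls B)) (sh k (lt A) @ x @ sh k' (lt B)) (in2 a N k A x k' B)"
proof -
  note h = gx_single(1)[OF A refl refl]
  have e: "len a N (sh k (lt A)) = len a N (sh k (ls A))" "ok a N (sh k (ls A))" "ok a N (sh k (lt A))"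
    using homD[OF h] by auto
  note h' = gx_single(1)[OF B refl refl]
  note e' = homD(2,3)[OF h']
  show "hom a N (sh k (ls A) @ x @ sh k' (ls B)) (sh k (lt A) @ x @ sh k' (lt B)) (in1 a N k A x k' B)"
    unfolding in1_def
    using hom_gx[of A a k N "[]" "x @ sh k' (ls B)"] hom_gx[of B a k' N "sh k (lt A) @ x" "[]"] A B e e' x
    by (auto intro!: hom_vc)
  show "hom a N (sh k (ls A) @ x @ sh k' (ls B)) (sh k (lt A) @ x @ sh k' (lt B)) (in2 a N k A x k' B)"
    unfolding in2_def
    using hom_gx[of A a k N "[]" "x @ sh k' (lt B)"] hom_gx[of B a k' N "sh k (ls A) @ x" "[]"] A B e e' x
    by (auto intro!: hom_vc)
qed

lemma hom_parallel: "hom a n s t A \<Longrightarrow> hom a n s t B \<Longrightarrow> parallel D 3 A B"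
  by (simp add: hom_def parallel_def)

lemma hom_tri:
  "hom Oy 2 [1, 0, 0] [0] (gx Oy 2 [] 0 (LN Oy) [0])"
  "hom Oy 2 [1, 0, 0] [0] (vc (gx Oy 2 [1] 0 (LX Oy 0) []) (gx Oy 2 [] 1 (LN Ox) [0]))"
  "hom Ox 0 [0, 2, 1] [0] (gx Ox 0 [0] 1 (LN Oy) [])"
  "hom Ox 0 [0, 2, 1] [0] (vc (gx Ox 0 [] 0 (LX Ox 0) [1]) (gx Ox 0 [0] 0 (LN Ox) []))"
proof -
  have o: "ob a 2 = a" for a by simp
  show "hom Oy 2 [1, 0, 0] [0] (gx Oy 2 [] 0 (LN Oy) [0])"
    using hom_gx[of "LN Oy" Oy 0 2 "[]" "[0]"] by (simp add: nx_def)
  show "hom Ox 0 [0, 2, 1] [0] (gx Ox 0 [0] 1 (LN Oy) [])"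
    using hom_gx[of "LN Oy" Ox 1 0 "[0]" "[]"] by (simp add: nx_def)
  show "hom Oy 2 [1, 0, 0] [0] (vc (gx Oy 2 [1] 0 (LX Oy 0) []) (gx Oy 2 [] 1 (LN Ox) [0]))"
    using hom_gx[of "LX Oy 0" Oy 0 2 "[1]" "[]"] hom_gx[of "LN Ox" Oy 1 2 "[]" "[0]"]
    by (auto simp: nx_def ob_def intro!: hom_vc)
  show "hom Ox 0 [0, 2, 1] [0] (vc (gx Ox 0 [] 0 (LX Ox 0) [1]) (gx Ox 0 [0] 0 (LN Ox) []))"
    using hom_gx[of "LX Ox 0" Ox 0 0 "[]" "[1]"] hom_gx[of "LN Ox" Ox 0 0 "[0]" "[]"]
    by (auto simp: nx_def ob_def intro!: hom_vc)
qed

end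

subsection \<open>The 4-generators\<close>

lemma interchange_start:
  assumes s: "ok a n s" and t: "ok b k t" and b: "b = ob a n"
  shows "cmp C3 2 2 (cmp C3 2 1 (up (str2 a n s)) (src C3 1 (up (str2 b k t))))
      (cmp C3 1 2 (tgt C3 1 (up (str2 a n s))) (up (str2 b k t))) = s3.S a (n + k) (s @ sh (len a n s) t)"
proof -
  have bs: "b = ob a (len a n s)" using b s by (simp add: ob_len)
  have e: "up (str2 a n s) = s3.S a n s" "up (str2 b k t) = s3.S b k t" by (simp_all add: s3.S_def)
  have o: "ok a (n + k) s" "ok a (len a n s + k) (sh (len a n s) t)" "len a n s + k = len a (n + k) s"
    using ok_add[OF s] len_add[OF s] ok_shift[of a "len a n s" k t] t bs by simp_all
  show ?thesis
    unfolding e s3.S_simps(2)[OF t] s3.S_simps(3)[OF s] s3.S_W[OF s b] s3.W_S[OF t bs] s3.S_cmp[OF o] ..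
qed

text \<open>Sources and targets of 3-generators are strings of length 0 or 2, which is why exactly
  these shapes are treated. The list composite ends in an identity, which is absorbed.\<close>

lemma interchange_left:
  assumes s: "ok a n s" "s = [] \<or> s = [p1, p2]" and t: "ok b k [m]" and b: "b = ob a n"
  shows "interchange Adj3 Inter (str2 a n s) (str2 b k [m]) = s3.intl a (n + k) s (len a n s + m)"
  using s(2)
proof
  assume e: "s = []"
  show ?thesis
    using interchange_start[OF s(1) t b] e t
    by (simp add: interchange_def Let_def decomp_str2 s3.intl_def)
next
  assume e: "s = [p1, p2]"
  define E where "E i = elem_swap Adj3 Inter (str2 a n s) (str2 b k [m]) i 0" for i
  have E: "E 1 = s3.sx a (n + k) [p1] p2 (len a n s + m) []"
    "E 0 = s3.sx a (n + k) [] p1 (nx a n p1 + m) [p2]"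
    using elem_swap_gx[OF s(1) t b, of 1 0] elem_swap_gx[OF s(1) t b, of 0 0] e by (simp_all add: E_def)
  have o: "p1 + din (ob a p1) \<le> n" "p2 + din (ob a p2) \<le> nx a n p1" using s(1) e by simp_all
  have eq: "len a n s + m - dout (ob a p2) + din (ob a p2) = nx a n p1 + m"
    using o by (simp add: nx_def e)
  have i: "s3.intl a (n + k) s (len a n s + m) = s3.vc (E 1) (E 0)"
    using E eq e by (simp add: s3.intl_def)
  note parts = s3.intl_parts[OF s(1)[unfolded e] t[unfolded b], folded e, unfolded eq]
  have "s3.hom a (n + k) ([] @ p1 # (nx a n p1 + m) # [p2]) ((n + m) # s) (E 0)"
    using s3.hom_sx[OF parts(3,4)] parts(5) E e by simp
  note h = s3.homD[OF this] s3.vc_id(2)[OF this]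
  have "[elem_swap Adj3 Inter (str2 a n s) (str2 b k [m]) i j.
      i \<leftarrow> rev [0..<length (wtriples a n s)], j \<leftarrow> [0..<length (wtriples b k [m])]] = [E 1, E 0]"
    by (simp add: e E_def)
  then have "interchange Adj3 Inter (str2 a n s) (str2 b k [m]) = s3.vc (E 1) (s3.vc (E 0) (idc C3 2 (tgt C3 2 (E 0))))"
    by (simp add: interchange_def Let_def decomp_str2[OF s(1)] decomp_str2[OF t])
  then show ?thesis using h i by simp
qed

lemma interchange_right:
  assumes t: "ok b n t" "t = [] \<or> t = [q1, q2]" and b: "b = ob a m"
  shows "interchange Adj3 Inter (str2 a (din a + m) [0]) (str2 b n t) = s3.intr a (din a + m + n) m t"
  using t(2)
proof -
  have s: "ok a (din a + m) [0]" by simp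
  have b': "b = ob a (din a + m)" using b by simp
  have nx: "nx a (din a + m) 0 = dout a + m" by (simp add: nx_def)
  show ?thesis
    using t(2)
  proof
    assume e: "t = []"
    show ?thesis
      using interchange_start[OF s t(1) b'] e
      by (simp add: interchange_def Let_def decomp_str2 s3.intr_def)
  next
    assume e: "t = [q1, q2]"
    define E where "E j = elem_swap Adj3 Inter (str2 a (din a + m) [0]) (str2 b n t) 0 j" for j
    have E: "E 0 = s3.sx a (din a + m + n) [] 0 (dout a + m + q1) [dout a + m + q2]"
      "E 1 = s3.sx a (din a + m + n) [din a + m + q1] 0 (dout a + m + q2) []"
      using elem_swap_gx[OF s t(1) b', of 0 0] elem_swap_gx[OF s t(1) b', of 0 1] e nx by (simp_all add: E_def)
    have i: "s3.intr a (din a + m + n) m t = s3.vc (E 0) (E 1)"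
      using E e by (simp add: s3.intr_def)
    have "s3.hom a (din a + m + n) ([din a + m + q1] @ 0 # (dout a + m + q2) # []) (sh (din a + m) t @ [0]) (E 1)"
      using s3.hom_sx[OF s3.intr_parts(2)[OF t(1)[unfolded e b]]] E e by (simp add: add_ac)
    note h = s3.homD[OF this] s3.vc_id(2)[OF this]
    have "[elem_swap Adj3 Inter (str2 a (din a + m) [0]) (str2 b n t) i j.
        i \<leftarrow> rev [0..<length (wtriples a (din a + m) [0])], j \<leftarrow> [0..<length (wtriples b n t)]] = [E 0, E 1]"
      by (simp add: e E_def)
    then have "interchange Adj3 Inter (str2 a (din a + m) [0]) (str2 b n t) = s3.vc (E 0) (s3.vc (E 1) (idc C3 2 (tgt C3 2 (E 1))))"
      by (simp add: interchange_def Let_def decomp_str2[OF s] decomp_str2[OF t(1)])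
    then show ?thesis using h i by simp
  qed
qed

lemma gen2_S: "up (gen2 Adj2 (tp b)) = s3.S b (din b) [0]"
  by (simp add: gen2_tp s3.S_def)

lemma dom3_S: "up (dom3 Adj3 (la L)) = s3.S (lb L) (ll L) (ls L)" "up (cod3 Adj3 (la L)) = s3.S (lb L) (ll L) (lt L)"
  by (simp_all add: dom3_la s3.S_def)

lemma C3_cells_1: "cells C3 1 = {s3.W a n |a n. True}"
  using e3.cells_E[of 1] C1_word by (auto simp: C3_def C2_cells s3.W_def)

text \<open>Composability leaves a label and the length of the intermediate word as the only free
  data of such a generator.\<close>

lemma natl_ok_iff: "natl_ok Adj3 A g \<beta> \<longleftrightarrow>
  (\<exists>L m. A = la L \<and> g = word (ob (lb L) (ll L)) m \<and> \<beta> = tp (ob (lb L) (ll L + m)))"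
proof
  assume n: "natl_ok Adj3 A g \<beta>"
  obtain L where L: "A = la L" using n by (auto simp: natl_ok_def gens3_Adj3)
  obtain c m where g: "g = word c m" using n C1_word[of g] by (auto simp: natl_ok_def)
  obtain b where b: "\<beta> = tp b" by (rule tp_exhaust)
  have "composable C3 3 1 (g3 L) (s3.W c m)" "composable C2 1 2 (up g) (gcell b)"
    using n L g b by (auto simp: natl_ok_def g3_def s3.W_def gcell_def)
  then have "c = ob (lb L) (ll L)" "b = ob c m"
    using s3.homD[OF s3.\<gamma>[of L]] g by (auto simp: composable_31 composable_12 gcell s3.O0_def ob_len)
  then show "\<exists>L m. A = la L \<and> g = word (ob (lb L) (ll L)) m \<and> \<beta> = tp (ob (lb L) (ll L + m))"
    using L g b by auto
next
  assume "\<exists>L m. A = la L \<and> g = word (ob (lb L) (ll L)) m \<and> \<beta> = tp (ob (lb L) (ll L + m))"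
  then obtain L m where e: "A = la L" "g = word (ob (lb L) (ll L)) m" "\<beta> = tp (ob (lb L) (ll L + m))" by blast
  show "natl_ok Adj3 A g \<beta>"
    using s3.hom_composable(2)[OF s3.\<gamma>[of L] refl, of m] gcell_composable(1)[OF refl, of "ob (lb L) (ll L)" m]
    by (simp add: natl_ok_def e gens3_Adj3 g3_def s3.W_def gcell_def)
qed

lemma natr_ok_iff: "natr_ok Adj3 \<alpha> g B \<longleftrightarrow>
  (\<exists>a m L. \<alpha> = tp a \<and> g = word a m \<and> B = la L \<and> lb L = ob a m)"
proof
  assume n: "natr_ok Adj3 \<alpha> g B"
  obtain L where L: "B = la L" using n by (auto simp: natr_ok_def gens3_Adj3)
  obtain c m where g: "g = word c m" using n C1_word[of g] by (auto simp: natr_ok_def)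
  obtain a where a: "\<alpha> = tp a" by (rule tp_exhaust)
  have "composable C3 1 3 (s3.W c m) (g3 L)" "composable C2 2 1 (gcell a) (up g)"
    using n L g a by (auto simp: natr_ok_def g3_def s3.W_def gcell_def)
  then have "c = a" "lb L = ob c m"
    using s3.homD[OF s3.\<gamma>[of L]] g by (auto simp: composable_13 composable_21 gcell s3.O0_def)
  then show "\<exists>a m L. \<alpha> = tp a \<and> g = word a m \<and> B = la L \<and> lb L = ob a m"
    using L g a by auto
next
  assume "\<exists>a m L. \<alpha> = tp a \<and> g = word a m \<and> B = la L \<and> lb L = ob a m"
  then obtain L a m where e: "\<alpha> = tp a" "g = word a m" "B = la L" "lb L = ob a m" by blast
  show "natr_ok Adj3 \<alpha> g B"
    using s3.hom_composable(1)[OF s3.\<gamma>[of L] e(4)] gcell_composable(2)[OF refl, of a m]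
    by (simp add: natr_ok_def e gens3_Adj3 g3_def s3.W_def gcell_def)
qed

lemma natl_sides:
  assumes c: "c = ob (lb L) (ll L)" and b: "b = ob c m"
  shows "natl_dom Adj3 Inter (la L) (word c m) (tp b) = s3.nl1 L m"
    "natl_cod Adj3 Inter (la L) (word c m) (tp b) = s3.nl2 L m"
proof -
  let ?a = "lb L"
  have b': "ob ?a (ll L + m) = b" using b c by simp
  obtain s1 s2 t1 t2 where s: "ls L = [] \<or> ls L = [s1, s2]" "lt L = [] \<or> lt L = [t1, t2]"
    by (rule label_lists)
  have t: "ok c (m + din b) [m]" using b by simp
  have gb: "cmp C2 1 2 (up (word c m)) (gen2 Adj2 (tp b)) = str2 c (m + din b) [m]"
    using str2_left[of b "din b" "[0]" c m] b by (simp add: gen2_tp)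
  have int: "interchange Adj3 Inter (cod3 Adj3 (la L)) (cmp C2 1 2 (up (word c m)) (gen2 Adj2 (tp b))) =
      s3.intl ?a (ll L + (m + din b)) (lt L) (lc L + m)"
    "interchange Adj3 Inter (dom3 Adj3 (la L)) (cmp C2 1 2 (up (word c m)) (gen2 Adj2 (tp b))) =
      s3.intl ?a (ll L + (m + din b)) (ls L) (lc L + m)"
    using interchange_left[OF label_ok(2) s(2) t c] interchange_left[OF label_ok(1) s(1) t c]
    by (simp_all add: gb dom3_la)
  have st: "src C3 1 (s3.S b (din b) [0]) = s3.W b (din b)" "tgt C3 1 (s3.S b (din b) [0]) = s3.W b (dout b)"
    "src C3 1 (s3.S ?a (ll L) (ls L)) = s3.W ?a (ll L)" "tgt C3 1 (s3.S ?a (ll L) (ls L)) = s3.W ?a (lc L)"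
    by (simp_all add: nx_def)
  have Wb: "cmp C3 1 2 (cmp C3 1 1 (s3.W ?a k) (s3.W c m)) (s3.S b (din b) [0]) = s3.S ?a (k + (m + din b)) [k + m]"
    if "ob ?a k = c" for k
    using that b s3.W_S[of b "din b" "[0]" ?a "k + m"] by (auto simp: s3.W_cmp add.assoc simp flip: ob_ob)
  \<comment> \<open>A left whisker by the empty word is inserted to give the composite the shape of
    a context.\<close>
  have R: "cmp C3 3 1 (cmp C3 3 1 (g3 L) (s3.W c m)) (s3.W b k) = s3.rw (s3.lw ?a 0 (g3 L)) c (m + k)" for k
    using s3.rw_rw[OF s3.\<gamma>[of L] c b, of k] s3.lw_0[OF s3.\<gamma>[of L]] by (simp add: s3.rw_def)
  have cl: "ob ?a (lc L) = c" "ob ?a (ll L) = c" using c by simp_all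
  have lens: "len ?a (ll L + (m + din b)) (ls L) = lc L + (m + din b)" by (simp add: len_add)
  have n1: "nx ?a (ll L + (m + din b)) (ll L + m) = ll L + (m + dout b)" by (simp add: nx_def b')
  have ok1: "ok ?a (lc L + (m + din b)) [lc L + m]" "ok ?a (ll L + (m + din b)) [ll L + m]" by (simp_all add: b')
  have G1: "s3.po (s3.rw (s3.lw ?a 0 (g3 L)) c (m + din b)) ?a (lc L + (m + din b)) [lc L + m] =
      s3.gx ?a (ll L + (m + din b)) [] 0 L [lc L + m]"
    using s3.gx_single(2)[of L ?a 0 "ll L + (m + din b)" c "m + din b", OF _ _ _ _ ok1(1)] c lens by simp
  have G2: "s3.pr ?a (ll L + (m + din b)) [ll L + m] (s3.rw (s3.lw ?a 0 (g3 L)) c (m + dout b)) =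
      s3.gx ?a (ll L + (m + din b)) [ll L + m] 0 L []"
    by (rule s3.gx_single(3)[OF _ _ _ _ ok1(2)]) (simp_all add: c n1)
  show "natl_dom Adj3 Inter (la L) (word c m) (tp b) = s3.nl1 L m"
    using Wb[OF cl(1)] G1
    by (simp add: natl_dom_def Let_def int gen2_S dom3_S st g3_def[symmetric] s3.W_def[symmetric] R s3.po_def
        s3.nl1_def b')
  show "natl_cod Adj3 Inter (la L) (word c m) (tp b) = s3.nl2 L m"
    using Wb[OF cl(2)] G2
    by (simp add: natl_cod_def Let_def int gen2_S dom3_S st g3_def[symmetric] s3.W_def[symmetric] R s3.pr_def
        s3.nl2_def b')
qed

lemma natr_sides:
  assumes L: "lb L = ob a m"
  shows "natr_dom Adj3 Inter (tp a) (word a m) (la L) = s3.nr1 a m L"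
    "natr_cod Adj3 Inter (tp a) (word a m) (la L) = s3.nr2 a m L"
proof -
  let ?b = "lb L"
  let ?N = "din a + m + ll L"
  obtain s1 s2 t1 t2 where s: "ls L = [] \<or> ls L = [s1, s2]" "lt L = [] \<or> lt L = [t1, t2]"
    by (rule label_lists)
  have ag: "cmp C2 2 1 (gen2 Adj2 (tp a)) (up (word a m)) = str2 a (din a + m) [0]"
    using str2_right[of a "din a" "[0]" a m] by (simp add: gen2_tp)
  have int: "interchange Adj3 Inter (cmp C2 2 1 (gen2 Adj2 (tp a)) (up (word a m))) (cod3 Adj3 (la L)) = s3.intr a ?N m (lt L)"
    "interchange Adj3 Inter (cmp C2 2 1 (gen2 Adj2 (tp a)) (up (word a m))) (dom3 Adj3 (la L)) = s3.intr a ?N m (ls L)"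
    using interchange_right[OF label_ok(2) s(2) L] interchange_right[OF label_ok(1) s(1) L]
    by (simp_all add: ag dom3_la)
  have st: "src C3 1 (s3.S a (din a) [0]) = s3.W a (din a)" "tgt C3 1 (s3.S a (din a) [0]) = s3.W a (dout a)"
    "src C3 1 (s3.S ?b (ll L) (ls L)) = s3.W ?b (ll L)" "tgt C3 1 (s3.S ?b (ll L) (ls L)) = s3.W ?b (lc L)"
    by (simp_all add: nx_def)
  have aW: "cmp C3 2 1 (cmp C3 2 1 (s3.S a (din a) [0]) (s3.W a m)) (s3.W ?b k) = s3.S a (din a + m + k) [0]" for k
    using s3.S_W[of a "din a" "[0]" a m] s3.S_W[of a "din a + m" "[0]" ?b k] L by simp
  have Rw: "cmp C3 1 3 (cmp C3 1 1 (s3.W a k) (s3.W a m)) (g3 L) = s3.rw (s3.lw a (k + m) (g3 L)) (ob a (k + m + ll L)) 0"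
    if "even k" for k
    using s3.rw_0[OF s3.hom_lw[OF s3.\<gamma>[of L], of a "k + m"], of "ob a (k + m + ll L)"] that L
    by (simp add: s3.lw_def s3.W_cmp)
  have nx: "nx a ?N 0 = dout a + m + ll L" by (simp add: nx_def)
  have lens: "len a ?N (sh (din a + m) (ls L)) = din a + m + lc L"
    using len_shift[of a "din a + m" "ll L" "ls L"] label_ok(1,3)[of L] L by simp
  have G1: "s3.pr a ?N [0] (s3.rw (s3.lw a (dout a + m) (g3 L)) (ob a (dout a + m + ll L)) 0) = s3.gx a ?N [0] (dout a + m) L []"
    by (rule s3.gx_single(3)) (simp_all add: L nx)
  have G2: "s3.po (s3.rw (s3.lw a (din a + m) (g3 L)) (ob a (din a + m + ll L)) 0) a (din a + m + lc L) [0] =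
     s3.gx a ?N [] (din a + m) L [0]"
    by (rule s3.gx_single(2)) (simp_all add: L lens)
  show "natr_dom Adj3 Inter (tp a) (word a m) (la L) = s3.nr1 a m L"
    using G1
    by (simp add: natr_dom_def Let_def int gen2_S dom3_S st g3_def[symmetric] s3.W_def[symmetric] aW Rw s3.pr_def
        s3.nr1_def)
  show "natr_cod Adj3 Inter (tp a) (word a m) (la L) = s3.nr2 a m L"
    using G2
    by (simp add: natr_cod_def Let_def int gen2_S dom3_S st g3_def[symmetric] s3.W_def[symmetric] aW Rw s3.po_def
        s3.nr2_def)
qed

lemma whisk_str2:
  assumes s: "ok (ob a k) n s"
  shows "whiskable C2 0 2 (up (word a k)) (str2 (ob a k) n s) (up (word (ob a (k + n)) r))"
    "whisk C2 0 2 (up (word a k)) (str2 (ob a k) n s) (up (word (ob a (k + n)) r)) = str2 a (k + n + r) (sh k s)"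
  using s str2_left[OF s refl] str2_right[of a "k + n" "sh k s" "ob a (k + n)" r] ob_len[OF s]
  by (simp_all add: whiskable_def whisk_def composable_12 composable_21 ok_shift ob_len)

lemma whiskable_str2D:
  assumes s: "ok b n s" and "whiskable C2 0 2 (up l) (str2 b n s) (up r)"
  shows "\<exists>a k m. b = ob a k \<and> l = word a k \<and> r = word (ob a (k + n)) m"
proof -
  have c: "composable C2 1 2 (up l) (str2 b n s)" "composable C2 2 1 (str2 b n s) (up r)"
    using assms(2) by (auto simp: whiskable_def)
  then have "l \<in> cells C1 1" "r \<in> cells C1 1" by (auto simp: composable_12 composable_21 C2_cells)
  then obtain a k c' m where "l = word a k" "r = word c' m" using C1_word by metis
  then show ?thesis using c s by (auto simp: composable_12 composable_21 ob_len)
qed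

text \<open>All words start at one object \<open>a\<close>, because vertically composable 2-cells
  have the same 0-dimensional source. The last equation makes the whiskered source of
  \<open>B\<close> begin where \<chi> ends.\<close>

lemma indep_ok_iff: "indep_ok Adj3 e A h \<chi> e' B h' \<longleftrightarrow>
  (\<exists>a k L r x k' L' r'. e = word a k \<and> A = la L \<and> h = word (ob a (k + ll L)) r \<and> lb L = ob a k \<and>
     \<chi> = str2 a (len a (k + ll L + r) (sh k (ls L))) x \<and> ok a (len a (k + ll L + r) (sh k (ls L))) x \<and>
     e' = word a k' \<and> B = la L' \<and> h' = word (ob a (k' + ll L')) r' \<and> lb L' = ob a k' \<and>
     k' + ll L' + r' = len a (len a (k + ll L + r) (sh k (ls L))) x)" (is "?l \<longleftrightarrow> ?r")
proof
  assume i: ?l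
  obtain L L' where L: "A = la L" "B = la L'" using i by (auto simp: indep_ok_def gens3_Adj3)
  obtain a k r where l: "lb L = ob a k" "e = word a k" "h = word (ob a (k + ll L)) r"
    using i L whiskable_str2D[OF label_ok(1)[of L], of e h] by (auto simp: indep_ok_def dom3_la)
  obtain a' k' r' where l': "lb L' = ob a' k'" "e' = word a' k'" "h' = word (ob a' (k' + ll L')) r'"
    using i L whiskable_str2D[OF label_ok(1)[of L'], of e' h'] by (auto simp: indep_ok_def dom3_la)
  have o: "ok (ob a k) (ll L) (ls L)" "ok (ob a' k') (ll L') (ls L')" using label_ok(1)[of L] label_ok(1)[of L'] l l' by auto
  have oo: "ok a (k + ll L + r) (sh k (ls L))" "ok a' (k' + ll L' + r') (sh k' (ls L'))"
    using o by (simp_all add: ok_add ok_shift)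
  have w: "whiskable C2 1 2 (str2 a (k + ll L + r) (sh k (ls L))) \<chi> (str2 a' (k' + ll L' + r') (sh k' (ls L')))"
    using i L l l' whisk_str2(2)[OF o(1), of r] whisk_str2(2)[OF o(2), of r'] by (simp add: indep_ok_def dom3_la)
  then have c: "composable C2 2 2 (str2 a (k + ll L + r) (sh k (ls L))) \<chi>" "composable C2 2 2 \<chi> (str2 a' (k' + ll L' + r') (sh k' (ls L')))"
    by (auto simp: whiskable_def)
  then obtain b m x where \<chi>: "\<chi> = str2 b m x" "ok b m x" using C2_str2[of \<chi>] by (auto simp: composable_22)
  have "b = a" "m = len a (k + ll L + r) (sh k (ls L))" "a' = b" "k' + ll L' + r' = len b m x"
    using c \<chi> oo by (auto simp: composable_22)
  then show ?r using L l l' \<chi> by blast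
next
  assume ?r
  then obtain a k L r x k' L' r' where h: "e = word a k" "A = la L" "h = word (ob a (k + ll L)) r" "lb L = ob a k"
     "\<chi> = str2 a (len a (k + ll L + r) (sh k (ls L))) x" "ok a (len a (k + ll L + r) (sh k (ls L))) x"
     "e' = word a k'" "B = la L'" "h' = word (ob a (k' + ll L')) r'" "lb L' = ob a k'"
     "k' + ll L' + r' = len a (len a (k + ll L + r) (sh k (ls L))) x" by blast
  have o: "ok (ob a k) (ll L) (ls L)" "ok (ob a k') (ll L') (ls L')" using label_ok(1)[of L] label_ok(1)[of L'] h by auto
  have oo: "ok a (k + ll L + r) (sh k (ls L))" "ok a (k' + ll L' + r') (sh k' (ls L'))"
    using o by (simp_all add: ok_add ok_shift)
  show ?l
    using whisk_str2[OF o(1), of r] whisk_str2[OF o(2), of r'] oo h(6,11)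
    by (simp add: indep_ok_def h(1-5,7-10) gens3_Adj3 dom3_la whiskable_def[of _ 1] composable_22)
qed

lemma indep_sides:
  assumes L: "lb L = ob a k" and L': "lb L' = ob a k'"
    and N: "N = k + ll L + r" and x: "ok a M x" "M = len a N (sh k (ls L))"
    and N': "k' + ll L' + r' = len a M x"
  shows "indep_dom Adj3 (word a k) (la L) (word (ob a (k + ll L)) r) (str2 a M x) (word a k') (la L') (word (ob a (k' + ll L')) r')
      = s3.in1 a N k L x k' L'"
    "indep_cod Adj3 (word a k) (la L) (word (ob a (k + ll L)) r) (str2 a M x) (word a k') (la L') (word (ob a (k' + ll L')) r')
      = s3.in2 a N k L x k' L'"
proof -
  let ?c = "ob a (k + ll L)" and ?c' = "ob a (k' + ll L')" and ?N' = "len a M x"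
  define A where "A = s3.rw (s3.lw a k (g3 L)) ?c r"
  define B where "B = s3.rw (s3.lw a k' (g3 L')) ?c' r'"
  have hA: "s3.hom a N (sh k (ls L)) (sh k (lt L)) A"
    unfolding A_def by (rule s3.gx_single(1)[OF L]) (simp_all add: N)
  have hB: "s3.hom a ?N' (sh k' (ls L')) (sh k' (lt L')) B"
    unfolding B_def by (rule s3.gx_single(1)[OF L']) (simp_all flip: N')
  note A' = s3.homD[OF hA] and B' = s3.homD[OF hB]
  have wS: "whisk C3 0 2 (s3.W b j) (s3.S (ob b j) n s) (s3.W (ob b (j + n)) i) = s3.S b (j + n + i) (sh j s)"
    if "ok (ob b j) n s" for b j n s i
    using that s3.W_S[OF that refl] s3.S_W[of b "j + n" "sh j s" "ob b (j + n)" i] by (simp add: whisk_def ok_shift)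
  have o: "ok (ob a k) (ll L) (ls L)" "ok (ob a k) (ll L) (lt L)" "ok (ob a k') (ll L') (ls L')" "ok (ob a k') (ll L') (lt L')"
    using label_ok(1,2)[of L] label_ok(1,2)[of L'] L L' by auto
  have S2: "whisk C3 0 2 (s3.W a k) (s3.S (lb L) (ll L) (ls L)) (s3.W ?c r) = s3.S a N (sh k (ls L))"
    "whisk C3 0 2 (s3.W a k) (s3.S (lb L) (ll L) (lt L)) (s3.W ?c r) = s3.S a N (sh k (lt L))"
    "whisk C3 0 2 (s3.W a k') (s3.S (lb L') (ll L') (ls L')) (s3.W ?c' r') = s3.S a ?N' (sh k' (ls L'))"
    "whisk C3 0 2 (s3.W a k') (s3.S (lb L') (ll L') (lt L')) (s3.W ?c' r') = s3.S a ?N' (sh k' (lt L'))"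
    using wS[OF o(1)] wS[OF o(2)] wS[OF o(3)] wS[OF o(4)] L L' N N' by simp_all
  have cS: "cmp C3 2 2 (s3.S a N (sh k (ls L))) (s3.S a M x) = s3.S a N (sh k (ls L) @ x)"
    "cmp C3 2 2 (s3.S a N (sh k (lt L))) (s3.S a M x) = s3.S a N (sh k (lt L) @ x)"
    using s3.S_cmp[OF A'(2) x(1)] s3.S_cmp[OF A'(3) x(1)] x(2) A'(6) by simp_all
  have l: "k + ll L \<le> N" "r = N - k - ll L" "k' + ll L' \<le> ?N'" "r' = ?N' - k' - ll L'" using N N' by simp_all
  have pA: "cmp C3 3 2 (cmp C3 3 2 A (s3.S a M x)) (s3.S a ?N' qs) = s3.gx a N [] k L (x @ qs)" if "ok a ?N' qs" for qs
  proof -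
    have "cmp C3 3 2 (cmp C3 3 2 A (s3.S a M x)) (s3.S a ?N' qs) = s3.po A a M (x @ qs)"
      using s3.po_po[OF hA x(1) x(2) that refl] by (simp add: s3.po_def)
    also have "\<dots> = s3.gx a N [] k L (x @ qs)"
      unfolding A_def by (rule s3.gx_single(2)[OF L l(1) refl l(2) _ x(2)]) (use x that in simp)
    finally show ?thesis .
  qed
  have pB: "cmp C3 2 3 (s3.S a N ps) B = s3.gx a N ps k' L' []" if "ok a N ps" "?N' = len a N ps" for ps
    using s3.gx_single(3)[OF L' l(3) refl l(4) that] by (simp add: s3.pr_def B_def)
  have os: "ok a N (sh k (ls L) @ x)" "?N' = len a N (sh k (ls L) @ x)" "ok a N (sh k (lt L) @ x)" "?N' = len a N (sh k (lt L) @ x)"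
    using A' x by simp_all
  have fold: "whisk C3 0 3 (s3.W a k) (g3 L) (s3.W ?c r) = A" "whisk C3 0 3 (s3.W a k') (g3 L') (s3.W ?c' r') = B"
    by (simp_all add: A_def B_def whisk_def s3.rw_def s3.lw_def)
  show "indep_dom Adj3 (word a k) (la L) (word (ob a (k + ll L)) r) (str2 a M x) (word a k') (la L') (word (ob a (k' + ll L')) r')
      = s3.in1 a N k L x k' L'"
    unfolding indep_dom_def Let_def free_simps g3_def[symmetric] s3.W_def[symmetric] s3.S_def[symmetric] dom3_S fold S2 cS s3.in1_def
    by (simp only: pA[OF B'(2)] pB[OF os(3,4)])
  show "indep_cod Adj3 (word a k) (la L) (word (ob a (k + ll L)) r) (str2 a M x) (word a k') (la L') (word (ob a (k' + ll L')) r')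
      = s3.in2 a N k L x k' L'"
    unfolding indep_cod_def Let_def free_simps g3_def[symmetric] s3.W_def[symmetric] s3.S_def[symmetric] dom3_S fold S2 cS s3.in2_def
    by (simp only: pA[OF B'(3)] pB[OF os(1,2)])
qed

lemma PAdj_eqs [simp]:
  "natl_dom PAdj = natl_dom Adj3" "natl_cod PAdj = natl_cod Adj3" "natr_dom PAdj = natr_dom Adj3" "natr_cod PAdj = natr_cod Adj3"
  "indep_dom PAdj = indep_dom Adj3" "indep_cod PAdj = indep_cod Adj3" "inter_dom PAdj = inter_dom Adj2" "inter_cod PAdj = inter_cod Adj2"
  "natl_ok PAdj = natl_ok Adj3" "natr_ok PAdj = natr_ok Adj3" "indep_ok PAdj = indep_ok Adj3" "inter_ok PAdj = inter_ok Adj2"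
proof -
  have "elem_swap PAdj = elem_swap Adj3" by (simp add: fun_eq_iff elem_swap_def)
  then have [simp]: "interchange PAdj = interchange Adj3" by (simp add: fun_eq_iff interchange_def)
  show "natl_dom PAdj = natl_dom Adj3" "natl_cod PAdj = natl_cod Adj3" "natr_dom PAdj = natr_dom Adj3" "natr_cod PAdj = natr_cod Adj3"
    by (simp_all add: fun_eq_iff natl_dom_def natl_cod_def natr_dom_def natr_cod_def)
  show "indep_dom PAdj = indep_dom Adj3" "indep_cod PAdj = indep_cod Adj3" "inter_dom PAdj = inter_dom Adj2" "inter_cod PAdj = inter_cod Adj2"
    by (simp_all add: fun_eq_iff indep_dom_def indep_cod_def inter_dom_def inter_cod_def)
  show "natl_ok PAdj = natl_ok Adj3" "natr_ok PAdj = natr_ok Adj3" "indep_ok PAdj = indep_ok Adj3" "inter_ok PAdj = inter_ok Adj2"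
    by (simp_all add: fun_eq_iff natl_ok_def natr_ok_def indep_ok_def inter_ok_def)
qed

lemma PAdj_gens: "inter_gen PAdj = Inter" "indep_gen PAdj = Indep" "natl_gen PAdj = NatL" "natr_gen PAdj = NatR"
  "gens4 PAdj = {Indep e A h \<chi> e' B h' |e A h \<chi> e' B h'. indep_ok Adj3 e A h \<chi> e' B h'} \<union>
            {NatL A h \<beta> |A h \<beta>. natl_ok Adj3 A h \<beta>} \<union>
            {NatR \<alpha> h B |\<alpha> h B. natr_ok Adj3 \<alpha> h B} \<union>
            {TriEps, TriEta}"
  by (simp_all only: PAdj_def Let_def prepoly3.defs prepoly4.defs gray.defs prepoly4.select_convs gray.select_convs)

text \<open>Interchange generators with an identity in the middle are the labels \<open>LX\<close>
  with gap 0. Empty words are inserted on either side to match contexts.\<close>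

lemma tri_sides:
  "dom4 PAdj TriEps = s3.gx Oy 2 [] 0 (LN Oy) [0]"
  "cod4 PAdj TriEps = s3.vc (s3.gx Oy 2 [1] 0 (LX Oy 0) []) (s3.gx Oy 2 [] 1 (LN Ox) [0])"
  "dom4 PAdj TriEta = s3.gx Ox 0 [0] 1 (LN Oy) []"
  "cod4 PAdj TriEta = s3.vc (s3.gx Ox 0 [] 0 (LX Ox 0) [1]) (s3.gx Ox 0 [0] 0 (LN Ox) [])"
proof -
  have g: "up (up (gen1 Adj1 Ff)) = s3.W Ox 1" "up (up (gen1 Adj1 Fg)) = s3.W Oy 1"
    "up (gen2 Adj2 Eta) = s3.S Ox 0 [0]" "up (gen2 Adj2 Eps) = s3.S Oy 2 [0]"
    "gen3 Adj3 Nf = g3 (LN Ox)" "gen3 Adj3 Ng = g3 (LN Oy)"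
    "gen3 Adj3 (Inter Eps (idc C1 0 (up Oy)) Eps) = g3 (LX Oy 0)" "gen3 Adj3 (Inter Eta (idc C1 0 (up Ox)) Eta) = g3 (LX Ox 0)"
    using gen1_word[of Ox] gen1_word[of Oy] gen2_S[of Ox] gen2_S[of Oy] by (simp_all add: s3.W_def g3_def)
  have w: "whisk C3 0 2 (s3.W Oy 1) (s3.S Ox 0 [0]) (s3.W Ox 1) = s3.S Oy 2 [1]"
    "whisk C3 0 2 (s3.W Ox 1) (s3.S Oy 2 [0]) (s3.W Oy 1) = s3.S Ox 4 [1]"
    using s3.W_S[of Ox 0 "[0]" Oy 1] s3.S_W[of Oy 1 "[1]" Ox 1] s3.W_S[of Oy 2 "[0]" Ox 1] s3.S_W[of Ox 3 "[1]" Oy 1]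
    by (simp_all add: whisk_def ob_def)
  note h = s3.\<gamma>[of "LN Ox"] s3.\<gamma>[of "LN Oy"] s3.\<gamma>[of "LX Ox 0"] s3.\<gamma>[of "LX Oy 0"]
  have h0: "s3.rw (s3.lw Ox 0 (g3 (LX Ox 0))) Ox 0 = g3 (LX Ox 0)" "s3.rw (s3.lw Oy 0 (g3 (LX Oy 0))) Oy 0 = g3 (LX Oy 0)"
    using s3.lw_0[OF h(3)] s3.lw_0[OF h(4)] s3.rw_0[OF h(3)] s3.rw_0[OF h(4)] by simp_all
  have 1: "cmp C3 3 2 (cmp C3 3 1 (g3 (LN Oy)) (s3.W Ox 1)) (s3.S Oy 2 [0]) = s3.gx Oy 2 [] 0 (LN Oy) [0]"
    using s3.gx_single(2)[of "LN Oy" Oy 0 2 Ox 1 2 "[0]"] s3.lw_0[OF h(2)] by (simp add: s3.rw_def s3.po_def nx_def)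
  note lr = s3.rw_0[OF s3.hom_lw[OF h(1), of Oy 1], of Oy] s3.rw_0[OF s3.hom_lw[OF h(2), of Ox 1], of Ox]
    s3.lw_0[OF h(1)]
  have x2: "s3.pr Oy 2 [1] (s3.rw (s3.lw Oy 0 (g3 (LX Oy 0))) Oy 0) = s3.gx Oy 2 [1] 0 (LX Oy 0) []"
    by (rule s3.gx_single(3)) (simp_all add: nx_def)
  have x3: "s3.po (s3.rw (s3.lw Oy 1 (g3 (LN Ox))) Oy 0) Oy 2 [0] = s3.gx Oy 2 [] 1 (LN Ox) [0]"
    by (rule s3.gx_single(2)) (simp_all add: nx_def)
  have x4: "s3.pr Ox 0 [0] (s3.rw (s3.lw Ox 1 (g3 (LN Oy))) Ox 0) = s3.gx Ox 0 [0] 1 (LN Oy) []"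
    by (rule s3.gx_single(3)) (simp_all add: nx_def)
  have x5: "s3.po (s3.rw (s3.lw Ox 0 (g3 (LX Ox 0))) Ox 0) Ox 4 [1] = s3.gx Ox 0 [] 0 (LX Ox 0) [1]"
    by (rule s3.gx_single(2)) (simp_all add: nx_def)
  have x6: "s3.pr Ox 0 [0] (s3.rw (s3.lw Ox 0 (g3 (LN Ox))) Oy 1) = s3.gx Ox 0 [0] 0 (LN Ox) []"
    by (rule s3.gx_single(3)) (simp_all add: nx_def)
  have 2: "cmp C3 2 3 (s3.S Oy 2 [1]) (g3 (LX Oy 0)) = s3.gx Oy 2 [1] 0 (LX Oy 0) []"
    using x2 unfolding h0 s3.pr_def .
  have 3: "cmp C3 3 2 (cmp C3 1 3 (s3.W Oy 1) (g3 (LN Ox))) (s3.S Oy 2 [0]) = s3.gx Oy 2 [] 1 (LN Ox) [0]"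
    using x3 lr(1) by (simp add: s3.lw_def s3.po_def)
  have 4: "cmp C3 2 3 (s3.S Ox 0 [0]) (cmp C3 1 3 (s3.W Ox 1) (g3 (LN Oy))) = s3.gx Ox 0 [0] 1 (LN Oy) []"
    using x4 lr(2) by (simp add: s3.lw_def s3.pr_def)
  have 5: "cmp C3 3 2 (g3 (LX Ox 0)) (s3.S Ox 4 [1]) = s3.gx Ox 0 [] 0 (LX Ox 0) [1]"
    using x5 unfolding h0 s3.po_def .
  have 6: "cmp C3 2 3 (s3.S Ox 0 [0]) (cmp C3 3 1 (g3 (LN Ox)) (s3.W Oy 1)) = s3.gx Ox 0 [0] 0 (LN Ox) []"
    using x6 lr(3) by (simp add: s3.rw_def s3.pr_def)
  show "dom4 PAdj TriEps = s3.gx Oy 2 [] 0 (LN Oy) [0]"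
    "cod4 PAdj TriEps = s3.vc (s3.gx Oy 2 [1] 0 (LX Oy 0) []) (s3.gx Oy 2 [] 1 (LN Ox) [0])"
    "dom4 PAdj TriEta = s3.gx Ox 0 [0] 1 (LN Oy) []"
    "cod4 PAdj TriEta = s3.vc (s3.gx Ox 0 [] 0 (LX Ox 0) [1]) (s3.gx Ox 0 [0] 0 (LN Ox) [])"
    by (simp_all only: PAdj_def Let_def prepoly3.defs prepoly4.defs gray.defs prepoly4.select_convs adj4.case free_simps
       g w 1 2 3 4 5 6)
qed

lemma dom4_PAdj:
  "dom4 PAdj (Indep e A h \<chi> e' B h') = indep_dom Adj3 e A h \<chi> e' B h'" "cod4 PAdj (Indep e A h \<chi> e' B h') = indep_cod Adj3 e A h \<chi> e' B h'"
  "dom4 PAdj (NatL A g \<beta>) = natl_dom Adj3 Inter A g \<beta>" "cod4 PAdj (NatL A g \<beta>) = natl_cod Adj3 Inter A g \<beta>"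
  "dom4 PAdj (NatR \<alpha> g A) = natr_dom Adj3 Inter \<alpha> g A" "cod4 PAdj (NatR \<alpha> g A) = natr_cod Adj3 Inter \<alpha> g A"
  by (simp_all only: PAdj_def Let_def prepoly3.defs prepoly4.defs gray.defs prepoly4.select_convs adj4.case)

text \<open>Both sides of each 4-generator are 3-cells between the same two strings, by
  \<open>hom_in\<close>, \<open>hom_nl\<close>, \<open>hom_nr\<close> and
  \<open>hom_tri\<close>.\<close>

lemma gens4_parallel:
  assumes "G \<in> gens4 PAdj"
  shows "parallel C3 3 (dom4 PAdj G) (cod4 PAdj G)"
  using assms unfolding PAdj_gens
proof (elim UnE insertE CollectE exE conjE)
  fix e A h \<chi> e' B h' assume G: "G = Indep e A h \<chi> e' B h'" and "indep_ok Adj3 e A h \<chi> e' B h'"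
  then obtain a k L r x k' L' r' where h: "e = word a k" "A = la L" "h = word (ob a (k + ll L)) r" "lb L = ob a k"
     "\<chi> = str2 a (len a (k + ll L + r) (sh k (ls L))) x" "ok a (len a (k + ll L + r) (sh k (ls L))) x"
     "e' = word a k'" "B = la L'" "h' = word (ob a (k' + ll L')) r'" "lb L' = ob a k'"
     "k' + ll L' + r' = len a (len a (k + ll L + r) (sh k (ls L))) x" unfolding indep_ok_iff by blast
  note i = indep_sides[OF h(4,10) refl h(6) refl h(11)]
  show ?thesis
    unfolding G dom4_PAdj h(1-3,5,7-9) i
    by (rule s3.hom_parallel[OF s3.hom_in[OF h(4) _ h(6,10)]]) (simp_all flip: h(11))
next
  fix A g \<beta> assume G: "G = NatL A g \<beta>" and "natl_ok Adj3 A g \<beta>"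
  then obtain L m where h: "A = la L" "g = word (ob (lb L) (ll L)) m" "\<beta> = tp (ob (lb L) (ll L + m))"
    unfolding natl_ok_iff by blast
  have "ob (lb L) (ll L + m) = ob (ob (lb L) (ll L)) m" by simp
  note i = natl_sides[OF refl this]
  show ?thesis unfolding G dom4_PAdj h i by (rule s3.hom_parallel[OF s3.hom_nl])
next
  fix \<alpha> g A assume G: "G = NatR \<alpha> g A" and "natr_ok Adj3 \<alpha> g A"
  then obtain L a m where h: "\<alpha> = tp a" "g = word a m" "A = la L" "lb L = ob a m"
    unfolding natr_ok_iff by blast
  show ?thesis unfolding G dom4_PAdj h(1-3) natr_sides[OF h(4)] by (rule s3.hom_parallel[OF s3.hom_nr[OF h(4)]])
next
  assume "G = TriEps"
  then show ?thesis using s3.hom_parallel[OF s3.hom_tri(1,2)] by (simp add: tri_sides)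
next
  assume "G = TriEta"
  then show ?thesis using s3.hom_parallel[OF s3.hom_tri(3,4)] by (simp add: tri_sides)
qed auto

lemma gray_PAdj: "gray_presentation PAdj"
  unfolding gray_presentation_def prepolygraph4_def
proof (intro conjI allI impI ballI)
  show "parallel (free0 PAdj) 0 (dom1 PAdj a) (cod1 PAdj a)" for a by (simp add: parallel_def)
  show "parallel (free1 PAdj) 1 (dom2 PAdj a) (cod2 PAdj a)" if "a \<in> gens2 PAdj" for a using e2.gens[of a] by simp
  show "parallel (free2 PAdj) 2 (dom3 PAdj a) (cod3 PAdj a)" if "a \<in> gens3 PAdj" for a using e3.gens[of a] that by simp
  show "parallel (free3 PAdj) 3 (dom4 PAdj a) (cod4 PAdj a)" if "a \<in> gens4 PAdj" for a using gens4_parallel[OF that] by simp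
next
  fix \<alpha> g \<beta> assume "inter_ok PAdj \<alpha> g \<beta>"
  then obtain a m where h: "\<alpha> = tp a" "g = word a m" "\<beta> = tp (ob a m)" by (auto simp: inter_ok_iff)
  have e: "Inter (tp a) (word a m) (tp (ob a m)) = la (LX a m)" by simp
  show "inter_gen PAdj \<alpha> g \<beta> \<in> gens3 PAdj" unfolding h PAdj_gens e by (simp only: PAdj_simps gens3_Adj3 rangeI)
  show "dom3 PAdj (inter_gen PAdj \<alpha> g \<beta>) = inter_dom PAdj \<alpha> g \<beta>"
    unfolding h PAdj_gens e PAdj_simps PAdj_eqs dom3_la inter_dom ..
  show "cod3 PAdj (inter_gen PAdj \<alpha> g \<beta>) = inter_cod PAdj \<alpha> g \<beta>"
    unfolding h PAdj_gens e PAdj_simps PAdj_eqs dom3_la inter_cod ..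
next
  fix e A h \<chi> e' B h' assume i: "indep_ok PAdj e A h \<chi> e' B h'"
  show "indep_gen PAdj e A h \<chi> e' B h' \<in> gens4 PAdj" using i unfolding PAdj_gens PAdj_eqs by blast
  show "dom4 PAdj (indep_gen PAdj e A h \<chi> e' B h') = indep_dom PAdj e A h \<chi> e' B h'"
    "cod4 PAdj (indep_gen PAdj e A h \<chi> e' B h') = indep_cod PAdj e A h \<chi> e' B h'"
    unfolding PAdj_gens PAdj_eqs dom4_PAdj by (rule refl)+
next
  fix A g \<beta> assume i: "natl_ok PAdj A g \<beta>"
  show "natl_gen PAdj A g \<beta> \<in> gens4 PAdj" using i unfolding PAdj_gens PAdj_eqs by blast
  show "dom4 PAdj (natl_gen PAdj A g \<beta>) = natl_dom PAdj (inter_gen PAdj) A g \<beta>"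
    "cod4 PAdj (natl_gen PAdj A g \<beta>) = natl_cod PAdj (inter_gen PAdj) A g \<beta>"
    unfolding PAdj_gens PAdj_eqs dom4_PAdj by (rule refl)+
next
  fix \<alpha> g B assume i: "natr_ok PAdj \<alpha> g B"
  show "natr_gen PAdj \<alpha> g B \<in> gens4 PAdj" using i unfolding PAdj_gens PAdj_eqs by blast
  show "dom4 PAdj (natr_gen PAdj \<alpha> g B) = natr_dom PAdj (inter_gen PAdj) \<alpha> g B"
    "cod4 PAdj (natr_gen PAdj \<alpha> g B) = natr_cod PAdj (inter_gen PAdj) \<alpha> g B"
    unfolding PAdj_gens PAdj_eqs dom4_PAdj by (rule refl)+
qed

section \<open>Formal inverses, the canonical morphism, and induction over localized 3-cells\<close>

section \<open>Localization\<close>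

lemma (in precat) law_cell:
  assumes "pc_law C n u v"
  shows "u \<in> cells C n"
proof -
  obtain m where "n = Suc m" using law_pos[OF assms] by (cases n) auto
  from law_parallel[OF this assms law[OF less_imp_le]] show ?thesis by (simp add: parallel_def)
qed

locale loc = precat 3 C for C :: "'c precat"
begin

abbreviation "LS \<equiv> cells C 3 <+> cells C 3"
abbreviation "Ls \<equiv> case_sum (src C 2) (tgt C 2)"
abbreviation "Lt \<equiv> case_sum (tgt C 2) (src C 2)"

sublocale ext: extension 2 C LS Ls Lt
proof
  show "precategory 2 C" using precat_axioms precategory_mono[of 3 C 2] by (simp add: precat_iff)
  have "parallel C 2 (src C 2 u) (tgt C 2 u)" if "u \<in> cells C 3" for u
    using that globular[of u 1] src_cell[of u 2] tgt_cell[of u 2] by (simp add: parallel_def)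
  then show "parallel C 2 (Ls g) (Lt g)" if "g \<in> LS" for g
    using that by (auto simp: parallel_def)
qed

lemma LS_simps [simp]: "Inl u \<in> LS \<longleftrightarrow> u \<in> cells C 3" "Inr u \<in> LS \<longleftrightarrow> u \<in> cells C 3"
  by auto

lemma loc_eqs: "loc_free 3 C = ext.E" "loc_gen 3 C = ext.gc"
  "loc_map 3 C k u = (if k = 3 then ext.gc (Inl u) else up u)"
proof -
  have e: "(3::nat) - 1 = 2" by simp
  show 1: "loc_free 3 C = ext.E" "loc_gen 3 C = ext.gc"
    unfolding loc_free_def loc_gen_def e by (rule refl)+
  show "loc_map 3 C k u = (if k = 3 then ext.gc (Inl u) else up u)"
    by (simp add: loc_map_def 1)
qed

sublocale E: precat 3 ext.E
  using ext.E_precategory by (simp add: precat_iff)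

abbreviation "lm \<equiv> loc_map 3 C"

lemma lm_low: "k \<le> 2 \<Longrightarrow> lm k u = up u"
  by (simp add: loc_eqs)

lemma gc3: "g \<in> LS \<Longrightarrow> ext.gc g \<in> cells ext.E 3" "g \<in> LS \<Longrightarrow> src ext.E 2 (ext.gc g) = up (Ls g)"
  "g \<in> LS \<Longrightarrow> tgt ext.E 2 (ext.gc g) = up (Lt g)"
  using ext.gc_cell[of g] ext.src_gc[of g] ext.tgt_gc[of g] by simp_all

lemma lm_3: "u \<in> cells C 3 \<Longrightarrow> lm 3 u \<in> cells ext.E 3" "u \<in> cells C 3 \<Longrightarrow> src ext.E 2 (lm 3 u) = up (src C 2 u)"
  "u \<in> cells C 3 \<Longrightarrow> tgt ext.E 2 (lm 3 u) = up (tgt C 2 u)"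
  using gc3[of "Inl u"] by (simp_all add: loc_eqs)

lemma lm_cell: "u \<in> cells C k \<Longrightarrow> k \<le> 3 \<Longrightarrow> lm k u \<in> cells ext.E k"
  using lm_3(1)[of u] ext.cells_E[of k] by (cases "k = 3") (auto simp: lm_low)

lemma lm_src: "u \<in> cells C (Suc i) \<Longrightarrow> i < 3 \<Longrightarrow> src ext.E i (lm (Suc i) u) = lm i (src C i u)"
  and lm_tgt: "u \<in> cells C (Suc i) \<Longrightarrow> i < 3 \<Longrightarrow> tgt ext.E i (lm (Suc i) u) = lm i (tgt C i u)"
proof -
  assume u: "u \<in> cells C (Suc i)" "i < 3"
  have "src ext.E i (lm (Suc i) u) = lm i (src C i u) \<and> tgt ext.E i (lm (Suc i) u) = lm i (tgt C i u)"
  proof (cases "i = 2")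
    case True
    then show ?thesis using lm_3[of u] u by (simp add: lm_low)
  next
    case False
    then show ?thesis
      using pmorph_src[OF ext.pmorph_up, of i u] pmorph_tgt[OF ext.pmorph_up, of i u] u by (simp add: lm_low)
  qed
  then show "src ext.E i (lm (Suc i) u) = lm i (src C i u)" "tgt ext.E i (lm (Suc i) u) = lm i (tgt C i u)"
    by auto
qed

lemma lm_srcs: "u \<in> cells C k \<Longrightarrow> i \<le> k \<Longrightarrow> k \<le> 3 \<Longrightarrow> srcs ext.E k i (lm k u) = lm i (srcs C k i u)"
proof (induction k arbitrary: u)
  case (Suc k)
  then show ?case by (cases "i = Suc k") (auto simp: srcs_Suc lm_src src_cell)
qed (simp add: srcs_self)

lemma lm_tgts: "u \<in> cells C k \<Longrightarrow> i \<le> k \<Longrightarrow> k \<le> 3 \<Longrightarrow> tgts ext.E k i (lm k u) = lm i (tgts C k i u)"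
proof (induction k arbitrary: u)
  case (Suc k)
  then show ?case by (cases "i = Suc k") (auto simp: tgts_Suc lm_tgt tgt_cell)
qed (simp add: tgts_self)

lemma lm_composable:
  assumes "composable C k l u v" "k \<le> 3" "l \<le> 3"
  shows "composable ext.E k l (lm k u) (lm l v)"
  using assms lm_cell lm_tgts[of u k "min k l - 1"] lm_srcs[of v l "min k l - 1"]
  unfolding composable_def by auto

text \<open>Parallelism lets the localizing relations generate a congruence. In the case of
  composites the boundaries are compared through the inclusion \<open>up\<close>, which is a
  morphism below dimension 3.\<close>

lemma loc_law_parallel: "loc_law 3 C x y \<Longrightarrow> parallel ext.E 3 x y"
proof (induction rule: loc_law.induct)
  case (1 a)
  have a: "a \<in> cells C 2" using 1 by simp
  have u: "up a \<in> cells ext.E 2" using a ext.cells_E[of 2] by simp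
  show ?case
    using lm_3[of "idc C 2 a"] id_cell[of a 2] src_id[of a 2] tgt_id[of a 2] a
      E.id_cell[of "up a" 2] E.src_id[of "up a" 2] E.tgt_id[of "up a" 2] u
    by (simp add: parallel_def loc_eqs(1))
next
  case (2 k l u v)
  have kl: "k \<le> 3" "l \<le> 3" using 2 by auto
  note com = 2(2) lm_composable[OF 2(2) kl]
  have cell: "cmp C k l u v \<in> cells C 3" using cmp_cell[OF 2(2) kl] 2 by simp
  have cell': "cmp ext.E k l (lm k u) (lm l v) \<in> cells ext.E 3" using E.cmp_cell[OF com(2) kl] 2(1) by simp
  have "0 < k" "0 < l" using com by (auto simp: composable_def)
  then consider "k = 3" "l = 3" | "k \<le> 2" "l = Suc 2" "l = 3" | "l \<le> 2" "k = Suc 2" "k = 3" using 2(1) by fastforce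
  then have "src ext.E 2 (cmp ext.E k l (lm k u) (lm l v)) = up (src C 2 (cmp C k l u v)) \<and>
    tgt ext.E 2 (cmp ext.E k l (lm k u) (lm l v)) = up (tgt C 2 (cmp C k l u v))"
  proof cases
    case 1
    then show ?thesis using com src_cmp_eq[of 2 u v] E.src_cmp_eq[of 2 "lm 3 u" "lm 3 v"]
      by (simp add: lm_3 composable_def)
  next
    case 2
    note c = com(1)[unfolded 2(2)] com(2)[unfolded 2(2)]
    have v: "v \<in> cells C 3" using com 2 by (simp add: composable_def)
    note e = composable_less[OF c(1) 2(1), simplified]
    show ?thesis
      using src_cmp_less[OF c(1) 2(1)] E.src_cmp_less[OF c(2) 2(1)] v 2
        pmorph_cmp_le[OF ext.pmorph_up 2(1) _ e(1)] pmorph_cmp_le[OF ext.pmorph_up 2(1) _ e(2)]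
      by (simp add: lm_3 lm_low)
  next
    case 3
    note c = com(1)[unfolded 3(2)] com(2)[unfolded 3(2)]
    have u: "u \<in> cells C 3" using com 3 by (simp add: composable_def)
    note e = composable_greater[OF c(1) 3(1), simplified]
    show ?thesis
      using src_cmp_greater[OF c(1) 3(1)] E.src_cmp_greater[OF c(2) 3(1)] u 3
        pmorph_cmp_ge[OF ext.pmorph_up 3(1) _ e(1)] pmorph_cmp_ge[OF ext.pmorph_up 3(1) _ e(2)]
      by (simp add: lm_3 lm_low)
  qed
  then show ?case using lm_3[OF cell] cell' by (simp add: parallel_def loc_eqs(1))
next
  case (3 u)
  have c: "composable ext.E 3 3 (ext.gc (Inl u)) (ext.gc (Inr u))"
    using 3 gc3[of "Inl u"] gc3[of "Inr u"] by (simp add: composable_33)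
  have u: "up (src C 2 u) \<in> cells ext.E 2" using 3 ext.cells_E[of 2] src_cell[of u 2] by simp
  show ?case
    using 3 gc3[of "Inl u"] gc3[of "Inr u"] E.cmp_cell_le[OF c] E.src_cmp_eq[of 2 "ext.gc (Inl u)" "ext.gc (Inr u)"] c
      E.id_cell[OF u] E.src_id[OF u] E.tgt_id[OF u]
    by (simp add: parallel_def loc_eqs(1,2))
next
  case (4 u)
  have c: "composable ext.E 3 3 (ext.gc (Inr u)) (ext.gc (Inl u))"
    using 4 gc3[of "Inl u"] gc3[of "Inr u"] by (simp add: composable_33)
  have u: "up (tgt C 2 u) \<in> cells ext.E 2" using 4 ext.cells_E[of 2] tgt_cell[of u 2] by simp
  show ?case
    using 4 gc3[of "Inl u"] gc3[of "Inr u"] E.cmp_cell_le[OF c] E.src_cmp_eq[of 2 "ext.gc (Inr u)" "ext.gc (Inl u)"] c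
      E.id_cell[OF u] E.src_id[OF u] E.tgt_id[OF u]
    by (simp add: parallel_def loc_eqs(1,2))
qed

abbreviation "LR \<equiv> least_congruence 3 ext.E (loc_law 3 C)"

text \<open>The free extension is already a precategory, so its laws lie in the relation by
  reflexivity.\<close>

sublocale lq: quotient 3 ext.E LR
proof
  show "congruence 3 ext.E LR" by (rule E.least_congruence) (simp_all add: loc_law_parallel)
  show "k < 3 \<Longrightarrow> pc_law ext.E k u v \<Longrightarrow> u = v" for k u v using E.law[of k u v] by simp
  show "(u, v) \<in> LR" if "pc_law ext.E 3 u v" for u v
  proof -
    have "u \<in> cells ext.E 3" using E.law_cell that by simp
    moreover have "u = v" using E.law[OF order_refl that] .
    ultimately show ?thesis using \<open>congruence 3 ext.E LR\<close> unfolding congruence_def equiv_def refl_on_def by auto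
  qed
qed simp

abbreviation "L \<equiv> localization 3 C"

lemma L_eq: "L = lq.Q"
  by (simp add: localization_def loc_eqs)

lemma L_precat: "precat 3 L"
  using lq.Q_precategory by (simp add: L_eq precat_iff)

text \<open>The canonical morphism to the localization; below dimension 3 it is an injective
  relabelling.\<close>

definition J :: "nat \<Rightarrow> 'c \<Rightarrow> _" where "J k u = lq.q k (lm k u)"

lemma J_low: "k \<le> 2 \<Longrightarrow> J k u = {up u}"
  by (simp add: J_def qclass_def lm_low)

lemma law_J: "loc_law 3 C x y \<Longrightarrow> lq.q 3 x = lq.q 3 y"
  using least_congruence_contains[of "loc_law 3 C" x y 3 ext.E] equiv_class_eq[OF lq.R_equiv]
  by (simp add: qclass_def)

lemma J_pmorph: "pmorph 3 C L J"
  unfolding pmorph_def L_eq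
proof (intro conjI allI ballI impI)
  fix k u assume "k \<le> 3" "u \<in> cells C k"
  then show "J k u \<in> cells lq.Q k" by (simp add: J_def lq.cells_Q lm_cell)
next
  fix i u assume "i < 3" "u \<in> cells C (Suc i)"
  then show "src lq.Q i (J (Suc i) u) = J i (src C i u)" "tgt lq.Q i (J (Suc i) u) = J i (tgt C i u)"
    by (simp_all add: J_def lq.src_Q lq.tgt_Q lm_cell lm_src lm_tgt)
next
  fix k u assume k: "k < 3" "u \<in> cells C k"
  have "J (Suc k) (idc C k u) = lq.q (Suc k) (idc ext.E k (lm k u))"
  proof (cases "k = 2")
    case True
    then show ?thesis using law_J[OF loc_law.intros(1)[of u C 3, simplified]] k by (simp add: J_def lm_low loc_eqs(1))
  next
    case False
    then show ?thesis using k pmorph_idc[OF ext.pmorph_up, of k u] by (simp add: J_def lm_low)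
  qed
  then show "J (Suc k) (idc C k u) = idc lq.Q k (J k u)"
    using k by (simp add: J_def lq.id_Q lm_cell)
next
  fix k l u v assume kl: "k \<le> 3" "l \<le> 3" and com: "composable C k l u v"
  have "J (max k l) (cmp C k l u v) = lq.q (max k l) (cmp ext.E k l (lm k u) (lm l v))"
  proof (cases "max k l = 3")
    case True
    then show ?thesis using law_J[OF loc_law.intros(2)[OF True com]] by (simp add: J_def loc_eqs(1))
  next
    case False
    then have "k \<le> 2" "l \<le> 2" using kl by auto
    then show ?thesis using pmorph_cmp[OF ext.pmorph_up _ _ com] by (simp add: J_def lm_low)
  qed
  then show "J (max k l) (cmp C k l u v) = cmp lq.Q k l (J k u) (J l v)"
    using lq.cmp_Q[OF lm_composable[OF com kl] kl] by (simp add: J_def)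
qed

lemma J_inverse:
  assumes u: "u \<in> cells C 3"
  shows "lq.q 3 (ext.gc (Inr u)) \<in> cells L 3"
    "cmp L 3 3 (J 3 u) (lq.q 3 (ext.gc (Inr u))) = idc L 2 (J 2 (src C 2 u))"
    "cmp L 3 3 (lq.q 3 (ext.gc (Inr u))) (J 3 u) = idc L 2 (J 2 (tgt C 2 u))"
    "src L 2 (lq.q 3 (ext.gc (Inr u))) = J 2 (tgt C 2 u)" "tgt L 2 (lq.q 3 (ext.gc (Inr u))) = J 2 (src C 2 u)"
proof -
  have g: "ext.gc (Inl u) \<in> cells ext.E 3" "ext.gc (Inr u) \<in> cells ext.E 3" using gc3 u by auto
  have up2: "up (src C 2 u) \<in> cells ext.E 2" "up (tgt C 2 u) \<in> cells ext.E 2"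
    using u ext.cells_E[of 2] src_cell[of u 2] tgt_cell[of u 2] by simp_all
  show "lq.q 3 (ext.gc (Inr u)) \<in> cells L 3" using g by (simp add: L_eq lq.cells_Q)
  have c: "composable ext.E 3 3 (ext.gc (Inl u)) (ext.gc (Inr u))" "composable ext.E 3 3 (ext.gc (Inr u)) (ext.gc (Inl u))"
    using u gc3[of "Inl u"] gc3[of "Inr u"] by (simp_all add: composable_33)
  have i: "idc lq.Q 2 (lq.q 2 x) = lq.q 3 (idc ext.E 2 x)" if "x \<in> cells ext.E 2" for x
    using lq.id_Q[OF that] by simp
  show "cmp L 3 3 (J 3 u) (lq.q 3 (ext.gc (Inr u))) = idc L 2 (J 2 (src C 2 u))"
    using law_J[OF loc_law.intros(3)[OF u]] lq.cmp_Q[OF c(1)] i[OF up2(1)]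
    by (simp add: J_def L_eq loc_eqs)
  show "cmp L 3 3 (lq.q 3 (ext.gc (Inr u))) (J 3 u) = idc L 2 (J 2 (tgt C 2 u))"
    using law_J[OF loc_law.intros(4)[OF u]] lq.cmp_Q[OF c(2)] i[OF up2(2)]
    by (simp add: J_def L_eq loc_eqs)
  show "src L 2 (lq.q 3 (ext.gc (Inr u))) = J 2 (tgt C 2 u)" "tgt L 2 (lq.q 3 (ext.gc (Inr u))) = J 2 (src C 2 u)"
    using lq.src_Q[of "ext.gc (Inr u)" 2] lq.tgt_Q[of "ext.gc (Inr u)" 2] g gc3[of "Inr u"] u
    by (simp_all add: J_def L_eq lm_low)
qed

text \<open>For a formal inverse the property of the inverted 3-cell is available, together with
  both inverse laws. Lower cells are taken from \<open>C\<close>, since localizing leaves these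
  dimensions unchanged.\<close>

lemma L_induct [consumes 1, case_names base inv ident left right comp]:
  assumes x: "x \<in> cells L 3"
    and b: "\<And>u. u \<in> cells C 3 \<Longrightarrow> P (J 3 u)"
    and v: "\<And>u x. u \<in> cells C 3 \<Longrightarrow> P (J 3 u) \<Longrightarrow> x \<in> cells L 3 \<Longrightarrow> src L 2 x = J 2 (tgt C 2 u) \<Longrightarrow>
      tgt L 2 x = J 2 (src C 2 u) \<Longrightarrow> cmp L 3 3 (J 3 u) x = idc L 2 (J 2 (src C 2 u)) \<Longrightarrow>
      cmp L 3 3 x (J 3 u) = idc L 2 (J 2 (tgt C 2 u)) \<Longrightarrow> P x"
    and i: "\<And>c. c \<in> cells C 2 \<Longrightarrow> P (idc L 2 (J 2 c))"
    and l: "\<And>k c u. k \<le> 2 \<Longrightarrow> c \<in> cells C k \<Longrightarrow> u \<in> cells L 3 \<Longrightarrow> P u \<Longrightarrow>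
      composable L k 3 (J k c) u \<Longrightarrow> P (cmp L k 3 (J k c) u)"
    and r: "\<And>k c u. k \<le> 2 \<Longrightarrow> c \<in> cells C k \<Longrightarrow> u \<in> cells L 3 \<Longrightarrow> P u \<Longrightarrow>
      composable L 3 k u (J k c) \<Longrightarrow> P (cmp L 3 k u (J k c))"
    and c: "\<And>u v. u \<in> cells L 3 \<Longrightarrow> v \<in> cells L 3 \<Longrightarrow> P u \<Longrightarrow> P v \<Longrightarrow>
      composable L 3 3 u v \<Longrightarrow> P (cmp L 3 3 u v)"
  shows "P x"
proof -
  have mem: "lq.q 3 y \<in> cells L 3" if "y \<in> cells ext.E 3" for y using that by (simp add: L_eq lq.cells_Q)
  have Jq: "lq.q k (up d) = J k d" if "k \<le> 2" for k d using that by (simp add: J_def lm_low)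
  have "P (lq.q 3 y)" if "y \<in> cells ext.E (Suc 2)" for y
    using that
  proof (induction rule: ext.E_induct)
    case (gen g)
    then show ?case
    proof
      fix u assume g: "g = Inl u" and u: "u \<in> cells C 3"
      then show ?thesis using b[OF u] by (simp add: J_def loc_eqs)
    next
      fix u assume g: "g = Inr u" and u: "u \<in> cells C 3"
      then show ?thesis using v[OF u b[OF u] J_inverse(1,4,5,2,3)[OF u]] by simp
    qed
  next
    case (ident d)
    have "up d \<in> cells ext.E 2" using ident ext.cells_E[of 2] by simp
    then show ?case using i[OF ident] lq.id_Q[of "up d" 2] by (simp add: L_eq Jq)
  next
    case (left k d y)
    have y: "y \<in> cells ext.E 3" "composable ext.E k 3 (up d) y" using left.hyps by simp_all
    have u: "up d \<in> cells ext.E k" using left.hyps ext.cells_E[of k] by simp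
    have k: "k \<le> 2" "k \<le> 3" using left.hyps by simp_all
    have "composable L k 3 (J k d) (lq.q 3 y)"
      using lq.composable_Q[OF u y(1) k(2)] y(2) k by (simp add: L_eq Jq)
    then have "P (cmp L k 3 (J k d) (lq.q 3 y))" using l[OF k(1)] left mem[OF y(1)] by blast
    moreover have "cmp L k 3 (J k d) (lq.q 3 y) = lq.q 3 (cmp ext.E k 3 (up d) y)"
      using lq.cmp_Q[OF y(2) k(2)] k by (simp add: L_eq Jq max_absorb2)
    ultimately show ?case by simp
  next
    case (right k d y)
    have y: "y \<in> cells ext.E 3" "composable ext.E 3 k y (up d)" using right.hyps by simp_all
    have u: "up d \<in> cells ext.E k" using right.hyps ext.cells_E[of k] by simp
    have k: "k \<le> 2" "k \<le> 3" using right.hyps by simp_all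
    have "composable L 3 k (lq.q 3 y) (J k d)"
      using lq.composable_Q[OF y(1) u _ k(2)] y(2) k by (simp add: L_eq Jq)
    then have "P (cmp L 3 k (lq.q 3 y) (J k d))" using r[OF k(1)] right mem[OF y(1)] by blast
    moreover have "cmp L 3 k (lq.q 3 y) (J k d) = lq.q 3 (cmp ext.E 3 k y (up d))"
      using lq.cmp_Q[OF y(2) _ k(2)] k by (simp add: L_eq Jq max_absorb1)
    ultimately show ?case by simp
  next
    case (comp y z)
    have y: "y \<in> cells ext.E 3" "z \<in> cells ext.E 3" "composable ext.E 3 3 y z" using comp.hyps by simp_all
    have "composable L 3 3 (lq.q 3 y) (lq.q 3 z)"
      using lq.composable_Q[OF y(1,2)] y(3) by (simp add: L_eq)
    then have "P (cmp L 3 3 (lq.q 3 y) (lq.q 3 z))" using c comp.IH mem y by blast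
    moreover have "cmp L 3 3 (lq.q 3 y) (lq.q 3 z) = lq.q 3 (cmp ext.E 3 3 y z)"
      using lq.cmp_Q[OF y(3)] by (simp add: L_eq)
    ultimately show ?case by simp
  qed
  moreover obtain y where "x = lq.q 3 y" "y \<in> cells ext.E 3" using x by (auto simp: L_eq lq.cells_Q)
  ultimately show ?thesis by simp
qed

end

section \<open>From free 3-cells to the localized presented precategory\<close>

section \<open>The localization of the presented precategory\<close>

interpretation qp: quotient 3 C3 "least_congruence 3 C3 (gen4_rel PAdj)"
proof
  have p: "parallel C3 3 u v" if "gen4_rel PAdj u v" for u v
    using that by cases (simp add: gens4_parallel)
  show cong: "congruence 3 C3 (least_congruence 3 C3 (gen4_rel PAdj))"
    by (rule c3.least_congruence) (simp_all add: p)
  show "k < 3 \<Longrightarrow> pc_law C3 k u v \<Longrightarrow> u = v" for k u v using c3.law[of k u v] by simp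
  show "(u, v) \<in> least_congruence 3 C3 (gen4_rel PAdj)" if "pc_law C3 3 u v" for u v
  proof -
    have "u \<in> cells C3 3" using c3.law_cell that by simp
    moreover have "u = v" using c3.law[OF order_refl that] .
    ultimately show ?thesis using cong unfolding congruence_def equiv_def refl_on_def by auto
  qed
qed simp

lemma presented_eq: "presented PAdj = qp.Q"
  by (simp add: presented_def)

interpretation pl: loc "presented PAdj"
  using qp.Q_precategory by (simp add: loc_def presented_eq precat_iff)

definition JJ where "JJ k u = pl.J k (qp.q k u)"

abbreviation "LL \<equiv> localization 3 (presented PAdj)"

lemma JJ_pmorph: "pmorph 3 C3 LL JJ"
  unfolding JJ_def using c3.pmorph_comp[OF qp.pmorph_q pl.J_pmorph[unfolded presented_eq]] by (simp add: presented_eq)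

lemma JJ_low: "k \<le> 2 \<Longrightarrow> JJ k u = {up {u}}"
  by (simp add: JJ_def pl.J_low qclass_def)

lemma JJ_rel:
  assumes "G \<in> gens4 PAdj"
  shows "JJ 3 (dom4 PAdj G) = JJ 3 (cod4 PAdj G)"
proof -
  have "gen4_rel PAdj (dom4 PAdj G) (cod4 PAdj G)" using assms by (rule gen4_rel.intros)
  then have "(dom4 PAdj G, cod4 PAdj G) \<in> least_congruence 3 C3 (gen4_rel PAdj)"
    by (rule least_congruence_contains)
  then have "qp.q 3 (dom4 PAdj G) = qp.q 3 (cod4 PAdj G)"
    using equiv_class_eq[OF qp.R_equiv] by (simp add: qclass_def)
  then show ?thesis by (simp add: JJ_def)
qed

text \<open>The inductions over free 3-cells, their quotient and the localization are combined: the
  3-generators are the base case, while inverses are those of arbitrary images of free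
  3-cells.\<close>

lemma LL_induct [consumes 1, case_names gen inv ident left right comp]:
  assumes x: "x \<in> cells LL 3"
    and g: "\<And>A. P (JJ 3 (g3 A))"
    and v: "\<And>u x. u \<in> cells C3 3 \<Longrightarrow> P (JJ 3 u) \<Longrightarrow> x \<in> cells LL 3 \<Longrightarrow> src LL 2 x = JJ 2 (tgt C3 2 u) \<Longrightarrow>
      tgt LL 2 x = JJ 2 (src C3 2 u) \<Longrightarrow> cmp LL 3 3 (JJ 3 u) x = idc LL 2 (JJ 2 (src C3 2 u)) \<Longrightarrow>
      cmp LL 3 3 x (JJ 3 u) = idc LL 2 (JJ 2 (tgt C3 2 u)) \<Longrightarrow> P x"
    and i: "\<And>c. c \<in> cells C3 2 \<Longrightarrow> P (idc LL 2 (JJ 2 c))"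
    and l: "\<And>k c u. k \<le> 2 \<Longrightarrow> c \<in> cells C3 k \<Longrightarrow> u \<in> cells LL 3 \<Longrightarrow> P u \<Longrightarrow>
      composable LL k 3 (JJ k c) u \<Longrightarrow> P (cmp LL k 3 (JJ k c) u)"
    and r: "\<And>k c u. k \<le> 2 \<Longrightarrow> c \<in> cells C3 k \<Longrightarrow> u \<in> cells LL 3 \<Longrightarrow> P u \<Longrightarrow>
      composable LL 3 k u (JJ k c) \<Longrightarrow> P (cmp LL 3 k u (JJ k c))"
    and c: "\<And>u v. u \<in> cells LL 3 \<Longrightarrow> v \<in> cells LL 3 \<Longrightarrow> P u \<Longrightarrow> P v \<Longrightarrow>
      composable LL 3 3 u v \<Longrightarrow> P (cmp LL 3 3 u v)"
  shows "P x"
proof -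
  have pc: "c \<in> cells (presented PAdj) k \<Longrightarrow> \<exists>d. d \<in> cells C3 k \<and> c = qp.q k d" for k c
    by (auto simp: presented_eq qp.cells_Q)
  \<comment> \<open>Images of free 3-cells are treated by induction over terms; for the localization
    they then act as base cells.\<close>
  have bs: "P (JJ 3 y)" if "y \<in> cells e3.E (Suc 2)" for y
    using that
  proof (induction rule: e3.E_induct)
    case (gen A)
    then obtain lab where "A = la lab" by (auto simp: gens3_Adj3)
    then show ?case using g[of lab] by (simp add: g3_def gen3_def)
  next
    case (ident d)
    have "up d \<in> cells C3 2" using ident e3.cells_E[of 2] by (simp add: C3_def)
    then show ?case using i[of "up d"] pmorph_idc[OF JJ_pmorph, of 2 "up d"] by (simp add: C3_def)
  next
    case (left k d y)
    have com: "composable C3 k 3 (up d) y" using left.hyps by (simp add: C3_def)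
    have k: "k \<le> 2" "k \<le> 3" using left.hyps by simp_all
    have y: "y \<in> cells C3 3" "up d \<in> cells C3 k" using com by (auto simp: composable_def)
    have "P (cmp LL k 3 (JJ k (up d)) (JJ 3 y))"
      using l[OF k(1) y(2) _ left.IH] pmorph_cell[OF JJ_pmorph _ y(1)] c3.pmorph_composable[OF JJ_pmorph com k(2)] by simp
    then show ?case using pmorph_cmp_le[OF JJ_pmorph k(2) _ com] by (simp add: C3_def)
  next
    case (right k d y)
    have com: "composable C3 3 k y (up d)" using right.hyps by (simp add: C3_def)
    have k: "k \<le> 2" "k \<le> 3" using right.hyps by simp_all
    have y: "y \<in> cells C3 3" "up d \<in> cells C3 k" using com by (auto simp: composable_def)
    have "P (cmp LL 3 k (JJ 3 y) (JJ k (up d)))"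
      using r[OF k(1) y(2) _ right.IH] pmorph_cell[OF JJ_pmorph _ y(1)] c3.pmorph_composable[OF JJ_pmorph com _ k(2)] by simp
    then show ?case using pmorph_cmp_ge[OF JJ_pmorph k(2) _ com] by (simp add: C3_def)
  next
    case (comp y z)
    have com: "composable C3 3 3 y z" using comp.hyps by (simp add: C3_def)
    have y: "y \<in> cells C3 3" "z \<in> cells C3 3" using com by (auto simp: composable_def)
    have "P (cmp LL 3 3 (JJ 3 y) (JJ 3 z))"
      using c[OF _ _ comp.IH] pmorph_cell[OF JJ_pmorph _ y(1)] pmorph_cell[OF JJ_pmorph _ y(2)] c3.pmorph_composable[OF JJ_pmorph com] by simp
    then show ?case using pmorph_cmp_le[OF JJ_pmorph order_refl _ com] by (simp add: C3_def)
  qed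
  have base: "P (pl.J 3 u)" if "u \<in> cells (presented PAdj) 3" for u
    using pc[OF that] bs by (auto simp: JJ_def C3_def)
  show ?thesis
    using x
  proof (induction rule: pl.L_induct)
    case (base u)
    then show ?case by (rule \<open>\<And>u. u \<in> cells (presented PAdj) 3 \<Longrightarrow> P (pl.J 3 u)\<close>)
  next
    case (inv u x)
    obtain d where d: "d \<in> cells C3 3" "u = qp.q 3 d" using pc inv.hyps(1) by blast
    have "src (presented PAdj) 2 u = qp.q 2 (src C3 2 d)" "tgt (presented PAdj) 2 u = qp.q 2 (tgt C3 2 d)"
      using qp.src_Q[of d 2] qp.tgt_Q[of d 2] d by (simp_all add: presented_eq)
    then show ?case using v[OF d(1), of x] inv d by (simp add: JJ_def)
  next
    case (ident c)
    then show ?case using pc[OF ident] i by (auto simp: JJ_def)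
  next
    case (left k c u)
    then show ?case using pc[OF left.hyps(2)] l[OF left.hyps(1) _ left.hyps(3) left.IH] by (auto simp: JJ_def)
  next
    case (right k c u)
    then show ?case using pc[OF right.hyps(2)] r[OF right.hyps(1) _ right.hyps(3) right.IH] by (auto simp: JJ_def)
  next
    case (comp u v)
    then show ?case using c by blast
  qed
qed

section \<open>Invertible 3-cells and the relations available in every context\<close>

section \<open>Coherence of invertible strings\<close>

context strings
begin

definition iso :: "adj0 \<Rightarrow> nat \<Rightarrow> nat list \<Rightarrow> nat list \<Rightarrow> 'd \<Rightarrow> 'd \<Rightarrow> bool" where
  "iso a n s t A B \<longleftrightarrow> hom a n s t A \<and> hom a n t s B \<and> vc A B = idc D 2 (S a n s) \<and> vc B A = idc D 2 (S a n t)"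

text \<open>On an invertible 3-cell this is its inverse, by \<open>iso_unique\<close>; elsewhere the
  value is arbitrary.\<close>

definition iv :: "'d \<Rightarrow> 'd" where
  "iv A = (SOME B. \<exists>a n s t. iso a n s t A B)"

lemma iso_sym: "iso a n s t A B \<Longrightarrow> iso a n t s B A"
  by (auto simp: iso_def)

lemma iso_unique:
  assumes "iso a n s t A B" "iso a' n' s' t' A B'"
  shows "B = B'"
proof -
  have e: "a' = a" "n' = n" "s' = s" "t' = t" using hom_unique assms unfolding iso_def by blast+
  have "B = vc B (vc A B')" using assms vc_id(2)[of a n t s B] unfolding iso_def e by simp
  also have "\<dots> = vc (vc B A) B'" using vc_assoc[of a n t s B t A s B'] assms unfolding iso_def e by simp
  also have "\<dots> = B'" using assms vc_id(1)[of a n t s B'] unfolding iso_def e by simp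
  finally show ?thesis .
qed

lemma iv_eq: "iso a n s t A B \<Longrightarrow> iv A = B"
  unfolding iv_def by (rule some_equality) (use iso_unique in blast)+

lemma iso_vc:
  assumes "iso a n s t A B" "iso a n t u A' B'"
  shows "iso a n s u (vc A A') (vc B' B)"
proof -
  have h: "hom a n s t A" "hom a n t s B" "hom a n t u A'" "hom a n u t B'" using assms by (auto simp: iso_def)
  have "vc (vc A A') (vc B' B) = vc A (vc (vc A' B') B)"
    using h by (simp add: vc_assoc[OF _ _ hom_vc] vc_assoc hom_vc)
  moreover have "vc (vc B' B) (vc A A') = vc B' (vc (vc B A) A')"
    using h by (simp add: vc_assoc[OF _ _ hom_vc] vc_assoc hom_vc)
  ultimately show ?thesis
    using assms h vc_id[OF h(2)] vc_id[OF h(3)] by (simp add: iso_def hom_vc)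
qed

lemma iso_id: "ok a n s \<Longrightarrow> iso a n s s (idc D 2 (S a n s)) (idc D 2 (S a n s))"
  using hom_id[of a n s] vc_id(1)[OF hom_id, of a n s] by (simp add: iso_def)

lemma iso_cx:
  assumes A: "iso (ob a k) m s t A B" and c: "ok a n ps" "k + m \<le> len a n ps" "ok a (len a n (ps @ sh k s)) qs"
  shows "iso a n (ps @ sh k s @ qs) (ps @ sh k t @ qs) (cx a n ps k m s A qs) (cx a n ps k m t B qs)"
proof -
  have h: "hom (ob a k) m s t A" "hom (ob a k) m t s B" using A by (auto simp: iso_def)
  have e: "len a n (ps @ sh k t) = len a n (ps @ sh k s)"
    using homD(6)[OF hom_prw[OF h(1) c(1,2)]] .
  have c': "ok a (len a n (ps @ sh k t)) qs" using c(3) e by simp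
  show ?thesis
    using hom_cx[OF h(1) c] hom_cx[OF h(2) c(1,2) c'] cx_vc[OF h c] cx_vc[OF h(2,1) c(1,2) c']
      cx_id[OF homD(2)[OF h(1)] c] cx_id[OF homD(3)[OF h(1)] c(1,2) c'] A
    by (simp add: iso_def)
qed

lemma cancel_left:
  assumes "iso a n s t A A'" "hom a n t u X" "hom a n s u Y"
  shows "vc A X = Y \<longleftrightarrow> X = vc A' Y"
proof -
  have h: "hom a n s t A" "hom a n t s A'" using assms by (auto simp: iso_def)
  have "vc A' (vc A X) = X" using vc_assoc[OF h(2,1) assms(2)] vc_id(1)[OF assms(2)] assms(1) by (simp add: iso_def)
  moreover have "vc A (vc A' Y) = Y" using vc_assoc[OF h assms(3)] vc_id(1)[OF assms(3)] assms(1) by (simp add: iso_def)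
  ultimately show ?thesis by auto
qed

lemma cancel_right:
  assumes "iso a n t u A A'" "hom a n s t X" "hom a n s u Y"
  shows "vc X A = Y \<longleftrightarrow> X = vc Y A'"
proof -
  have h: "hom a n t u A" "hom a n u t A'" using assms by (auto simp: iso_def)
  have "vc (vc X A) A' = X" using vc_assoc[OF assms(2) h] vc_id(2)[OF assms(2)] assms(1) by (simp add: iso_def)
  moreover have "vc (vc Y A') A = Y" using vc_assoc[OF assms(3) h(2,1)] vc_id(2)[OF assms(3)] assms(1) by (simp add: iso_def)
  ultimately show ?thesis by auto
qed

text \<open>A commuting square stays commuting when two opposite invertible sides are
  reversed.\<close>

lemma square_invert_left:
  assumes "iso a n s t A A'" "iso a n v w B B'" "hom a n t w X" "hom a n s v Y" "vc A X = vc Y B"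
  shows "vc A' Y = vc X B'"
proof -
  have "X = vc A' (vc Y B)"
    using cancel_left[OF assms(1,3) hom_vc[OF assms(4)]] assms(2,5) unfolding iso_def by blast
  also have "\<dots> = vc (vc A' Y) B"
    using vc_assoc[of a n t s A' v Y w B] assms unfolding iso_def by simp
  finally show ?thesis
    using cancel_right[OF assms(2) hom_vc[OF _ assms(4)] assms(3)] assms(1) unfolding iso_def by metis
qed

end

context gen_strings
begin

lemma cx_gx:
  assumes "lb L = ob a' (k' + k)"
    and "ok (ob a' k') n ps" "k + ll L \<le> len (ob a' k') n ps" "ok (ob a' k') (len (ob a' k') n (ps @ sh k (ls L))) qs"
    and "ok a' n' ps'" "k' + n \<le> len a' n' ps'" "ok a' (len a' n' (ps' @ sh k' (ps @ sh k (ls L) @ qs))) qs'"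
    and s: "s = ps @ sh k (ls L) @ qs"
  shows "cx a' n' ps' k' n s (gx (ob a' k') n ps k L qs) qs' = gx a' n' (ps' @ sh k' ps) (k' + k) L (sh k' qs @ qs')"
proof -
  have "hom (ob (ob a' k') k) (ll L) (ls L) (lt L) (\<gamma> L)" using \<gamma>[of L] assms(1) by simp
  from cx_cx[OF this assms(2-7)] show ?thesis by (simp add: gx_def s)
qed

lemma swap_label:
  assumes "p + dout (ob a p) \<le> q"
  obtains m where "q = p + dout (ob a p) + m" "sx a n ps p q qs = gx a n ps p (LX (ob a p) m) qs"
    "sh p (ls (LX (ob a p) m)) = [p, q]" "sh p (lt (LX (ob a p) m)) = [q - dout (ob a p) + din (ob a p), p]"
    "ll (LX (ob a p) m) = din (ob a p) + m + din (ob a q)" "ob (ob a p) m = ob a q"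
proof (rule that[of "q - p - dout (ob a p)"])
  define m where "m = q - p - dout (ob a p)"
  have q: "q = p + dout (ob a p) + m" using assms by (simp add: m_def)
  have o: "ob a (p + m) = ob a q" unfolding q by simp
  show "q = p + dout (ob a p) + (q - p - dout (ob a p))" using assms by simp
  show "sx a n ps p q qs = gx a n ps p (LX (ob a p) (q - p - dout (ob a p))) qs" by (simp add: sx_def)
  show "sh p (ls (LX (ob a p) (q - p - dout (ob a p)))) = [p, q]"
    "sh p (lt (LX (ob a p) (q - p - dout (ob a p)))) = [q - dout (ob a p) + din (ob a p), p]"
    unfolding m_def[symmetric] by (simp_all add: q)
  show "ll (LX (ob a p) (q - p - dout (ob a p))) = din (ob a p) + (q - p - dout (ob a p)) + din (ob a q)" "ob (ob a p) (q - p - dout (ob a p)) = ob a q"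
    unfolding m_def[symmetric] using o by simp_all
qed

lemma cx_sx:
  assumes le: "p + dout (ob a' (k' + p)) \<le> q"
    and o: "ok (ob a' k') n (ps @ p # q # qs)"
    and c: "ok a' n' ps'" "k' + n \<le> len a' n' ps'" "ok a' (len a' n' (ps' @ sh k' (ps @ p # q # qs))) qs'"
  shows "cx a' n' ps' k' n (ps @ p # q # qs) (sx (ob a' k') n ps p q qs) qs' = sx a' n' (ps' @ sh k' ps) (k' + p) (k' + q) (sh k' qs @ qs')"
proof -
  let ?a = "ob a' k'"
  have le': "p + dout (ob ?a p) \<le> q" using le by simp
  obtain m where m: "q = p + dout (ob ?a p) + m" "sx ?a n ps p q qs = gx ?a n ps p (LX (ob ?a p) m) qs"
    "sh p (ls (LX (ob ?a p) m)) = [p, q]" "ll (LX (ob ?a p) m) = din (ob ?a p) + m + din (ob ?a q)"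
    by (rule swap_label[OF le'])
  have "p + ll (LX (ob ?a p) m) \<le> len ?a n ps"
    using o m(1) unfolding m(4) by (auto simp: nx_def)
  moreover have "ok ?a (len ?a n (ps @ [p, q])) qs" using o by simp
  moreover have "ok ?a n ps" using o by simp
  ultimately have "cx a' n' ps' k' n (ps @ p # q # qs) (gx ?a n ps p (LX (ob ?a p) m) qs) qs' =
     gx a' n' (ps' @ sh k' ps) (k' + p) (LX (ob ?a p) m) (sh k' qs @ qs')"
    using c by (intro cx_gx) (simp_all only: m(3)[unfolded ob_ob] lb.simps ob_ob append.simps)
  moreover have "q - p - dout (ob a' (k' + p)) = m" "k' + q - (k' + p) - dout (ob a' (k' + p)) = m" using m(1) by simp_all
  ultimately show ?thesis by (simp add: sx_def m(2))
qed

end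

text \<open>The relations are assumed in the form in which the 4-generators give them, without
  surrounding context; every larger context is derived through \<open>cx_gx\<close>.\<close>

locale coherent_strings = gen_strings D F \<gamma> for D :: "'d precat" and F \<gamma> +
  assumes nat_left: "nl1 A m = nl2 A m"
    and nat_right: "lb B = ob a m \<Longrightarrow> nr1 a m B = nr2 a m B"
    and indep: "lb A = ob a k \<Longrightarrow> k + ll A \<le> N \<Longrightarrow> ok a (len a N (sh k (ls A))) x \<Longrightarrow> lb B = ob a k' \<Longrightarrow>
      k' + ll B \<le> len a (len a N (sh k (ls A))) x \<Longrightarrow> in1 a N k A x k' B = in2 a N k A x k' B"
    and tri_eps: "gx Oy 2 [] 0 (LN Oy) [0] = vc (gx Oy 2 [1] 0 (LX Oy 0) []) (gx Oy 2 [] 1 (LN Ox) [0])"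
    and tri_eta: "gx Ox 0 [0] 1 (LN Oy) [] = vc (gx Ox 0 [] 0 (LX Ox 0) [1]) (gx Ox 0 [0] 0 (LN Ox) [])"
    and \<gamma>_iso: "\<exists>B. iso (lb A) (ll A) (ls A) (lt A) (\<gamma> A) B"
begin

lemma iso_gx:
  assumes "lb L = ob a k" "ok a n ps" "k + ll L \<le> len a n ps" "ok a (len a n (ps @ sh k (ls L))) qs"
  shows "iso a n (ps @ sh k (ls L) @ qs) (ps @ sh k (lt L) @ qs) (gx a n ps k L qs) (iv (gx a n ps k L qs))"
proof -
  obtain B where "iso (ob a k) (ll L) (ls L) (lt L) (\<gamma> L) B" using \<gamma>_iso[of L] assms(1) by auto
  from iso_cx[OF this assms(2-4)] show ?thesis unfolding gx_def using iv_eq by simp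
qed

lemma iso_sx:
  assumes "ok a n (ps @ p # q # qs)" "p + dout (ob a p) \<le> q"
  shows "iso a n (ps @ p # q # qs) (ps @ (q - dout (ob a p) + din (ob a p)) # p # qs) (sx a n ps p q qs) (iv (sx a n ps p q qs))"
proof -
  obtain m where m: "q = p + dout (ob a p) + m" "sx a n ps p q qs = gx a n ps p (LX (ob a p) m) qs"
    "sh p (ls (LX (ob a p) m)) = [p, q]" "sh p (lt (LX (ob a p) m)) = [q - dout (ob a p) + din (ob a p), p]"
    "ll (LX (ob a p) m) = din (ob a p) + m + din (ob a q)"
    by (rule swap_label[OF assms(2)])
  have "p + ll (LX (ob a p) m) \<le> len a n ps" using assms(1) m(1) unfolding m(5) by (auto simp: nx_def)
  then show ?thesis using iso_gx[of "LX (ob a p) m" a p n ps qs] assms(1) unfolding m(2-4) by simp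
qed

subsection \<open>Local relations\<close>

lemma len_cx:
  assumes "hom (ob a k) m s t A" "ok a n ps" "k + m \<le> len a n ps"
  shows "len a n (ps @ sh k t) = len a n (ps @ sh k s)"
  using homD(6)[OF hom_prw[OF assms]] .

lemma cx_vc3:
  assumes h: "hom (ob a k) m s t A" "hom (ob a k) m t u B" "hom (ob a k) m u v E"
    and c: "ok a n ps" "k + m \<le> len a n ps" "ok a (len a n (ps @ sh k s)) qs"
  shows "cx a n ps k m s (vc A (vc B E)) qs = vc (cx a n ps k m s A qs) (vc (cx a n ps k m t B qs) (cx a n ps k m u E qs))"
    "ok a (len a n (ps @ sh k t)) qs" "ok a (len a n (ps @ sh k u)) qs"
proof -
  have e: "len a n (ps @ sh k t) = len a n (ps @ sh k s)" "len a n (ps @ sh k u) = len a n (ps @ sh k t)"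
    using len_cx[OF h(1) c(1,2)] len_cx[OF h(2) c(1,2)] .
  show c': "ok a (len a n (ps @ sh k t)) qs" "ok a (len a n (ps @ sh k u)) qs" unfolding e by (fact c(3))+
  show "cx a n ps k m s (vc A (vc B E)) qs = vc (cx a n ps k m s A qs) (vc (cx a n ps k m t B qs) (cx a n ps k m u E qs))"
    unfolding cx_vc[OF h(1) hom_vc[OF h(2,3)] c] cx_vc[OF h(2,3) c(1,2) c'(1)] ..
qed

text \<open>Naturality of the interchanger of the first two generators with respect to the third, on
  the smallest word. The gaps are \<open>m1\<close> and \<open>m2\<close>; both ways around reverse
  the order of the three generators, and the defined numbers are the positions met on the
  way.\<close>

lemma hexagon_0:
  fixes b :: adj0 and m1 m2 :: nat
  defines "q \<equiv> dout b + m1" and "r \<equiv> dout b + m1 + dout (ob b m1) + m2"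
    and "q1 \<equiv> din b + m1" and "\<rho> \<equiv> din b + m1 + dout (ob b m1) + m2"
    and "r1 \<equiv> dout b + m1 + din (ob b m1) + m2" and "r2 \<equiv> din b + m1 + din (ob b m1) + m2"
    and "M \<equiv> din b + m1 + din (ob b m1) + (m2 + din (ob b (m1 + m2)))"
  shows "hom b M [0, q, r] [q1, 0, r] (sx b M [] 0 q [r])" "hom b M [q1, 0, r] [q1, \<rho>, 0] (sx b M [q1] 0 r [])"
    "hom b M [q1, \<rho>, 0] [r2, q1, 0] (sx b M [] q1 \<rho> [0])"
    "hom b M [0, q, r] [0, r1, q] (sx b M [0] q r [])" "hom b M [0, r1, q] [r2, 0, q] (sx b M [] 0 r1 [q])"
    "hom b M [r2, 0, q] [r2, q1, 0] (sx b M [r2] 0 q [])"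
    "vc (sx b M [] 0 q [r]) (vc (sx b M [q1] 0 r []) (sx b M [] q1 \<rho> [0])) =
     vc (sx b M [0] q r []) (vc (sx b M [] 0 r1 [q]) (sx b M [r2] 0 q []))"
proof -
  have ob: "ob b q = ob b m1" "ob b q1 = ob b m1" "ob b r = ob b (m1 + m2)" by (simp_all add: q_def q1_def r_def)
  have nx: "nx b M 0 = dout b + m1 + din (ob b m1) + (m2 + din (ob b (m1 + m2)))"
    "nx b (nx b M 0) q = dout b + m1 + dout (ob b m1) + (m2 + din (ob b (m1 + m2)))"
    by (simp_all add: nx_def M_def ob)
  have o: "ok b M [0, q, r]"
    using nx by (simp add: ob) (simp add: M_def q_def r_def)
  show 1: "hom b M [0, q, r] [q1, 0, r] (sx b M [] 0 q [r])"
    using hom_sx[of b M "[]" 0 q "[r]"] o by (simp add: q_def q1_def add_ac)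
  show 2: "hom b M [q1, 0, r] [q1, \<rho>, 0] (sx b M [q1] 0 r [])"
    using hom_sx[of b M "[q1]" 0 r "[]"] homD(3)[OF 1] by (simp add: r_def \<rho>_def add_ac)
  show 3: "hom b M [q1, \<rho>, 0] [r2, q1, 0] (sx b M [] q1 \<rho> [0])"
    using hom_sx[of b M "[]" q1 \<rho> "[0]"] homD(3)[OF 2] by (simp add: ob) (simp add: q1_def \<rho>_def r2_def add_ac)
  show 4: "hom b M [0, q, r] [0, r1, q] (sx b M [0] q r [])"
    using hom_sx[of b M "[0]" q r "[]"] o by (simp add: ob) (simp add: q_def r_def r1_def add_ac)
  show 5: "hom b M [0, r1, q] [r2, 0, q] (sx b M [] 0 r1 [q])"
    using hom_sx[of b M "[]" 0 r1 "[q]"] homD(3)[OF 4] by (simp add: r1_def r2_def add_ac)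
  show 6: "hom b M [r2, 0, q] [r2, q1, 0] (sx b M [r2] 0 q [])"
    using hom_sx[of b M "[r2]" 0 q "[]"] homD(3)[OF 5] by (simp add: q_def q1_def add_ac)
  let ?A = "LX b m1"
  have g: "gx b M ps 0 ?A qs = sx b M ps 0 q qs" for ps qs by (simp add: sx_def q_def)
  have obs: "ob b (ll ?A + m2) = ob b (m1 + m2)" by simp
  have e: "ll ?A + m2 = r2" "lc ?A + m2 = r"
    by (simp_all add: r_def r2_def)
  have e': "ll ?A + (m2 + din (ob (lb ?A) r2)) = M"
    unfolding lb.simps obs[unfolded e] by (simp add: M_def)
  have i1: "intl b M (lt ?A) r = vc (sx b M [q1] 0 r []) (sx b M [] q1 \<rho> [0])"
    by (simp add: intl_def q1_def[symmetric]) (simp add: r_def \<rho>_def add_ac)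
  have i2: "intl b M (ls ?A) r = vc (sx b M [0] q r []) (sx b M [] 0 r1 [q])"
    by (simp add: intl_def q_def[symmetric] ob) (simp add: r_def r1_def q_def add_ac)
  have "vc (gx b M [] 0 ?A [r]) (intl b M (lt ?A) r) = vc (intl b M (ls ?A) r) (gx b M [r2] 0 ?A [])"
    using nat_left[of ?A m2] unfolding nl1_def nl2_def Let_def e e' by (simp only: lb.simps)
  then show "vc (sx b M [] 0 q [r]) (vc (sx b M [q1] 0 r []) (sx b M [] q1 \<rho> [0])) =
     vc (sx b M [0] q r []) (vc (sx b M [] 0 r1 [q]) (sx b M [r2] 0 q []))"
    unfolding g i1 i2 vc_assoc[OF 4 5 6] .
qed

lemma cx_sx_0:
  assumes h: "hom (ob a k) M (xs @ x # y # ys) t (sx (ob a k) M xs x y ys)" and le: "x + dout (ob a (k + x)) \<le> y"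
    and c: "ok a n ps" "k + M \<le> len a n ps" "ok a (len a n (ps @ sh k (xs @ x # y # ys))) qs"
  shows "cx a n ps k M (xs @ x # y # ys) (sx (ob a k) M xs x y ys) qs = sx a n (ps @ sh k xs) (k + x) (k + y) (sh k ys @ qs)"
  by (rule cx_sx[OF le homD(2)[OF h] c])

text \<open>The hexagon of the smallest word is moved to position \<open>p\<close> by a context. The
  truncated differences are exact, because each generator lies to the right of the output of the
  preceding one.\<close>

lemma hexagon:
  assumes o: "ok a n (ps @ p # q # r # qs)" and le: "p + dout (ob a p) \<le> q" "q + dout (ob a q) \<le> r"
    and q1: "q1 = q - dout (ob a p) + din (ob a p)" and r1: "r1 = r - dout (ob a q) + din (ob a q)"
    and \<rho>: "\<rho> = r - dout (ob a p) + din (ob a p)" and r2: "r2 = r1 - dout (ob a p) + din (ob a p)"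
  shows "vc (sx a n ps p q (r # qs)) (vc (sx a n (ps @ [q1]) p r qs) (sx a n ps q1 \<rho> (p # qs))) =
    vc (sx a n (ps @ [p]) q r qs) (vc (sx a n ps p r1 (q # qs)) (sx a n (ps @ [r2]) p q qs))"
proof -
  define b where "b = ob a p"
  obtain m1 where m1: "q = p + dout b + m1" using le(1) le_Suc_ex unfolding b_def by blast
  have oq: "ob a q = ob b m1" unfolding m1 b_def by simp
  obtain m2 where m2: "r = q + dout (ob b m1) + m2" using le(2) le_Suc_ex unfolding oq by blast
  have "ob a r = ob (ob a q) m2" unfolding m2 by simp
  then have orr: "ob a r = ob b (m1 + m2)" unfolding oq by simp
  define M where "M = din b + m1 + din (ob b m1) + (m2 + din (ob b (m1 + m2)))"
  define N where "N = len a n ps"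
  define x1 x2 y1 y2 z1 z2 where "x1 = dout b + m1" and "x2 = dout b + m1 + dout (ob b m1) + m2"
    and "y1 = din b + m1" and "y2 = din b + m1 + dout (ob b m1) + m2"
    and "z1 = dout b + m1 + din (ob b m1) + m2" and "z2 = din b + m1 + din (ob b m1) + m2"
  note h = hexagon_0[of b m1 m2, folded M_def x1_def x2_def y1_def y2_def z1_def z2_def]
  have ps: "ok a n ps" using o by simp
  have oN: "p + din b \<le> N" "q + din (ob b m1) \<le> nx a N p" "r + din (ob b (m1 + m2)) \<le> nx a (nx a N p) q"
    and qs: "ok a (len a n (ps @ [p, q, r])) qs"
    using o oq orr by (auto simp: N_def b_def)
  have pM: "p + M \<le> N" "p + M \<le> len a n ps"
    using oN oq unfolding M_def nx_def b_def[symmetric] m2 m1 N_def by auto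
  have pos: "p + x1 = q" "p + x2 = r" "p + y1 = q1" "p + y2 = \<rho>" "p + z1 = r1" "p + z2 = r2"
    unfolding q1 \<rho> r2 r1 oq b_def[symmetric] x1_def x2_def y1_def y2_def z1_def z2_def by (simp_all add: m1 m2)
  have qs': "ok a (len a n (ps @ sh p [0, x1, x2])) qs" using qs pos by simp
  note h' = h(1-6)[unfolded b_def]
  note c1 = cx_vc3[OF h'(1-3) ps pM(2) qs'] and c2 = cx_vc3[OF h'(4-6) ps pM(2) qs']
  have ob0: "ob b x1 = ob b m1" "ob b y1 = ob b m1" by (simp_all add: x1_def y1_def)
  have obp: "ob a (p + k) = ob b k" for k by (simp add: b_def)
  have le': "0 + dout (ob a (p + 0)) \<le> x1" "0 + dout (ob a (p + 0)) \<le> x2" "y1 + dout (ob a (p + y1)) \<le> y2"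
    "x1 + dout (ob a (p + x1)) \<le> x2" "0 + dout (ob a (p + 0)) \<le> z1"
    unfolding obp ob0 by (simp_all add: x1_def x2_def y1_def y2_def z1_def)
  note L = cx_sx_0[OF _ _ ps pM(2), of _ _ _ _ _ qs]
  have s1: "cx a n ps p M [0, x1, x2] (sx (ob a p) M [] 0 x1 [x2]) qs = sx a n ps p q (r # qs)"
    using L[of "[]" 0 x1 "[x2]", OF _ le'(1)] h'(1) qs' pos by simp
  have s2: "cx a n ps p M [y1, 0, x2] (sx (ob a p) M [y1] 0 x2 []) qs = sx a n (ps @ [q1]) p r qs"
    using L[of "[y1]" 0 x2 "[]", OF _ le'(2)] h'(2) c1(2) pos by simp
  have s3: "cx a n ps p M [y1, y2, 0] (sx (ob a p) M [] y1 y2 [0]) qs = sx a n ps q1 \<rho> (p # qs)"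
    using L[of "[]" y1 y2 "[0]", OF _ le'(3)] h'(3) c1(3) pos by simp
  have s4: "cx a n ps p M [0, x1, x2] (sx (ob a p) M [0] x1 x2 []) qs = sx a n (ps @ [p]) q r qs"
    using L[of "[0]" x1 x2 "[]", OF _ le'(4)] h'(4) qs' pos by simp
  have s5: "cx a n ps p M [0, z1, x1] (sx (ob a p) M [] 0 z1 [x1]) qs = sx a n ps p r1 (q # qs)"
    using L[of "[]" 0 z1 "[x1]", OF _ le'(5)] h'(5) c2(2) pos by simp
  have s6: "cx a n ps p M [z2, 0, x1] (sx (ob a p) M [z2] 0 x1 []) qs = sx a n (ps @ [r2]) p q qs"
    using L[of "[z2]" 0 x1 "[]", OF _ le'(1)] h'(6) c2(3) pos by simp
  show ?thesis
    using c1(1) c2(1) h(7)[unfolded b_def] unfolding s1 s2 s3 s4 s5 s6 by simp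
qed

text \<open>Positions of the \<eta> and the \<epsilon> of the zigzag \<open>LN b\<close>, relative
  to its left end. The \<eta> always comes first in the string, but for \<open>b = Oy\<close> it
  acts one letter further right.\<close>

primrec za :: "adj0 \<Rightarrow> nat" where "za Ox = 0" | "za Oy = 1"
primrec zb :: "adj0 \<Rightarrow> nat" where "zb Ox = 1" | "zb Oy = 0"

lemma ls_LN: "ls (LN b) = [za b, zb b]"
  by (cases b) auto

lemma ob_z: "ob b (za b) = Ox" "ob b (zb b) = Oy"
  by (cases b; simp)+

lemma z_le: "za b \<le> 1" "zb b \<le> 1"
  by (cases b; simp)+

declare ls.simps(1) [simp del] ls_LN [simp] ob_z [simp]

text \<open>Naturality of the zigzag with respect to a generator on its right. The target of the
  zigzag is an identity, so one of the two interchanges is trivial. The generator moves to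
  \<open>m + 3\<close> when it passes the \<epsilon>, whose input is two letters longer than its
  output, and back to \<open>1 + m\<close> when it passes the \<eta>.\<close>

lemma slide_left_0:
  fixes b :: adj0 and m :: nat
  defines "M \<equiv> 1 + (m + din (ob b (1 + m)))"
  shows "hom b M [za b, zb b, 1 + m] [1 + m] (gx b M [] 0 (LN b) [1 + m])"
    "hom b M [za b, zb b, 1 + m] [za b, m + 3, zb b] (sx b M [za b] (zb b) (1 + m) [])"
    "hom b M [za b, m + 3, zb b] [1 + m, za b, zb b] (sx b M [] (za b) (m + 3) [zb b])"
    "hom b M [1 + m, za b, zb b] [1 + m] (gx b M [1 + m] 0 (LN b) [])"
    "gx b M [] 0 (LN b) [1 + m] = vc (sx b M [za b] (zb b) (1 + m) []) (vc (sx b M [] (za b) (m + 3) [zb b]) (gx b M [1 + m] 0 (LN b) []))"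
proof -
  have l: "len b M [za b, zb b] = M"
    by (cases b) (simp_all add: M_def nx_def)
  have ok1: "ok b M [za b, zb b]" by (cases b) (simp_all add: M_def nx_def)
  have ok2: "ok b M [1 + m]" by (simp add: M_def)
  have e3: "Suc (Suc (1 + m)) = m + 3" by simp
  show 1: "hom b M [za b, zb b, 1 + m] [1 + m] (gx b M [] 0 (LN b) [1 + m])"
    using hom_gx[of "LN b" b 0 M "[]" "[1 + m]"] ok2 l by (simp add: M_def)
  show 2: "hom b M [za b, zb b, 1 + m] [za b, m + 3, zb b] (sx b M [za b] (zb b) (1 + m) [])"
    using hom_sx[of b M "[za b]" "zb b" "1 + m" "[]"] ok1 ok2 l z_le(2)[of b] e3 by (simp add: add_ac)
  show 3: "hom b M [za b, m + 3, zb b] [1 + m, za b, zb b] (sx b M [] (za b) (m + 3) [zb b])"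
    using hom_sx[of b M "[]" "za b" "m + 3" "[zb b]"] homD(3)[OF 2] z_le(1)[of b] by (simp add: add_ac)
  show 4: "hom b M [1 + m, za b, zb b] [1 + m] (gx b M [1 + m] 0 (LN b) [])"
    using hom_gx[of "LN b" b 0 M "[1 + m]" "[]"] ok2 by (simp add: nx_def M_def)
  have e: "ll (LN b) + m = 1 + m" "lc (LN b) + m = 1 + m" "ll (LN b) + (m + din (ob (lb (LN b)) (1 + m))) = M"
    by (simp_all add: M_def)
  have i1: "intl b M (lt (LN b)) (1 + m) = idc D 2 (S b M [1 + m])" by (simp add: intl_def)
  have i2: "intl b M (ls (LN b)) (1 + m) = vc (sx b M [za b] (zb b) (1 + m) []) (sx b M [] (za b) (m + 3) [zb b])"
    by (simp add: intl_def e3)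
  have "vc (gx b M [] 0 (LN b) [1 + m]) (idc D 2 (S b M [1 + m])) = vc (intl b M (ls (LN b)) (1 + m)) (gx b M [1 + m] 0 (LN b) [])"
    using nat_left[of "LN b" m] unfolding nl1_def nl2_def Let_def e e[unfolded lb.simps] lb.simps i1 .
  then show "gx b M [] 0 (LN b) [1 + m] = vc (sx b M [za b] (zb b) (1 + m) []) (vc (sx b M [] (za b) (m + 3) [zb b]) (gx b M [1 + m] 0 (LN b) []))"
    unfolding i2 vc_id(2)[OF 1] vc_assoc[OF 2 3 4] .
qed

lemma slide_left:
  fixes a :: adj0 and k r :: nat
  defines "b \<equiv> ob a k"
  assumes o: "ok a n (ps @ (k + za b) # (k + zb b) # r # qs)" and r: "k + 1 \<le> r"
  shows "gx a n ps k (LN b) (r # qs) = vc (sx a n (ps @ [k + za b]) (k + zb b) r qs)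
     (vc (sx a n ps (k + za b) (r + 2) ((k + zb b) # qs)) (gx a n (ps @ [r]) k (LN b) qs))"
proof -
  obtain m where m: "r = k + (1 + m)" using r le_Suc_ex by (metis add.assoc)
  define M where "M = 1 + (m + din (ob b (1 + m)))"
  note h = slide_left_0[of b m, folded M_def]
  note h' = h(1-4)[unfolded b_def, folded b_def]
  have h'': "hom (ob a k) M [za b, zb b, 1 + m] [1 + m] (gx b M [] 0 (LN b) [1 + m])"
    "hom (ob a k) M [za b, zb b, 1 + m] [za b, m + 3, zb b] (sx b M [za b] (zb b) (1 + m) [])"
    "hom (ob a k) M [za b, m + 3, zb b] [1 + m, za b, zb b] (sx b M [] (za b) (m + 3) [zb b])"
    "hom (ob a k) M [1 + m, za b, zb b] [1 + m] (gx b M [1 + m] 0 (LN b) [])"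
    using h(1-4) unfolding b_def by auto
  have ps: "ok a n ps" and qs: "ok a (len a n (ps @ sh k [za b, zb b, 1 + m])) qs" using o m by (auto simp: add.assoc)
  have obk: "ob a (k + i) = ob b i" for i by (simp add: b_def)
  have orr: "ob a r = ob b (1 + m)" unfolding m obk ..
  define N where "N = len a n ps"
  have oo: "k + za b \<le> N" "k + zb b + 2 \<le> nx a N (k + za b)" "r + din (ob b (1 + m)) \<le> nx a (nx a N (k + za b)) (k + zb b)"
    using o obk orr by (auto simp: N_def)
  have nx: "nx a N (k + za b) = N + 2" "nx a (N + 2) (k + zb b) = N" unfolding nx_def obk by simp_all
  have kM: "k + M \<le> len a n ps" using oo(3)[unfolded nx] unfolding N_def M_def m by simp
  note c = cx_vc3[OF h''(2-4) ps kM qs]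
  have pk: "k + (1 + m) = r" "k + (m + 3) = r + 2" by (simp_all add: m)
  have Mx: "nx b M (1 + m) = 1 + (m + dout (ob b (1 + m)))" by (simp add: nx_def M_def)
  have M1: "1 \<le> M" "1 \<le> nx (ob a k) M (1 + m)" using Mx by (simp_all add: M_def b_def)
  have lx: "lb (LN b) = ob a (k + 0)" by (simp add: b_def)
  have c3: "ok a (len a n (ps @ sh k [1 + m, za b, zb b])) qs" "ok a (len a n (ps @ sh k [za b, m + 3, zb b])) qs"
    using c(3) c(2) .
  have hb: "hom b M = hom (ob a k) M" "gx b M = gx (ob a k) M" "sx b M = sx (ob a k) M" "ok b M = ok (ob a k) M"
     "len b M = len (ob a k) M" by (simp_all add: b_def)
  have g1: "cx a n ps k M [za b, zb b, 1 + m] (gx b M [] 0 (LN b) [1 + m]) qs = gx a n ps k (LN b) (r # qs)"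
  proof -
    have "cx a n ps k M [za b, zb b, 1 + m] (gx b M [] 0 (LN b) [1 + m]) qs = gx a n (ps @ sh k []) (k + 0) (LN b) (sh k [1 + m] @ qs)"
      unfolding hb
      by (rule cx_gx[OF lx _ _ _ ps kM]) (use homD(2)[OF h(1)[unfolded hb]] M1 qs in simp_all)
    then show ?thesis by (simp only: sh_simps pk add_0_right append_Nil append_Nil2 append_Cons)
  qed
  have g2: "cx a n ps k M [za b, zb b, 1 + m] (sx b M [za b] (zb b) (1 + m) []) qs = sx a n (ps @ [k + za b]) (k + zb b) r qs"
  proof -
    have "zb b + dout (ob a (k + zb b)) \<le> 1 + m" unfolding obk using z_le(2)[of b] by simp
    from cx_sx_0[of a k M "[za b]" "zb b" "1 + m" "[]" _ n ps qs, unfolded append_Nil append_Cons, OF h(2)[unfolded hb] this ps kM qs]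
    show ?thesis by (simp only: hb sh_simps pk add_0_right append_Nil append_Nil2 append_Cons)
  qed
  have g3: "cx a n ps k M [za b, m + 3, zb b] (sx b M [] (za b) (m + 3) [zb b]) qs = sx a n ps (k + za b) (r + 2) ((k + zb b) # qs)"
  proof -
    have "za b + dout (ob a (k + za b)) \<le> m + 3" unfolding obk using z_le(1)[of b] by simp
    from cx_sx_0[of a k M "[]" "za b" "m + 3" "[zb b]" _ n ps qs, unfolded append_Nil append_Cons, OF h(3)[unfolded hb] this ps kM c3(2)]
    show ?thesis by (simp only: hb sh_simps pk add_0_right append_Nil append_Nil2 append_Cons)
  qed
  have g4: "cx a n ps k M [1 + m, za b, zb b] (gx b M [1 + m] 0 (LN b) []) qs = gx a n (ps @ [r]) k (LN b) qs"
  proof -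
    have "cx a n ps k M [1 + m, za b, zb b] (gx b M [1 + m] 0 (LN b) []) qs = gx a n (ps @ sh k [1 + m]) (k + 0) (LN b) (sh k [] @ qs)"
      unfolding hb
      by (rule cx_gx[OF lx _ _ _ ps kM]) (use homD(2)[OF h(4)[unfolded hb]] M1 c3(1) in simp_all)
    then show ?thesis by (simp only: sh_simps pk add_0_right append_Nil append_Nil2 append_Cons)
  qed
  show ?thesis using c(1) unfolding h(5)[symmetric] g1 g2 g3 g4 .
qed

text \<open>Naturality of the zigzag with respect to a generator on its left. Past that generator
  the zigzag begins at \<open>x\<close>, counted over the input, instead of \<open>y\<close>,
  counted over the output.\<close>

lemma slide_right_0:
  fixes b :: adj0 and m :: nat
  defines "M \<equiv> din b + m + 1" and "z \<equiv> ob b m" and "x \<equiv> din b + m" and "y \<equiv> dout b + m"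
  shows "hom b M [0, y + za z, y + zb z] [0] (gx b M [0] y (LN z) [])"
    "hom b M [0, y + za z, y + zb z] [x + za z, 0, y + zb z] (sx b M [] 0 (y + za z) [y + zb z])"
    "hom b M [x + za z, 0, y + zb z] [x + za z, x + zb z, 0] (sx b M [x + za z] 0 (y + zb z) [])"
    "hom b M [x + za z, x + zb z, 0] [0] (gx b M [] x (LN z) [0])"
    "gx b M [0] y (LN z) [] = vc (sx b M [] 0 (y + za z) [y + zb z]) (vc (sx b M [x + za z] 0 (y + zb z) []) (gx b M [] x (LN z) [0]))"
proof -
  have oy: "ob b y = z" "ob b x = z" by (simp_all add: y_def x_def z_def)
  have oz: "ob b (y + i) = ob z i" "ob b (x + i) = ob z i" for i using oy by (metis ob_ob)+
  have n0: "nx b M 0 = y + 1" by (simp add: nx_def M_def y_def)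
  have n1: "nx b (y + 1) (y + za z) = y + 3" "nx b (y + 3) (y + zb z) = y + 1" unfolding nx_def oz by simp_all
  have n2: "nx b (x + 1) (x + za z) = x + 3" "nx b (x + 3) (x + zb z) = x + 1" unfolding nx_def oz by simp_all
  have M: "M = x + 1" "din b \<le> M" by (simp_all add: M_def x_def)
  show 1: "hom b M [0, y + za z, y + zb z] [0] (gx b M [0] y (LN z) [])"
    using hom_gx[of "LN z" b y M "[0]" "[]"] oy n0 M(2) by simp
  have o: "ok b M [0, y + za z, y + zb z]" by (rule homD(2)[OF 1])
  have xy: "y - dout b + din b = x" "y + i - dout b + din b = x + i" for i by (simp_all add: x_def y_def add_ac)
  have le: "dout b \<le> y + i" for i by (simp add: y_def)
  show 2: "hom b M [0, y + za z, y + zb z] [x + za z, 0, y + zb z] (sx b M [] 0 (y + za z) [y + zb z])"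
    using hom_sx[of b M "[]" 0 "y + za z" "[y + zb z]"] o le[of "za z"] xy(2)[of "za z"] by simp
  show 3: "hom b M [x + za z, 0, y + zb z] [x + za z, x + zb z, 0] (sx b M [x + za z] 0 (y + zb z) [])"
    using hom_sx[of b M "[x + za z]" 0 "y + zb z" "[]"] homD(3)[OF 2] le[of "zb z"] xy(2)[of "zb z"] by simp
  have "ok b M [0]" using M(2) by simp
  then have "ok b (len b M (sh x (ls (LN z)))) [0]" using n2 M by simp
  then show 4: "hom b M [x + za z, x + zb z, 0] [0] (gx b M [] x (LN z) [0])"
    using hom_gx[of "LN z" b x M "[]" "[0]"] oy M by simp
  have e: "din b + m + ll (LN z) = M" by (simp add: M_def)
  have i1: "intr b M m (lt (LN z)) = idc D 2 (S b M [0])" by (simp add: intr_def)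
  have i2: "intr b M m (ls (LN z)) = vc (sx b M [] 0 (y + za z) [y + zb z]) (sx b M [x + za z] 0 (y + zb z) [])"
    by (simp add: intr_def x_def y_def)
  have "vc (gx b M [0] y (LN z) []) (idc D 2 (S b M [0])) = vc (intr b M m (ls (LN z))) (gx b M [] x (LN z) [0])"
    using nat_right[of "LN z" b m] unfolding nr1_def nr2_def Let_def e i1 by (simp only: lb.simps z_def x_def y_def)
  then show "gx b M [0] y (LN z) [] = vc (sx b M [] 0 (y + za z) [y + zb z]) (vc (sx b M [x + za z] 0 (y + zb z) []) (gx b M [] x (LN z) [0]))"
    unfolding i2 vc_id(2)[OF 1] vc_assoc[OF 2 3 4] .
qed

lemma slide_right:
  fixes a :: adj0 and k p :: nat
  defines "z \<equiv> ob a k"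
  assumes o: "ok a n (ps @ p # (k + za z) # (k + zb z) # qs)" and p: "p + dout (ob a p) \<le> k"
    and k': "k' = k - dout (ob a p) + din (ob a p)"
  shows "gx a n (ps @ [p]) k (LN z) qs = vc (sx a n ps p (k + za z) ((k + zb z) # qs))
     (vc (sx a n (ps @ [k' + za z]) p (k + zb z) qs) (gx a n ps k' (LN z) (p # qs)))"
proof -
  define b where "b = ob a p"
  obtain m where m: "k = p + dout b + m" using p le_Suc_ex unfolding b_def by blast
  have zz: "z = ob b m" unfolding z_def m b_def by simp
  define M x y where "M = din b + m + 1" and "x = din b + m" and "y = dout b + m"
  have h: "hom (ob a p) M [0, y + za z, y + zb z] [0] (gx (ob a p) M [0] y (LN z) [])"
    "hom (ob a p) M [0, y + za z, y + zb z] [x + za z, 0, y + zb z] (sx (ob a p) M [] 0 (y + za z) [y + zb z])"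
    "hom (ob a p) M [x + za z, 0, y + zb z] [x + za z, x + zb z, 0] (sx (ob a p) M [x + za z] 0 (y + zb z) [])"
    "hom (ob a p) M [x + za z, x + zb z, 0] [0] (gx (ob a p) M [] x (LN z) [0])"
    "gx (ob a p) M [0] y (LN z) [] = vc (sx (ob a p) M [] 0 (y + za z) [y + zb z])
        (vc (sx (ob a p) M [x + za z] 0 (y + zb z) []) (gx (ob a p) M [] x (LN z) [0]))"
    using slide_right_0[of b m] unfolding zz M_def x_def y_def b_def by auto
  have pk: "p + (y + i) = k + i" "p + (x + i) = k' + i" "p + y = k" "p + x = k'" for i
    unfolding k' b_def[symmetric] by (simp_all add: m x_def y_def)
  have ps: "ok a n ps" and qs: "ok a (len a n (ps @ sh p [0, y + za z, y + zb z])) qs" using o by (auto simp: pk)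
  define N where "N = len a n ps"
  have oN: "p + din b \<le> N" "k + zb z + din (ob a (k + zb z)) \<le> nx a (nx a N p) (k + za z)" "k + za z \<le> nx a N p"
    using o by (auto simp: b_def N_def)
  have obk: "ob a (k + i) = ob z i" for i by (simp add: z_def)
  have "k + 1 \<le> nx a N p" using oN(2,3) unfolding nx_def[of a "nx a N p"] obk by (cases z) auto
  then have pM: "p + M \<le> len a n ps" using oN(1) unfolding nx_def b_def[symmetric] m M_def N_def by auto
  note c = cx_vc3[OF h(2-4) ps pM qs]
  have le: "0 + dout (ob a (p + 0)) \<le> y + i" for i by (simp add: b_def[symmetric] y_def)
  have ox: "ob b y = z" "ob b x = z" by (simp_all add: zz x_def y_def)
  have ox': "ob a (p + y) = ob b y" "ob a (p + x) = ob b x" by (simp_all add: b_def)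
  have lx: "lb (LN z) = ob a (p + y)" "lb (LN z) = ob a (p + x)"
    using ox ox' by (simp_all only: lb.simps)
  have obs: "ok (ob a p) M [0, y + za z, y + zb z]" "ok (ob a p) M [x + za z, x + zb z, 0]" using homD(2)[OF h(1)] homD(2)[OF h(4)] .
  have ny: "nx (ob a p) M 0 = y + 1" by (simp add: nx_def M_def y_def b_def)
  have sp: "sh p [0, y + za z, y + zb z] = [p, k + za z, k + zb z]" "sh p [x + za z, 0, y + zb z] = [k' + za z, p, k + zb z]"
    "sh p [x + za z, x + zb z, 0] = [k' + za z, k' + zb z, p]"
    by (simp_all only: sh_simps pk add_0_right)
  have c3: "ok a (len a n (ps @ sh p [x + za z, x + zb z, 0])) qs" "ok a (len a n (ps @ sh p [x + za z, 0, y + zb z])) qs"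
    using c(3) c(2) .
  have g1: "cx a n ps p M [0, y + za z, y + zb z] (gx (ob a p) M [0] y (LN z) []) qs = gx a n (ps @ [p]) k (LN z) qs"
  proof -
    have "cx a n ps p M [0, y + za z, y + zb z] (gx (ob a p) M [0] y (LN z) []) qs = gx a n (ps @ sh p [0]) (p + y) (LN z) (sh p [] @ qs)"
      by (rule cx_gx[OF lx(1) _ _ _ ps pM]) (use obs(1) ny qs in \<open>simp_all add: add.assoc\<close>)
    then show ?thesis by (simp only: sh_simps pk add_0_right append_Nil)
  qed
  have g2: "cx a n ps p M [0, y + za z, y + zb z] (sx (ob a p) M [] 0 (y + za z) [y + zb z]) qs = sx a n ps p (k + za z) ((k + zb z) # qs)"
    using cx_sx_0[of a p M "[]" 0 "y + za z" "[y + zb z]" _ n ps qs, unfolded append_Nil, OF h(2) le ps pM qs]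
    by (simp only: sh_simps pk add_0_right append_Nil append_Nil2 append_Cons)
  have g3: "cx a n ps p M [x + za z, 0, y + zb z] (sx (ob a p) M [x + za z] 0 (y + zb z) []) qs = sx a n (ps @ [k' + za z]) p (k + zb z) qs"
    using cx_sx_0[of a p M "[x + za z]" 0 "y + zb z" "[]" _ n ps qs, unfolded append_Nil append_Cons, OF h(3) le ps pM c3(2)]
    by (simp only: sh_simps pk add_0_right append_Nil append_Nil2 append_Cons)
  have g4: "cx a n ps p M [x + za z, x + zb z, 0] (gx (ob a p) M [] x (LN z) [0]) qs = gx a n ps k' (LN z) (p # qs)"
  proof -
    have Mx: "M = x + 1" by (simp add: M_def x_def)
    have "cx a n ps p M [x + za z, x + zb z, 0] (gx (ob a p) M [] x (LN z) [0]) qs = gx a n (ps @ sh p []) (p + x) (LN z) (sh p [0] @ qs)"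
      by (rule cx_gx[OF lx(2) _ _ _ ps pM]) (use obs(2) c3(1) in \<open>simp_all add: Mx add.assoc\<close>)
    then show ?thesis by (simp only: sh_simps pk add_0_right append_Nil append_Nil2 append_Cons)
  qed
  show ?thesis using c(1) unfolding h(5)[symmetric] g1 g2 g3 g4 .
qed

text \<open>The \<eta> can be cancelled against either of the two \<epsilon>s that follow it:
  against the first directly, against the second after the two \<epsilon>s have been
  interchanged.\<close>

lemma triangle_eps:
  assumes k: "ob a k = Oy" and o: "ok a n (ps @ (k + 1) # k # k # qs)"
  shows "gx a n ps k (LN Oy) (k # qs) = vc (sx a n (ps @ [k + 1]) k k qs) (gx a n ps (k + 1) (LN Ox) (k # qs))"
proof -
  let ?cx = "\<lambda>s X. cx a n ps k 2 s X qs"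
  have ob1: "ob a (k + 1) = Ox" using k by (cases a) (auto simp: ob_def split: if_splits)
  have h: "hom Oy 2 [1, 0, 0] [1, 2, 0] (gx Oy 2 [1] 0 (LX Oy 0) [])" "hom Oy 2 [1, 2, 0] [0] (gx Oy 2 [] 1 (LN Ox) [0])"
    using hom_gx[of "LX Oy 0" Oy 0 2 "[1]" "[]"] hom_gx[of "LN Ox" Oy 1 2 "[]" "[0]"]
    by (auto simp: nx_def ob_def)
  have oks: "ok Oy 2 [1, 0, 0]" "ok Oy 2 [1, 2, 0]" using homD(2,3)[OF h(1)] by auto
  have ps: "ok a n ps" "k + 2 \<le> len a n ps" and qs: "ok a (len a n (ps @ sh k [1, 0, 0])) qs"
    using o k ob1 by (auto simp: nx_def)
  have qs': "ok a (len a n (ps @ sh k [1, 2, 0])) qs"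
    using len_cx[of a k 2 _ _ _ n ps, unfolded k, OF h(1) ps] qs by simp
  have n: "nx Oy 2 1 = 4" "nx Oy 4 0 = 2" "nx Oy 4 2 = 2" "nx Oy 2 0 = 0" by (simp_all add: nx_def)
  have l: "lb (LN Oy) = ob a (k + 0)" "lb (LX Oy 0) = ob a (k + 0)" "lb (LN Ox) = ob a (k + 1)" using k ob1 by simp_all
  have 1: "?cx [1, 0, 0] (gx Oy 2 [] 0 (LN Oy) [0]) = gx a n ps k (LN Oy) (k # qs)"
  proof -
    have "?cx [1, 0, 0] (gx (ob a k) 2 [] 0 (LN Oy) [0]) = gx a n (ps @ sh k []) (k + 0) (LN Oy) (sh k [0] @ qs)"
      by (rule cx_gx[OF l(1) _ _ _ ps]) (use qs in \<open>simp_all add: k n\<close>)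
    then show ?thesis by (simp add: k)
  qed
  have 2: "?cx [1, 0, 0] (gx Oy 2 [1] 0 (LX Oy 0) []) = gx a n (ps @ [k + 1]) k (LX Oy 0) qs"
  proof -
    have "?cx [1, 0, 0] (gx (ob a k) 2 [1] 0 (LX Oy 0) []) = gx a n (ps @ sh k [1]) (k + 0) (LX Oy 0) (sh k [] @ qs)"
      by (rule cx_gx[OF l(2) _ _ _ ps]) (use qs in \<open>simp_all add: k n\<close>)
    then show ?thesis by (simp add: k)
  qed
  have 3: "?cx [1, 2, 0] (gx Oy 2 [] 1 (LN Ox) [0]) = gx a n ps (k + 1) (LN Ox) (k # qs)"
  proof -
    have "?cx [1, 2, 0] (gx (ob a k) 2 [] 1 (LN Ox) [0]) = gx a n (ps @ sh k []) (k + 1) (LN Ox) (sh k [0] @ qs)"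
      by (rule cx_gx[OF l(3) _ _ _ ps]) (use qs' in \<open>simp_all add: k n\<close>)
    then show ?thesis by (simp add: k)
  qed
  have "?cx [1, 0, 0] (vc (gx Oy 2 [1] 0 (LX Oy 0) []) (gx Oy 2 [] 1 (LN Ox) [0])) =
     vc (?cx [1, 0, 0] (gx Oy 2 [1] 0 (LX Oy 0) [])) (?cx [1, 2, 0] (gx Oy 2 [] 1 (LN Ox) [0]))"
    using cx_vc[of a k 2 _ _ _ _ _ n ps qs, unfolded k, OF h ps qs] .
  then show ?thesis
    unfolding tri_eps[symmetric] 1 2 3 using k by (simp add: sx_def)
qed

text \<open>Dually, the \<epsilon> can be cancelled against the second \<eta> directly, or against
  the first after the two \<eta>s have been interchanged.\<close>

lemma triangle_eta:
  assumes k: "ob a k = Ox" and o: "ok a n (ps @ k # (k + 2) # (k + 1) # qs)"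
  shows "gx a n (ps @ [k]) (k + 1) (LN Oy) qs = vc (sx a n ps k (k + 2) ((k + 1) # qs)) (gx a n (ps @ [k]) k (LN Ox) qs)"
proof -
  let ?cx = "\<lambda>s X. cx a n ps k 0 s X qs"
  have h: "hom Ox 0 [0, 2, 1] [0, 0, 1] (gx Ox 0 [] 0 (LX Ox 0) [1])" "hom Ox 0 [0, 0, 1] [0] (gx Ox 0 [0] 0 (LN Ox) [])"
    using hom_gx[of "LX Ox 0" Ox 0 0 "[]" "[1]"] hom_gx[of "LN Ox" Ox 0 0 "[0]" "[]"]
    by (auto simp: nx_def ob_def)
  have oks: "ok Ox 0 [0, 2, 1]" "ok Ox 0 [0, 0, 1]" using homD(2,3)[OF h(1)] by auto
  have ps: "ok a n ps" "k + 0 \<le> len a n ps" and qs: "ok a (len a n (ps @ sh k [0, 2, 1])) qs"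
    using o k by (auto simp: nx_def)
  have qs': "ok a (len a n (ps @ sh k [0, 0, 1])) qs"
    using len_cx[of a k 0 _ _ _ n ps, unfolded k, OF h(1) ps] qs by simp
  have n: "nx Ox 0 0 = 2" "nx Ox 2 2 = 4" "nx Ox 2 0 = 4" "nx Ox 4 1 = 2" by (simp_all add: nx_def)
  have ob1: "ob a (k + 1) = Oy" using k by (cases a) (auto simp: ob_def split: if_splits)
  have l: "lb (LN Oy) = ob a (k + 1)" "lb (LX Ox 0) = ob a (k + 0)" "lb (LN Ox) = ob a (k + 0)" using k ob1 by simp_all
  have 1: "?cx [0, 2, 1] (gx Ox 0 [0] 1 (LN Oy) []) = gx a n (ps @ [k]) (k + 1) (LN Oy) qs"
  proof -
    have "?cx [0, 2, 1] (gx (ob a k) 0 [0] 1 (LN Oy) []) = gx a n (ps @ sh k [0]) (k + 1) (LN Oy) (sh k [] @ qs)"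
      by (rule cx_gx[OF l(1) _ _ _ ps]) (use qs in \<open>simp_all add: k n\<close>)
    then show ?thesis by (simp add: k)
  qed
  have 2: "?cx [0, 2, 1] (gx Ox 0 [] 0 (LX Ox 0) [1]) = gx a n ps k (LX Ox 0) ((k + 1) # qs)"
  proof -
    have "?cx [0, 2, 1] (gx (ob a k) 0 [] 0 (LX Ox 0) [1]) = gx a n (ps @ sh k []) (k + 0) (LX Ox 0) (sh k [1] @ qs)"
      by (rule cx_gx[OF l(2) _ _ _ ps]) (use qs in \<open>simp_all add: k n\<close>)
    then show ?thesis by (simp add: k)
  qed
  have 3: "?cx [0, 0, 1] (gx Ox 0 [0] 0 (LN Ox) []) = gx a n (ps @ [k]) k (LN Ox) qs"
  proof -
    have "?cx [0, 0, 1] (gx (ob a k) 0 [0] 0 (LN Ox) []) = gx a n (ps @ sh k [0]) (k + 0) (LN Ox) (sh k [] @ qs)"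
      by (rule cx_gx[OF l(3) _ _ _ ps]) (use qs' in \<open>simp_all add: k n\<close>)
    then show ?thesis by (simp add: k)
  qed
  have "?cx [0, 2, 1] (vc (gx Ox 0 [] 0 (LX Ox 0) [1]) (gx Ox 0 [0] 0 (LN Ox) [])) =
     vc (?cx [0, 2, 1] (gx Ox 0 [] 0 (LX Ox 0) [1])) (?cx [0, 0, 1] (gx Ox 0 [0] 0 (LN Ox) []))"
    using cx_vc[of a k 0 _ _ _ _ _ n ps qs, unfolded k, OF h ps qs] .
  then show ?thesis
    unfolding tri_eta[symmetric] 1 2 3 using k by (simp add: sx_def)
qed

text \<open>The assumed relation starts at the beginning of a string; \<open>ps\<close> and
  \<open>qs\<close> are added by a context at position 0 that spans the whole word of length
  \<open>N\<close>.\<close>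

lemma independence:
  assumes A: "lb A = ob a k" "ok a n ps" "k + ll A \<le> len a n ps"
    and x: "ok a (len a n (ps @ sh k (ls A))) x"
    and B: "lb B = ob a k'" "k' + ll B \<le> len a n (ps @ sh k (ls A) @ x)"
    and q: "ok a (len a n (ps @ sh k (ls A) @ x @ sh k' (ls B))) qs"
  shows "vc (gx a n ps k A (x @ sh k' (ls B) @ qs)) (gx a n (ps @ sh k (lt A) @ x) k' B qs) =
    vc (gx a n (ps @ sh k (ls A) @ x) k' B qs) (gx a n ps k A (x @ sh k' (lt B) @ qs))"
proof -
  define N where "N = len a n ps"
  let ?s = "sh k (ls A) @ x @ sh k' (ls B)"
  let ?cx = "\<lambda>s X. cx a n ps 0 N s X qs"
  have A': "k + ll A \<le> N" using A by (simp add: N_def)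
  note hA = gx_single(1)[OF A(1) A' refl refl]
  have e: "len a N (sh k (lt A)) = len a N (sh k (ls A))" "ok a N (sh k (ls A))" "ok a N (sh k (lt A))"
    using homD[OF hA] by auto
  have x': "ok a (len a N (sh k (ls A))) x" "k' + ll B \<le> len a (len a N (sh k (ls A))) x"
    using x B by (simp_all add: N_def)
  note hB = gx_single(1)[OF B(1) x'(2) refl refl]
  have e': "len a (len a (len a N (sh k (ls A))) x) (sh k' (lt B)) = len a (len a (len a N (sh k (ls A))) x) (sh k' (ls B))"
    "ok a (len a (len a N (sh k (ls A))) x) (sh k' (ls B))" "ok a (len a (len a N (sh k (ls A))) x) (sh k' (lt B))"
    using homD[OF hB] by auto
  have q': "ok a (len a (len a (len a N (sh k (ls A))) x) (sh k' (ls B))) qs" using q by (simp add: N_def)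
  have 0: "ok a N []" "k + ll A \<le> len a N []" using A' by simp_all
  have l: "ok a (len a N ([] @ sh k (ls A))) (x @ sh k' (ls B))" "ok a (len a N ([] @ sh k (ls A))) (x @ sh k' (lt B))"
    "ok a N (sh k (ls A) @ x)" "ok a N (sh k (lt A) @ x)" "k' + ll B \<le> len a N (sh k (ls A) @ x)" "k' + ll B \<le> len a N (sh k (lt A) @ x)"
    using x' e e' by simp_all
  have g1: "hom a N ?s (sh k (lt A) @ x @ sh k' (ls B)) (gx a N [] k A (x @ sh k' (ls B)))"
    using hom_gx[OF A(1) 0 l(1)] by simp
  have g2: "hom a N (sh k (lt A) @ x @ sh k' (ls B)) (sh k (lt A) @ x @ sh k' (lt B)) (gx a N (sh k (lt A) @ x) k' B [])"
    using hom_gx[OF B(1) l(4,6), of "[]"] by simp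
  have g3: "hom a N ?s (sh k (ls A) @ x @ sh k' (lt B)) (gx a N (sh k (ls A) @ x) k' B [])"
    using hom_gx[OF B(1) l(3,5), of "[]"] by simp
  have g4: "hom a N (sh k (ls A) @ x @ sh k' (lt B)) (sh k (lt A) @ x @ sh k' (lt B)) (gx a N [] k A (x @ sh k' (lt B)))"
    using hom_gx[OF A(1) 0 l(2)] by simp
  have N: "ok a n ps" "0 + N \<le> len a n ps" using A(2) by (simp_all add: N_def)
  have q2: "ok a (len a n (ps @ sh 0 ?s)) qs" using q' by (simp add: N_def)
  have q3: "ok a (len a n (ps @ sh 0 (sh k (lt A) @ x @ sh k' (ls B)))) qs" "ok a (len a n (ps @ sh 0 (sh k (ls A) @ x @ sh k' (lt B)))) qs"
    using q' e e' by (simp_all add: N_def)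
  have a0: "a = ob a 0" "ob a 0 = a" by simp_all
  have k0: "lb A = ob a (0 + k)" "lb B = ob a (0 + k')" using A(1) B(1) by simp_all
  note G = cx_gx[where k' = 0 and a' = a, unfolded a0(2), OF k0(1) _ _ _ N] cx_gx[where k' = 0 and a' = a, unfolded a0(2), OF k0(2) _ _ _ N]
  have c1: "?cx ?s (gx a N [] k A (x @ sh k' (ls B))) = gx a n ps k A (x @ sh k' (ls B) @ qs)"
    using G(1)[OF 0 l(1), unfolded append_Nil, OF q2 refl] by simp
  have c2: "?cx (sh k (lt A) @ x @ sh k' (ls B)) (gx a N (sh k (lt A) @ x) k' B []) = gx a n (ps @ sh k (lt A) @ x) k' B qs"
    using G(2)[OF l(4,6), of "[]" qs, simplified, OF q3(1)[simplified] refl] by simp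
  have c3: "?cx ?s (gx a N (sh k (ls A) @ x) k' B []) = gx a n (ps @ sh k (ls A) @ x) k' B qs"
    using G(2)[OF l(3,5), of "[]" qs, simplified, OF q2[simplified] refl] by simp
  have c4: "?cx (sh k (ls A) @ x @ sh k' (lt B)) (gx a N [] k A (x @ sh k' (lt B))) = gx a n ps k A (x @ sh k' (lt B) @ qs)"
    using G(1)[OF 0 l(2), unfolded append_Nil, OF q3(2) refl] by simp
  note V = cx_vc[where k = 0 and a = a, unfolded a0(2)]
  have "in1 a N k A x k' B = in2 a N k A x k' B" by (rule indep[OF A(1) A' x'(1) B(1) x'(2)])
  moreover have "?cx ?s (in1 a N k A x k' B) = vc (gx a n ps k A (x @ sh k' (ls B) @ qs)) (gx a n (ps @ sh k (lt A) @ x) k' B qs)"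
    unfolding in1_def V[OF g1 g2 N q2] c1 c2 ..
  moreover have "?cx ?s (in2 a N k A x k' B) = vc (gx a n (ps @ sh k (ls A) @ x) k' B qs) (gx a n ps k A (x @ sh k' (lt B) @ qs))"
    unfolding in2_def V[OF g3 g4 N q2] c3 c4 ..
  ultimately show ?thesis by simp
qed

end

section \<open>A terminating system of steps, and peaks closed in the groupoid of 3-cells\<close>

subsection \<open>Rewriting strings\<close>

definition n_eta :: "adj0 \<Rightarrow> nat list \<Rightarrow> nat" where "n_eta a w = length (filter (\<lambda>p. ob a p = Ox) w)"
definition n_eps :: "adj0 \<Rightarrow> nat list \<Rightarrow> nat" where "n_eps a w = length (filter (\<lambda>p. ob a p = Oy) w)"

text \<open>\<open>m1\<close> counts the pairs of an \<eta> before an \<epsilon>. \<open>m2\<close>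
  adds the distances of the \<eta>s from the left end and of the \<epsilon>s from the right end of
  the current word; sorting two adjacent generators of the same kind lowers it by 2.\<close>

fun m1 :: "adj0 \<Rightarrow> nat list \<Rightarrow> nat" where
  "m1 a [] = 0" | "m1 a (p # w) = (if ob a p = Ox then n_eps a w else 0) + m1 a w"

fun m2 :: "adj0 \<Rightarrow> nat \<Rightarrow> nat list \<Rightarrow> nat" where
  "m2 a n [] = 0" | "m2 a n (p # w) = (if ob a p = Ox then p else n - p) + m2 a (nx a n p) w"

definition smaller :: "adj0 \<Rightarrow> nat \<Rightarrow> (nat list \<times> nat list) set" where
  "smaller a n = inv_image (less_than <*lex*> less_than) (\<lambda>w. (m1 a w, m2 a n w))"

lemma wf_smaller: "wf (smaller a n)"
  unfolding smaller_def by (intro wf_inv_image wf_lex_prod wf_less_than)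

lemma n_append: "n_eta a (v @ w) = n_eta a v + n_eta a w" "n_eps a (v @ w) = n_eps a v + n_eps a w"
  by (simp_all add: n_eta_def n_eps_def)

lemma m1_append: "m1 a (v @ w) = m1 a v + n_eta a v * n_eps a w + m1 a w"
proof (induction v)
  case (Cons p v)
  then show ?case by (cases "ob a p") (simp_all add: n_append, simp_all add: n_eta_def algebra_simps)
qed (simp add: n_eta_def)

lemma m2_append: "m2 a n (v @ w) = m2 a n v + m2 a (len a n v) w"
  by (induction a n v rule: ok.induct) simp_all

text \<open>The cross terms of \<open>m1\<close> depend only on the numbers of \<eta>s and
  \<epsilon>s, which therefore must not grow. When \<open>m1\<close> ties, the word length after the
  replaced part has to agree too, since \<open>m2\<close> of the suffix depends on it.\<close>

lemma smaller_context:
  assumes c: "n_eta a t \<le> n_eta a s" "n_eps a t \<le> n_eps a s"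
    and m: "m1 a t < m1 a s \<or> m1 a t = m1 a s \<and> n_eta a t = n_eta a s \<and> n_eps a t = n_eps a s \<and>
      len a (len a n ps) t = len a (len a n ps) s \<and> m2 a (len a n ps) t < m2 a (len a n ps) s"
  shows "(ps @ t @ qs, ps @ s @ qs) \<in> smaller a n"
proof -
  have T: "m1 a (ps @ x @ qs) = m1 a x + n_eta a ps * n_eps a x + n_eta a x * n_eps a qs +
      (m1 a ps + n_eta a ps * n_eps a qs + m1 a qs)" for x
    by (simp add: m1_append n_append algebra_simps)
  have c': "n_eta a ps * n_eps a t \<le> n_eta a ps * n_eps a s" "n_eta a t * n_eps a qs \<le> n_eta a s * n_eps a qs"
    using c by simp_all
  show ?thesis
  proof (cases "m1 a t < m1 a s")
    case True
    then have "m1 a (ps @ t @ qs) < m1 a (ps @ s @ qs)" unfolding T using c' by linarith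
    then show ?thesis by (simp add: smaller_def)
  next
    case False
    then have "m1 a (ps @ t @ qs) = m1 a (ps @ s @ qs)" "m2 a n (ps @ t @ qs) < m2 a n (ps @ s @ qs)"
      using m by (auto simp: T m2_append)
    then show ?thesis by (simp add: smaller_def)
  qed
qed

lemma ob_plus_1 [simp]: "ob a (p + 1) = opp (ob a p)"
  by (simp add: ob_def)

lemma n_simps [simp]: "n_eta a [] = 0" "n_eps a [] = 0"
  "n_eta a (p # w) = (if ob a p = Ox then 1 else 0) + n_eta a w"
  "n_eps a (p # w) = (if ob a p = Ox then 0 else 1) + n_eps a w"
  by (auto simp: n_eta_def n_eps_def) (metis adj0.exhaust)+

lemma ob_shift_2 [simp]: "ob a (Suc (Suc p)) = ob a p" "2 \<le> p \<Longrightarrow> ob a (p - 2) = ob a p" "4 \<le> p \<Longrightarrow> ob a (p - 4) = ob a p"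
  by (auto simp: ob_def)

lemma not_Ox [simp]: "a \<noteq> Ox \<longleftrightarrow> a = Oy"
  by (cases a) auto

context coherent_strings
begin

text \<open>The orientation moves every \<open>\<epsilon>\<close> before every \<open>\<eta>\<close>, cancelling them where \<open>N\<close> or \<open>N'\<close>
  applies, and sorts the \<open>\<epsilon>\<close>s and the \<open>\<eta>\<close>s with the rightmost first; unlike for the orientation
  of the interchange generators, termination is then evident from counting.\<close>

inductive pst :: "adj0 \<Rightarrow> nat \<Rightarrow> nat list \<Rightarrow> nat \<Rightarrow> nat \<Rightarrow> nat list \<Rightarrow> nat list \<Rightarrow> 'd \<Rightarrow> bool" for a n ps p q qs where
  X: "p + dout (ob a p) \<le> q \<Longrightarrow> ob a p = Ox \<or> ob a q = Oy \<Longrightarrow> q' = q - dout (ob a p) + din (ob a p) \<Longrightarrow>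
     pst a n ps p q qs [q', p] (sx a n ps p q qs)"
| Y: "ob a p = Ox \<Longrightarrow> ob a q = Oy \<Longrightarrow> q + 2 \<le> p \<Longrightarrow>
     pst a n ps p q qs [q, p - 2] (iv (sx a n ps q (p - 2) qs))"
| N: "p = k + za (ob a k) \<Longrightarrow> q = k + zb (ob a k) \<Longrightarrow> pst a n ps p q qs [] (gx a n ps k (LN (ob a k)) qs)"

definition step :: "adj0 \<Rightarrow> nat \<Rightarrow> nat list \<Rightarrow> 'd \<Rightarrow> nat list \<Rightarrow> bool" where
  "step a n w u w' \<longleftrightarrow> (\<exists>ps p q qs rhs. w = ps @ p # q # qs \<and> w' = ps @ rhs @ qs \<and> ok a n w \<and> pst a n ps p q qs rhs u)"

lemma ob_k_z [simp]: "ob a (k + za (ob a k)) = Ox" "ob a (k + zb (ob a k)) = Oy"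
  by (metis ob_ob ob_z)+

lemma pst_eta_eta:
  assumes "pst a n ps p q qs rhs u" "ob a p = Ox" "ob a q = Ox"
  shows "p + 2 \<le> q" "rhs = [q - 2, p]" "u = sx a n ps p q qs"
  using assms by (auto elim!: pst.cases)

lemma pst_eps_eps:
  assumes "pst a n ps p q qs rhs u" "ob a p = Oy" "ob a q = Oy"
  shows "p \<le> q" "rhs = [q + 2, p]" "u = sx a n ps p q qs"
  using assms by (auto elim!: pst.cases)

lemma pst_eps_eta:
  assumes "pst a n ps p q qs rhs u" "ob a q = Ox"
  shows "ob a p = Ox"
  using assms by (auto elim!: pst.cases)

text \<open>The \<epsilon> lies to the right of the output of the \<eta>, lies far enough to its
  left to act first, or takes exactly one of its two new letters; the last situation is
  \<open>N\<close> or \<open>N'\<close> according to the side.\<close>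

lemma pst_eta_eps:
  assumes "pst a n ps p q qs rhs u" "ob a p = Ox" "ob a q = Oy"
  obtains (X) "p + 2 \<le> q" "rhs = [q - 2, p]" "u = sx a n ps p q qs"
  | (Y) "q + 2 \<le> p" "rhs = [q, p - 2]" "u = iv (sx a n ps q (p - 2) qs)"
  | (N1) "q = p + 1" "rhs = []" "u = gx a n ps p (LN Ox) qs"
  | (N2) "p = q + 1" "rhs = []" "u = gx a n ps q (LN Oy) qs"
  using assms(1)
proof cases
  case X
  then show ?thesis using that(1) assms(2) by simp
next
  case Y
  then show ?thesis using that(2) by simp
next
  case (N k)
  then show ?thesis using that(3,4) by (cases "ob a k") simp_all
qed

text \<open>Kinds and relative positions of the two generators select a single rule, so two steps on
  the same pair coincide.\<close>

lemma pst_functional: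
  assumes "pst a n ps p q qs rhs u" "pst a n ps p q qs rhs' u'"
  shows "rhs = rhs' \<and> u = u'"
proof (cases "ob a q")
  case Ox
  then have "ob a p = Ox" using pst_eps_eta[OF assms(1)] by simp
  then show ?thesis using pst_eta_eta[OF assms(1)] pst_eta_eta[OF assms(2)] Ox by simp
next
  case q: Oy
  show ?thesis
  proof (cases "ob a p")
    case Ox
    from assms(1) Ox q show ?thesis
    proof (cases rule: pst_eta_eps)
      case X
      from assms(2) Ox q show ?thesis by (cases rule: pst_eta_eps) (use X in auto)
    next
      case Y
      from assms(2) Ox q show ?thesis by (cases rule: pst_eta_eps) (use Y in auto)
    next
      case N1
      from assms(2) Ox q show ?thesis by (cases rule: pst_eta_eps) (use N1 in auto)
    next
      case N2
      from assms(2) Ox q show ?thesis by (cases rule: pst_eta_eps) (use N2 in auto)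
    qed
  next
    case Oy
    then show ?thesis using pst_eps_eps[OF assms(1)] pst_eps_eps[OF assms(2)] q by simp
  qed
qed

lemma iso_iv: "iso a n s t A (iv A) \<Longrightarrow> iso a n t s (iv A) (iv (iv A)) \<and> iv (iv A) = A"
  using iso_sym iv_eq by metis

lemma iso_iv1: "iso a n s t A (iv A) \<Longrightarrow> iso a n t s (iv A) (iv (iv A))"
  using iso_iv by blast

text \<open>The \<epsilon> lies entirely to the left of the inserted letters, so it may act first;
  the \<eta> then acts two letters further left.\<close>

lemma ok_Y:
  assumes "ok a n (ps @ p # q # qs)" "ob a p = Ox" "ob a q = Oy" "q + 2 \<le> p"
  shows "ok a n (ps @ q # (p - 2) # qs)"
proof -
  define N where "N = len a n ps"
  have h: "p \<le> N" "q + 2 \<le> N + 2" "ok a N qs" using assms by (auto simp: N_def nx_def)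
  have "nx a N q = N - 2" "nx a (N - 2) (p - 2) = N" using assms h by (auto simp: nx_def)
  then show ?thesis using assms h by (auto simp: N_def[symmetric])
qed

lemma iso_N:
  assumes "ok a n (ps @ (k + za (ob a k)) # (k + zb (ob a k)) # qs)"
  shows "iso a n (ps @ (k + za (ob a k)) # (k + zb (ob a k)) # qs) (ps @ qs) (gx a n ps k (LN (ob a k)) qs)
    (iv (gx a n ps k (LN (ob a k)) qs))"
proof -
  have "k + 1 \<le> len a n ps"
    using assms by (cases "ob a k") (auto simp: nx_def)
  then show ?thesis using iso_gx[of "LN (ob a k)" a k n ps qs] assms by simp
qed

lemma pst_iso:
  assumes "pst a n ps p q qs rhs u" "ok a n (ps @ p # q # qs)"
  shows "iso a n (ps @ p # q # qs) (ps @ rhs @ qs) u (iv u)"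
  using assms(1)
proof cases
  case (X q')
  then show ?thesis using iso_sx[OF assms(2) X(3)] by simp
next
  case Y
  have "p - 2 - dout (ob a q) + din (ob a q) = p" "q + dout (ob a q) \<le> p - 2" using Y by simp_all
  then have "iso a n (ps @ q # (p - 2) # qs) (ps @ p # q # qs) (sx a n ps q (p - 2) qs) (iv (sx a n ps q (p - 2) qs))"
    using iso_sx[OF ok_Y[OF assms(2) Y(3-5)]] by simp
  from iso_iv1[OF this] show ?thesis unfolding Y(1,2) by simp
next
  case (N k)
  then show ?thesis using iso_N[of a n ps k qs] assms(2) by simp
qed

lemma step_iso: "step a n w u w' \<Longrightarrow> iso a n w w' u (iv u)"
  unfolding step_def using pst_iso by blast

lemma smaller_3:
  assumes "n_eta a [x, y, z] = n_eta a [p, q, r]" "n_eps a [x, y, z] = n_eps a [p, q, r]"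
    "m1 a [x, y, z] < m1 a [p, q, r] \<or> m1 a [x, y, z] = m1 a [p, q, r] \<and>
      len a (len a n ps) [x, y, z] = len a (len a n ps) [p, q, r] \<and> m2 a (len a n ps) [x, y, z] < m2 a (len a n ps) [p, q, r]"
  shows "(ps @ x # y # z # qs, ps @ p # q # r # qs) \<in> smaller a n"
  using smaller_context[of a "[x, y, z]" "[p, q, r]" n ps qs] assms by auto

text \<open>Steps on an \<eta> and an \<epsilon> lower \<open>m1\<close>; the sorting steps keep it
  and lower \<open>m2\<close>.\<close>

lemma step_smaller:
  assumes "step a n w u w'"
  shows "(w', w) \<in> smaller a n"
proof -
  obtain ps p q qs rhs where w: "w = ps @ [p, q] @ qs" "w' = ps @ rhs @ qs" "ok a n w" and st: "pst a n ps p q qs rhs u"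
    using assms unfolding step_def by auto
  define N where "N = len a n ps"
  have o: "p + din (ob a p) \<le> N" "q + din (ob a q) \<le> nx a N p" using w by (auto simp: N_def)
  show ?thesis
  proof (cases "ob a q")
    case q: Ox
    then have p: "ob a p = Ox" using pst_eps_eta[OF st] by simp
    show ?thesis
      unfolding w(1,2) using pst_eta_eta[OF st p q] o p q
      by (intro smaller_context) (auto simp: N_def[symmetric] nx_def)
  next
    case q: Oy
    show ?thesis
    proof (cases "ob a p")
      case p: Oy
      show ?thesis
        unfolding w(1,2) using pst_eps_eps[OF st p q] o p q
        by (intro smaller_context) (auto simp: N_def[symmetric] nx_def)
    next
      case p: Ox
      from st p q show ?thesis
        unfolding w(1,2) by (cases rule: pst_eta_eps; intro smaller_context) (use p q in auto)
    qed
  qed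
qed

text \<open>A normalization path records the composite of its steps as well as its end. Comparing
  composites, not only ends, is what turns confluence into coherence.\<close>

inductive nfp :: "adj0 \<Rightarrow> nat \<Rightarrow> nat list \<Rightarrow> 'd \<Rightarrow> nat list \<Rightarrow> bool" for a n where
  stop: "ok a n w \<Longrightarrow> \<nexists>u w'. step a n w u w' \<Longrightarrow> nfp a n w (idc D 2 (S a n w)) w"
| go: "step a n w u w' \<Longrightarrow> nfp a n w' v z \<Longrightarrow> nfp a n w (vc u v) z"

lemma nfp_exists: "ok a n w \<Longrightarrow> \<exists>v z. nfp a n w v z"
proof (induction w rule: wf_induct_rule[OF wf_smaller[of a n]])
  case (1 w)
  show ?case
  proof (cases "\<exists>u w'. step a n w u w'")
    case True
    then obtain u w' where s: "step a n w u w'" by blast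
    have "ok a n w'" using step_iso[OF s] homD(3) unfolding iso_def by blast
    then show ?thesis using 1(1)[OF step_smaller[OF s]] nfp.go[OF s] by blast
  next
    case False
    then show ?thesis using nfp.stop[OF 1(2)] by blast
  qed
qed

lemma nfp_iso: "nfp a n w v z \<Longrightarrow> iso a n w z v (iv v)"
proof (induction rule: nfp.induct)
  case (stop w)
  show ?case using iso_id[OF stop(1)] iv_eq by metis
next
  case (go w u w' v z)
  show ?case using iso_vc[OF step_iso[OF go(1)] go(3)] iv_eq by metis
qed

text \<open>A fixed choice of path, available from termination alone, before uniqueness is
  known.\<close>

definition nf :: "adj0 \<Rightarrow> nat \<Rightarrow> nat list \<Rightarrow> 'd \<times> nat list" where
  "nf a n w = (SOME (v, z). nfp a n w v z)"

abbreviation "cc a n w \<equiv> fst (nf a n w)"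
abbreviation "zz a n w \<equiv> snd (nf a n w)"

lemma nf: "ok a n w \<Longrightarrow> nfp a n w (cc a n w) (zz a n w)"
  using someI_ex[of "\<lambda>(v, z). nfp a n w v z"] nfp_exists[of a n w] unfolding nf_def by (auto split: prod.splits)

lemma iso_cc: "ok a n w \<Longrightarrow> iso a n w (zz a n w) (cc a n w) (iv (cc a n w))"
  using nf nfp_iso by blast

text \<open>Serves as induction hypothesis, with \<open>B\<close> the set of strings below a
  peak.\<close>

definition unique_on :: "adj0 \<Rightarrow> nat \<Rightarrow> nat list set \<Rightarrow> bool" where
  "unique_on a n B \<longleftrightarrow> (\<forall>s\<in>B. \<forall>v z. nfp a n s v z \<longrightarrow> nf a n s = (v, z))"

definition good :: "adj0 \<Rightarrow> nat \<Rightarrow> nat list \<Rightarrow> 'd \<Rightarrow> nat list \<Rightarrow> bool" where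
  "good a n s A t \<longleftrightarrow> iso a n s t A (iv A) \<and> zz a n s = zz a n t \<and> vc A (cc a n t) = cc a n s"

text \<open>A closed peak with legs \<open>A\<close> and \<open>B\<close>, expressed by the chosen
  paths from their ends to normal form rather than by a common reduct.\<close>

definition joined :: "adj0 \<Rightarrow> nat \<Rightarrow> 'd \<Rightarrow> nat list \<Rightarrow> 'd \<Rightarrow> nat list \<Rightarrow> bool" where
  "joined a n A s B t \<longleftrightarrow> zz a n s = zz a n t \<and> vc A (cc a n s) = vc B (cc a n t)"

lemma joined_sym: "joined a n A s B t \<Longrightarrow> joined a n B t A s"
  by (simp add: joined_def)

lemma isoD: "iso a n s t A B \<Longrightarrow> hom a n s t A" "iso a n s t A B \<Longrightarrow> hom a n t s B"
  "iso a n s t A B \<Longrightarrow> ok a n s" "iso a n s t A B \<Longrightarrow> ok a n t"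
  unfolding iso_def using homD(2,3) by blast+

lemma good_iso: "good a n s A t \<Longrightarrow> iso a n s t A (iv A)"
  by (simp add: good_def)

lemma hom_cc: "ok a n s \<Longrightarrow> hom a n s (zz a n s) (cc a n s)"
  using iso_cc isoD(1) by blast

lemma good_step:
  assumes "unique_on a n B" "s \<in> B" "step a n s u t"
  shows "good a n s u t"
proof -
  note i = step_iso[OF assms(3)]
  have "nfp a n s (vc u (cc a n t)) (zz a n t)" using nfp.go[OF assms(3) nf[OF isoD(4)[OF i]]] .
  then show ?thesis using assms(1,2) i unfolding unique_on_def good_def by auto
qed

lemma good_iv:
  assumes "good a n s A t"
  shows "good a n t (iv A) s"
proof -
  have i: "iso a n s t A (iv A)" and z: "zz a n s = zz a n t" and c: "vc A (cc a n t) = cc a n s"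
    using assms unfolding good_def by auto
  have "cc a n t = vc (iv A) (cc a n s)"
    using cancel_left[OF i hom_cc[OF isoD(4)[OF i]] hom_cc[OF isoD(3)[OF i], unfolded z]] c by simp
  then show ?thesis using iso_iv1[OF i] z unfolding good_def by metis
qed

lemma iso_vc':
  assumes "iso a n s t A (iv A)" "iso a n t u B (iv B)"
  shows "iso a n s u (vc A B) (iv (vc A B)) \<and> iv (vc A B) = vc (iv B) (iv A)"
proof -
  note i = iso_vc[OF assms]
  show ?thesis unfolding iv_eq[OF i] using i by blast
qed

lemma good_vc:
  assumes A: "good a n s A t" and B: "good a n t B u"
  shows "good a n s (vc A B) u"
proof -
  note i = good_iso[OF A] good_iso[OF B]
  have "vc (vc A B) (cc a n u) = cc a n s"
    using vc_assoc[OF isoD(1)[OF i(1)] isoD(1)[OF i(2)] hom_cc[OF isoD(4)[OF i(2)]]] A B unfolding good_def by simp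
  then show ?thesis using conjunct1[OF iso_vc'[OF i]] A B unfolding good_def by metis
qed

text \<open>A leg of a peak may be lengthened or shortened by any good 3-cell, even by one that is
  not a composite of steps, such as the inverse of a step.\<close>

lemma joined_good:
  assumes A: "iso a n x s A (iv A)" and B: "good a n s B s'"
  shows "joined a n (vc A B) s' U t \<longleftrightarrow> joined a n A s U t"
  using vc_assoc[OF isoD(1)[OF A] isoD(1)[OF good_iso[OF B]] hom_cc[OF isoD(4)[OF good_iso[OF B]]]] B
  unfolding joined_def good_def by simp

lemma joined_source:
  assumes A: "iso a n x0 x1 A (iv A)" "good a n x1 A' x3" and B: "iso a n x0 x2 B (iv B)" "good a n x2 B' x3"
    and e: "vc A A' = vc B B'"
  shows "joined a n A x1 B x2"
proof -
  have "joined a n (vc A A') x3 (vc B B') x3" unfolding e by (simp add: joined_def)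
  then have "joined a n A x1 (vc B B') x3" using joined_good[OF A] by blast
  then have "joined a n (vc B B') x3 A x1" by (rule joined_sym)
  then have "joined a n B x2 A x1" using joined_good[OF B] by blast
  then show ?thesis by (rule joined_sym)
qed

text \<open>The peak lies in the middle of a path: one leg runs backwards along \<open>A\<close>,
  the other forwards along \<open>A'\<close>.\<close>

lemma joined_middle:
  assumes A: "iso a n x0 x1 A (iv A)" "iso a n x1 x2 A' (iv A')" and e: "good a n x0 (vc A A') x2"
  shows "joined a n (iv A) x0 A' x2"
proof -
  have z: "zz a n x0 = zz a n x2" and c: "vc (vc A A') (cc a n x2) = cc a n x0" using e unfolding good_def by auto
  have h: "hom a n x2 (zz a n x2) (cc a n x2)" using hom_cc[OF isoD(4)[OF A(2)]] .
  have "vc A (vc A' (cc a n x2)) = cc a n x0"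
    using vc_assoc[OF isoD(1)[OF A(1)] isoD(1)[OF A(2)] h] c by simp
  then have "vc A' (cc a n x2) = vc (iv A) (cc a n x0)"
    using cancel_left[OF A(1) hom_vc[OF isoD(1)[OF A(2)] h] hom_cc[OF isoD(3)[OF A(1)], unfolded z]] by blast
  then show ?thesis using z unfolding joined_def by simp
qed

end

context coherent_strings
begin

subsection \<open>Critical peaks\<close>

text \<open>Every interchanger is a step or the inverse of one: in the remaining case, an \<epsilon>
  before an \<eta>, its source is the result of rule \<open>Y\<close>. Either end may thus be the
  start of the step, so both are required in \<open>B\<close>.\<close>

lemma good_sx:
  assumes U: "unique_on a n B" and o: "ok a n (ps @ p # q # qs)" and le: "p + dout (ob a p) \<le> q"
    and q': "q' = q - dout (ob a p) + din (ob a p)"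
    and b: "ps @ p # q # qs \<in> B" "ps @ q' # p # qs \<in> B"
  shows "good a n (ps @ p # q # qs) (sx a n ps p q qs) (ps @ q' # p # qs)"
proof (cases "ob a p = Ox \<or> ob a q = Oy")
  case True
  have "step a n (ps @ p # q # qs) (sx a n ps p q qs) (ps @ q' # p # qs)"
    unfolding step_def using pst.X[OF le True q', of n ps qs] o by fastforce
  then show ?thesis by (rule good_step[OF U b(1)])
next
  case False
  then have ob: "ob a p = Oy" "ob a q = Ox" using adj0.exhaust by blast+
  have e: "q' = q + 2" "ob a q' = Ox" using ob by (simp_all add: q')
  note i = iso_sx[OF o le, folded q']
  have "pst a n ps q' p qs [p, q' - 2] (iv (sx a n ps p (q' - 2) qs))"
    by (rule pst.Y) (use ob le e in auto)
  then have "step a n (ps @ q' # p # qs) (iv (sx a n ps p q qs)) (ps @ p # q # qs)"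
    unfolding step_def using isoD(4)[OF i] e(1) by fastforce
  from good_iv[OF good_step[OF U b(2) this]] show ?thesis using iso_iv[OF i] by simp
qed

lemma good_N:
  assumes U: "unique_on a n B" and o: "ok a n (ps @ (k + za (ob a k)) # (k + zb (ob a k)) # qs)"
    and b: "ps @ (k + za (ob a k)) # (k + zb (ob a k)) # qs \<in> B"
  shows "good a n (ps @ (k + za (ob a k)) # (k + zb (ob a k)) # qs) (gx a n ps k (LN (ob a k)) qs) (ps @ qs)"
proof -
  have "step a n (ps @ (k + za (ob a k)) # (k + zb (ob a k)) # qs) (gx a n ps k (LN (ob a k)) qs) (ps @ qs)"
    unfolding step_def using pst.N[OF refl refl, of a n ps k qs] o by fastforce
  then show ?thesis by (rule good_step[OF U b])
qed

text \<open>A relation between a path of three 3-cells and a 3-cell \<open>B\<close> closes the peak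
  at the start or at either inner vertex of the path, given that the 3-cells completing the circuit
  are good.\<close>

lemma joined_path:
  assumes i: "iso a n x0 x1 A1 (iv A1)" "iso a n x1 x2 A2 (iv A2)" "iso a n x2 x3 A3 (iv A3)"
    and e: "vc A1 (vc A2 A3) = B"
  shows "good a n x1 A2 x2 \<Longrightarrow> good a n x2 A3 x3 \<Longrightarrow> joined a n A1 x1 B x3"
    "good a n x0 B x3 \<Longrightarrow> good a n x2 A3 x3 \<Longrightarrow> joined a n (iv A1) x0 A2 x2"
    "good a n x0 B x3 \<Longrightarrow> good a n x0 A1 x1 \<Longrightarrow> joined a n (iv A2) x1 A3 x3"
proof -
  show "joined a n A1 x1 B x3" if g: "good a n x1 A2 x2" "good a n x2 A3 x3"
  proof -
    have "joined a n (vc A1 (vc A2 A3)) x3 B x3" unfolding e by (simp add: joined_def)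
    then show ?thesis using joined_good[OF i(1) good_vc[OF g]] by blast
  qed
  show "joined a n (iv A1) x0 A2 x2" if g: "good a n x0 B x3" "good a n x2 A3 x3"
  proof -
    have "joined a n (iv A1) x0 (vc A2 A3) x3"
      by (rule joined_middle[OF i(1) conjunct1[OF iso_vc'[OF i(2,3)]]]) (use g e in simp)
    then have "joined a n (vc A2 A3) x3 (iv A1) x0" by (rule joined_sym)
    then have "joined a n A2 x2 (iv A1) x0" using joined_good[OF i(2) g(2)] by blast
    then show ?thesis by (rule joined_sym)
  qed
  show "joined a n (iv A2) x1 A3 x3" if g: "good a n x0 B x3" "good a n x0 A1 x1"
  proof -
    note v = iso_vc'[OF i(1,2)]
    have "vc (vc A1 A2) A3 = B" using vc_assoc[OF isoD(1)[OF i(1)] isoD(1)[OF i(2)] isoD(1)[OF i(3)]] e by simp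
    then have "joined a n (iv (vc A1 A2)) x0 A3 x3"
      using joined_middle[OF conjunct1[OF v] i(3)] g by simp
    then have "joined a n (vc (iv A2) (iv A1)) x0 A3 x3" using v by simp
    then show ?thesis using joined_good[OF iso_iv1[OF i(2)] good_iv[OF g(2)]] by blast
  qed
qed

text \<open>According to the orientation of its sides, the peak is any vertex of the hexagon except
  the last. In each conclusion the other five vertices lie in \<open>B\<close>, where normalization
  is already unique.\<close>

lemma hexagon_joined:
  assumes o: "ok a n (ps @ p # q # r # qs)" and le: "p + dout (ob a p) \<le> q" "q + dout (ob a q) \<le> r"
    and q1: "q1 = q - dout (ob a p) + din (ob a p)" and r1: "r1 = r - dout (ob a q) + din (ob a q)"
    and \<rho>: "\<rho> = r - dout (ob a p) + din (ob a p)" and r2: "r2 = r1 - dout (ob a p) + din (ob a p)"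
    and U: "unique_on a n B"
  defines "v0 \<equiv> ps @ p # q # r # qs" and "v1 \<equiv> ps @ q1 # p # r # qs" and "v2 \<equiv> ps @ q1 # \<rho> # p # qs"
    and "v3 \<equiv> ps @ p # r1 # q # qs" and "v4 \<equiv> ps @ r2 # p # q # qs" and "v5 \<equiv> ps @ r2 # q1 # p # qs"
  shows "v1 \<in> B \<Longrightarrow> v2 \<in> B \<Longrightarrow> v3 \<in> B \<Longrightarrow> v4 \<in> B \<Longrightarrow> v5 \<in> B \<Longrightarrow>
      joined a n (sx a n ps p q (r # qs)) v1 (sx a n (ps @ [p]) q r qs) v3"
    "v0 \<in> B \<Longrightarrow> v2 \<in> B \<Longrightarrow> v3 \<in> B \<Longrightarrow> v4 \<in> B \<Longrightarrow> v5 \<in> B \<Longrightarrow>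
      joined a n (iv (sx a n ps p q (r # qs))) v0 (sx a n (ps @ [q1]) p r qs) v2"
    "v0 \<in> B \<Longrightarrow> v1 \<in> B \<Longrightarrow> v3 \<in> B \<Longrightarrow> v4 \<in> B \<Longrightarrow> v5 \<in> B \<Longrightarrow>
      joined a n (iv (sx a n (ps @ [q1]) p r qs)) v1 (sx a n ps q1 \<rho> (p # qs)) v5"
    "v0 \<in> B \<Longrightarrow> v1 \<in> B \<Longrightarrow> v2 \<in> B \<Longrightarrow> v4 \<in> B \<Longrightarrow> v5 \<in> B \<Longrightarrow>
      joined a n (iv (sx a n (ps @ [p]) q r qs)) v0 (sx a n ps p r1 (q # qs)) v4"
    "v0 \<in> B \<Longrightarrow> v1 \<in> B \<Longrightarrow> v2 \<in> B \<Longrightarrow> v3 \<in> B \<Longrightarrow> v5 \<in> B \<Longrightarrow>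
      joined a n (iv (sx a n ps p r1 (q # qs))) v3 (sx a n (ps @ [r2]) p q qs) v5"
proof -
  let ?A1 = "sx a n ps p q (r # qs)" and ?A2 = "sx a n (ps @ [q1]) p r qs" and ?A3 = "sx a n ps q1 \<rho> (p # qs)"
  let ?B1 = "sx a n (ps @ [p]) q r qs" and ?B2 = "sx a n ps p r1 (q # qs)" and ?B3 = "sx a n (ps @ [r2]) p q qs"
  have e: "vc ?A1 (vc ?A2 ?A3) = vc ?B1 (vc ?B2 ?B3)" by (rule hexagon[OF o le q1 r1 \<rho> r2])
  have obq: "ob a q1 = ob a q" using le by (auto simp: q1 ob_def)
  have l: "p + dout (ob a p) \<le> r" "q1 + dout (ob a q1) \<le> \<rho>" "p + dout (ob a p) \<le> r1"
    using le unfolding obq by (simp_all add: q1 \<rho> r1)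
  have t: "r2 = \<rho> - dout (ob a q1) + din (ob a q1)" using le unfolding obq by (simp add: q1 \<rho> r1 r2)
  have A1: "iso a n v0 v1 ?A1 (iv ?A1)" using iso_sx[OF o le(1)] by (simp add: v0_def v1_def q1)
  have o1: "ok a n ((ps @ [q1]) @ p # r # qs)" using isoD(4)[OF A1] by (simp add: v1_def)
  have A2: "iso a n v1 v2 ?A2 (iv ?A2)" using iso_sx[OF o1 l(1), folded \<rho>] by (simp add: v1_def v2_def)
  have o2: "ok a n (ps @ q1 # \<rho> # p # qs)" using isoD(4)[OF A2] by (simp add: v2_def)
  have A3: "iso a n v2 v5 ?A3 (iv ?A3)" using iso_sx[OF o2 l(2), folded t] by (simp add: v5_def v2_def)
  have o0: "ok a n ((ps @ [p]) @ q # r # qs)" using o by simp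
  have B1: "iso a n v0 v3 ?B1 (iv ?B1)" using iso_sx[OF o0 le(2), folded r1] by (simp add: v0_def v3_def)
  have o3: "ok a n (ps @ p # r1 # q # qs)" using isoD(4)[OF B1] by (simp add: v3_def)
  have B2: "iso a n v3 v4 ?B2 (iv ?B2)" using iso_sx[OF o3 l(3), folded r2] by (simp add: v4_def v3_def)
  have o4: "ok a n ((ps @ [r2]) @ p # q # qs)" using isoD(4)[OF B2] by (simp add: v4_def)
  have B3: "iso a n v4 v5 ?B3 (iv ?B3)" using iso_sx[OF o4 le(1), folded q1] by (simp add: v4_def v5_def)
  have gA1: "good a n v0 ?A1 v1" if "v0 \<in> B" "v1 \<in> B" using good_sx[OF U o le(1) q1] that by (simp add: v0_def v1_def)
  have gA2: "good a n v1 ?A2 v2" if "v1 \<in> B" "v2 \<in> B" using good_sx[OF U o1 l(1) \<rho>] that by (simp add: v2_def v1_def)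
  have gA3: "good a n v2 ?A3 v5" if "v2 \<in> B" "v5 \<in> B" using good_sx[OF U o2 l(2) t] that by (simp add: v2_def v5_def)
  have gB1: "good a n v0 ?B1 v3" if "v0 \<in> B" "v3 \<in> B" using good_sx[OF U o0 le(2) r1] that by (simp add: v0_def v3_def)
  have gB2: "good a n v3 ?B2 v4" if "v3 \<in> B" "v4 \<in> B" using good_sx[OF U o3 l(3) r2] that by (simp add: v3_def v4_def)
  have gB3: "good a n v4 ?B3 v5" if "v4 \<in> B" "v5 \<in> B" using good_sx[OF U o4 le(1) q1] that by (simp add: v5_def v4_def)
  show "joined a n ?A1 v1 ?B1 v3" if "v1 \<in> B" "v2 \<in> B" "v3 \<in> B" "v4 \<in> B" "v5 \<in> B"
    by (rule joined_source[OF A1 good_vc[OF gA2 gA3] B1 good_vc[OF gB2 gB3] e]) (use that in simp_all)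
  show "joined a n (iv ?A1) v0 ?A2 v2" if "v0 \<in> B" "v2 \<in> B" "v3 \<in> B" "v4 \<in> B" "v5 \<in> B"
    by (rule joined_path(2)[OF A1 A2 A3 e good_vc[OF gB1 good_vc[OF gB2 gB3]] gA3]) (use that in simp_all)
  show "joined a n (iv ?A2) v1 ?A3 v5" if "v0 \<in> B" "v1 \<in> B" "v3 \<in> B" "v4 \<in> B" "v5 \<in> B"
    by (rule joined_path(3)[OF A1 A2 A3 e good_vc[OF gB1 good_vc[OF gB2 gB3]] gA1]) (use that in simp_all)
  show "joined a n (iv ?B1) v0 ?B2 v4" if "v0 \<in> B" "v1 \<in> B" "v2 \<in> B" "v4 \<in> B" "v5 \<in> B"
    by (rule joined_path(2)[OF B1 B2 B3 e[symmetric] good_vc[OF gA1 good_vc[OF gA2 gA3]] gB3]) (use that in simp_all)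
  show "joined a n (iv ?B2) v3 ?B3 v5" if "v0 \<in> B" "v1 \<in> B" "v2 \<in> B" "v3 \<in> B" "v5 \<in> B"
    by (rule joined_path(3)[OF B1 B2 B3 e[symmetric] good_vc[OF gA1 good_vc[OF gA2 gA3]] gB1]) (use that in simp_all)
qed

text \<open>The peak is the start of the slide or the string after its first swap; in the second
  case that swap is traversed backwards.\<close>

lemma slide_left_joined:
  fixes a :: adj0 and k r :: nat
  defines "b \<equiv> ob a k"
  assumes o: "ok a n (ps @ (k + za b) # (k + zb b) # r # qs)" and r: "k + 1 \<le> r"
    and U: "unique_on a n B"
  defines "x0 \<equiv> ps @ (k + za b) # (k + zb b) # r # qs" and "x1 \<equiv> ps @ (k + za b) # (r + 2) # (k + zb b) # qs"
    and "x2 \<equiv> ps @ r # (k + za b) # (k + zb b) # qs"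
  shows "x1 \<in> B \<Longrightarrow> x2 \<in> B \<Longrightarrow> joined a n (gx a n ps k (LN b) (r # qs)) (ps @ r # qs) (sx a n (ps @ [k + za b]) (k + zb b) r qs) x1"
    "x0 \<in> B \<Longrightarrow> x2 \<in> B \<Longrightarrow> joined a n (iv (sx a n (ps @ [k + za b]) (k + zb b) r qs)) x0 (sx a n ps (k + za b) (r + 2) ((k + zb b) # qs)) x2"
proof -
  let ?U = "gx a n ps k (LN b) (r # qs)" and ?A1 = "sx a n (ps @ [k + za b]) (k + zb b) r qs"
    and ?A2 = "sx a n ps (k + za b) (r + 2) ((k + zb b) # qs)" and ?A3 = "gx a n (ps @ [r]) k (LN b) qs"
  have e: "vc ?A1 (vc ?A2 ?A3) = ?U" using slide_left[OF o[unfolded b_def] r] by (simp add: b_def)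
  have ob: "ob a (k + za b) = Ox" "ob a (k + zb b) = Oy" by (simp_all add: b_def)
  have l: "k + zb b + dout (ob a (k + zb b)) \<le> r" "k + za b + dout (ob a (k + za b)) \<le> r + 2"
    using r z_le[of b] unfolding ob by simp_all
  have t: "r + 2 = r - dout (ob a (k + zb b)) + din (ob a (k + zb b))" "r = r + 2 - dout (ob a (k + za b)) + din (ob a (k + za b))"
    unfolding ob by simp_all
  have o0: "ok a n ((ps @ [k + za b]) @ (k + zb b) # r # qs)" using o by simp
  have A1: "iso a n x0 x1 ?A1 (iv ?A1)" using iso_sx[OF o0 l(1), folded t] by (simp add: x0_def x1_def)
  have o1: "ok a n (ps @ (k + za b) # (r + 2) # (k + zb b) # qs)" using isoD(4)[OF A1] by (simp only: x1_def)
  have A2: "iso a n x1 x2 ?A2 (iv ?A2)" using iso_sx[OF o1 l(2)] unfolding t(2)[symmetric] x1_def x2_def .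
  have o2: "ok a n ((ps @ [r]) @ (k + za (ob a k)) # (k + zb (ob a k)) # qs)" using isoD(4)[OF A2] by (simp add: x2_def b_def)
  have A3: "iso a n x2 (ps @ r # qs) ?A3 (iv ?A3)" using iso_N[OF o2] by (simp add: x2_def b_def)
  have gA2: "good a n x1 ?A2 x2" if "x1 \<in> B" "x2 \<in> B" using good_sx[OF U o1 l(2) t(2)] that by (simp add: x1_def x2_def)
  have gA3: "good a n x2 ?A3 (ps @ r # qs)" if "x2 \<in> B" using good_N[OF U o2] that by (simp add: x2_def b_def)
  have gU: "good a n x0 ?U (ps @ r # qs)" if "x0 \<in> B" using good_N[OF U, of ps k "r # qs"] o that by (simp add: x0_def b_def)
  show "joined a n ?U (ps @ r # qs) ?A1 x1" if "x1 \<in> B" "x2 \<in> B"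
    by (rule joined_sym, rule joined_path(1)[OF A1 A2 A3 e gA2 gA3]) (use that in simp_all)
  show "joined a n (iv ?A1) x0 ?A2 x2" if "x0 \<in> B" "x2 \<in> B"
    by (rule joined_path(2)[OF A1 A2 A3 e gU gA3]) (use that in simp_all)
qed

lemma slide_right_joined:
  fixes a :: adj0 and k p :: nat
  defines "z \<equiv> ob a k"
  assumes o: "ok a n (ps @ p # (k + za z) # (k + zb z) # qs)" and p: "p + dout (ob a p) \<le> k"
    and k': "k' = k - dout (ob a p) + din (ob a p)" and U: "unique_on a n B"
  defines "x0 \<equiv> ps @ p # (k + za z) # (k + zb z) # qs" and "x1 \<equiv> ps @ (k' + za z) # p # (k + zb z) # qs"
    and "x2 \<equiv> ps @ (k' + za z) # (k' + zb z) # p # qs"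
  shows "x1 \<in> B \<Longrightarrow> x2 \<in> B \<Longrightarrow> joined a n (sx a n ps p (k + za z) ((k + zb z) # qs)) x1 (gx a n (ps @ [p]) k (LN z) qs) (ps @ p # qs)"
    "x0 \<in> B \<Longrightarrow> x2 \<in> B \<Longrightarrow> joined a n (iv (sx a n ps p (k + za z) ((k + zb z) # qs))) x0 (sx a n (ps @ [k' + za z]) p (k + zb z) qs) x2"
proof -
  let ?U = "gx a n (ps @ [p]) k (LN z) qs" and ?A1 = "sx a n ps p (k + za z) ((k + zb z) # qs)"
    and ?A2 = "sx a n (ps @ [k' + za z]) p (k + zb z) qs" and ?A3 = "gx a n ps k' (LN z) (p # qs)"
  have e: "vc ?A1 (vc ?A2 ?A3) = ?U" using slide_right[OF o[unfolded z_def] p k'] by (simp add: z_def)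
  have ok': "ob a k' = z" using p by (auto simp: k' z_def ob_def)
  have l: "p + dout (ob a p) \<le> k + za z" "p + dout (ob a p) \<le> k + zb z" using p by simp_all
  have t: "k' + za z = k + za z - dout (ob a p) + din (ob a p)" "k' + zb z = k + zb z - dout (ob a p) + din (ob a p)"
    using p by (simp_all add: k')
  have A1: "iso a n x0 x1 ?A1 (iv ?A1)" using iso_sx[OF o l(1)] unfolding t(1)[symmetric] x0_def x1_def .
  have o1: "ok a n ((ps @ [k' + za z]) @ p # (k + zb z) # qs)" using isoD(4)[OF A1] by (simp add: x1_def)
  have A2: "iso a n x1 x2 ?A2 (iv ?A2)" using iso_sx[OF o1 l(2)] unfolding t(2)[symmetric] x1_def x2_def by simp
  have o2: "ok a n (ps @ (k' + za (ob a k')) # (k' + zb (ob a k')) # p # qs)" using isoD(4)[OF A2] by (simp add: x2_def ok')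
  have A3: "iso a n x2 (ps @ p # qs) ?A3 (iv ?A3)" using iso_N[OF o2] by (simp add: x2_def ok')
  have o0: "ok a n ((ps @ [p]) @ (k + za (ob a k)) # (k + zb (ob a k)) # qs)" using o by (simp add: z_def)
  have gA2: "good a n x1 ?A2 x2" if "x1 \<in> B" "x2 \<in> B" using good_sx[OF U o1 l(2) t(2)] that by (simp add: x1_def x2_def)
  have gA3: "good a n x2 ?A3 (ps @ p # qs)" if "x2 \<in> B" using good_N[OF U o2] that by (simp add: x2_def ok')
  have gU: "good a n x0 ?U (ps @ p # qs)" if "x0 \<in> B" using good_N[OF U o0] that by (simp add: x0_def z_def)
  show "joined a n ?A1 x1 ?U (ps @ p # qs)" if "x1 \<in> B" "x2 \<in> B"
    by (rule joined_path(1)[OF A1 A2 A3 e gA2 gA3]) (use that in simp_all)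
  show "joined a n (iv ?A1) x0 ?A2 x2" if "x0 \<in> B" "x2 \<in> B"
    by (rule joined_path(2)[OF A1 A2 A3 e gU gA3]) (use that in simp_all)
qed

lemma joined_triangle:
  assumes "iso a n x0 x1 A1 (iv A1)" "good a n x1 A2 x2" "U = vc A1 A2"
  shows "joined a n U x2 A1 x1"
proof -
  have "joined a n (vc A1 A2) x2 U x2" unfolding assms(3) by (simp add: joined_def)
  then have "joined a n A1 x1 U x2" using joined_good[OF assms(1,2)] by blast
  then show ?thesis by (rule joined_sym)
qed

lemma triangle_eps_joined:
  assumes k: "ob a k = Oy" and o: "ok a n (ps @ (k + 1) # k # k # qs)" and U: "unique_on a n B"
    and b: "ps @ (k + 1) # (k + 2) # k # qs \<in> B"
  shows "joined a n (gx a n ps k (LN Oy) (k # qs)) (ps @ k # qs) (sx a n (ps @ [k + 1]) k k qs) (ps @ (k + 1) # (k + 2) # k # qs)"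
proof (rule joined_triangle[OF _ _ triangle_eps[OF k o]])
  have o': "ok a n ((ps @ [k + 1]) @ k # k # qs)" using o by simp
  have l: "k + dout (ob a k) \<le> k" "k - dout (ob a k) + din (ob a k) = k + 2" using k by simp_all
  show i: "iso a n (ps @ (k + 1) # k # k # qs) (ps @ (k + 1) # (k + 2) # k # qs) (sx a n (ps @ [k + 1]) k k qs) (iv (sx a n (ps @ [k + 1]) k k qs))"
    using iso_sx[OF o' l(1)] unfolding l(2) by simp
  have z: "ob a (k + 1) = Ox" "k + 1 + 1 = k + 2" "za Ox = 0" "zb Ox = 1" using k by simp_all
  show "good a n (ps @ (k + 1) # (k + 2) # k # qs) (gx a n ps (k + 1) (LN Ox) (k # qs)) (ps @ k # qs)"
    using good_N[OF U, of ps "k + 1" "k # qs"] b isoD(4)[OF i] unfolding z by (simp only: z add_0_right)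
qed

lemma triangle_eta_joined:
  assumes k: "ob a k = Ox" and o: "ok a n (ps @ k # (k + 2) # (k + 1) # qs)" and U: "unique_on a n B"
    and b: "ps @ k # k # (k + 1) # qs \<in> B"
  shows "joined a n (gx a n (ps @ [k]) (k + 1) (LN Oy) qs) (ps @ k # qs) (sx a n ps k (k + 2) ((k + 1) # qs)) (ps @ k # k # (k + 1) # qs)"
proof (rule joined_triangle[OF _ _ triangle_eta[OF k o]])
  have l: "k + dout (ob a k) \<le> k + 2" "k + 2 - dout (ob a k) + din (ob a k) = k" using k by simp_all
  show i: "iso a n (ps @ k # (k + 2) # (k + 1) # qs) (ps @ k # k # (k + 1) # qs) (sx a n ps k (k + 2) ((k + 1) # qs)) (iv (sx a n ps k (k + 2) ((k + 1) # qs)))"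
    using iso_sx[OF o l(1)] unfolding l(2) by simp
  have o': "ok a n ((ps @ [k]) @ (k + za (ob a k)) # (k + zb (ob a k)) # qs)" using isoD(4)[OF i] k by simp
  show "good a n (ps @ k # k # (k + 1) # qs) (gx a n (ps @ [k]) k (LN Ox) qs) (ps @ k # qs)"
    using good_N[OF U o'] b k by simp
qed

end

context coherent_strings
begin

text \<open>With three \<eta>s, every other vertex of the hexagon has a smaller sum of positions
  than the start, which is the peak.\<close>

lemma critical_eta:
  assumes o: "ok a n (ps @ p # q # r # qs)" and U: "unique_on a n {s. (s, ps @ p # q # r # qs) \<in> smaller a n}"
    and s: "pst a n ps p q (r # qs) rhs1 u1" "pst a n (ps @ [p]) q r qs rhs2 u2" and r: "ob a r = Ox"
  shows "joined a n u1 (ps @ rhs1 @ r # qs) u2 (ps @ p # rhs2 @ qs)"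
proof -
  have ob: "ob a q = Ox" "ob a p = Ox" "ob a r = Ox" using pst_eps_eta[OF s(2) r] pst_eps_eta[OF s(1)] r by auto
  note 1 = pst_eta_eta[OF s(1) ob(2,1)] and 2 = pst_eta_eta[OF s(2) ob(1,3)]
  have le: "p + dout (ob a p) \<le> q" "q + dout (ob a q) \<le> r" using 1(1) 2(1) ob by simp_all
  have e: "q - 2 = q - dout (ob a p) + din (ob a p)" "r - 2 = r - dout (ob a q) + din (ob a q)"
    "r - 2 = r - dout (ob a p) + din (ob a p)" "r - 4 = r - 2 - dout (ob a p) + din (ob a p)" using ob by simp_all
  have B: "(ps @ x # y # z # qs, ps @ p # q # r # qs) \<in> smaller a n"
    if "ob a x = Ox" "ob a y = Ox" "ob a z = Ox" "x + y + z < p + q + r" for x y z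
    by (rule smaller_3) (use ob that in \<open>simp_all add: nx_def\<close>)
  have "joined a n (sx a n ps p q (r # qs)) (ps @ (q - 2) # p # r # qs) (sx a n (ps @ [p]) q r qs) (ps @ p # (r - 2) # q # qs)"
    by (rule hexagon_joined(1)[OF o le e U]; rule CollectI; rule B) (use ob 1(1) 2(1) in simp_all)
  then show ?thesis using 1 2 by simp
qed

lemma critical_eps:
  assumes o: "ok a n (ps @ p # q # r # qs)" and U: "unique_on a n {s. (s, ps @ p # q # r # qs) \<in> smaller a n}"
    and s: "pst a n ps p q (r # qs) rhs1 u1" "pst a n (ps @ [p]) q r qs rhs2 u2"
    and ob: "ob a p = Oy" "ob a q = Oy" "ob a r = Oy"
  shows "joined a n u1 (ps @ rhs1 @ r # qs) u2 (ps @ p # rhs2 @ qs)"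
proof -
  note 1 = pst_eps_eps[OF s(1) ob(1,2)] and 2 = pst_eps_eps[OF s(2) ob(2,3)]
  define N where "N = len a n ps"
  have le: "p + dout (ob a p) \<le> q" "q + dout (ob a q) \<le> r" using 1(1) 2(1) ob by simp_all
  have e: "q + 2 = q - dout (ob a p) + din (ob a p)" "r + 2 = r - dout (ob a q) + din (ob a q)"
    "r + 2 = r - dout (ob a p) + din (ob a p)" "r + 4 = r + 2 - dout (ob a p) + din (ob a p)" using ob by simp_all
  \<comment> \<open>Three successive deletions fit into the word; this bound keeps the differences
    in \<open>m2\<close> from being truncated.\<close>
  have N: "r + 6 \<le> N" using o ob 1(1) 2(1) by (auto simp: nx_def N_def[symmetric])
  have B: "(ps @ x # y # z # qs, ps @ p # q # r # qs) \<in> smaller a n"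
    if "ob a x = Oy" "ob a y = Oy" "ob a z = Oy" "p + q + r < x + y + z" "x \<le> N" "y + 2 \<le> N" "z + 4 \<le> N" for x y z
    by (rule smaller_3) (use ob that N 1(1) 2(1) in \<open>simp_all add: nx_def N_def[symmetric]\<close>)
  have "joined a n (sx a n ps p q (r # qs)) (ps @ (q + 2) # p # r # qs) (sx a n (ps @ [p]) q r qs) (ps @ p # (r + 2) # q # qs)"
    by (rule hexagon_joined(1)[OF o le e U]; rule CollectI; rule B) (use ob 1(1) 2(1) N in simp_all)
  then show ?thesis using 1 2 by simp
qed

text \<open>The two \<eta>s admit only the sorting step. The shape of the peak depends on the
  position of the \<epsilon> relative to the second \<eta> and, when it lies far to the left of
  that, relative to the first as well.\<close>

lemma critical_eta_eta_eps:
  assumes o: "ok a n (ps @ p # q # r # qs)" and U: "unique_on a n {s. (s, ps @ p # q # r # qs) \<in> smaller a n}"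
    and s: "pst a n ps p q (r # qs) rhs1 u1" "pst a n (ps @ [p]) q r qs rhs2 u2"
    and ob: "ob a p = Ox" "ob a q = Ox" "ob a r = Oy"
  shows "joined a n u1 (ps @ rhs1 @ r # qs) u2 (ps @ p # rhs2 @ qs)"
proof -
  note 1 = pst_eta_eta[OF s(1) ob(1,2)]
  have par: "q \<noteq> p + 3" "p \<noteq> r" "q \<noteq> r" "q \<noteq> r + 2" "p \<noteq> r + 2"
    using ob by (auto simp: ob_def split: if_splits)
  define N where "N = len a n ps"
  have oN: "p \<le> N" "q \<le> N + 2" "r \<le> N + 2" using o ob by (auto simp: nx_def N_def[symmetric])
  \<comment> \<open>The three generators of the peak contribute 2 to \<open>m1\<close>. An
    \<epsilon> that is not last lowers this; otherwise the \<epsilon> stays at \<open>r\<close> and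
    the \<eta>s have moved left in total.\<close>
  have B: "ps @ x # y # z # qs \<in> {s. (s, ps @ p # q # r # qs) \<in> smaller a n}"
    if "n_eta a [x, y, z] = 2" "ob a z = Ox \<or> ob a y = Ox \<and> ob a x = Oy \<or> ob a x = Ox \<and> ob a y = Ox \<and> x + y < p + q \<and> z = r" for x y z
    using that smaller_3[of a x y z p q r n ps qs] ob oN by (auto simp: nx_def N_def[symmetric] split: if_splits)
  have D: "joined a n (sx a n ps p q (r # qs)) (ps @ (q - 2) # p # r # qs) u2 (ps @ p # rhs2 @ qs)"
    using s(2) ob(2,3)
  proof (cases rule: pst_eta_eps)
    case X
    have le: "p + dout (ob a p) \<le> q" "q + dout (ob a q) \<le> r" using 1(1) X ob by simp_all
    have e: "q - 2 = q - dout (ob a p) + din (ob a p)" "r - 2 = r - dout (ob a q) + din (ob a q)"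
      "r - 2 = r - dout (ob a p) + din (ob a p)" "r - 4 = r - 2 - dout (ob a p) + din (ob a p)" using ob by simp_all
    have "joined a n (sx a n ps p q (r # qs)) (ps @ (q - 2) # p # r # qs) (sx a n (ps @ [p]) q r qs) (ps @ p # (r - 2) # q # qs)"
      by (rule hexagon_joined(1)[OF o le e U]; rule B) (use ob 1(1) X in simp_all)
    then show ?thesis using X by simp
  next
    case N1
    have q1: "ob a (q - 1) = Oy" using ob_plus_1[of a "q - 1"] 1(1) ob by (cases "ob a (q - 1)") simp_all
    have p: "p + dout (ob a p) \<le> q" and k': "q - 2 = q - dout (ob a p) + din (ob a p)" using ob 1 by simp_all
    have o': "ok a n (ps @ p # (q + za (ob a q)) # (q + zb (ob a q)) # qs)" using o ob N1 by simp
    have U': "unique_on a n {s. (s, ps @ p # q # (q + 1) # qs) \<in> smaller a n}" using U N1 by simp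
    have B': "ps @ x # y # z # qs \<in> {s. (s, ps @ p # q # (q + 1) # qs) \<in> smaller a n} \<longleftrightarrow> ps @ x # y # z # qs \<in> {s. (s, ps @ p # q # r # qs) \<in> smaller a n}" for x y z
      using N1 by simp
    note J = slide_right_joined(1)[OF o' p k' U', unfolded ob za.simps zb.simps add_0_right B']
    have "joined a n (sx a n ps p q ((q + 1) # qs)) (ps @ (q - 2) # p # (q + 1) # qs) (gx a n (ps @ [p]) q (LN Ox) qs) (ps @ p # qs)"
      by (rule J; rule B) (use ob 1(1) N1 q1 in simp_all)
    then show ?thesis using N1 by simp
  next
    case N2
    show ?thesis
    \<comment> \<open>For \<open>q = p + 2\<close> the \<epsilon> takes one letter from the output
      of each \<eta>, and the triangle relation applies. Otherwise parity leaves enough room for the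
      first \<eta> and the zigzag to slide past each other.\<close>
    proof (cases "q = p + 2")
      case True
      have r: "r = p + 1" using N2 True by simp
      have o': "ok a n (ps @ p # (p + 2) # (p + 1) # qs)" using o r True by simp
      have b: "ps @ p # p # (p + 1) # qs \<in> {s. (s, ps @ p # q # r # qs) \<in> smaller a n}"
        by (rule B) (use ob r True in simp_all)
      show ?thesis using joined_sym[OF triangle_eta_joined[OF ob(1) o' U b]] N2 r True by simp
    next
      case False
      have r: "p + dout (ob a p) \<le> r" "2 \<le> r" and k': "r - 2 = r - dout (ob a p) + din (ob a p)"
        using ob 1(1) False par N2 by simp_all
      have eq: "r + 1 = q" "r - 2 + 1 = q - 2" using N2 r by simp_all
      have o': "ok a n (ps @ p # (r + za (ob a r)) # (r + zb (ob a r)) # qs)" using o ob N2 by simp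
      note J = slide_right_joined(1)[OF o' r(1) k' U, unfolded ob za.simps zb.simps add_0_right eq]
      have "joined a n (sx a n ps p q (r # qs)) (ps @ (q - 2) # p # r # qs) (gx a n (ps @ [p]) r (LN Oy) qs) (ps @ p # qs)"
        by (rule J; rule B) (use ob 1(1) r eq in simp_all)
      then show ?thesis using N2 by simp
    qed
  next
    case Y
    have q2: "q - 2 + 2 = q" using Y by simp
    have oY: "ok a n ((ps @ [p]) @ r # (q - 2) # qs)" by (rule ok_Y) (use o ob Y in simp_all)
    then have oY': "ok a n (ps @ p # r # (q - 2) # qs)" by simp
    \<comment> \<open>After the \<epsilon> has passed the second \<eta>, its position relative to
      the first decides. In the outer two cases it is clear of that \<eta>, and the peak is an inner
      vertex of a hexagon; in the middle two it forms a zigzag with it, and the second \<eta> slides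
      past.\<close>
    consider (1) "p + 2 \<le> r" | (2) "r = p + 1" | (3) "p = r + 1" | (4) "r + 2 \<le> p" using par by linarith
    then have "joined a n (iv (sx a n (ps @ [p]) r (q - 2) qs)) (ps @ p # r # (q - 2) # qs) (sx a n ps p q (r # qs)) (ps @ (q - 2) # p # r # qs)"
    proof cases
      case 1: 1
      have le: "p + dout (ob a p) \<le> r" "r + dout (ob a r) \<le> q - 2" using 1 Y ob by simp_all
      have e: "r - 2 = r - dout (ob a p) + din (ob a p)" "q = q - 2 - dout (ob a r) + din (ob a r)"
        "q - 4 = q - 2 - dout (ob a p) + din (ob a p)" "q - 2 = q - dout (ob a p) + din (ob a p)" using ob Y by simp_all
      show ?thesis by (rule hexagon_joined(4)[OF oY' le e U]; rule B) (use ob 1 Y in simp_all)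
    next
      case 2
      have o': "ok a n (ps @ (p + za (ob a p)) # (p + zb (ob a p)) # (q - 2) # qs)" using oY' ob 2 by simp
      have le: "p + 1 \<le> q - 2" using Y 2 by simp
      note J = slide_left_joined(2)[OF o' le U, unfolded ob za.simps zb.simps add_0_right q2 2[symmetric]]
      show ?thesis by (rule J; rule B) (use ob 2 Y \<open>p + 2 \<le> q\<close> in simp_all)
    next
      case 3
      have o': "ok a n (ps @ (r + za (ob a r)) # (r + zb (ob a r)) # (q - 2) # qs)" using oY' ob 3 by simp
      have le: "r + 1 \<le> q - 2" using 1(1) 3 by simp
      note J = slide_left_joined(2)[OF o' le U, unfolded ob za.simps zb.simps add_0_right q2 3[symmetric]]
      show ?thesis by (rule J; rule B) (use ob 3 Y \<open>p + 2 \<le> q\<close> in simp_all)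
    next
      case 4
      have o': "ok a n (ps @ r # (p - 2) # (q - 2) # qs)" by (rule ok_Y) (use oY ob 4 in simp_all)
      have le: "r + dout (ob a r) \<le> p - 2" "p - 2 + dout (ob a (p - 2)) \<le> q - 2" using 1(1) 4 ob by simp_all
      have e: "p = p - 2 - dout (ob a r) + din (ob a r)" "q - 4 = q - 2 - dout (ob a (p - 2)) + din (ob a (p - 2))"
        "q = q - 2 - dout (ob a r) + din (ob a r)" "q - 2 = q - 4 - dout (ob a r) + din (ob a r)" using ob 1(1) 4 by simp_all
      show ?thesis by (rule hexagon_joined(3)[OF o' le e U]; rule B) (use ob 4 Y \<open>p + 2 \<le> q\<close> in simp_all)
    qed
    then show ?thesis using joined_sym Y by simp
  qed
  then show ?thesis using 1 by simp
qed

text \<open>The two \<epsilon>s admit only the sorting step. The shape of the peak depends on the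
  position of the \<eta> relative to the first \<epsilon>, and sometimes relative to the
  second.\<close>

lemma critical_eta_eps_eps:
  assumes o: "ok a n (ps @ p # q # r # qs)" and U: "unique_on a n {s. (s, ps @ p # q # r # qs) \<in> smaller a n}"
    and s: "pst a n ps p q (r # qs) rhs1 u1" "pst a n (ps @ [p]) q r qs rhs2 u2"
    and ob: "ob a p = Ox" "ob a q = Oy" "ob a r = Oy"
  shows "joined a n u1 (ps @ rhs1 @ r # qs) u2 (ps @ p # rhs2 @ qs)"
proof -
  note 2 = pst_eps_eps[OF s(2) ob(2,3)]
  have par: "r + 2 \<noteq> p" "p \<noteq> r" "p \<noteq> r + 4" "p \<noteq> q" using ob by (auto simp: ob_def split: if_splits)
  define N where "N = len a n ps"
  have oN: "p \<le> N" "q \<le> N" "r + 2 \<le> N" using o ob by (auto simp: nx_def N_def[symmetric])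
  \<comment> \<open>The peak again contributes 2 to \<open>m1\<close>. With an \<epsilon> in front
    at most 1 remains; otherwise the \<eta> stays at \<open>p\<close>, the \<epsilon>s have moved
    right in total, and the bounds by \<open>N\<close> prevent truncation in
    \<open>m2\<close>.\<close>
  have B: "ps @ x # y # z # qs \<in> {s. (s, ps @ p # q # r # qs) \<in> smaller a n}"
    if "n_eta a [x, y, z] = 1" "ob a x = Oy \<or> x = p \<and> ob a y = Oy \<and> ob a z = Oy \<and> q + r < y + z \<and> y \<le> N + 2 \<and> z \<le> N" for x y z
    using that smaller_3[of a x y z p q r n ps qs] ob oN by (auto simp: nx_def N_def[symmetric] split: if_splits)
  have D: "joined a n u1 (ps @ rhs1 @ r # qs) (sx a n (ps @ [p]) q r qs) (ps @ p # (r + 2) # q # qs)"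
    using s(1) ob(1,2)
  proof (cases rule: pst_eta_eps)
    case X
    have le: "p + dout (ob a p) \<le> q" "q + dout (ob a q) \<le> r" using 2(1) X ob by simp_all
    have e: "q - 2 = q - dout (ob a p) + din (ob a p)" "r + 2 = r - dout (ob a q) + din (ob a q)"
      "r - 2 = r - dout (ob a p) + din (ob a p)" "r = r + 2 - dout (ob a p) + din (ob a p)" using ob by simp_all
    have "joined a n (sx a n ps p q (r # qs)) (ps @ (q - 2) # p # r # qs) (sx a n (ps @ [p]) q r qs) (ps @ p # (r + 2) # q # qs)"
      by (rule hexagon_joined(1)[OF o le e U]; rule B) (use ob 2(1) X oN in simp_all)
    then show ?thesis using X by simp
  next
    case N1
    have o': "ok a n (ps @ (p + za (ob a p)) # (p + zb (ob a p)) # r # qs)" using o ob N1 by simp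
    have le: "p + 1 \<le> r" using 2(1) N1 by simp
    note J = slide_left_joined(1)[OF o' le U, unfolded ob za.simps zb.simps add_0_right N1(1)[symmetric]]
    have "joined a n (gx a n ps p (LN Ox) (r # qs)) (ps @ r # qs) (sx a n (ps @ [p]) q r qs) (ps @ p # (r + 2) # q # qs)"
      by (rule J; rule B) (use ob 2(1) oN in simp_all)
    then show ?thesis using N1 by simp
  next
    case N2
    show ?thesis
    \<comment> \<open>For \<open>r = q\<close> each of the two \<epsilon>s takes one of the letters
      inserted by the \<eta>, and the triangle relation applies; otherwise the second \<epsilon> is
      clear of the zigzag and slides past it.\<close>
    proof (cases "r = q")
      case True
      have o': "ok a n (ps @ (q + 1) # q # q # qs)" using o N2 True by simp
      have b: "ps @ (q + 1) # (q + 2) # q # qs \<in> {s. (s, ps @ p # q # r # qs) \<in> smaller a n}"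
        by (rule B) (use ob N2 True oN in simp_all)
      show ?thesis using triangle_eps_joined[OF ob(2) o' U b] N2 True by simp
    next
      case False
      have o': "ok a n (ps @ (q + za (ob a q)) # (q + zb (ob a q)) # r # qs)" using o ob N2 by simp
      have le: "q + 1 \<le> r" using 2(1) False by simp
      note J = slide_left_joined(1)[OF o' le U, unfolded ob za.simps zb.simps add_0_right N2(1)[symmetric]]
      have "joined a n (gx a n ps q (LN Oy) (r # qs)) (ps @ r # qs) (sx a n (ps @ [p]) q r qs) (ps @ p # (r + 2) # q # qs)"
        by (rule J; rule B) (use ob 2(1) oN in simp_all)
      then show ?thesis using N2 by simp
    qed
  next
    case Y
    have oY: "ok a n (ps @ q # (p - 2) # r # qs)" by (rule ok_Y) (use o ob Y in simp_all)
    \<comment> \<open>After passing the first \<epsilon> the \<eta> stands at \<open>p - 2\<close>.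
      In the outer two cases it is clear of the second \<epsilon>, and a hexagon applies; in the
      middle two it meets it in a zigzag, \<open>N\<close> for \<open>p = r + 1\<close> and
      \<open>N'\<close> for \<open>p = r + 3\<close>. Parity excludes
      \<open>p = r + 2\<close>.\<close>
    consider (1) "p \<le> r" | (2) "p = r + 1" | (3) "p = r + 3" | (4) "r + 4 \<le> p" using par by linarith
    then have "joined a n (iv (sx a n ps q (p - 2) (r # qs))) (ps @ q # (p - 2) # r # qs) (sx a n (ps @ [p]) q r qs) (ps @ p # (r + 2) # q # qs)"
    proof cases
      case 1
      have le: "q + dout (ob a q) \<le> p - 2" "p - 2 + dout (ob a (p - 2)) \<le> r" using 1 Y ob by simp_all
      have e: "p = p - 2 - dout (ob a q) + din (ob a q)" "r - 2 = r - dout (ob a (p - 2)) + din (ob a (p - 2))"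
        "r + 2 = r - dout (ob a q) + din (ob a q)" "r = r - 2 - dout (ob a q) + din (ob a q)" using ob 1 Y by simp_all
      show ?thesis by (rule hexagon_joined(2)[OF oY le e U]; rule B) (use ob 1 Y oN 2(1) in simp_all)
    next
      case 2: 2
      have k: "ob a (p - 2) = Ox" using ob Y by simp
      have eq: "p - 2 + 1 = r" "p + 1 = r + 2" using 2 Y by simp_all
      have o': "ok a n (ps @ q # (p - 2 + za (ob a (p - 2))) # (p - 2 + zb (ob a (p - 2))) # qs)"
        using oY unfolding k za.simps zb.simps add_0_right eq .
      have le: "q + dout (ob a q) \<le> p - 2" "p = p - 2 - dout (ob a q) + din (ob a q)" using Y ob by simp_all
      note J = slide_right_joined(2)[OF o' le U, unfolded k za.simps zb.simps add_0_right eq]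
      have k2: "ob a (r - 1) = Ox" using k 2 by simp
      show ?thesis by (rule J; rule B) (use ob Y oN 2 k2 in simp_all)
    next
      case 3
      have eq: "r + 1 = p - 2" "r + 2 + 1 = p" using 3 by simp_all
      have o': "ok a n (ps @ q # (r + za (ob a r)) # (r + zb (ob a r)) # qs)" using oY ob eq by simp
      have le: "q + dout (ob a q) \<le> r" "r + 2 = r - dout (ob a q) + din (ob a q)" using 2(1) ob by simp_all
      note J = slide_right_joined(2)[OF o' le U, unfolded ob za.simps zb.simps add_0_right eq]
      have k3: "ob a (1 + r) = Ox" using ob_plus_1[of a r] ob by (simp add: add.commute)
      show ?thesis by (rule J; rule B) (use ob Y oN 3 k3 in simp_all)
    next
      case 4
      have "ok a n ((ps @ [q]) @ r # (p - 2 - 2) # qs)" by (rule ok_Y) (use oY ob 4 in simp_all)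
      then have o': "ok a n (ps @ q # r # (p - 4) # qs)" by simp
      have le: "q + dout (ob a q) \<le> r" "r + dout (ob a r) \<le> p - 4" using 2(1) 4 ob by simp_all
      have e: "r + 2 = r - dout (ob a q) + din (ob a q)" "p - 2 = p - 4 - dout (ob a r) + din (ob a r)"
        "p - 2 = p - 4 - dout (ob a q) + din (ob a q)" "p = p - 2 - dout (ob a q) + din (ob a q)" using ob 4 by simp_all
      show ?thesis by (rule hexagon_joined(5)[OF o' le e U]; rule B) (use ob 4 Y oN 2(1) in simp_all)
    qed
    then show ?thesis using Y by simp
  qed
  then show ?thesis using 2 by simp
qed

text \<open>No step applies to an \<epsilon> followed by an \<eta>, so only four of the eight
  patterns of three generators carry two overlapping steps.\<close>

lemma critical:
  assumes "ok a n (ps @ p # q # r # qs)" "unique_on a n {s. (s, ps @ p # q # r # qs) \<in> smaller a n}"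
    and s: "pst a n ps p q (r # qs) rhs1 u1" "pst a n (ps @ [p]) q r qs rhs2 u2"
  shows "joined a n u1 (ps @ rhs1 @ r # qs) u2 (ps @ p # rhs2 @ qs)"
proof (cases "ob a r")
  case Ox
  then show ?thesis using critical_eta[OF assms] by simp
next
  case r: Oy
  show ?thesis
  proof (cases "ob a q")
    case Ox
    then show ?thesis using critical_eta_eta_eps[OF assms pst_eps_eta[OF s(1)] _ r] by simp
  next
    case q: Oy
    then show ?thesis
      using critical_eta_eps_eps[OF assms _ q r] critical_eps[OF assms _ q r] by (cases "ob a p") simp_all
  qed
qed

section \<open>Independent steps, uniqueness of normalization paths, and stability in all
  contexts\<close>

subsection \<open>Confluence\<close>

definition gg :: "bool \<Rightarrow> adj0 \<Rightarrow> nat \<Rightarrow> nat list \<Rightarrow> nat \<Rightarrow> lab \<Rightarrow> nat list \<Rightarrow> 'd" where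
  "gg \<sigma> a n ps k L qs = (if \<sigma> then gx a n ps k L qs else iv (gx a n ps k L qs))"

abbreviation "gs \<sigma> L \<equiv> (if \<sigma> then ls L else lt L)"
abbreviation "gt \<sigma> L \<equiv> (if \<sigma> then lt L else ls L)"

text \<open>Rule \<open>Y\<close> uses inverse generators, so the independence square is also
  required with one or both pairs of opposite sides reversed.\<close>

lemma independence_signed:
  assumes A: "lb A = ob a k" "ok a n ps" "k + ll A \<le> len a n ps" and B: "lb B = ob a k'"
    and x: "ok a (len a n (ps @ sh k (gs \<sigma> A))) x"
    and k': "k' + ll B \<le> len a n (ps @ sh k (gs \<sigma> A) @ x)"
    and q: "ok a (len a n (ps @ sh k (gs \<sigma> A) @ x @ sh k' (gs \<tau> B))) qs"
  shows "vc (gg \<sigma> a n ps k A (x @ sh k' (gs \<tau> B) @ qs)) (gg \<tau> a n (ps @ sh k (gt \<sigma> A) @ x) k' B qs) =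
    vc (gg \<tau> a n (ps @ sh k (gs \<sigma> A) @ x) k' B qs) (gg \<sigma> a n ps k A (x @ sh k' (gt \<tau> B) @ qs))"
proof -
  note hA = homD[OF gx_single(1)[OF A(1,3) refl refl]]
  have eA: "len a n (ps @ sh k (lt A)) = len a n (ps @ sh k (ls A))" "ok a n (ps @ sh k (lt A))" "ok a n (ps @ sh k (ls A))"
    using hA(2,3,6) A(2) by simp_all
  have x': "ok a (len a n (ps @ sh k (ls A))) x" "ok a (len a n (ps @ sh k (lt A))) x" using x eA by (simp_all split: if_splits)
  have eX: "len a n (ps @ sh k (lt A) @ x) = len a n (ps @ sh k (ls A) @ x)" using eA by simp
  have k2: "k' + ll B \<le> len a n (ps @ sh k (ls A) @ x)" "k' + ll B \<le> len a n (ps @ sh k (lt A) @ x)"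
    using k' eX by (simp_all split: if_splits)
  note hB = homD[OF gx_single(1)[OF B k2(1) refl refl]]
  have eB: "len a n (ps @ sh k s @ x @ sh k' (lt B)) = len a n (ps @ sh k (ls A) @ x @ sh k' (ls B))"
      "len a n (ps @ sh k s @ x @ sh k' (ls B)) = len a n (ps @ sh k (ls A) @ x @ sh k' (ls B))"
      "ok a (len a n (ps @ sh k s @ x)) (sh k' (ls B))" "ok a (len a n (ps @ sh k s @ x)) (sh k' (lt B))"
    if "s = ls A \<or> s = lt A" for s
    using that hB(2,3,6) eX by auto
  have q': "ok a (len a n (ps @ sh k s @ x @ sh k' t)) qs" if "s = ls A \<or> s = lt A" "t = ls B \<or> t = lt B" for s t
    using q eB[of s] eB[of "gs \<sigma> A"] that by (auto split: if_splits)
  let ?a1 = "gx a n ps k A (x @ sh k' (ls B) @ qs)" and ?a2 = "gx a n ps k A (x @ sh k' (lt B) @ qs)"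
  let ?b1 = "gx a n (ps @ sh k (ls A) @ x) k' B qs" and ?b2 = "gx a n (ps @ sh k (lt A) @ x) k' B qs"
  let ?v = "\<lambda>s t. ps @ sh k s @ x @ sh k' t @ qs"
  have e: "vc ?a1 ?b2 = vc ?b1 ?a2" by (rule independence[OF A x'(1) B k2(1) q']) simp_all
  have oq: "ok a (len a n (ps @ sh k (ls A))) (x @ sh k' t @ qs)" if "t = ls B \<or> t = lt B" for t
    using that x' q'[of "ls A" t] eB(3,4)[of "ls A"] by auto
  have ox: "ok a n (ps @ sh k s @ x)" if "s = ls A \<or> s = lt A" for s
    using that x' eA by auto
  have i: "iso a n (?v (ls A) (ls B)) (?v (lt A) (ls B)) ?a1 (iv ?a1)" "iso a n (?v (ls A) (lt B)) (?v (lt A) (lt B)) ?a2 (iv ?a2)"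
    using iso_gx[OF A oq[of "ls B"]] iso_gx[OF A oq[of "lt B"]] by simp_all
  have j: "iso a n (?v (ls A) (ls B)) (?v (ls A) (lt B)) ?b1 (iv ?b1)"
    using iso_gx[OF B ox k2(1), of qs] q'[of "ls A" "ls B"] by simp
  have j': "iso a n (?v (lt A) (ls B)) (?v (lt A) (lt B)) ?b2 (iv ?b2)"
    using iso_gx[OF B ox k2(2), of qs] q'[of "lt A" "ls B"] by simp
  have 1: "vc (iv ?b1) ?a1 = vc ?a2 (iv ?b2)" by (rule square_invert_left[OF j j' isoD(1)[OF i(2)] isoD(1)[OF i(1)] e[symmetric]])
  have 2: "vc (iv ?a1) ?b1 = vc ?b2 (iv ?a2)" by (rule square_invert_left[OF i(1,2) isoD(1)[OF j'] isoD(1)[OF j] e])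
  have 3: "vc (iv ?b2) (iv ?a1) = vc (iv ?a2) (iv ?b1)"
    using iso_vc'[OF i(1) j'] iso_vc'[OF j i(2)] e by simp
  show ?thesis using e 1 2 3 by (cases \<sigma>; cases \<tau>) (simp_all add: gg_def)
qed

lemma swap_label_all:
  assumes "p + dout (ob a p) \<le> q"
  obtains m where "q = p + dout (ob a p) + m" "\<forall>n ps qs. sx a n ps p q qs = gx a n ps p (LX (ob a p) m) qs"
    "sh p (ls (LX (ob a p) m)) = [p, q]" "sh p (lt (LX (ob a p) m)) = [q - dout (ob a p) + din (ob a p), p]"
    "ll (LX (ob a p) m) = din (ob a p) + m + din (ob a q)"
proof (rule that)
  have "q = p + dout (ob a p) + (q - p - dout (ob a p))" using assms by simp
  moreover define m where "m = q - p - dout (ob a p)"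
  ultimately have q: "q = p + dout (ob a p) + m" by simp
  show "q = p + dout (ob a p) + m" by (fact q)
  show "\<forall>n ps qs. sx a n ps p q qs = gx a n ps p (LX (ob a p) m) qs" by (simp add: sx_def m_def)
  show "sh p (ls (LX (ob a p) m)) = [p, q]" "sh p (lt (LX (ob a p) m)) = [q - dout (ob a p) + din (ob a p), p]"
    by (simp_all add: q)
  have "ob a q = ob (ob a p) m" unfolding q by simp
  then show "ll (LX (ob a p) m) = din (ob a p) + m + din (ob a q)" by simp
qed

text \<open>Label, position and sign depend only on the two positions involved, so a step stays
  available after another step has changed its surroundings.\<close>

lemma pst_signed:
  assumes "pst a n ps p q qs rhs u"
  obtains L k \<sigma> where "lb L = ob a k" "[p, q] = sh k (gs \<sigma> L)" "rhs = sh k (gt \<sigma> L)"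
    "\<forall>n ps qs. pst a n ps p q qs rhs (gg \<sigma> a n ps k L qs)"
    "\<forall>n ps qs. ok a n (ps @ p # q # qs) \<longrightarrow> k + ll L \<le> len a n ps"
  using assms
proof cases
  case (X q')
  obtain m where m: "q = p + dout (ob a p) + m" "\<forall>n ps qs. sx a n ps p q qs = gx a n ps p (LX (ob a p) m) qs"
    "sh p (ls (LX (ob a p) m)) = [p, q]" "sh p (lt (LX (ob a p) m)) = [q', p]"
    "ll (LX (ob a p) m) = din (ob a p) + m + din (ob a q)"
    using X(5) by (rule_tac swap_label_all[OF X(3)]) simp
  show ?thesis
  proof (rule that[of "LX (ob a p) m" p True])
    show "\<forall>n ps qs. pst a n ps p q qs rhs (gg True a n ps p (LX (ob a p) m) qs)"
      using pst.X[OF X(3,4,5)] X(1) m(2) by (simp add: gg_def)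
    show "\<forall>n ps qs. ok a n (ps @ p # q # qs) \<longrightarrow> p + ll (LX (ob a p) m) \<le> len a n ps"
      using m(1) unfolding m(5) by (auto simp: nx_def)
  qed (use m X in simp_all)
next
  case Y
  have l: "q + dout (ob a q) \<le> p - 2" using Y by simp
  obtain m where m: "p - 2 = q + dout (ob a q) + m" "\<forall>n ps qs. sx a n ps q (p - 2) qs = gx a n ps q (LX (ob a q) m) qs"
    "sh q (ls (LX (ob a q) m)) = [q, p - 2]" "sh q (lt (LX (ob a q) m)) = [p - 2 - dout (ob a q) + din (ob a q), q]"
    "ll (LX (ob a q) m) = din (ob a q) + m + din (ob a (p - 2))"
    by (rule swap_label_all[OF l])
  show ?thesis
  proof (rule that[of "LX (ob a q) m" q False])
    show "\<forall>n ps qs. pst a n ps p q qs rhs (gg False a n ps q (LX (ob a q) m) qs)"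
      using pst.Y[OF Y(3,4,5)] Y(1) m(2) by (simp add: gg_def)
    show "[p, q] = sh q (gs False (LX (ob a q) m))" using m(4) Y by simp
    have "ob a (p - 2) = ob a p" by (rule ob_shift_2) (use Y in simp)
    then have d: "din (ob a (p - 2)) = 0" "p = q + 2 + m" using Y(3,5) m(1) Y(4) by (simp_all del: ob_shift_2)
    show "\<forall>n ps qs. ok a n (ps @ p # q # qs) \<longrightarrow> q + ll (LX (ob a q) m) \<le> len a n ps"
      using d(2) Y(3,4) unfolding m(5) d(1) by auto
  qed (use m Y in simp_all)
next
  case (N k)
  show ?thesis
  proof (rule that[of "LN (ob a k)" k True])
    show "\<forall>n ps qs. pst a n ps p q qs rhs (gg True a n ps k (LN (ob a k)) qs)"
      using pst.N[OF N(3,4)] N(1) by (simp add: gg_def)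
    show "\<forall>n ps qs. ok a n (ps @ p # q # qs) \<longrightarrow> k + ll (LN (ob a k)) \<le> len a n ps"
      using N(3,4) by (cases "ob a k") (auto simp: nx_def)
  qed (use N in simp_all)
qed

text \<open>Each step can still be performed after the other, and the resulting square commutes by
  independence.\<close>

lemma disjoint_joined:
  assumes o: "ok a n (ps @ p # q # x @ p' # q' # qs)"
    and U: "unique_on a n {s. (s, ps @ p # q # x @ p' # q' # qs) \<in> smaller a n}"
    and s: "pst a n ps p q (x @ p' # q' # qs) rhs u" "pst a n (ps @ p # q # x) p' q' qs rhs' u'"
  shows "joined a n u (ps @ rhs @ x @ p' # q' # qs) u' (ps @ p # q # x @ rhs' @ qs)"
proof -
  obtain L k \<sigma> where 1: "lb L = ob a k" "[p, q] = sh k (gs \<sigma> L)" "rhs = sh k (gt \<sigma> L)"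
    "\<forall>n ps qs. pst a n ps p q qs rhs (gg \<sigma> a n ps k L qs)"
    "\<forall>n ps qs. ok a n (ps @ p # q # qs) \<longrightarrow> k + ll L \<le> len a n ps"
    by (rule pst_signed[OF s(1)])
  obtain L' k' \<tau> where 2: "lb L' = ob a k'" "[p', q'] = sh k' (gs \<tau> L')" "rhs' = sh k' (gt \<tau> L')"
    "\<forall>n ps qs. pst a n ps p' q' qs rhs' (gg \<tau> a n ps k' L' qs)"
    "\<forall>n ps qs. ok a n (ps @ p' # q' # qs) \<longrightarrow> k' + ll L' \<le> len a n ps"
    by (rule pst_signed[OF s(2)])
  have u: "u = gg \<sigma> a n ps k L (x @ p' # q' # qs)" "u' = gg \<tau> a n (ps @ p # q # x) k' L' qs"
    using pst_functional[OF s(1) 1(4)[rule_format]] pst_functional[OF s(2) 2(4)[rule_format]] by auto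
  let ?w = "ps @ p # q # x @ p' # q' # qs"
  let ?u2 = "gg \<sigma> a n ps k L (x @ rhs' @ qs)" and ?u2' = "gg \<tau> a n (ps @ rhs @ x) k' L' qs"
  have A: "step a n ?w u (ps @ rhs @ x @ p' # q' # qs)"
    unfolding step_def using o s(1) by blast
  have B: "step a n ?w u' (ps @ p # q # x @ rhs' @ qs)"
    unfolding step_def
    by (rule exI[of _ "ps @ p # q # x"], rule exI[of _ p'], rule exI[of _ q'], rule exI[of _ qs], rule exI[of _ rhs'])
      (use o s(2) in simp)
  note i = step_iso[OF A] step_iso[OF B]
  have A': "step a n (ps @ rhs @ x @ p' # q' # qs) ?u2' (ps @ rhs @ x @ rhs' @ qs)"
    unfolding step_def
    by (rule exI[of _ "ps @ rhs @ x"], rule exI[of _ p'], rule exI[of _ q'], rule exI[of _ qs], rule exI[of _ rhs'])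
      (use isoD(4)[OF i(1)] 2(4) in simp)
  have B': "step a n (ps @ p # q # x @ rhs' @ qs) ?u2 (ps @ rhs @ x @ rhs' @ qs)"
    unfolding step_def
    by (rule exI[of _ ps], rule exI[of _ p], rule exI[of _ q], rule exI[of _ "x @ rhs' @ qs"], rule exI[of _ rhs])
      (use isoD(4)[OF i(2)] 1(4) in simp)
  have g: "good a n (ps @ rhs @ x @ p' # q' # qs) ?u2' (ps @ rhs @ x @ rhs' @ qs)"
    "good a n (ps @ p # q # x @ rhs' @ qs) ?u2 (ps @ rhs @ x @ rhs' @ qs)"
    using good_step[OF U _ A'] good_step[OF U _ B'] step_smaller[OF A] step_smaller[OF B] by simp_all
  have l1: "ps @ sh k (gs \<sigma> L) = ps @ [p, q]" "ps @ sh k (gs \<sigma> L) @ x = ps @ p # q # x"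
    "ps @ sh k (gs \<sigma> L) @ x @ sh k' (gs \<tau> L') = (ps @ p # q # x) @ [p', q']"
    "x @ sh k' (gs \<tau> L') @ qs = x @ p' # q' # qs"
    unfolding 1(2)[symmetric] 2(2)[symmetric] by simp_all
  have "vc u ?u2' = vc u' ?u2"
    using independence_signed[of L a k n ps L' k' \<sigma> x \<tau> qs, unfolded l1, folded 1(3) 2(3)]
      1(1) 1(5)[rule_format, of n ps "x @ p' # q' # qs"] 2(1) 2(5)[rule_format, of n "ps @ p # q # x" qs] o
    unfolding u by simp
  then show ?thesis by (rule joined_source[OF i(1) g(1) i(2) g(2)])
qed

lemma peaks_joined:
  assumes U: "unique_on a n {s. (s, w) \<in> smaller a n}" and s: "step a n w u1 w1" "step a n w u2 w2"
  shows "joined a n u1 w1 u2 w2"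
proof -
  obtain ps p q qs rhs where 1: "w = ps @ p # q # qs" "w1 = ps @ rhs @ qs" "ok a n w" "pst a n ps p q qs rhs u1"
    using s(1) unfolding step_def by blast
  obtain ps' p' q' qs' rhs' where 2: "w = ps' @ p' # q' # qs'" "w2 = ps' @ rhs' @ qs'" "pst a n ps' p' q' qs' rhs' u2"
    using s(2) unfolding step_def by blast
  have J: "joined a n u (ps @ rhs @ qs) u' ((ps @ us) @ rhs' @ qs')"
    if "w = ps @ p # q # qs" "pst a n ps p q qs rhs u" "pst a n (ps @ us) p' q' qs' rhs' u'" "p # q # qs = us @ p' # q' # qs'"
    for ps p q qs rhs u us p' q' qs' rhs' u'
  \<comment> \<open>\<open>us\<close> is the offset between the two pairs: it is empty for the same
    pair, has one entry for overlapping pairs, and has at least two for disjoint ones.\<close>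
  proof (cases us)
    case Nil
    then have e: "p' = p" "q' = q" "qs' = qs" using that(4) by simp_all
    have "rhs = rhs' \<and> u = u'" using pst_functional[OF that(2)] that(3) unfolding Nil e by simp
    then show ?thesis unfolding Nil e by (simp add: joined_def)
  next
    case (Cons y us')
    show ?thesis
    proof (cases us')
      case Nil
      then have e: "y = p" "p' = q" "qs = q' # qs'" using that(4) Cons by simp_all
      show ?thesis
        using critical[of a n ps p q q' qs' rhs u rhs' u'] 1(3) U that(1-3) unfolding Cons Nil e by simp
    next
      case (Cons z x)
      then have e: "us = p # q # x" "qs = x @ p' # q' # qs'" using that(4) \<open>us = y # us'\<close> by simp_all
      show ?thesis
        using disjoint_joined[of a n ps p q x p' q' qs' rhs u rhs' u'] 1(3) U that(1-3) unfolding e by simp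
    qed
  qed
  have "ps @ p # q # qs = ps' @ p' # q' # qs'" using 1(1) 2(1) by simp
  then obtain us where "ps' = ps @ us \<and> p # q # qs = us @ p' # q' # qs' \<or> ps = ps' @ us \<and> p' # q' # qs' = us @ p # q # qs"
    unfolding append_eq_append_conv2 by metis
  then show ?thesis
  proof
    assume e: "ps' = ps @ us \<and> p # q # qs = us @ p' # q' # qs'"
    then show ?thesis using J[OF 1(1,4), of us p' q' qs' rhs' u2] 2 unfolding 1(2) by simp
  next
    assume e: "ps = ps' @ us \<and> p' # q' # qs' = us @ p # q # qs"
    then have "joined a n u2 w2 u1 w1" using J[OF 2(1,3), of us p q qs rhs u1] 1 unfolding 2(2) by simp
    then show ?thesis by (rule joined_sym)
  qed
qed

text \<open>By well-founded induction normalization is unique below \<open>w\<close>, so all peaks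
  at \<open>w\<close> are joined; two paths from \<open>w\<close> are then compared through their
  first steps.\<close>

lemma nfp_unique: "unique_on a n UNIV"
proof -
  have "nfp a n w v z \<Longrightarrow> nfp a n w v' z' \<Longrightarrow> v = v' \<and> z = z'" for w v z v' z'
  proof (induction w arbitrary: v z v' z' rule: wf_induct_rule[OF wf_smaller[of a n]])
    case (1 w)
    have U: "nf a n s = (x, y)" if "(s, w) \<in> smaller a n" "nfp a n s x y" for s x y
    proof -
      have "ok a n s" using isoD(3)[OF nfp_iso[OF that(2)]] .
      from 1(1)[OF that(1) nf[OF this] that(2)] show ?thesis by (simp add: prod_eq_iff)
    qed
    then have UB: "unique_on a n {s. (s, w) \<in> smaller a n}" unfolding unique_on_def by simp
    from 1(2) show ?case
    proof cases
      case stop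
      from 1(3) show ?thesis
        by cases (use stop in auto)
    next
      case (go u1 w1 v1)
      from 1(3) show ?thesis
      proof cases
        case stop
        then show ?thesis using go by auto
      next
        case go': (go u2 w2 v2)
        have "nf a n w1 = (v1, z)" "nf a n w2 = (v2, z')"
          using U[OF step_smaller[OF go(2)] go(3)] U[OF step_smaller[OF go'(2)] go'(3)] .
        then show ?thesis
          using peaks_joined[OF UB go(2) go'(2)] go(1) go'(1) by (simp add: joined_def)
      qed
    qed
  qed
  then show ?thesis unfolding unique_on_def using nf isoD(3)[OF nfp_iso] by (metis prod.collapse)
qed

text \<open>With uniqueness known for all strings, \<open>good_sx\<close> and \<open>good_N\<close>
  apply to every generator in every context, whichever way the rewriting is oriented there.\<close>

theorem good_gx:
  assumes L: "lb L = ob a k" and o: "ok a n ps" "k + ll L \<le> len a n ps" "ok a (len a n (ps @ sh k (ls L))) qs"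
  shows "good a n (ps @ sh k (ls L) @ qs) (gx a n ps k L qs) (ps @ sh k (lt L) @ qs)"
proof (cases L)
  case (LN b)
  then have b: "b = ob a k" using L by simp
  show ?thesis
    using good_N[OF nfp_unique[of a n], of ps k qs] isoD(3)[OF iso_gx[OF L o]] unfolding LN b by simp
next
  case (LX b m)
  then have b: "b = ob a k" using L by simp
  have e: "sh k (ls L) = [k, k + dout b + m]" "sh k (lt L) = [k + din b + m, k]" unfolding LX by (simp_all add: add.assoc)
  have "gx a n ps k L qs = sx a n ps k (k + dout b + m) qs" unfolding sx_def LX b by simp
  moreover have "ok a n (ps @ k # (k + dout b + m) # qs)" using isoD(3)[OF iso_gx[OF L o]] unfolding e by simp
  then have "good a n (ps @ k # (k + dout b + m) # qs) (sx a n ps k (k + dout b + m) qs) (ps @ (k + din b + m) # k # qs)"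
    by (rule good_sx[OF nfp_unique[of a n]]) (simp_all add: b)
  ultimately show ?thesis unfolding e by simp
qed

lemma good_id: "ok a n s \<Longrightarrow> good a n s (idc D 2 (S a n s)) s"
  using iso_id[of a n s] iv_eq[OF iso_id[of a n s]] vc_id(1)[OF hom_cc[of a n s]] unfolding good_def by simp

text \<open>\<open>good\<close> speaks of one string and its chosen path. Quantifying over all
  contexts makes the property visibly stable under composition with 1-cells and 2-cells.\<close>

definition nice :: "adj0 \<Rightarrow> nat \<Rightarrow> nat list \<Rightarrow> nat list \<Rightarrow> 'd \<Rightarrow> bool" where
  "nice a n s t A \<longleftrightarrow> hom a n s t A \<and> (\<forall>a' k n' ps qs. a = ob a' k \<longrightarrow> ok a' n' ps \<longrightarrow> k + n \<le> len a' n' ps \<longrightarrow>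
     ok a' (len a' n' (ps @ sh k s)) qs \<longrightarrow> good a' n' (ps @ sh k s @ qs) (cx a' n' ps k n s A qs) (ps @ sh k t @ qs))"

lemma niceD:
  assumes "nice (ob a k) m s t A"
  shows "hom (ob a k) m s t A"
    "ok a n ps \<Longrightarrow> k + m \<le> len a n ps \<Longrightarrow> ok a (len a n (ps @ sh k s)) qs \<Longrightarrow>
      good a n (ps @ sh k s @ qs) (cx a n ps k m s A qs) (ps @ sh k t @ qs)"
  using assms unfolding nice_def by blast+

lemma niceI:
  assumes "hom a m s t A"
    and "\<And>a' k n ps qs. a = ob a' k \<Longrightarrow> hom (ob a' k) m s t A \<Longrightarrow> ok a' n ps \<Longrightarrow> k + m \<le> len a' n ps \<Longrightarrow>
      ok a' (len a' n (ps @ sh k s)) qs \<Longrightarrow> good a' n (ps @ sh k s @ qs) (cx a' n ps k m s A qs) (ps @ sh k t @ qs)"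
  shows "nice a m s t A"
  using assms unfolding nice_def by blast

lemma nice_gen: "nice (lb L) (ll L) (ls L) (lt L) (\<gamma> L)"
  using \<gamma> good_gx[of L] unfolding nice_def gx_def by blast

lemma nice_id:
  assumes "ok a n s"
  shows "nice a n s s (idc D 2 (S a n s))"
proof (rule niceI)
  show "hom a n s s (idc D 2 (S a n s))" by (rule hom_id[OF assms])
  fix a' k n' ps qs
  assume a: "a = ob a' k" and h: "hom (ob a' k) n s s (idc D 2 (S a n s))"
    and c: "ok a' n' ps" "k + n \<le> len a' n' ps" "ok a' (len a' n' (ps @ sh k s)) qs"
  have o: "ok a' n' (ps @ sh k s @ qs)" using homD(2)[OF hom_cx[OF h c]] .
  show "good a' n' (ps @ sh k s @ qs) (cx a' n' ps k n s (idc D 2 (S a n s)) qs) (ps @ sh k s @ qs)"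
    using cx_id[OF assms[unfolded a] c] good_id[OF o] unfolding a by simp
qed

lemma nice_vc:
  assumes A: "nice a n s t A" and B: "nice a n t u B"
  shows "nice a n s u (vc A B)"
proof (rule niceI)
  have hA: "hom a n s t A" and hB: "hom a n t u B" using A B unfolding nice_def by auto
  show "hom a n s u (vc A B)" by (rule hom_vc[OF hA hB])
  fix a' k n' ps qs
  assume a: "a = ob a' k" and c: "ok a' n' ps" "k + n \<le> len a' n' ps" "ok a' (len a' n' (ps @ sh k s)) qs"
  have c': "ok a' (len a' n' (ps @ sh k t)) qs" unfolding len_cx[OF hA[unfolded a] c(1,2)] by (rule c(3))
  show "good a' n' (ps @ sh k s @ qs) (cx a' n' ps k n s (vc A B) qs) (ps @ sh k u @ qs)"
    unfolding cx_vc[OF hA[unfolded a] hB[unfolded a] c]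
    by (rule good_vc[OF niceD(2)[OF A[unfolded a] c] niceD(2)[OF B[unfolded a] c(1,2) c']])
qed

lemma nice_inverse:
  assumes A: "nice a n s t A" and i: "iso a n s t A B"
  shows "nice a n t s B"
proof (rule niceI)
  show "hom a n t s B" by (rule isoD(2)[OF i])
  fix a' k n' ps qs
  assume a: "a = ob a' k" and c: "ok a' n' ps" "k + n \<le> len a' n' ps" "ok a' (len a' n' (ps @ sh k t)) qs"
  have c': "ok a' (len a' n' (ps @ sh k s)) qs" using c(3) unfolding len_cx[OF isoD(1)[OF i[unfolded a]] c(1,2)] .
  have "cx a' n' ps k n t B qs = iv (cx a' n' ps k n s A qs)"
    using iv_eq[OF iso_cx[OF i[unfolded a] c(1,2) c']] by simp
  then show "good a' n' (ps @ sh k t @ qs) (cx a' n' ps k n t B qs) (ps @ sh k s @ qs)"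
    using good_iv[OF niceD(2)[OF A[unfolded a] c(1,2) c']] by simp
qed

lemma nice_cx:
  assumes A: "nice (ob a k) m s t A" and c: "ok a n ps" "k + m \<le> len a n ps" "ok a (len a n (ps @ sh k s)) qs"
  shows "nice a n (ps @ sh k s @ qs) (ps @ sh k t @ qs) (cx a n ps k m s A qs)"
proof (rule niceI)
  show h: "hom a n (ps @ sh k s @ qs) (ps @ sh k t @ qs) (cx a n ps k m s A qs)"
    by (rule hom_cx[OF niceD(1)[OF A] c])
  fix a' k' n' ps' qs'
  assume a: "a = ob a' k'" and c': "ok a' n' ps'" "k' + n \<le> len a' n' ps'"
    "ok a' (len a' n' (ps' @ sh k' (ps @ sh k s @ qs))) qs'"
  let ?N = "len a' n' ps'"
  have o: "ok a' ?N (sh k' ps)" "len a' ?N (sh k' ps) = k' + len a n ps + (?N - k' - n)"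
    using ok_context[of a' k' n ps ?N] c(1) c'(2) a by auto
  have "ok a' ?N (sh k' (ps @ sh k s @ qs))"
    using ok_context[of a' k' n "ps @ sh k s @ qs" ?N] homD(2)[OF h] c'(2) a by blast
  then have o2: "ok a' n' (ps' @ sh k' ps)" "ok a' (len a' n' ((ps' @ sh k' ps) @ sh (k' + k) s)) (sh k' qs @ qs')"
    using c' o by simp_all
  have l: "k' + k + m \<le> len a' n' (ps' @ sh k' ps)" using o(2) c(2) by simp
  note A' = A[unfolded a ob_ob]
  have "good a' n' ((ps' @ sh k' ps) @ sh (k' + k) s @ sh k' qs @ qs')
     (cx a' n' (ps' @ sh k' ps) (k' + k) m s A (sh k' qs @ qs')) ((ps' @ sh k' ps) @ sh (k' + k) t @ sh k' qs @ qs')"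
    by (rule niceD(2)[OF A' o2(1) l o2(2)])
  then show "good a' n' (ps' @ sh k' (ps @ sh k s @ qs) @ qs') (cx a' n' ps' k' n (ps @ sh k s @ qs) (cx a n ps k m s A qs) qs')
      (ps' @ sh k' (ps @ sh k t @ qs) @ qs')"
    using cx_cx[OF niceD(1)[OF A[unfolded a]] c[unfolded a] c'] unfolding a by simp
qed

text \<open>In the empty context the equation \<open>vc A (cc a n t) = cc a n s\<close> determines
  \<open>A\<close>, because \<open>cc a n t\<close> is invertible.\<close>

theorem nice_unique:
  assumes "nice a n s t A" "nice a n s t B"
  shows "A = B"
proof -
  have g: "good a n s A t \<and> hom a n s t A" if A: "nice a n s t A" for A
  proof -
    have h: "hom a n s t A" using A unfolding nice_def by blast
    have "good a n ([] @ sh 0 s @ []) (cx a n [] 0 n s A []) ([] @ sh 0 t @ [])"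
      by (rule niceD(2)) (use A in simp_all)
    then show ?thesis using cx_unit[OF h] h by simp
  qed
  note gA = g[OF assms(1)] and gB = g[OF assms(2)]
  have i: "iso a n t (zz a n s) (cc a n t) (iv (cc a n t))"
    using iso_cc[OF homD(3)] gA unfolding good_def by metis
  have h: "hom a n s (zz a n s) (cc a n s)" using hom_cc[OF homD(2)] gA by blast
  show ?thesis
    using cancel_right[OF i _ h, of A] cancel_right[OF i _ h, of B] gA gB unfolding good_def by simp
qed

end

section \<open>Transfer of the relations to the localization, and the conclusion\<close>

section \<open>Coherence of pseudoadjunctions\<close>

definition FL where "FL k x = JJ k (up x)"
definition gL where "gL A = JJ 3 (g3 A)"

text \<open>Neither the quotient on 3-cells nor the localization identifies cells of dimension at
  most 2, so injectivity is inherited from \<open>up\<close>.\<close>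

interpretation sL: strings LL FL
proof -
  interpret precat 3 LL by (rule pl.L_precat)
  have "pmorph 2 C2 LL (\<lambda>k x. JJ k (up x))"
    using c2.pmorph_comp[OF s3.F pmorph_mono[OF JJ_pmorph, of 2]] by simp
  moreover have "inj_on (JJ k \<circ> up) A" if "k \<le> 2" for k and A :: "adj_cell2 set"
    using JJ_low[OF that] by (auto intro!: inj_onI)
  ultimately show "strings LL FL"
    by unfold_locales (auto simp: FL_def[abs_def] comp_def)
qed

lemma JJ_W: "JJ 1 (s3.W a n) = sL.W a n" and JJ_S: "JJ 2 (s3.S a n ps) = sL.S a n ps"
  by (simp_all add: s3.W_def s3.S_def sL.W_def sL.S_def FL_def)

lemma JJ_hom:
  assumes "s3.hom a n s t A"
  shows "sL.hom a n s t (JJ 3 A)"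
proof -
  note h = s3.homD[OF assms]
  have "src LL 2 (JJ (Suc 2) A) = JJ 2 (src C3 2 A)" "tgt LL 2 (JJ (Suc 2) A) = JJ 2 (tgt C3 2 A)"
    by (rule pmorph_src[OF JJ_pmorph] pmorph_tgt[OF JJ_pmorph]; use h in simp)+
  then show ?thesis
    using pmorph_cell[OF JJ_pmorph order_refl h(1)] h by (simp add: sL.hom_def JJ_S)
qed

interpretation sL: gen_strings LL FL gL
  by unfold_locales (simp add: gL_def JJ_hom s3.\<gamma>)

lemma JJ_vc: "s3.hom a n s t A \<Longrightarrow> s3.hom a n t u B \<Longrightarrow> JJ 3 (s3.vc A B) = sL.vc (JJ 3 A) (JJ 3 B)"
  by (rule pmorph_cmp_le[OF JJ_pmorph _ _ s3.hom_composable(5)]) simp_all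

lemma JJ_id: "ok a n s \<Longrightarrow> JJ 3 (idc C3 2 (s3.S a n s)) = idc LL 2 (sL.S a n s)"
  using pmorph_idc[OF JJ_pmorph, of 2 "s3.S a n s"] by (simp add: JJ_S)

text \<open>A morphism preserves composites where they are defined; the side conditions provide
  definedness at each layer of the context.\<close>

lemma JJ_cx:
  assumes h: "s3.hom (ob a k) m s t A" and c: "ok a n ps" "k + m \<le> len a n ps" "ok a (len a n (ps @ sh k s)) qs"
  shows "JJ 3 (s3.cx a n ps k m s A qs) = sL.cx a n ps k m s (JJ 3 A) qs"
proof -
  have lw: "JJ 3 (s3.lw a k A) = sL.lw a k (JJ 3 A)"
    using pmorph_cmp_le[OF JJ_pmorph _ _ s3.hom_composable(1)[OF h refl]] by (simp add: s3.lw_def sL.lw_def JJ_W)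
  have rw: "JJ 3 (s3.rw (s3.lw a k A) (ob a (k + m)) r) = sL.rw (sL.lw a k (JJ 3 A)) (ob a (k + m)) r" for r
    using pmorph_cmp_ge[OF JJ_pmorph _ _ s3.hom_composable(2)[OF s3.hom_lw[OF h refl] refl]] lw
    by (simp add: s3.rw_def sL.rw_def JJ_W)
  have pr: "JJ 3 (s3.pr a n ps (s3.rw (s3.lw a k A) (ob a (k + m)) (len a n ps - k - m))) =
      sL.pr a n ps (sL.rw (sL.lw a k (JJ 3 A)) (ob a (k + m)) (len a n ps - k - m))"
    using pmorph_cmp_le[OF JJ_pmorph _ _ s3.hom_composable(3)[OF s3.hom_lrw[OF h c(2)] c(1) refl]] rw
    by (simp add: s3.pr_def sL.pr_def JJ_S)
  show ?thesis
    using pmorph_cmp_ge[OF JJ_pmorph _ _ s3.hom_composable(4)[OF s3.hom_prw[OF h c(1,2)] c(3) refl]] pr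
    by (simp add: s3.cx_def' sL.cx_def' s3.po_def sL.po_def JJ_S)
qed

lemma JJ_gx:
  assumes "lb L = ob a k" "ok a n ps" "k + ll L \<le> len a n ps" "ok a (len a n (ps @ sh k (ls L))) qs"
  shows "JJ 3 (s3.gx a n ps k L qs) = sL.gx a n ps k L qs"
  using JJ_cx[OF _ assms(2-4)] s3.\<gamma>[of L] assms(1) by (simp add: s3.gx_def sL.gx_def gL_def)

lemma JJ_sx:
  assumes o: "ok a n (ps @ p # q # qs)" and le: "p + dout (ob a p) \<le> q"
  shows "JJ 3 (s3.sx a n ps p q qs) = sL.sx a n ps p q qs"
proof -
  define m where "m = q - p - dout (ob a p)"
  have q: "q = p + dout (ob a p) + m" using le by (simp add: m_def)
  have "ob a q = ob (ob a p) m" unfolding q by simp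
  then have ll: "ll (LX (ob a p) m) = din (ob a p) + m + din (ob a q)" by simp
  have s: "sh p (ls (LX (ob a p) m)) = [p, q]" by (simp add: q)
  have "p + ll (LX (ob a p) m) \<le> len a n ps" using o q unfolding ll by (auto simp: nx_def)
  then show ?thesis
    using JJ_gx[of "LX (ob a p) m" a p n ps qs] o unfolding s s3.sx_def sL.sx_def m_def[symmetric] by simp
qed

lemma JJ_intl:
  assumes s: "ok a n s" "s = [] \<or> s = [p1, p2]" and m: "ok (ob a n) k [m]"
  shows "JJ 3 (s3.intl a (n + k) s (len a n s + m)) = sL.intl a (n + k) s (len a n s + m)"
  using s(2)
proof
  assume e: "s = []"
  then show ?thesis using JJ_id[of a "n + k" "[n + m]"] m by (simp add: s3.intl_def sL.intl_def)
next
  assume e: "s = [p1, p2]"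
  note o = s3.intl_parts[OF s(1)[unfolded e] m]
  note h = s3.hom_sx[OF o(1,2)] s3.hom_sx[OF o(3,4)]
  have "JJ 3 (s3.vc (s3.sx a (n + k) [p1] p2 (len a n s + m) [])
       (s3.sx a (n + k) [] p1 (len a n s + m - dout (ob a p2) + din (ob a p2)) [p2])) =
     sL.vc (sL.sx a (n + k) [p1] p2 (len a n s + m) [])
       (sL.sx a (n + k) [] p1 (len a n s + m - dout (ob a p2) + din (ob a p2)) [p2])"
    unfolding JJ_sx[OF o(1,2), folded e, symmetric] JJ_sx[OF o(3,4), folded e, symmetric]
    by (rule JJ_vc[OF h(1)[folded e]]) (use h(2)[folded e] in simp)
  then show ?thesis by (simp add: s3.intl_def sL.intl_def e)
qed

lemma JJ_intr:
  assumes t: "ok (ob a m) n t" "t = [] \<or> t = [q1, q2]"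
  shows "JJ 3 (s3.intr a (din a + m + n) m t) = sL.intr a (din a + m + n) m t"
  using t(2)
proof
  assume "t = []"
  then show ?thesis using JJ_id[of a "din a + m + n" "[0]"] by (simp add: s3.intr_def sL.intr_def)
next
  assume e: "t = [q1, q2]"
  note o = s3.intr_parts[OF t(1)[unfolded e]]
  have le: "0 + dout (ob a 0) \<le> dout a + m + q" for q by simp
  note h = s3.hom_sx[OF o(1) le] s3.hom_sx[OF o(2) le]
  have "JJ 3 (s3.vc (s3.sx a (din a + m + n) [] 0 (dout a + m + q1) [dout a + m + q2])
       (s3.sx a (din a + m + n) [din a + m + q1] 0 (dout a + m + q2) [])) =
     sL.vc (sL.sx a (din a + m + n) [] 0 (dout a + m + q1) [dout a + m + q2])
       (sL.sx a (din a + m + n) [din a + m + q1] 0 (dout a + m + q2) [])"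
    unfolding JJ_sx[OF o(1) le, symmetric] JJ_sx[OF o(2) le, symmetric]
    by (rule JJ_vc[OF h(1)]) (use h(2) in \<open>simp add: add_ac\<close>)
  then show ?thesis by (simp add: s3.intr_def sL.intr_def e)
qed

lemma ok_Nil: "ok a n []"
  by simp

lemma JJ_nl: "JJ 3 (s3.nl1 A m) = sL.nl1 A m" "JJ 3 (s3.nl2 A m) = sL.nl2 A m"
proof -
  let ?a = "lb A" and ?b = "ob (lb A) (ll A + m)"
  let ?k = "m + din ?b"
  obtain s1 s2 t1 t2 where s: "ls A = [] \<or> ls A = [s1, s2]" "lt A = [] \<or> lt A = [t1, t2]"
    by (rule label_lists)
  have m: "ok (ob ?a (ll A)) ?k [m]" by simp
  note i = s3.hom_intl[OF label_ok(1) s(1) m, unfolded label_ok] s3.hom_intl[OF label_ok(2) s(2) m, unfolded label_ok]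
  note j = JJ_intl[OF label_ok(1) s(1) m, unfolded label_ok] JJ_intl[OF label_ok(2) s(2) m, unfolded label_ok]
  have len: "len ?a (ll A + ?k) (ls A) = lc A + ?k" by (simp add: len_add)
  have nx: "nx ?a (ll A + ?k) (ll A + m) = ll A + (m + dout ?b)" by (simp add: nx_def)
  have c: "lb A = ob ?a 0" "ok ?a (ll A + ?k) []" "0 + ll A \<le> len ?a (ll A + ?k) []"
    "ok ?a (len ?a (ll A + ?k) ([] @ sh 0 (ls A))) [lc A + m]"
    "ok ?a (ll A + ?k) [ll A + m]" "0 + ll A \<le> len ?a (ll A + ?k) [ll A + m]"
    using len nx by simp_all
  show "JJ 3 (s3.nl1 A m) = sL.nl1 A m"
    unfolding s3.nl1_def sL.nl1_def Let_def JJ_gx[OF c(1-4), symmetric] j(2)[symmetric]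
    by (rule JJ_vc[OF _ i(2)]) (use s3.hom_gx[OF c(1-4)] in simp)
  show "JJ 3 (s3.nl2 A m) = sL.nl2 A m"
    unfolding s3.nl2_def sL.nl2_def Let_def JJ_gx[OF c(1,5,6) ok_Nil, symmetric] j(1)[symmetric]
    by (rule JJ_vc[OF i(1)]) (use s3.hom_gx[OF c(1,5,6) ok_Nil] in simp)
qed

lemma JJ_nr:
  assumes B: "lb B = ob a m"
  shows "JJ 3 (s3.nr1 a m B) = sL.nr1 a m B" "JJ 3 (s3.nr2 a m B) = sL.nr2 a m B"
proof -
  let ?N = "din a + m + ll B"
  obtain s1 s2 t1 t2 where s: "ls B = [] \<or> ls B = [s1, s2]" "lt B = [] \<or> lt B = [t1, t2]"
    by (rule label_lists)
  have okB: "ok (ob a m) (ll B) (ls B)" "ok (ob a m) (ll B) (lt B)" "len (ob a m) (ll B) (ls B) = lc B"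
    using label_ok[of B] B by auto
  note i = s3.hom_intr[OF okB(1) s(1)] s3.hom_intr[OF okB(2) s(2)]
  note j = JJ_intr[OF okB(1) s(1)] JJ_intr[OF okB(2) s(2)]
  have nx: "nx a ?N 0 = dout a + m + ll B" by (simp add: nx_def)
  have len: "len a ?N (sh (din a + m) (ls B)) = din a + m + lc B"
    using len_shift[of a "din a + m" "ll B" "ls B"] okB by simp
  have c: "lb B = ob a (dout a + m)" "ok a ?N [0]" "dout a + m + ll B \<le> len a ?N [0]"
    and d: "lb B = ob a (din a + m)" "ok a ?N []" "din a + m + ll B \<le> len a ?N []"
      "ok a (len a ?N ([] @ sh (din a + m) (ls B))) [0]"
    using B nx len by simp_all
  show "JJ 3 (s3.nr1 a m B) = sL.nr1 a m B"
    unfolding s3.nr1_def sL.nr1_def Let_def JJ_gx[OF c ok_Nil, symmetric] j(2)[symmetric]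
    by (rule JJ_vc[OF _ i(2)]) (use s3.hom_gx[OF c ok_Nil] in simp)
  show "JJ 3 (s3.nr2 a m B) = sL.nr2 a m B"
    unfolding s3.nr2_def sL.nr2_def Let_def JJ_gx[OF d, symmetric] j(1)[symmetric]
    by (rule JJ_vc[OF i(1)]) (use s3.hom_gx[OF d] in simp)
qed

lemma JJ_in:
  assumes A: "lb A = ob a k" "k + ll A \<le> N" and x: "ok a (len a N (sh k (ls A))) x"
    and B: "lb B = ob a k'" "k' + ll B \<le> len a (len a N (sh k (ls A))) x"
  shows "JJ 3 (s3.in1 a N k A x k' B) = sL.in1 a N k A x k' B" "JJ 3 (s3.in2 a N k A x k' B) = sL.in2 a N k A x k' B"
proof -
  note h = s3.homD[OF s3.gx_single(1)[OF A refl refl]]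
  note h' = s3.homD[OF s3.gx_single(1)[OF B refl refl]]
  have A0: "ok a N []" "k + ll A \<le> len a N []" using A by simp_all
  have l: "ok a (len a N ([] @ sh k (ls A))) (x @ sh k' (ls B))" "ok a (len a N ([] @ sh k (ls A))) (x @ sh k' (lt B))"
    "ok a N (sh k (ls A) @ x)" "ok a N (sh k (lt A) @ x)" "k' + ll B \<le> len a N (sh k (ls A) @ x)" "k' + ll B \<le> len a N (sh k (lt A) @ x)"
    using x B h h' by simp_all
  show "JJ 3 (s3.in1 a N k A x k' B) = sL.in1 a N k A x k' B"
    unfolding s3.in1_def sL.in1_def JJ_gx[OF A(1) A0 l(1), symmetric] JJ_gx[OF B(1) l(4,6) ok_Nil, symmetric]
    by (rule JJ_vc[OF s3.hom_gx[OF A(1) A0 l(1)]]) (use s3.hom_gx[OF B(1) l(4,6) ok_Nil] in simp)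
  show "JJ 3 (s3.in2 a N k A x k' B) = sL.in2 a N k A x k' B"
    unfolding s3.in2_def sL.in2_def JJ_gx[OF A(1) A0 l(2), symmetric] JJ_gx[OF B(1) l(3,5) ok_Nil, symmetric]
    by (rule JJ_vc[OF s3.hom_gx[OF B(1) l(3,5) ok_Nil]]) (use s3.hom_gx[OF A(1) A0 l(2)] in simp)
qed

text \<open>Each relation is the image under \<open>JJ\<close> of the two sides of a 4-generator,
  computed as strings in the free 3-precategory. Invertibility of the generators comes from their
  formal inverses.\<close>

interpretation sL: coherent_strings LL FL gL
proof
  show "sL.nl1 A m = sL.nl2 A m" for A m
  proof -
    let ?c = "ob (lb A) (ll A)" and ?b = "ob (lb A) (ll A + m)"
    have "natl_ok Adj3 (la A) (word ?c m) (tp ?b)" unfolding natl_ok_iff by blast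
    then have "NatL (la A) (word ?c m) (tp ?b) \<in> gens4 PAdj" unfolding PAdj_gens by blast
    from JJ_rel[OF this, unfolded dom4_PAdj] show ?thesis
      using natl_sides[OF refl, of ?b A m] JJ_nl[of A m] by simp
  qed
  show "sL.nr1 a m B = sL.nr2 a m B" if B: "lb B = ob a m" for a m B
  proof -
    have "natr_ok Adj3 (tp a) (word a m) (la B)" unfolding natr_ok_iff using B by blast
    then have "NatR (tp a) (word a m) (la B) \<in> gens4 PAdj" unfolding PAdj_gens by blast
    from JJ_rel[OF this, unfolded dom4_PAdj natr_sides[OF B]] show ?thesis
      unfolding JJ_nr[OF B] .
  qed
  show "sL.in1 a N k A x k' B = sL.in2 a N k A x k' B"
    if A: "lb A = ob a k" "k + ll A \<le> N" and x: "ok a (len a N (sh k (ls A))) x"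
      and B: "lb B = ob a k'" "k' + ll B \<le> len a (len a N (sh k (ls A))) x" for a N k A x k' B
  proof -
    \<comment> \<open>Independence generators are indexed by the words on the right as well; their
      lengths are recovered as differences.\<close>
    define r r' where "r = N - (k + ll A)" and "r' = len a (len a N (sh k (ls A))) x - (k' + ll B)"
    have r: "N = k + ll A + r" "k' + ll B + r' = len a (len a N (sh k (ls A))) x" using A(2) B(2) by (simp_all add: r_def r'_def)
    let ?G = "Indep (word a k) (la A) (word (ob a (k + ll A)) r) (str2 a (len a N (sh k (ls A))) x)
      (word a k') (la B) (word (ob a (k' + ll B)) r')"
    have "indep_ok Adj3 (word a k) (la A) (word (ob a (k + ll A)) r) (str2 a (len a N (sh k (ls A))) x)
      (word a k') (la B) (word (ob a (k' + ll B)) r')"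
      unfolding indep_ok_iff using A(1) B(1) x r by blast
    then have "?G \<in> gens4 PAdj" unfolding PAdj_gens by blast
    from JJ_rel[OF this, unfolded dom4_PAdj indep_sides[OF A(1) B(1) r(1) x refl r(2)]] show ?thesis
      unfolding JJ_in[OF A x B] .
  qed
  have ob1: "ob Oy 1 = Ox" "ob Ox 1 = Oy" by simp_all
  note h = s3.hom_gx[of "LX Oy 0" Oy 0 2 "[1]" "[]"] s3.hom_gx[of "LN Ox" Oy 1 2 "[]" "[0]"]
    s3.hom_gx[of "LX Ox 0" Ox 0 0 "[]" "[1]"] s3.hom_gx[of "LN Ox" Ox 0 0 "[0]" "[]"]
  have h1: "s3.hom Oy 2 [1, 0, 0] [1, 2, 0] (s3.gx Oy 2 [1] 0 (LX Oy 0) [])"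
    "s3.hom Oy 2 [1, 2, 0] [0] (s3.gx Oy 2 [] 1 (LN Ox) [0])"
    "s3.hom Ox 0 [0, 2, 1] [0, 0, 1] (s3.gx Ox 0 [] 0 (LX Ox 0) [1])"
    "s3.hom Ox 0 [0, 0, 1] [0] (s3.gx Ox 0 [0] 0 (LN Ox) [])"
    using h by (auto simp: nx_def ob_def)
  have g: "JJ 3 (s3.gx Oy 2 [] 0 (LN Oy) [0]) = sL.gx Oy 2 [] 0 (LN Oy) [0]"
    "JJ 3 (s3.gx Oy 2 [1] 0 (LX Oy 0) []) = sL.gx Oy 2 [1] 0 (LX Oy 0) []"
    "JJ 3 (s3.gx Oy 2 [] 1 (LN Ox) [0]) = sL.gx Oy 2 [] 1 (LN Ox) [0]"
    "JJ 3 (s3.gx Ox 0 [0] 1 (LN Oy) []) = sL.gx Ox 0 [0] 1 (LN Oy) []"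
    "JJ 3 (s3.gx Ox 0 [] 0 (LX Ox 0) [1]) = sL.gx Ox 0 [] 0 (LX Ox 0) [1]"
    "JJ 3 (s3.gx Ox 0 [0] 0 (LN Ox) []) = sL.gx Ox 0 [0] 0 (LN Ox) []"
    by (rule JJ_gx; simp add: nx_def ob_def)+
  have "TriEps \<in> gens4 PAdj" "TriEta \<in> gens4 PAdj" unfolding PAdj_gens by blast+
  note r = this[THEN JJ_rel, unfolded tri_sides]
  show "sL.gx Oy 2 [] 0 (LN Oy) [0] = sL.vc (sL.gx Oy 2 [1] 0 (LX Oy 0) []) (sL.gx Oy 2 [] 1 (LN Ox) [0])"
    using r(1) unfolding JJ_vc[OF h1(1,2)] g .
  show "sL.gx Ox 0 [0] 1 (LN Oy) [] = sL.vc (sL.gx Ox 0 [] 0 (LX Ox 0) [1]) (sL.gx Ox 0 [0] 0 (LN Ox) [])"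
    using r(2) unfolding JJ_vc[OF h1(3,4)] g .
  show "\<exists>B. sL.iso (lb A) (ll A) (ls A) (lt A) (gL A) B" for A
  proof -
    note h = s3.homD[OF s3.\<gamma>[of A]]
    have u: "qp.q 3 (g3 A) \<in> cells (presented PAdj) 3" using h(1) by (simp add: presented_eq qp.cells_Q)
    have st: "src (presented PAdj) 2 (qp.q 3 (g3 A)) = qp.q 2 (s3.S (lb A) (ll A) (ls A))"
      "tgt (presented PAdj) 2 (qp.q 3 (g3 A)) = qp.q 2 (s3.S (lb A) (ll A) (lt A))"
      using qp.src_Q[of "g3 A" 2] qp.tgt_Q[of "g3 A" 2] h by (simp_all add: presented_eq)
    have J: "pl.J 2 (qp.q 2 (s3.S a n s)) = sL.S a n s" "pl.J 3 (qp.q 3 (g3 A)) = gL A" for a n s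
      using JJ_S[of a n s] by (simp_all add: JJ_def gL_def)
    show ?thesis
      using pl.J_inverse[OF u] sL.\<gamma>[of A] unfolding st J sL.iso_def sL.hom_def by auto
  qed
qed

lemma sL_O0_inj: "sL.O0 a = sL.O0 b \<longleftrightarrow> a = b"
  by (auto simp: sL.O0_def FL_def JJ_low)

lemma C3_cells_2: "cells C3 2 = {s3.S a n ps |a n ps. ok a n ps}"
  using e3.cells_E[of 2] by (auto simp: C3_def s3.S_def dest!: C2_str2)

text \<open>Composition with 1-cells and 2-cells is absorbed into contexts. For an inverse, the
  inverse laws exhibit it as the \<open>iv\<close> of a 3-cell that is nice by induction.\<close>

lemma all_nice: "x \<in> cells LL 3 \<Longrightarrow> \<exists>a n s t. sL.nice a n s t x"
proof (induction rule: LL_induct)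
  case (gen A)
  show ?case using sL.nice_gen[of A] unfolding gL_def[symmetric] by blast
next
  case (inv u x)
  obtain a n s t where N: "sL.nice a n s t (JJ 3 u)" using inv.IH by blast
  have h: "sL.hom a n s t (JJ 3 u)" using N unfolding sL.nice_def by blast
  have "src LL 2 (JJ (Suc 2) u) = JJ 2 (src C3 2 u)" "tgt LL 2 (JJ (Suc 2) u) = JJ 2 (tgt C3 2 u)"
    by (rule pmorph_src[OF JJ_pmorph] pmorph_tgt[OF JJ_pmorph]; use inv.hyps(1) in simp)+
  then have st: "JJ 2 (src C3 2 u) = sL.S a n s" "JJ 2 (tgt C3 2 u) = sL.S a n t" using sL.homD(4,5)[OF h] by simp_all
  have "sL.iso a n s t (JJ 3 u) x"
    using h inv.hyps(2-6) unfolding sL.iso_def sL.hom_def st by simp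
  then show ?case using sL.nice_inverse[OF N] by blast
next
  case (ident c)
  then obtain a n s where "c = s3.S a n s" "ok a n s" unfolding C3_cells_2 by blast
  then show ?case using sL.nice_id[of a n s] by (auto simp: JJ_S)
next
  case (left k c u)
  obtain a n s t where N: "sL.nice a n s t u" using left.IH by blast
  have h: "sL.hom a n s t u" using N unfolding sL.nice_def by blast
  have "0 < k" using left.hyps(4) unfolding composable_def by blast
  then have "k = 1 \<or> k = 2" using left.hyps(1) by linarith
  then show ?case
  proof
    assume k: "k = 1"
    obtain b m where c: "c = s3.W b m" using left.hyps(2)[unfolded k C3_cells_1] by blast
    have a: "a = ob b m"
      using left.hyps(4)[unfolded k c] sL.homD[OF h] by (auto simp: JJ_W composable_13 sL_O0_inj)
    have "cmp LL k 3 (JJ k c) u = sL.cx b (m + n) [] m n s u []"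
      using sL.lw_cx[OF h a] by (simp add: k c JJ_W sL.lw_def)
    then show ?thesis using sL.nice_cx[OF N[unfolded a], of "m + n" "[]" "[]"] by auto
  next
    assume k: "k = 2"
    obtain b m ps where c: "c = s3.S b m ps" "ok b m ps" using left.hyps(2)[unfolded k C3_cells_2] by blast
    have a: "b = a" "n = len a m ps"
      using left.hyps(4)[unfolded k c(1)] sL.homD[OF h] c(2) by (auto simp: JJ_S composable_23)
    have N': "sL.nice (ob a 0) n s t u" using N by simp
    have "cmp LL k 3 (JJ k c) u = sL.cx a m ps 0 n s u []"
      using sL.pr_cx[OF h _ a(2)] c a by (simp add: k JJ_S sL.pr_def)
    then show ?thesis using sL.nice_cx[OF N', of m ps "[]"] c a by auto
  qed
next
  case (right k c u)
  obtain a n s t where N: "sL.nice a n s t u" using right.IH by blast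
  have h: "sL.hom a n s t u" using N unfolding sL.nice_def by blast
  have N': "sL.nice (ob a 0) n s t u" using N by simp
  have "0 < k" using right.hyps(4) unfolding composable_def by blast
  then have "k = 1 \<or> k = 2" using right.hyps(1) by linarith
  then show ?case
  proof
    assume k: "k = 1"
    obtain b m where c: "c = s3.W b m" using right.hyps(2)[unfolded k C3_cells_1] by blast
    have a: "b = ob a n"
      using right.hyps(4)[unfolded k c] sL.homD[OF h] by (auto simp: JJ_W composable_31 sL_O0_inj ob_len)
    have "cmp LL 3 k u (JJ k c) = sL.cx a (n + m) [] 0 n s u []"
      using sL.rw_cx[OF h a] by (simp add: k c JJ_W sL.rw_def)
    then show ?thesis using sL.nice_cx[OF N', of "n + m" "[]" "[]"] by auto
  next
    assume k: "k = 2"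
    obtain b m qs where c: "c = s3.S b m qs" "ok b m qs" using right.hyps(2)[unfolded k C3_cells_2] by blast
    have a: "b = a" "m = len a n s"
      using right.hyps(4)[unfolded k c(1)] sL.homD[OF h] c(2) by (auto simp: JJ_S composable_32)
    have "cmp LL 3 k u (JJ k c) = sL.cx a n [] 0 n s u qs"
      using sL.po_cx[OF h _ a(2)] c a by (simp add: k JJ_S sL.po_def)
    then show ?thesis using sL.nice_cx[OF N', of n "[]" qs] c a by auto
  qed
next
  case (comp u v)
  obtain a n s t where N: "sL.nice a n s t u" using comp.IH(1) by blast
  obtain b m s' t' where N': "sL.nice b m s' t' v" using comp.IH(2) by blast
  have h: "sL.hom a n s t u" "sL.hom b m s' t' v" using N N' unfolding sL.nice_def by blast+
  have "sL.S a n t = sL.S b m s'" using comp.hyps(3) sL.homD[OF h(1)] sL.homD[OF h(2)] by (simp add: composable_33)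
  then have "b = a" "m = n" "s' = t" using sL.S_inj[of a n t b m s'] sL.homD[OF h(1)] sL.homD[OF h(2)] by auto
  then show ?case using sL.nice_vc[OF N] N' by blast
qed

theorem mainTheorem8:
  shows "gray_presentation PAdj \<and> coherent PAdj"
proof
  show "gray_presentation PAdj" by (rule gray_PAdj)
  show "coherent PAdj"
    unfolding coherent_def
  proof (intro allI impI)
    fix u v assume p: "parallel LL 3 u v"
    then have uv: "u \<in> cells LL 3" "v \<in> cells LL 3" "src LL 2 u = src LL 2 v" "tgt LL 2 u = tgt LL 2 v"
      by (auto simp: parallel_def)
    obtain a n s t where N: "sL.nice a n s t u" using all_nice[OF uv(1)] by blast
    obtain b m s' t' where N': "sL.nice b m s' t' v" using all_nice[OF uv(2)] by blast
    have h: "sL.hom a n s t u" "sL.hom b m s' t' v" using N N' unfolding sL.nice_def by blast+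
    \<comment> \<open>Equal boundary 2-cells in the localization come from equal strings by
      injectivity, so both 3-cells are nice between the same strings.\<close>
    have "sL.S a n s = sL.S b m s'" "sL.S a n t = sL.S b m t'"
      using uv sL.homD[OF h(1)] sL.homD[OF h(2)] by simp_all
    then have "a = b \<and> n = m \<and> s = s' \<and> t = t'"
      using sL.S_inj[OF sL.homD(2)[OF h(1)] sL.homD(2)[OF h(2)]] sL.S_inj[OF sL.homD(3)[OF h(1)] sL.homD(3)[OF h(2)]]
      by blast
    then show "u = v" using sL.nice_unique[OF N] N' by blast
  qed
qed

end
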